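(* Let $n,r$ be positive integers with $n\ge 2$ and let $\xi=(\xi_1,\xi_2,\dots)\in\mathcal{P}_{n,r}$. Let $T_r(W_\xi)$ be the $T_r(\mathfrak{sl}_n)$-submodule of $V_{n,r}$ generated by $\bm{y}_\xi$. Then $$T_r(W_\xi)\cong W_r(\lambda(\xi))$$ as $T_r(\mathfrak{sl}_n)$-modules, where $\lambda(\xi)=\sum_{i=1}^{n-1}(\xi_i-\xi_{i+1})\omega_i$.
   Context: All Lie algebras are over $\mathbb{C}$. $E_{i,j}$ are the matrix units of $\mathfrak{gl}_n$, $\mathfrak{sl}_n=[\mathfrak{gl}_n,\mathfrak{gl}_n]$, $\mathfrak{n}_n^+=\sum_{i<j}\mathbb{C}E_{i,j}$, $h_i=E_{i,i}-E_{i+1,i+1}$ ($1\le i\le n-1$), $\mathfrak{h}_n=\bigoplus_{i=1}^{n-1}\mathbb{C}h_i$, $\omega_1,\dots,\omega_{n-1}\in\mathfrak{h}_n^*$ is the basis dual to $h_1,\dots,h_{n-1}$, and $P_+=\bigoplus_i\mathbb{N}\omega_i$ with $\mathbb{N}=\{0,1,2,\dots\}$. Partitions: a partition is a non-increasing sequence $\xi=(\xi_1,\xi_2,\dots)$ of non-negative integers with finitely many non-zero terms; $\ell(\xi)$ is the number of non-zero terms; $\xi'$ is the transposed partition. $\mathcal{P}_{n,r}$ is the set of partitions $\xi$ with $\ell(\xi)\le n$ and $\ell(\xi')\le r$ (i.e. $\xi_1\le r$). Takiff algebra: for a Lie algebra $\mathfrak{a}$, $T_r(\mathfrak{a})=\mathfrak{a}\otimes\mathbb{C}[t]/t^r\mathbb{C}[t]$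 with bracket $[x\otimes f,y\otimes g]=[x,y]\otimes fg$; $\overline{t^k}$ is the class of $t^k$. Action on the exterior algebra: $V_{n,r}=\Lambda[y_{i,j}\mid 1\le i\le n,\ 0\le j\le r-1]$ is the exterior algebra on the variables $y_{i,j}$. $T_r(\mathfrak{gl}_n)$ acts on it by $E_{i,j}\otimes\overline{t^k}\mapsto\sum_{s=0}^{r-k-1}y_{i,s}\frac{\partial}{\partial y_{j,s+k}}$ for $1\le i,j\le n$, $0\le k\le r-1$ (with $\partial/\partial y_{j,s}$ the odd left partial derivatives), and $V_{n,r}$ is a $T_r(\mathfrak{sl}_n)$-module by restriction. For $\xi\in\mathcal{P}_{n,r}$, $\bm{y}_\xi=\bm{y}_1(\xi_1)\bm{y}_2(\xi_2)\cdots\bm{y}_{\ell(\xi)}(\xi_{\ell(\xi)})$ with $\bm{y}_i(\xi_i)=y_{i,0}y_{i,1}\cdots y_{i,\xi_i-1}$. Local Weyl modules for $T_r(\mathfrak{sl}_n)$: for $\lambda\in P_+$, $W_r(\lambda)$ is the cyclic $T_r(\mathfrak{sl}_n)$-module generated by a vector $v$ with defining relations $T_r(\mathfrak{n}_n^+).v=0$, $(h_i\otimes\overline{t^j}).v=\delta_{j,0}\lambda(h_i)v$, $(E_{i+1,i}\otimes\overline{1})^{\lambda(h_i)+1}.v=0$ for $1\le i\le n-1$ and $0\le j\le r-1$. *)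

theory Defs
  imports "Jordan_Normal_Form.VS_Connect" "HOL-Algebra.QuotRing"
begin

text \<open>
  Indices are shifted to start from 0: rows and columns of \<open>n \<times> n\<close> matrices, the parts of a
  partition and the first index of a variable \<open>y i j\<close> range over \<open>{0..<n}\<close>, and the simple
  coroots over \<open>{0..<n-1}\<close>.

  Complex vector spaces are \<^type>\<open>module\<close> records over \<^term>\<open>class_ring\<close>. As for
  \<^const>\<open>module_vec\<close>, the fields \<^const>\<open>mult\<close> and \<^const>\<open>one\<close> are \<^const>\<open>undefined\<close> where the
  space carries no associative product.
\<close>


section \<open>Lie algebras and their modules\<close>

record ('c, 'l) lie_algebra = "('c, 'l) module" +
  lie_bracket :: "'l \<Rightarrow> 'l \<Rightarrow> 'l"

record ('c, 'l, 'v) lie_module = "('c, 'v) module" +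
  lie_act :: "'l \<Rightarrow> 'v \<Rightarrow> 'v"

definition lie_submodule ::
  "(complex, 'l) lie_algebra \<Rightarrow> (complex, 'l, 'v) lie_module \<Rightarrow> 'v set \<Rightarrow> bool" where
  "lie_submodule L M N \<longleftrightarrow>
     LinearCombinations.submodule class_ring N M \<and> (\<forall>x\<in>carrier L. \<forall>m\<in>N. lie_act M x m \<in> N)"

definition generated_lie_submodule ::
  "(complex, 'l) lie_algebra \<Rightarrow> (complex, 'l, 'v) lie_module \<Rightarrow> 'v
     \<Rightarrow> (complex, 'l, 'v) lie_module" where
  "generated_lie_submodule L M v = M\<lparr>carrier := \<Inter>{N. lie_submodule L M N \<and> v \<in> N}\<rparr>"

definition lie_module_isomorphic ::
  "(complex, 'l) lie_algebra \<Rightarrow> (complex, 'l, 'v) lie_module \<Rightarrow> (complex, 'l, 'w) lie_module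
     \<Rightarrow> bool" where
  "lie_module_isomorphic L M N \<longleftrightarrow>
     (\<exists>\<phi>. \<phi> \<in> LinearCombinations.module_hom class_ring M N \<and> bij_betw \<phi> (carrier M) (carrier N) \<and>
          (\<forall>x\<in>carrier L. \<forall>m\<in>carrier M. \<phi> (lie_act M x m) = lie_act N x (\<phi> m)))"


section \<open>The Lie algebras\<close>

definition gl :: "nat \<Rightarrow> (complex, complex mat) lie_algebra" where
  "gl n = \<lparr>carrier = carrier_mat n n, mult = undefined, one = undefined,
           zero = 0\<^sub>m n n, add = (+), smult = (\<cdot>\<^sub>m),
           lie_bracket = (\<lambda>A B. A * B - B * A)\<rparr>"

lemma module_gl: "module class_ring (gl n)"
proof (rule moduleI)
  show "cring (class_ring :: complex ring)" ..
  show "abelian_group (gl n)"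
  proof (rule abelian_groupI)
    fix A assume "A \<in> carrier (gl n)"
    then show "\<exists>B\<in>carrier (gl n). B \<oplus>\<^bsub>gl n\<^esub> A = \<zero>\<^bsub>gl n\<^esub>"
      by (intro bexI[of _ "- A"]) (auto simp: gl_def)
  qed (auto simp: gl_def comm_add_mat)
qed (auto simp: gl_def add_smult_distrib_right_mat add_smult_distrib_left_mat)

definition mat_unit :: "nat \<Rightarrow> nat \<Rightarrow> nat \<Rightarrow> complex mat" where
  "mat_unit n i j = mat n n (\<lambda>(a, b). if a = i \<and> b = j then 1 else 0)"

definition sl :: "nat \<Rightarrow> (complex, complex mat) lie_algebra" where
  "sl n = (gl n)\<lparr>carrier := LinearCombinations.module.span class_ring (gl n)
     {lie_bracket (gl n) A B | A B. A \<in> carrier (gl n) \<and> B \<in> carrier (gl n)}\<rparr>"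

definition n_plus :: "nat \<Rightarrow> (complex, complex mat) lie_algebra" where
  "n_plus n = (gl n)\<lparr>carrier := LinearCombinations.module.span class_ring (gl n)
     {mat_unit n i j | i j. i < j \<and> j < n}\<rparr>"

definition coroot :: "nat \<Rightarrow> nat \<Rightarrow> complex mat" where
  "coroot n i = mat_unit n i i - mat_unit n (Suc i) (Suc i)"

text \<open>
  The element \<open>\<Sum>k<r. x\<^sub>k \<otimes> t\<^sup>k\<close> of \<open>L \<otimes> \<complex>[t]/t\<^sup>r\<complex>[t]\<close> is represented by the sequence of its
  coefficients \<open>x\<^sub>k\<close>, extended by zero for \<open>k \<ge> r\<close>.
\<close>
definition takiff :: "nat \<Rightarrow> ('c, 'l) lie_algebra \<Rightarrow> ('c, nat \<Rightarrow> 'l) lie_algebra" where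
  "takiff r L =
     \<lparr>carrier = {x. (\<forall>k<r. x k \<in> carrier L) \<and> (\<forall>k\<ge>r. x k = \<zero>\<^bsub>L\<^esub>)},
      mult = undefined, one = undefined,
      zero = (\<lambda>k. \<zero>\<^bsub>L\<^esub>),
      add = (\<lambda>x y k. x k \<oplus>\<^bsub>L\<^esub> y k),
      smult = (\<lambda>c x k. c \<odot>\<^bsub>L\<^esub> x k),
      lie_bracket = (\<lambda>x y k. if k < r then \<Oplus>\<^bsub>L\<^esub>i\<in>{..k}. lie_bracket L (x i) (y (k - i))
                              else \<zero>\<^bsub>L\<^esub>)\<rparr>"

text \<open>The element \<open>a \<otimes> t\<^sup>k\<close>.\<close>
definition takiff_tensor :: "nat \<Rightarrow> ('c, 'l) lie_algebra \<Rightarrow> 'l \<Rightarrow> nat \<Rightarrow> (nat \<Rightarrow> 'l)" where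
  "takiff_tensor r L a k = (\<lambda>m. if m = k \<and> k < r then a else \<zero>\<^bsub>L\<^esub>)"


section \<open>Universal enveloping algebras and modules given by generators and relations\<close>

text \<open>The free associative unital algebra on \<open>X\<close>: finitely supported functions on words in \<open>X\<close>.\<close>
definition free_algebra :: "'x set \<Rightarrow> (complex, 'x list \<Rightarrow> complex) module" where
  "free_algebra X =
     \<lparr>carrier = {f. finite {w. f w \<noteq> 0} \<and> (\<forall>w. f w \<noteq> 0 \<longrightarrow> set w \<subseteq> X)},
      mult = (\<lambda>f g w. \<Sum>k\<le>length w. f (take k w) * g (drop k w)),
      one = (\<lambda>w. if w = [] then 1 else 0),
      zero = (\<lambda>w. 0),
      add = (\<lambda>f g w. f w + g w),
      smult = (\<lambda>c f w. c * f w)\<rparr>"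

definition letter :: "'x \<Rightarrow> 'x list \<Rightarrow> complex" where
  "letter x = (\<lambda>w. if w = [x] then 1 else 0)"

lemma ring_free_algebra: "ring (free_algebra X)"
proof (rule ringI)
  let ?F = "free_algebra X"
  show "abelian_group ?F"
  proof (rule abelian_groupI)
    fix f g assume "f \<in> carrier ?F" "g \<in> carrier ?F"
    then have "finite {w. f w \<noteq> 0}" "finite {w. g w \<noteq> 0}" by (auto simp: free_algebra_def)
    then have "finite {w. f w + g w \<noteq> 0}"
      by (rule finite_subset[OF _ finite_UnI, rotated]) auto
    then show "f \<oplus>\<^bsub>?F\<^esub> g \<in> carrier ?F"
      using \<open>f \<in> carrier ?F\<close> \<open>g \<in> carrier ?F\<close>
      by (auto simp: free_algebra_def) (metis (no_types, lifting) add.left_neutral subsetD)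
  next
    fix f assume "f \<in> carrier ?F"
    then show "\<exists>g\<in>carrier ?F. g \<oplus>\<^bsub>?F\<^esub> f = \<zero>\<^bsub>?F\<^esub>"
      by (intro bexI[of _ "\<lambda>w. - f w"]) (auto simp: free_algebra_def)
  qed (auto simp: free_algebra_def fun_eq_iff)
  have mult_closed: "f \<otimes>\<^bsub>?F\<^esub> g \<in> carrier ?F" if fg: "f \<in> carrier ?F" "g \<in> carrier ?F" for f g
  proof -
    let ?h = "\<lambda>w. \<Sum>k\<le>length w. f (take k w) * g (drop k w)"
    have ex: "\<exists>k. f (take k w) \<noteq> 0 \<and> g (drop k w) \<noteq> 0" if "?h w \<noteq> 0" for w
      using that by (metis (no_types, lifting) mult_eq_0_iff sum.neutral)
    have "{w. ?h w \<noteq> 0} \<subseteq> (\<lambda>(u, v). u @ v) ` ({w. f w \<noteq> 0} \<times> {w. g w \<noteq> 0})"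
    proof
      fix w assume "w \<in> {w. ?h w \<noteq> 0}"
      then obtain k where "f (take k w) \<noteq> 0" "g (drop k w) \<noteq> 0" using ex by blast
      then show "w \<in> (\<lambda>(u, v). u @ v) ` ({w. f w \<noteq> 0} \<times> {w. g w \<noteq> 0})"
        by (intro image_eqI[of _ _ "(take k w, drop k w)"]) auto
    qed
    moreover have "finite ((\<lambda>(u, v). u @ v) ` ({w. f w \<noteq> 0} \<times> {w. g w \<noteq> 0}))"
      using fg by (auto simp: free_algebra_def)
    ultimately have "finite {w. ?h w \<noteq> 0}" by (rule finite_subset)
    moreover have "set w \<subseteq> X" if "?h w \<noteq> 0" for w
    proof -
      obtain k where "f (take k w) \<noteq> 0" "g (drop k w) \<noteq> 0" using ex[of w] \<open>?h w \<noteq> 0\<close> by blast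
      then have "set (take k w) \<subseteq> X" "set (drop k w) \<subseteq> X"
        using fg by (auto simp: free_algebra_def)
      then show ?thesis by (metis append_take_drop_id le_sup_iff set_append)
    qed
    ultimately show ?thesis by (simp add: free_algebra_def)
  qed
  show "monoid ?F"
  proof (rule monoidI)
    fix f g h :: "'a list \<Rightarrow> complex"
    show "f \<otimes>\<^bsub>?F\<^esub> g \<otimes>\<^bsub>?F\<^esub> h = f \<otimes>\<^bsub>?F\<^esub> (g \<otimes>\<^bsub>?F\<^esub> h)"
    proof
      fix w :: "'a list"
      have "(f \<otimes>\<^bsub>?F\<^esub> g \<otimes>\<^bsub>?F\<^esub> h) w =
        (\<Sum>k\<le>length w. \<Sum>l\<le>k. f (take l w) * g (drop l (take k w)) * h (drop k w))"
        by (auto simp: free_algebra_def sum_distrib_right min_def intro!: sum.cong)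
      also have "\<dots> = (\<Sum>l\<le>length w. \<Sum>k=l..length w. f (take l w) * g (drop l (take k w)) * h (drop k w))"
        by (simp add: sum.Sigma)
           (rule sum.reindex_bij_witness[of _ "\<lambda>(l,k). (k,l)" "\<lambda>(k,l). (l,k)"], auto)
      also have "\<dots> = (\<Sum>l\<le>length w. \<Sum>m\<le>length w - l. f (take l w) * g (take m (drop l w)) * h (drop m (drop l w)))"
      proof (rule sum.cong[OF refl])
        fix l assume "l \<in> {..length w}"
        then show "(\<Sum>k=l..length w. f (take l w) * g (drop l (take k w)) * h (drop k w)) =
          (\<Sum>m\<le>length w - l. f (take l w) * g (take m (drop l w)) * h (drop m (drop l w)))"
          by (intro sum.reindex_bij_witness[of _ "\<lambda>m. m + l" "\<lambda>k. k - l"])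
             (auto simp: drop_take)
      qed
      also have "\<dots> = (f \<otimes>\<^bsub>?F\<^esub> (g \<otimes>\<^bsub>?F\<^esub> h)) w"
        by (auto simp: free_algebra_def sum_distrib_left mult.assoc intro!: sum.cong)
      finally show "(f \<otimes>\<^bsub>?F\<^esub> g \<otimes>\<^bsub>?F\<^esub> h) w = (f \<otimes>\<^bsub>?F\<^esub> (g \<otimes>\<^bsub>?F\<^esub> h)) w" .
    qed
  next
    fix f :: "'a list \<Rightarrow> complex"
    have "(\<Sum>k\<le>length w. (if take k w = [] then 1 else 0) * f (drop k w)) = f w" for w :: "'a list"
    proof -
      have "(\<Sum>k\<le>length w. (if take k w = [] then 1 else 0) * f (drop k w)) =
        (\<Sum>k\<le>length w. if k = 0 then f w else 0)"
        by (rule sum.cong) auto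
      then show ?thesis by simp
    qed
    then show "\<one>\<^bsub>?F\<^esub> \<otimes>\<^bsub>?F\<^esub> f = f" by (simp add: free_algebra_def)
    have "(\<Sum>k\<le>length w. f (take k w) * (if drop k w = [] then 1 else 0)) = f w" for w :: "'a list"
    proof -
      have "(\<Sum>k\<le>length w. f (take k w) * (if drop k w = [] then 1 else 0)) =
        (\<Sum>k\<le>length w. if k = length w then f w else 0)"
        by (rule sum.cong) auto
      then show ?thesis by simp
    qed
    then show "f \<otimes>\<^bsub>?F\<^esub> \<one>\<^bsub>?F\<^esub> = f" by (simp add: free_algebra_def)
  qed (auto simp: mult_closed, auto simp: free_algebra_def)
qed (auto simp: free_algebra_def fun_eq_iff algebra_simps sum.distrib)

lemma module_free_algebra: "module class_ring (free_algebra X)"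
proof (rule moduleI)
  show "cring (class_ring :: complex ring)" ..
  show "abelian_group (free_algebra X)" using ring_free_algebra ring.is_abelian_group by blast
qed (auto simp: free_algebra_def fun_eq_iff algebra_simps)

text \<open>
  \<^const>\<open>FactRing\<close> with the induced scalar multiplication. The fields other than \<^const>\<open>mult\<close> and
  \<^const>\<open>one\<close> make sense whenever \<open>I\<close> is just a subspace.
\<close>
definition quotient_algebra :: "(complex, 'a) module \<Rightarrow> 'a set \<Rightarrow> (complex, 'a set) module" where
  "quotient_algebra A I =
     \<lparr>carrier = a_rcosets\<^bsub>A\<^esub> I,
      mult = rcoset_mult A I,
      one = I +>\<^bsub>A\<^esub> \<one>\<^bsub>A\<^esub>,
      zero = I,
      add = set_add A,
      smult = (\<lambda>c X. \<Union>x\<in>X. I +>\<^bsub>A\<^esub> (c \<odot>\<^bsub>A\<^esub> x))\<rparr>"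

definition uea_relations :: "(complex, 'l) lie_algebra \<Rightarrow> ('l list \<Rightarrow> complex) set" where
  "uea_relations L = (let F = free_algebra (carrier L) in
     {letter (x \<oplus>\<^bsub>L\<^esub> y) \<ominus>\<^bsub>F\<^esub> (letter x \<oplus>\<^bsub>F\<^esub> letter y) | x y. x \<in> carrier L \<and> y \<in> carrier L}
   \<union> {letter (c \<odot>\<^bsub>L\<^esub> x) \<ominus>\<^bsub>F\<^esub> (c \<odot>\<^bsub>F\<^esub> letter x) | c x. x \<in> carrier L}
   \<union> {(letter x \<otimes>\<^bsub>F\<^esub> letter y \<ominus>\<^bsub>F\<^esub> letter y \<otimes>\<^bsub>F\<^esub> letter x) \<ominus>\<^bsub>F\<^esub> letter (lie_bracket L x y)
       | x y. x \<in> carrier L \<and> y \<in> carrier L})"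

definition uea_ideal :: "(complex, 'l) lie_algebra \<Rightarrow> ('l list \<Rightarrow> complex) set" where
  "uea_ideal L = Idl\<^bsub>free_algebra (carrier L)\<^esub> (uea_relations L)"

definition uea :: "(complex, 'l) lie_algebra \<Rightarrow> (complex, ('l list \<Rightarrow> complex) set) module" where
  "uea L = quotient_algebra (free_algebra (carrier L)) (uea_ideal L)"

definition uea_emb :: "(complex, 'l) lie_algebra \<Rightarrow> 'l \<Rightarrow> ('l list \<Rightarrow> complex) set" where
  "uea_emb L x = uea_ideal L +>\<^bsub>free_algebra (carrier L)\<^esub> letter x"

definition left_ideal :: "'a set \<Rightarrow> ('a, 'm) ring_scheme \<Rightarrow> bool" where
  "left_ideal J A \<longleftrightarrow>
     additive_subgroup J A \<and> (\<forall>a\<in>carrier A. \<forall>x\<in>J. a \<otimes>\<^bsub>A\<^esub> x \<in> J)"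

definition generated_left_ideal :: "('a, 'm) ring_scheme \<Rightarrow> 'a set \<Rightarrow> 'a set" where
  "generated_left_ideal A S = \<Inter>{J. left_ideal J A \<and> S \<subseteq> J}"

text \<open>
  The cyclic \<open>L\<close>-module with a generator \<open>v\<close> and defining relations \<open>u.v = 0\<close> for \<open>u \<in> R\<close>, where
  \<open>R\<close> is a set of elements of the enveloping algebra \<open>U(L)\<close>: the quotient of \<open>U(L)\<close> by the left
  ideal generated by \<open>R\<close>, with \<open>v\<close> the class of 1.
\<close>
definition cyclic_lie_module ::
  "(complex, 'l) lie_algebra \<Rightarrow> ('l list \<Rightarrow> complex) set set
     \<Rightarrow> (complex, 'l, ('l list \<Rightarrow> complex) set set) lie_module" where
  "cyclic_lie_module L R =
     (let U = uea L; J = generated_left_ideal U R; Q = quotient_algebra U J in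
      \<lparr>carrier = carrier Q, mult = undefined, one = undefined,
       zero = zero Q, add = add Q, smult = smult Q,
       lie_act = (\<lambda>x X. \<Union>u\<in>X. J +>\<^bsub>U\<^esub> (uea_emb L x \<otimes>\<^bsub>U\<^esub> u))\<rparr>)"


section \<open>Local Weyl modules\<close>

text \<open>
  A dominant integral weight \<open>\<lambda> = \<Sum>i<n-1. \<lambda>\<^sub>i \<omega>\<^sub>i\<close> in \<open>P\<^sub>+\<close> is given by its coefficients
  \<open>\<lambda>\<^sub>i\<close>, natural numbers; as the \<open>\<omega>\<^sub>i\<close> are dual to the simple coroots \<open>h\<^sub>i\<close>, one has
  \<open>\<lambda>(h\<^sub>i) = \<lambda>\<^sub>i\<close>. Only the values \<open>\<lambda>\<^sub>i\<close> with \<open>i < n - 1\<close> matter.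
\<close>
definition weyl_relations ::
  "nat \<Rightarrow> nat \<Rightarrow> (nat \<Rightarrow> nat) \<Rightarrow> ((nat \<Rightarrow> complex mat) list \<Rightarrow> complex) set set" where
  "weyl_relations n r lam = (let L = takiff r (sl n); U = uea L in
     {uea_emb L x | x. x \<in> carrier (takiff r (n_plus n))}
   \<union> {uea_emb L (takiff_tensor r (sl n) (coroot n i) j)
        \<ominus>\<^bsub>U\<^esub> ((if j = 0 then of_nat (lam i) else 0) \<odot>\<^bsub>U\<^esub> \<one>\<^bsub>U\<^esub>) | i j. i < n - 1 \<and> j < r}
   \<union> {uea_emb L (takiff_tensor r (sl n) (mat_unit n (Suc i) i) 0) [^]\<^bsub>U\<^esub> (lam i + 1)
        | i. i < n - 1})"

definition local_weyl_module ::
  "nat \<Rightarrow> nat \<Rightarrow> (nat \<Rightarrow> nat)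
     \<Rightarrow> (complex, nat \<Rightarrow> complex mat, ((nat \<Rightarrow> complex mat) list \<Rightarrow> complex) set set) lie_module"
  where
  "local_weyl_module n r lam = cyclic_lie_module (takiff r (sl n)) (weyl_relations n r lam)"


section \<open>The exterior algebra\<close>

text \<open>
  An element of the exterior algebra on the variables \<open>y\<^sub>p\<close>, where \<open>p = (i, j)\<close>, is represented by
  its coefficients in the basis of monomials \<open>y\<^sub>S\<close>, the product of the \<open>y\<^sub>p\<close> for \<open>p \<in> S\<close> in
  increasing lexicographic order. For disjoint \<open>A\<close> and \<open>B\<close>,
  \<open>y\<^sub>A y\<^sub>B = wedge_sign A B * y\<^sub>(\<^sub>A\<^sub>\<union>\<^sub>B\<^sub>)\<close>, the sign of the permutation sorting the factors.
\<close>
definition wedge_sign :: "(nat \<times> nat) set \<Rightarrow> (nat \<times> nat) set \<Rightarrow> complex" where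
  "wedge_sign A B = (-1) ^ card {(a, b) \<in> A \<times> B. (b, a) \<in> less_than <*lex*> less_than}"

definition wedge ::
  "((nat \<times> nat) set \<Rightarrow> complex) \<Rightarrow> ((nat \<times> nat) set \<Rightarrow> complex) \<Rightarrow> (nat \<times> nat) set \<Rightarrow> complex" where
  "wedge f g = (\<lambda>S. \<Sum>A\<in>Pow S. wedge_sign A (S - A) * f A * g (S - A))"

definition wedge_one :: "(nat \<times> nat) set \<Rightarrow> complex" where
  "wedge_one = (\<lambda>S. if S = {} then 1 else 0)"

definition yvar :: "nat \<Rightarrow> nat \<Rightarrow> (nat \<times> nat) set \<Rightarrow> complex" where
  "yvar i j = (\<lambda>S. if S = {(i, j)} then 1 else 0)"

text \<open>
  The odd left derivative with respect to \<open>y\<^sub>i\<^sub>j\<close>: if \<open>(i, j) \<notin> S\<close>, it sends the monomial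
  \<open>y\<^sub>i\<^sub>j y\<^sub>S\<close> to \<open>y\<^sub>S\<close>, and it sends \<open>y\<^sub>S\<close> to 0. See \<open>yderiv_yvar_wedge\<close> below.
\<close>
definition yderiv ::
  "nat \<Rightarrow> nat \<Rightarrow> ((nat \<times> nat) set \<Rightarrow> complex) \<Rightarrow> (nat \<times> nat) set \<Rightarrow> complex" where
  "yderiv i j f = (\<lambda>S. if (i, j) \<in> S then 0
                        else wedge_sign {(i, j)} S * f (insert (i, j) S))"

lemma wedge_sign_singleton:
  "wedge_sign {a} S = (-1) ^ card {b\<in>S. (b, a) \<in> less_than <*lex*> less_than}"
proof -
  have "{(a', b) \<in> {a} \<times> S. (b, a') \<in> less_than <*lex*> less_than} =
    Pair a ` {b\<in>S. (b, a) \<in> less_than <*lex*> less_than}" by auto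
  then show ?thesis
    unfolding wedge_sign_def by (simp add: card_image inj_on_def)
qed

lemma wedge_sign_insert:
  assumes "finite S" "b \<notin> S"
  shows "wedge_sign {a} (insert b S) =
    (if (b, a) \<in> less_than <*lex*> less_than then - wedge_sign {a} S else wedge_sign {a} S)"
proof -
  have "{c\<in>insert b S. (c, a) \<in> less_than <*lex*> less_than} =
    (if (b, a) \<in> less_than <*lex*> less_than then insert b {c\<in>S. (c, a) \<in> less_than <*lex*> less_than}
     else {c\<in>S. (c, a) \<in> less_than <*lex*> less_than})" by auto
  moreover have "b \<notin> {c\<in>S. (c, a) \<in> less_than <*lex*> less_than}" using assms by simp
  ultimately show ?thesis
    using assms unfolding wedge_sign_singleton by auto
qed

lemma yvar_wedge:
  assumes "finite S"
  shows "wedge (yvar i j) f S =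
    (if (i, j) \<in> S then wedge_sign {(i, j)} (S - {(i, j)}) * f (S - {(i, j)}) else 0)"
proof -
  have "wedge (yvar i j) f S =
    (\<Sum>A\<in>Pow S. if A = {(i, j)} then wedge_sign {(i, j)} (S - {(i, j)}) * f (S - {(i, j)}) else 0)"
    unfolding wedge_def yvar_def by (rule sum.cong) auto
  then show ?thesis using assms by simp
qed

lemma wedge_infinite: "infinite S \<Longrightarrow> wedge f g S = 0"
  by (simp add: wedge_def)

lemma lex_total: "(a :: nat \<times> nat) \<noteq> b \<Longrightarrow>
  (a, b) \<in> less_than <*lex*> less_than \<longleftrightarrow> (b, a) \<notin> less_than <*lex*> less_than"
  by (cases a; cases b) auto

lemma wedge_sign_sq [simp]: "wedge_sign A B * wedge_sign A B = 1"
  by (simp add: wedge_sign_def flip: power_mult_distrib)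

lemma wedge_sign_swap:
  assumes "finite S" "a \<notin> S" "b \<notin> S" "a \<noteq> b"
  shows "wedge_sign {a} (insert b S) * wedge_sign {b} S =
    - (wedge_sign {b} (insert a S) * wedge_sign {a} S)"
  using assms lex_total[of a b] by (auto simp: wedge_sign_insert)

lemma yvar_anticommute:
  "wedge (yvar i j) (wedge (yvar k l) f) S = - wedge (yvar k l) (wedge (yvar i j) f) S"
proof (cases "finite S \<and> (i,j) \<in> S \<and> (k,l) \<in> S \<and> (i,j) \<noteq> (k,l)")
  case True
  define R where "R = S - {(i,j)} - {(k,l)}"
  have R: "finite R" "(i,j) \<notin> R" "(k,l) \<notin> R" "S - {(i,j)} = insert (k,l) R"
    "S - {(k,l)} = insert (i,j) R" "insert (k,l) R - {(k,l)} = R" "insert (i,j) R - {(i,j)} = R"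
    using True by (auto simp: R_def)
  have "wedge (yvar i j) (wedge (yvar k l) f) S =
     wedge_sign {(i,j)} (insert (k,l) R) * wedge_sign {(k,l)} R * f R"
    using True R by (simp add: yvar_wedge)
  moreover have "wedge (yvar k l) (wedge (yvar i j) f) S =
     wedge_sign {(k,l)} (insert (i,j) R) * wedge_sign {(i,j)} R * f R"
    using True R by (simp add: yvar_wedge)
  ultimately show ?thesis using wedge_sign_swap[of R "(i,j)" "(k,l)"] R True by simp
next
  case False
  then show ?thesis by (cases "finite S") (auto simp: yvar_wedge wedge_infinite)
qed

lemma yderiv_yvar_wedge:
  assumes "finite S"
  shows "yderiv i j (wedge (yvar k l) f) S =
    (if (i, j) = (k, l) then f S else 0) - wedge (yvar k l) (yderiv i j f) S"
proof (cases "(i,j) = (k,l)")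
  case True
  then show ?thesis using assms
    by (auto simp: yderiv_def yvar_wedge insert_absorb simp flip: mult.assoc)
next
  case neq: False
  show ?thesis
  proof (cases "(i,j) \<notin> S \<and> (k,l) \<in> S")
    case True
    define R where "R = S - {(k,l)}"
    have R: "finite R" "(i,j) \<notin> R" "(k,l) \<notin> R" "S = insert (k,l) R"
      "insert (i,j) (insert (k,l) R) - {(k,l)} = insert (i,j) R" "insert (k,l) R - {(k,l)} = R"
      using True neq assms by (auto simp: R_def)
    have "wedge_sign {(i,j)} (insert (k,l) R) * wedge_sign {(k,l)} (insert (i,j) R) =
      - (wedge_sign {(k,l)} R * wedge_sign {(i,j)} R)"
      using R neq lex_total[of "(i,j)" "(k,l)"] by (auto simp: wedge_sign_insert)
    then show ?thesis using neq R True
      by (auto simp: yderiv_def yvar_wedge R(4) simp flip: mult.assoc)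
  next
    case False
    then show ?thesis using neq assms by (auto simp: yderiv_def yvar_wedge)
  qed
qed

text \<open>
  \<open>V\<^sub>n\<^sub>,\<^sub>r\<close>, with \<open>E\<^sub>i\<^sub>,\<^sub>j \<otimes> t\<^sup>k\<close> acting by \<open>\<Sum>s<r-k. y\<^sub>i\<^sub>,\<^sub>s \<partial>/\<partial>y\<^sub>j\<^sub>,\<^sub>s\<^sub>+\<^sub>k\<close>, extended linearly to
  all \<open>x = \<Sum>k<r. \<Sum>i,j<n. (x\<^sub>k)\<^sub>i\<^sub>j E\<^sub>i\<^sub>,\<^sub>j \<otimes> t\<^sup>k\<close>.
\<close>
definition ext_module ::
  "nat \<Rightarrow> nat \<Rightarrow> (complex, nat \<Rightarrow> complex mat, (nat \<times> nat) set \<Rightarrow> complex) lie_module" where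
  "ext_module n r =
     \<lparr>carrier = {f. \<forall>S. f S \<noteq> 0 \<longrightarrow> S \<subseteq> {..<n} \<times> {..<r}},
      mult = wedge,
      one = wedge_one,
      zero = (\<lambda>S. 0),
      add = (\<lambda>f g S. f S + g S),
      smult = (\<lambda>c f S. c * f S),
      lie_act = (\<lambda>x f S. \<Sum>k<r. \<Sum>i<n. \<Sum>j<n.
                   x k $$ (i, j) * (\<Sum>s<r - k. wedge (yvar i s) (yderiv j (s + k) f) S))\<rparr>"

lemma module_ext_module: "module class_ring (ext_module n r)"
proof (rule moduleI)
  show "cring (class_ring :: complex ring)" ..
  show "abelian_group (ext_module n r)"
  proof (rule abelian_groupI)
    fix f g assume "f \<in> carrier (ext_module n r)" "g \<in> carrier (ext_module n r)"
    then show "f \<oplus>\<^bsub>ext_module n r\<^esub> g \<in> carrier (ext_module n r)"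
      by (simp add: ext_module_def) (metis add.left_neutral)
  next
    fix f assume "f \<in> carrier (ext_module n r)"
    then show "\<exists>g\<in>carrier (ext_module n r). g \<oplus>\<^bsub>ext_module n r\<^esub> f = \<zero>\<^bsub>ext_module n r\<^esub>"
      by (intro bexI[of _ "\<lambda>S. - f S"]) (auto simp: ext_module_def)
  qed (auto simp: ext_module_def fun_eq_iff)
qed (auto simp: ext_module_def fun_eq_iff algebra_simps)


section \<open>Partitions\<close>

definition is_partition :: "(nat \<Rightarrow> nat) \<Rightarrow> bool" where
  "is_partition \<xi> \<longleftrightarrow> antimono \<xi> \<and> finite {i. \<xi> i \<noteq> 0}"

definition part_length :: "(nat \<Rightarrow> nat) \<Rightarrow> nat" where
  "part_length \<xi> = card {i. \<xi> i \<noteq> 0}"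

definition part_transpose :: "(nat \<Rightarrow> nat) \<Rightarrow> nat \<Rightarrow> nat" where
  "part_transpose \<xi> = (\<lambda>j. card {i. j < \<xi> i})"

definition partitions :: "nat \<Rightarrow> nat \<Rightarrow> (nat \<Rightarrow> nat) set" where
  "partitions n r = {\<xi>. is_partition \<xi> \<and> part_length \<xi> \<le> n \<and> part_length (part_transpose \<xi>) \<le> r}"

definition y_row :: "nat \<Rightarrow> nat \<Rightarrow> (nat \<times> nat) set \<Rightarrow> complex" where
  "y_row i m = foldr wedge (map (yvar i) [0..<m]) wedge_one"

definition y_part :: "(nat \<Rightarrow> nat) \<Rightarrow> (nat \<times> nat) set \<Rightarrow> complex" where
  "y_part \<xi> = foldr wedge (map (\<lambda>i. y_row i (\<xi> i)) [0..<part_length \<xi>]) wedge_one"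

definition T_W ::
  "nat \<Rightarrow> nat \<Rightarrow> (nat \<Rightarrow> nat)
     \<Rightarrow> (complex, nat \<Rightarrow> complex mat, (nat \<times> nat) set \<Rightarrow> complex) lie_module" where
  "T_W n r \<xi> = generated_lie_submodule (takiff r (sl n)) (ext_module n r) (y_part \<xi>)"

text \<open>The coefficients of \<open>\<lambda>(\<xi>)\<close> in the fundamental weights; the truncated subtraction is exact
  because \<open>\<xi>\<close> is non-increasing.\<close>
definition part_weight :: "(nat \<Rightarrow> nat) \<Rightarrow> nat \<Rightarrow> nat" where
  "part_weight \<xi> = (\<lambda>i. \<xi> i - \<xi> (i + 1))"

end

theory Submission
  imports Defs "HOL-Library.Function_Algebras" "HOL-Library.Multiset"
begin

text \<open>
  The point is that the homomorphism from the local Weyl module to the exterior algebra sending the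
  generator to \<open>y\<^sub>\<xi>\<close> is injective. Letting the identity matrix act by scalars, one extends the
  action on the Weyl module to \<open>gl\<^sub>n\<close>, and proves by induction on \<open>n\<close> that, on a module
  generated by a highest weight vector \<open>w\<close>, a \<open>gl\<^sub>n\<close>-equivariant map to the exterior algebra is
  injective as soon as it sends \<open>w\<close> to a monomial whose first \<open>n\<close> rows form the diagram of the
  weight; the remaining rows are arbitrary.

  For the step to \<open>gl\<^sub>n\<^sub>+\<^sub>1\<close>, filter the module by the \<open>gl\<^sub>n\<close>-submodules generated by the
  vectors \<open>P M = (\<Prod>i\<in>M. E\<^sub>n\<^sub>,\<^sub>i) w\<close>, where \<open>M\<close> runs over multisets ordered by the height of the
  weight they lower. Modulo the lower layers, \<open>P M\<close> is killed by the upper triangular matrices of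
  \<open>gl\<^sub>n\<close>, and Garland's identity shows that it is also killed by the complete homogeneous
  polynomials of large degree in the power sums \<open>- E\<^sub>i\<^sub>i \<otimes> t\<^sup>b\<close>; the elementary ones of degree above
  the multiplicity of \<open>i\<close> in \<open>M\<close> kill it as well. So \<open>P M\<close> generates a module filtered by cyclic
  modules of highest weight that correspond to the sets of holes \<open>M\<close> can leave in the diagram.
  Composing with the derivatives \<open>\<partial>/\<partial>y\<^sub>n\<^sub>,\<^sub>s\<close> isolates one set of holes at a time, and the
  induction hypothesis applies to each.
\<close>

section \<open>Symmetric functions of commuting power sums\<close>

text \<open>A count lies behind the match of the two sides. On a vector killed by the complete
  homogeneous polynomials of degree above M and the elementary ones of degree above k, the power
  sums act through the cohomology ring of the Grassmannian of k-planes in (k+M)-space, of dimension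
  binomial(k+M, k). This is also the number of k-element sets of holes in a stretch of k+M boxes, so
  the relations leave no more cyclic pieces than the exterior algebra can separate. The pieces are
  then peeled off one at a time, without any dimension formula.

  Each layer is a subquotient, and the argument descends through many of them. They all live on one
  space, as congruences modulo a stable subspace \<open>N\<close>, and faithfulness says that the
  part of the cyclic module killed by the map lies in \<open>N\<close>. The descent forces the
  arbitrary further rows of the monomial: restricting from gl_(n+1) to gl_n leaves row n occupied.
  In the abstract modules no power of t is assumed to act by zero; only the exterior algebra is
  truncated at t^r, and the bounds by \<open>r\<close> keep every diagram inside it.\<close>

fun Hop :: "(complex \<Rightarrow> 'v \<Rightarrow> 'v::ab_group_add) \<Rightarrow> (nat \<Rightarrow> 'v \<Rightarrow> 'v) \<Rightarrow> nat \<Rightarrow> 'v \<Rightarrow> 'v" where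
  "Hop sc p j v = (if j = 0 then v else sc (1 / of_nat j) (\<Sum>b\<in>{1..j}. p b (Hop sc p (j - b) v)))"

text \<open>\<open>Hop\<close> is Newton's recursion j h_j = sum of p_b h_(j-b); \<open>Eop\<close>
  is the relation between the two series, sum of (-1)^c h_(J-c) e_c = 0, solved for e_J.\<close>

fun Eop :: "(complex \<Rightarrow> 'v \<Rightarrow> 'v::ab_group_add) \<Rightarrow> (nat \<Rightarrow> 'v \<Rightarrow> 'v) \<Rightarrow> nat \<Rightarrow> 'v \<Rightarrow> 'v" where
  "Eop sc p j v =
     (if j = 0 then v else \<Sum>c\<in>{..<j}. sc ((-1) ^ (j - c - 1)) (Hop sc p (j - c) (Eop sc p c v)))"

declare Hop.simps [simp del] Eop.simps [simp del]

lemma Hop_0 [simp]: "Hop sc p 0 v = v"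
  by (simp add: Hop.simps)

lemma Eop_0 [simp]: "Eop sc p 0 v = v"
  by (simp add: Eop.simps)

locale power_sum_action = vector_space scale
  for scale :: "complex \<Rightarrow> 'v::ab_group_add \<Rightarrow> 'v" +
  fixes p :: "nat \<Rightarrow> 'v \<Rightarrow> 'v"
  assumes p_add: "p b (v + w) = p b v + p b w"
    and p_scale: "p b (scale c v) = scale c (p b v)"
begin

abbreviation H where "H \<equiv> Hop scale p"
abbreviation El where "El \<equiv> Eop scale p"

lemma p_zero [simp]: "p b 0 = 0"
  using p_scale[of b 0 0] by simp

lemma p_sum: "p b (\<Sum>i\<in>I. f i) = (\<Sum>i\<in>I. p b (f i))"
  by (induction I rule: infinite_finite_induct) (auto simp: p_add)

lemma H_newton: "scale (of_nat j) (H j v) = (\<Sum>b\<in>{1..j}. p b (H (j - b) v))"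
  by (cases "j = 0") (auto simp: Hop.simps[of _ _ j])

lemma H_add: "H j (v + w) = H j v + H j w"
proof (induction j rule: less_induct)
  case (less j)
  then show ?case
    by (cases "j = 0") (simp_all add: Hop.simps[of _ _ j] p_add sum.distrib scale_right_distrib)
qed

lemma H_scale: "H j (scale c v) = scale c (H j v)"
proof (induction j rule: less_induct)
  case (less j)
  then show ?case
    by (cases "j = 0") (simp_all add: Hop.simps[of _ _ j] p_scale scale_left_commute scale_sum_right)
qed

lemma H_zero [simp]: "H j 0 = 0"
  using H_scale[of j 0 0] by simp

lemma H_closed:
  assumes "subspace N" "\<And>b u. b \<ge> 1 \<Longrightarrow> u \<in> N \<Longrightarrow> p b u \<in> N" "v \<in> N"
  shows "H j v \<in> N"
proof (induction j rule: less_induct)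
  case (less j)
  then show ?case
    using assms(2,3)
    by (subst Hop.simps) (auto intro!: subspace_scale[OF assms(1)] subspace_sum[OF assms(1)])
qed

lemma H_vanish:
  assumes "subspace N" "\<And>b u. b \<ge> 1 \<Longrightarrow> u \<in> N \<Longrightarrow> p b u \<in> N" "\<And>b. b \<ge> 1 \<Longrightarrow> p b v \<in> N" "j \<ge> 1"
  shows "H j v \<in> N"
  using assms(4)
proof (induction j rule: less_induct)
  case (less j)
  have "p b (H (j - b) v) \<in> N" if "b \<in> {1..j}" for b
  proof (cases "b = j")
    case False
    then show ?thesis using less that assms(2) by auto
  qed (use assms(3) that in auto)
  then show ?case
    using less.prems
    by (subst Hop.simps) (auto intro!: subspace_scale[OF assms(1)] subspace_sum[OF assms(1)])
qed

text \<open>Newton's identity solved for the top power sum: b h_b minus terms in which a power sum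
  hits a complete homogeneous operator of positive degree.\<close>

lemma p_vanish_if_H_vanish:
  assumes N: "subspace N" "\<And>b u. b \<ge> 1 \<Longrightarrow> u \<in> N \<Longrightarrow> p b u \<in> N"
    and H: "\<And>j. j \<ge> 1 \<Longrightarrow> H j v \<in> N" and "b \<ge> 1"
  shows "p b v \<in> N"
proof -
  have "{1..b} = insert b {1..<b}" using \<open>b \<ge> 1\<close> by auto
  then have "scale (of_nat b) (H b v) = p b v + (\<Sum>c\<in>{1..<b}. p c (H (b - c) v))"
    by (simp add: H_newton)
  then have "p b v = scale (of_nat b) (H b v) - (\<Sum>c\<in>{1..<b}. p c (H (b - c) v))"
    by simp
  also have "\<dots> \<in> N"
    by (intro subspace_diff[OF N(1)] subspace_scale[OF N(1)] subspace_sum[OF N(1)] N(2) H)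
       (use \<open>b \<ge> 1\<close> in auto)
  finally show ?thesis .
qed

lemma H_commute:
  assumes "\<And>v w. q (v + w) = q v + q w" "\<And>c v. q (scale c v) = scale c (q v)"
    and "\<And>b v. b \<ge> 1 \<Longrightarrow> q (p b v) = p b (q v)"
  shows "q (H j v) = H j (q v)"
proof (induction j rule: less_induct)
  case (less j)
  have z: "q 0 = 0" using assms(2)[of 0 0] by simp
  have s: "q (\<Sum>i\<in>I. f i) = (\<Sum>i\<in>I. q (f i))" for I and f :: "nat \<Rightarrow> 'v"
    by (induction I rule: infinite_finite_induct) (auto simp: assms(1) z)
  show ?case
    using less by (cases "j = 0") (simp_all add: Hop.simps[of _ _ j] assms(2,3) s)
qed

text \<open>The third hypothesis says that \<open>g\<close> carries one extra variable t, with
  \<open>g a\<close> in the role of t^a, so that p_b becomes p_b + t^b. The generating series of the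
  complete homogeneous polynomials is therefore multiplied by 1/(1 - tz).\<close>

lemma H_shift_sum:
  assumes ga: "\<And>a v w. g a (v + w) = g a v + g a w" and gs: "\<And>a c v. g a (scale c v) = scale c (g a v)"
    and pg: "\<And>a b v. b \<ge> 1 \<Longrightarrow> p b (g a v) = g a (p b v) + g (a + b) v"
  shows "H j (g a v) = (\<Sum>c\<le>j. g (a + c) (H (j - c) v))"
proof (induction j rule: less_induct)
  case (less j)
  have gz: "g a 0 = 0" for a using gs[of a 0 0] by simp
  have gsum: "g a (\<Sum>i\<in>I. f i) = (\<Sum>i\<in>I. g a (f i))" for a I and f :: "nat \<Rightarrow> 'v"
    by (induction I rule: infinite_finite_induct) (auto simp: ga gz)
  show ?case
  proof (cases "j = 0")
    case False
    \<comment> \<open>Of the two parts of Newton's sum, \<open>?F\<close> carries the weight j - c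
      by Newton's identity for the old variables, and \<open>?G\<close> the weight c, since each t^c
      arises from c choices of b. The weights add up to j, which cancels the 1/j in the
      recursion.\<close>
    let ?F = "\<lambda>c b. g (a + c) (p b (H (j - b - c) v))"
    let ?G = "\<lambda>c b. g (a + c + b) (H (j - b - c) v)"
    have "(\<Sum>b\<in>{1..j}. p b (H (j - b) (g a v))) =
        (\<Sum>b\<in>{1..j}. \<Sum>c\<le>j - b. ?F c b + ?G c b)"
      by (intro sum.cong refl) (use less in \<open>auto simp: p_sum pg\<close>)
    also have "\<dots> = (\<Sum>b\<in>{1..j}. \<Sum>c\<le>j - b. ?F c b) + (\<Sum>b\<in>{1..j}. \<Sum>c\<le>j - b. ?G c b)"
      by (simp add: sum.distrib)
    also have "(\<Sum>b\<in>{1..j}. \<Sum>c\<le>j - b. ?F c b) = (\<Sum>c\<le>j. \<Sum>b\<in>{1..j - c}. ?F c b)"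
      by (simp add: sum.Sigma)
         (rule sum.reindex_bij_witness[of _ "\<lambda>(c,b). (b,c)" "\<lambda>(b,c). (c,b)"], auto)
    also have "\<dots> = (\<Sum>c\<le>j. scale (of_nat (j - c)) (g (a + c) (H (j - c) v)))"
    proof (rule sum.cong[OF refl])
      fix c
      show "(\<Sum>b\<in>{1..j - c}. ?F c b) = scale (of_nat (j - c)) (g (a + c) (H (j - c) v))"
        by (simp add: gsum[symmetric] gs[symmetric] H_newton add.commute)
    qed
    also have "(\<Sum>b\<in>{1..j}. \<Sum>c\<le>j - b. ?G c b) = (\<Sum>c\<le>j. \<Sum>b\<in>{1..c}. g (a + c) (H (j - c) v))"
      by (simp add: sum.Sigma)
         (rule sum.reindex_bij_witness[of _ "\<lambda>(c,b). (b,c-b)" "\<lambda>(b,c). (c+b,b)"],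
          auto simp: ac_simps)
    also have "\<dots> = (\<Sum>c\<le>j. scale (of_nat c) (g (a + c) (H (j - c) v)))"
      by (simp add: sum_constant_scale del: sum_constant)
    also have "(\<Sum>c\<le>j. scale (of_nat (j - c)) (g (a + c) (H (j - c) v))) + \<dots> =
        (\<Sum>c\<le>j. scale (of_nat j) (g (a + c) (H (j - c) v)))"
      by (simp add: sum.distrib[symmetric] scale_left_distrib[symmetric])
    finally show ?thesis
      using False by (simp add: Hop.simps[of _ _ j "g a v"] scale_sum_right)
  qed simp
qed

text \<open>The same rule after multiplication by 1 - tz, which leaves two terms and lends itself to
  induction.\<close>

lemma H_shift:
  assumes ga: "\<And>a v w. g a (v + w) = g a v + g a w" and gs: "\<And>a c v. g a (scale c v) = scale c (g a v)"
    and pg: "\<And>a b v. b \<ge> 1 \<Longrightarrow> p b (g a v) = g a (p b v) + g (a + b) v"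
  shows "H (Suc j) (g a v) = g a (H (Suc j) v) + H j (g (Suc a) v)"
proof -
  have "H (Suc j) (g a v) = (\<Sum>c\<le>Suc j. g (a + c) (H (Suc j - c) v))"
    by (rule H_shift_sum) (use assms in auto)
  also have "\<dots> = g a (H (Suc j) v) + (\<Sum>c\<le>j. g (Suc a + c) (H (j - c) v))"
    by (subst sum.atMost_Suc_shift) simp
  also have "(\<Sum>c\<le>j. g (Suc a + c) (H (j - c) v)) = H j (g (Suc a) v)"
    by (rule H_shift_sum[symmetric]) (use assms in auto)
  finally show ?thesis .
qed

lemma El_recurrence:
  assumes "J \<ge> 1"
  shows "El J v = (\<Sum>c<J. scale ((-1) ^ (J - c - 1)) (H (J - c) (El c v)))"
  using assms by (subst Eop.simps) auto

lemma El_H_sum: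
  assumes "J \<ge> 1"
  shows "(\<Sum>c\<le>J. scale ((-1) ^ c) (H (J - c) (El c v))) = 0"
proof -
  have e: "(-1 :: complex) ^ J * (-1) ^ (J - Suc c) = - ((-1) ^ c)" if "c < J" for c
  proof -
    have "J + (J - Suc c) = Suc c + 2 * (J - Suc c)" using that by simp
    then have "(-1 :: complex) ^ (J + (J - Suc c)) = (-1) ^ (Suc c + 2 * (J - Suc c))" by (rule arg_cong)
    then show ?thesis by (simp only: power_add power_mult) simp
  qed
  have "scale ((-1) ^ J) (El J v) = (\<Sum>c<J. - scale ((-1) ^ c) (H (J - c) (El c v)))"
    unfolding El_recurrence[OF assms] scale_sum_right scale_scale
    by (intro sum.cong refl) (simp add: e)
  then have "scale ((-1) ^ J) (El J v) = - (\<Sum>c<J. scale ((-1) ^ c) (H (J - c) (El c v)))"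
    by (simp add: sum_negf)
  then show ?thesis
    by (simp add: lessThan_Suc_atMost[symmetric])
qed

lemma El_closed:
  assumes "subspace N" "\<And>b u. b \<ge> 1 \<Longrightarrow> u \<in> N \<Longrightarrow> p b u \<in> N" "v \<in> N"
  shows "El j v \<in> N"
proof (induction j rule: less_induct)
  case (less j)
  then show ?case
    by (subst Eop.simps)
       (auto intro!: subspace_scale[OF assms(1)] subspace_sum[OF assms(1)] assms(3)
          H_closed[OF assms(1,2)])
qed

lemma El_vanish:
  assumes "subspace N" "\<And>b u. b \<ge> 1 \<Longrightarrow> u \<in> N \<Longrightarrow> p b u \<in> N" "\<And>b. b \<ge> 1 \<Longrightarrow> p b v \<in> N" "j \<ge> 1"
  shows "El j v \<in> N"
  using assms(4)
proof (induction j rule: less_induct)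
  case (less j)
  have "H (j - c) (El c v) \<in> N" if "c < j" for c
  proof (cases "c = 0")
    case True
    then show ?thesis using H_vanish[OF assms(1,2,3)] that by simp
  next
    case False
    then show ?thesis using H_closed[OF assms(1,2)] less that by simp
  qed
  then show ?case
    using less.prems
    by (subst Eop.simps) (auto intro!: subspace_scale[OF assms(1)] subspace_sum[OF assms(1)])
qed

lemma El_commute:
  assumes "\<And>v w. q (v + w) = q v + q w" "\<And>c v. q (scale c v) = scale c (q v)"
    and "\<And>b v. b \<ge> 1 \<Longrightarrow> q (p b v) = p b (q v)"
  shows "q (El j v) = El j (q v)"
proof (induction j rule: less_induct)
  case (less j)
  have z: "q 0 = 0" using assms(2)[of 0 0] by simp
  have s: "q (\<Sum>i\<in>I. f i) = (\<Sum>i\<in>I. q (f i))" for I and f :: "nat \<Rightarrow> 'v"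
    by (induction I rule: infinite_finite_induct) (auto simp: assms(1) z)
  show ?case
    using less
    by (cases "j = 0") (simp_all add: Eop.simps[of _ _ j] assms(2) s H_commute[OF assms])
qed

text \<open>On the elementary side the extra variable multiplies the series by 1 + tz, so it raises
  the degree by at most one. This is what bounds the elementary operators on products of lowering
  operators.\<close>

lemma El_shift:
  assumes ga: "\<And>a v w. g a (v + w) = g a v + g a w" and gs: "\<And>a c v. g a (scale c v) = scale c (g a v)"
    and pg: "\<And>a b v. b \<ge> 1 \<Longrightarrow> p b (g a v) = g a (p b v) + g (a + b) v"
  shows "El (Suc j) (g a v) = g a (El (Suc j) v) + g (Suc a) (El j v)"
proof (induction j rule: less_induct)
  case (less j)
  have gz: "g a 0 = 0" for a using gs[of a 0 0] by simp
  have gsum: "g a (\<Sum>i\<in>I. f i) = (\<Sum>i\<in>I. g a (f i))" for a I and f :: "nat \<Rightarrow> 'v"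
    by (induction I rule: infinite_finite_induct) (auto simp: ga gz)
  have Hs: "H (Suc j) (g a v) = g a (H (Suc j) v) + H j (g (Suc a) v)" for j a v
    by (rule H_shift) (use assms in auto)
  have "El (Suc j) (g a v) = (\<Sum>c\<le>j. scale ((-1) ^ (j - c)) (H (Suc (j - c)) (El c (g a v))))"
    by (subst El_recurrence) (auto simp: lessThan_Suc_atMost Suc_diff_le intro!: sum.cong)
  also have "\<dots> = H (Suc j) (scale ((-1) ^ j) (g a v)) +
      (\<Sum>c<j. scale ((-1) ^ (j - Suc c)) (H (Suc (j - Suc c)) (El (Suc c) (g a v))))"
    by (subst sum.atMost_shift) (simp add: H_scale)
  also have "(\<Sum>c<j. scale ((-1) ^ (j - Suc c)) (H (Suc (j - Suc c)) (El (Suc c) (g a v)))) =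
      (\<Sum>c<j. scale ((-1) ^ (j - Suc c)) (H (Suc (j - Suc c)) (g a (El (Suc c) v)))) +
      (\<Sum>c<j. scale ((-1) ^ (j - Suc c)) (H (j - c) (g (Suc a) (El c v))))"
    unfolding sum.distrib[symmetric]
    by (intro sum.cong refl) (use less in \<open>simp add: H_add scale_right_distrib Suc_diff_Suc\<close>)
  also have "H (Suc j) (scale ((-1) ^ j) (g a v)) +
      ((\<Sum>c<j. scale ((-1) ^ (j - Suc c)) (H (Suc (j - Suc c)) (g a (El (Suc c) v)))) +
      (\<Sum>c<j. scale ((-1) ^ (j - Suc c)) (H (j - c) (g (Suc a) (El c v))))) =
      (\<Sum>c\<le>j. scale ((-1) ^ (j - c)) (H (Suc (j - c)) (g a (El c v)))) +
      (\<Sum>c<j. scale ((-1) ^ (j - Suc c)) (H (j - c) (g (Suc a) (El c v))))"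
    by (subst sum.atMost_shift) (simp add: H_scale)
  also have "(\<Sum>c\<le>j. scale ((-1) ^ (j - c)) (H (Suc (j - c)) (g a (El c v)))) =
      g a (El (Suc j) v) + (\<Sum>c\<le>j. scale ((-1) ^ (j - c)) (H (j - c) (g (Suc a) (El c v))))"
    by (subst El_recurrence)
       (auto simp: lessThan_Suc_atMost Hs scale_right_distrib sum.distrib gsum gs Suc_diff_le
         intro!: sum.cong)
  also have "(\<Sum>c\<le>j. scale ((-1) ^ (j - c)) (H (j - c) (g (Suc a) (El c v)))) =
      g (Suc a) (El j v) + (\<Sum>c<j. - scale ((-1) ^ (j - Suc c)) (H (j - c) (g (Suc a) (El c v))))"
    by (simp add: lessThan_Suc_atMost[symmetric])
       (intro sum.cong refl, simp add: Suc_diff_Suc[symmetric])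
  finally show ?case by (simp add: sum_negf)
qed

end

section \<open>Currents on the exterior algebra\<close>

type_synonym fock = "(nat \<times> nat) set \<Rightarrow> complex"

definition fscale :: "complex \<Rightarrow> fock \<Rightarrow> fock" where
  "fscale c f = (\<lambda>S. c * f S)"

definition creat :: "nat \<times> nat \<Rightarrow> fock \<Rightarrow> fock" where
  "creat p f = (\<lambda>S. if finite S \<and> p \<in> S then wedge_sign {p} (S - {p}) * f (S - {p}) else 0)"

text \<open>The guard differs from \<open>yderiv\<close>, but becomes invisible once a variable is
  multiplied on, since a wedge product vanishes on infinite sets. There \<open>wedge_sign\<close> no
  longer counts inversions, and without the guard two derivatives need not anticommute.\<close>

definition annih :: "nat \<times> nat \<Rightarrow> fock \<Rightarrow> fock" where
  "annih p f = (\<lambda>S. if finite S \<and> p \<notin> S then wedge_sign {p} S * f (insert p S) else 0)"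

definition current :: "nat \<Rightarrow> nat \<Rightarrow> nat \<Rightarrow> nat \<Rightarrow> fock \<Rightarrow> fock" where
  "current r i j a f = (\<Sum>s<r - a. creat (i, s) (annih (j, s + a) f))"

text \<open>Replacing the derivatives from column \<open>r\<close> on by zero models C[t]/t^r:
  shifting a derivative by t^a then has no boundary case.\<close>

definition annih_below :: "nat \<Rightarrow> nat \<Rightarrow> nat \<Rightarrow> fock \<Rightarrow> fock" where
  "annih_below r i s f = (if s < r then annih (i, s) f else 0)"

definition monomial :: "(nat \<times> nat) set \<Rightarrow> fock" where
  "monomial Q = (\<lambda>S. if S = Q then 1 else 0)"

lemmas fun_apply = plus_fun_apply zero_fun_apply minus_apply uminus_apply

declare plus_fun_apply [simp del] zero_fun_apply [simp del] minus_apply [simp del]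
  uminus_apply [simp del]

lemma vector_space_fscale: "vector_space fscale"
  by unfold_locales (auto simp: fscale_def algebra_simps fun_eq_iff fun_apply)

interpretation fock: vector_space fscale
  by (rule vector_space_fscale)

lemma fscale_apply: "fscale c f S = c * f S"
  by (simp add: fscale_def)

section \<open>Clifford relations between variables and derivatives\<close>

lemma creat_linear:
  "creat p (f + g) = creat p f + creat p g" "creat p (fscale c f) = fscale c (creat p f)"
  "creat p 0 = 0" "creat p (- f) = - creat p f"
  by (auto simp: creat_def fun_eq_iff algebra_simps fun_apply fscale_apply)

lemma annih_linear:
  "annih p (f + g) = annih p f + annih p g" "annih p (fscale c f) = fscale c (annih p f)"
  "annih p 0 = 0" "annih p (- f) = - annih p f"
  by (auto simp: annih_def fun_eq_iff algebra_simps fun_apply fscale_apply)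

lemma annih_sum: "annih p (\<Sum>i\<in>I. f i) = (\<Sum>i\<in>I. annih p (f i))"
  by (induction I rule: infinite_finite_induct) (auto simp: annih_linear)

lemma creat_sum: "creat p (\<Sum>i\<in>I. f i) = (\<Sum>i\<in>I. creat p (f i))"
  by (induction I rule: infinite_finite_induct) (auto simp: creat_linear)

lemma annih_annih: "annih p (annih q f) = - annih q (annih p f)"
proof
  fix S
  show "annih p (annih q f) S = (- annih q (annih p f)) S"
  proof (cases "finite S \<and> p \<notin> S \<and> q \<notin> S \<and> p \<noteq> q")
    case True
    then have "wedge_sign {p} S * wedge_sign {q} (insert p S) =
        - (wedge_sign {q} S * wedge_sign {p} (insert q S))"
      using wedge_sign_swap[of S p q] by (simp add: mult.commute)
    then show ?thesis
      using True by (auto simp: annih_def insert_commute fun_apply simp flip: mult.assoc)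
  qed (auto simp: annih_def fun_apply)
qed

text \<open>The Clifford relation. On an infinite set both operators return zero, so the identity
  term is right only for an \<open>f\<close> that vanishes there.\<close>

lemma annih_creat:
  assumes "\<And>S. infinite S \<Longrightarrow> f S = 0"
  shows "annih p (creat q f) = (if p = q then f else 0) - creat q (annih p f)"
proof
  fix S
  show "annih p (creat q f) S = ((if p = q then f else 0) - creat q (annih p f)) S"
  proof (cases "finite S")
    case fin: True
    show ?thesis
    proof (cases "p = q")
      case True
      then show ?thesis using fin
        by (auto simp: creat_def annih_def insert_absorb fun_apply simp flip: mult.assoc)
    next
      case neq: False
      show ?thesis
      proof (cases "p \<notin> S \<and> q \<in> S")
        case True
        define R where "R = S - {q}"
        have R: "finite R" "p \<notin> R" "q \<notin> R" "S = insert q R" "insert p (insert q R) - {q} = insert p R"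
          "insert q R - {q} = R"
          using True fin neq by (auto simp: R_def)
        have "wedge_sign {p} (insert q R) * wedge_sign {q} (insert p R) =
            - (wedge_sign {q} R * wedge_sign {p} R)"
          using R neq lex_total[of p q] by (auto simp: wedge_sign_insert)
        then show ?thesis
          using neq R True by (auto simp: annih_def creat_def R(4) fun_apply simp flip: mult.assoc)
      next
        case False
        then show ?thesis using fin neq by (auto simp: annih_def creat_def fun_apply)
      qed
    qed
  next
    case False
    then show ?thesis using assms by (auto simp: annih_def creat_def fun_apply)
  qed
qed

lemma annih_creat_annih:
  "annih p (creat q (annih t f)) = (if p = q then annih t f else 0) + creat q (annih t (annih p f))"
proof (subst annih_creat)
  show "infinite S \<Longrightarrow> annih t f S = 0" for S by (simp add: annih_def)
qed (simp add: annih_annih[of p t] creat_linear)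

lemma current_linear:
  "current r i j a (f + g) = current r i j a f + current r i j a g"
  "current r i j a (fscale c f) = fscale c (current r i j a f)"
  by (simp_all add: current_def creat_linear annih_linear sum.distrib fock.scale_sum_right)

lemma current_zero [simp]: "current r i j a 0 = 0"
  by (simp add: current_def creat_linear annih_linear)

lemma annih_below_linear:
  "annih_below r i s (f + g) = annih_below r i s f + annih_below r i s g"
  "annih_below r i s (fscale c f) = fscale c (annih_below r i s f)"
  "annih_below r i s (- f) = - annih_below r i s f"
  by (simp_all add: annih_below_def annih_linear)

lemma annih_below_zero [simp]: "annih_below r i s 0 = 0"
  by (simp add: annih_below_def annih_linear)

lemma annih_below_anticommute:
  "annih_below r i s (annih_below r j t f) = - annih_below r j t (annih_below r i s f)"
  using annih_annih[of "(i,s)" "(j,t)" f] by (simp add: annih_below_def annih_linear)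

lemma annih_below_square [simp]: "annih_below r i s (annih_below r i s f) = 0"
proof
  fix S
  have "annih_below r i s (annih_below r i s f) S = - annih_below r i s (annih_below r i s f) S"
    using annih_below_anticommute[of r i s i s f] by (metis uminus_apply)
  then show "annih_below r i s (annih_below r i s f) S = 0 S" by (simp add: fun_apply)
qed

text \<open>By the Clifford relation only the variable y_(i,s) with (i, s) = (k, t) contributes to
  the bracket. The derivatives of a row thus behave like powers of t: the current passes from row i
  to row j and multiplies by t^a.\<close>

lemma annih_below_current:
  "annih_below r k t (current r i j a f) =
     current r i j a (annih_below r k t f) + (if k = i then annih_below r j (t + a) f else 0)"
proof (cases "t < r")
  case True
  have "annih (k, t) (current r i j a f) =
      (\<Sum>s<r - a. (if k = i \<and> t = s then annih (j, s + a) f else 0) +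
        creat (i, s) (annih (j, s + a) (annih (k, t) f)))"
    by (simp add: current_def annih_sum annih_creat_annih)
  also have "\<dots> = (\<Sum>s<r - a. if s = t then (if k = i then annih (j, s + a) f else 0) else 0) +
      current r i j a (annih (k, t) f)"
    by (auto simp: current_def sum.distrib intro!: sum.cong)
  finally show ?thesis
    using True by (auto simp: annih_below_def)
qed (simp add: annih_below_def)

lemma annih_below_monomial:
  assumes "finite Q"
  shows "annih_below r i s (monomial Q) =
    (if s < r \<and> (i, s) \<in> Q then fscale (wedge_sign {(i, s)} (Q - {(i, s)})) (monomial (Q - {(i, s)})) else 0)"
proof
  fix S
  have "finite S \<and> (i, s) \<notin> S \<and> insert (i, s) S = Q \<longleftrightarrow> (i, s) \<in> Q \<and> S = Q - {(i, s)}"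
    using assms by (auto simp: insert_absorb)
  then show "annih_below r i s (monomial Q) S =
    (if s < r \<and> (i, s) \<in> Q then fscale (wedge_sign {(i, s)} (Q - {(i, s)})) (monomial (Q - {(i, s)})) else 0) S"
    using assms by (auto simp: annih_below_def annih_def monomial_def fun_apply fscale_apply)
qed

section \<open>Commutators of currents\<close>

lemma creat_creat: "creat p (creat q f) = - creat q (creat p f)"
proof
  fix S
  show "creat p (creat q f) S = (- creat q (creat p f)) S"
  proof (cases "finite S \<and> p \<in> S \<and> q \<in> S \<and> p \<noteq> q")
    case True
    define R where "R = S - {p} - {q}"
    have R: "finite R" "p \<notin> R" "q \<notin> R" "S - {p} = insert q R" "S - {q} = insert p R"
      "insert p R - {p} = R" "insert q R - {q} = R"
      using True by (auto simp: R_def)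
    have "wedge_sign {p} (insert q R) * wedge_sign {q} R = - (wedge_sign {q} (insert p R) * wedge_sign {p} R)"
      using wedge_sign_swap[of R p q] R True by simp
    then show ?thesis
      using True R by (simp add: creat_def fun_apply flip: mult.assoc)
  qed (auto simp: creat_def fun_apply)
qed

lemma current_eq_sum: "current r i j a f = (\<Sum>s<r. creat (i, s) (annih_below r j (s + a) f))"
  unfolding current_def
  by (rule sum.mono_neutral_cong_left) (auto simp: annih_below_def creat_linear)

text \<open>Dually to the derivatives, variables are moved down by \<open>b\<close> columns, and a
  move below column 0 gives zero; hence the guard \<open>b \<le> s\<close>.\<close>

lemma current_creat:
  assumes "\<And>S. infinite S \<Longrightarrow> h S = 0" "s < r"
  shows "current r k l b (creat (i, s) h) =
    creat (i, s) (current r k l b h) + (if l = i \<and> b \<le> s then creat (k, s - b) h else 0)"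
proof -
  have "current r k l b (creat (i, s) h) =
      (\<Sum>u<r - b. creat (k, u) ((if (l, u + b) = (i, s) then h else 0) - creat (i, s) (annih (l, u + b) h)))"
    unfolding current_def using annih_creat[OF assms(1)] by simp
  also have "\<dots> = (\<Sum>u<r - b. (if u = s - b then (if l = i \<and> b \<le> s then creat (k, u) h else 0) else 0) +
      creat (i, s) (creat (k, u) (annih (l, u + b) h)))"
  proof (rule sum.cong[OF refl])
    fix u
    have "creat (k, u) (g - creat (i, s) g') = creat (k, u) g + creat (i, s) (creat (k, u) g')" for g g'
      unfolding diff_conv_add_uminus creat_linear by (simp add: creat_creat[of "(k, u)" "(i, s)"])
    then show "creat (k, u) ((if (l, u + b) = (i, s) then h else 0) - creat (i, s) (annih (l, u + b) h)) =
      (if u = s - b then (if l = i \<and> b \<le> s then creat (k, u) h else 0) else 0) +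
      creat (i, s) (creat (k, u) (annih (l, u + b) h))"
      by (auto simp: creat_linear)
  qed
  finally show ?thesis
    using assms(2) by (auto simp: sum.distrib current_def creat_sum)
qed

lemma current_commutator:
  "current r i j a (current r k l b f) = current r k l b (current r i j a f) +
     (if j = k then current r i l (a + b) f else 0) - (if l = i then current r k j (a + b) f else 0)"
proof -
  let ?g = "\<lambda>s. annih_below r j (s + a) f"
  have fin: "?g s S = 0" if "infinite S" for s S
    using that by (simp add: annih_below_def annih_def fun_apply)
  have shift: "creat (i, s) (current r k l b (?g s)) = current r k l b (creat (i, s) (?g s)) -
      (if l = i \<and> b \<le> s then creat (k, s - b) (?g s) else 0)" if "s < r" for s
    using current_creat[of "?g s" s r k l b i] fin that by simp
  have "current r i j a (current r k l b f) =
      (\<Sum>s<r. creat (i, s) (current r k l b (?g s)) +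
        (if j = k then creat (i, s) (annih_below r l (s + (a + b)) f) else 0))"
    unfolding current_eq_sum[of r i j]
    by (intro sum.cong refl) (simp add: annih_below_current creat_linear add.assoc)
  also have "\<dots> = (\<Sum>s<r. creat (i, s) (current r k l b (?g s))) +
      (if j = k then current r i l (a + b) f else 0)"
    by (simp add: sum.distrib current_eq_sum[of r i l])
  also have "(\<Sum>s<r. creat (i, s) (current r k l b (?g s))) = (\<Sum>s<r. current r k l b (creat (i, s) (?g s))) -
      (\<Sum>s<r. if l = i \<and> b \<le> s then creat (k, s - b) (?g s) else 0)"
    unfolding sum_subtractf[symmetric] by (intro sum.cong refl) (use shift in auto)
  also have "(\<Sum>s<r. current r k l b (creat (i, s) (?g s))) = current r k l b (current r i j a f)"
  proof -
    have "current r k l b (\<Sum>s<r'. h s) = (\<Sum>s<r'. current r k l b (h s))" for r' and h :: "nat \<Rightarrow> fock"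
      by (induction r') (simp_all add: current_linear current_def creat_linear annih_linear)
    then show ?thesis by (simp add: current_eq_sum[of r i j])
  qed
  also have "(\<Sum>s<r. if l = i \<and> b \<le> s then creat (k, s - b) (?g s) else 0) =
      (if l = i then current r k j (a + b) f else 0)"
  \<comment> \<open>With u = s - b the columns b, ..., r-1 become 0, ..., r-b-1. The sum may be
    extended up to r, because the added terms differentiate beyond the truncation.\<close>
  proof (cases "l = i")
    case True
    have "(\<Sum>s<r. if b \<le> s then creat (k, s - b) (?g s) else 0) =
        (\<Sum>s\<in>{b..<r}. creat (k, s - b) (?g s))"
      by (intro sum.mono_neutral_cong_right) auto
    also have "\<dots> = (\<Sum>u<r - b. creat (k, u) (annih_below r j (u + (a + b)) f))"
      by (rule sum.reindex_bij_witness[of _ "\<lambda>u. u + b" "\<lambda>s. s - b"]) (auto simp: ac_simps)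
    also have "\<dots> = (\<Sum>u<r. creat (k, u) (annih_below r j (u + (a + b)) f))"
      by (intro sum.mono_neutral_left) (auto simp: annih_below_def creat_linear)
    finally show ?thesis using True by (simp add: current_eq_sum[of r k j])
  qed simp
  finally show ?thesis by simp
qed

lemma wedge_sign_nonzero: "wedge_sign A B \<noteq> 0"
  by (simp add: wedge_sign_def)

text \<open>The current moves a box from column s + a to column s, which needs the former occupied
  and the latter free.\<close>

lemma current_monomial_contiguous:
  assumes "finite Q" "a \<ge> 1" "\<And>s. (i, s + a) \<in> Q \<Longrightarrow> (i, s) \<in> Q"
  shows "current r i i a (monomial Q) = 0"
proof -
  have "creat (i, s) (annih (i, s + a) (monomial Q)) S = 0" for s S
  proof (cases "finite S \<and> (i, s) \<in> S \<and> (i, s + a) \<notin> S - {(i, s)} \<and> insert (i, s + a) (S - {(i, s)}) = Q")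
    case True
    then have "(i, s) \<in> Q" using assms(3)[of s] by blast
    then show ?thesis using True \<open>a \<ge> 1\<close> by auto
  qed (auto simp: creat_def annih_def monomial_def)
  then have "creat (i, s) (annih (i, s + a) (monomial Q)) = 0" for s
    by (simp add: fun_eq_iff fun_apply)
  then show ?thesis by (simp add: current_def)
qed

text \<open>The operator by which the power sum of degree \<open>b\<close> acts on row \<open>i\<close>.\<close>
abbreviation fock_p :: "nat \<Rightarrow> nat \<Rightarrow> nat \<Rightarrow> fock \<Rightarrow> fock" where
  "fock_p r i \<equiv> \<lambda>b f. - current r i i b f"

abbreviation fock_H :: "nat \<Rightarrow> nat \<Rightarrow> nat \<Rightarrow> fock \<Rightarrow> fock" where
  "fock_H r i \<equiv> Hop fscale (fock_p r i)"

interpretation fock_p: power_sum_action fscale "fock_p r i" for r i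
  by unfold_locales (auto simp: current_linear)

text \<open>The sign in \<open>fock_p\<close> makes p_b move a derivative from column s to column s
  + b with coefficient +1, so every derivative in row i counts as one variable.\<close>

lemma fock_H_shift:
  "fock_H r i (Suc j) (annih_below r i s f) =
     annih_below r i s (fock_H r i (Suc j) f) + fock_H r i j (annih_below r i (Suc s) f)"
  by (rule fock_p.H_shift[where g = "annih_below r i"])
     (auto simp: annih_below_linear annih_below_current)

lemma fock_H_commute:
  assumes "k \<noteq> i"
  shows "annih_below r k t (fock_H r i j f) = fock_H r i j (annih_below r k t f)"
  by (rule fock_p.H_commute) (auto simp: annih_below_linear annih_below_current assms)

section \<open>Complete homogeneous operators on the holes of one row\<close>

definition row_annih :: "nat \<Rightarrow> nat \<Rightarrow> nat list \<Rightarrow> fock \<Rightarrow> fock" where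
  "row_annih r i ss f = foldr (annih_below r i) ss f"

lemma row_annih_simps [simp]:
  "row_annih r i [] f = f" "row_annih r i (s # ss) f = annih_below r i s (row_annih r i ss f)"
  by (simp_all add: row_annih_def)

lemma row_annih_append: "row_annih r i (ss @ ts) f = row_annih r i ss (row_annih r i ts f)"
  by (simp add: row_annih_def)

lemma annih_below_row_annih_mem:
  "s \<in> set ss \<Longrightarrow> annih_below r i s (row_annih r i ss f) = 0"
proof (induction ss)
  case (Cons t ss)
  show ?case
  proof (cases "s = t")
    case False
    then have "annih_below r i s (row_annih r i ss f) = 0" using Cons by auto
    then show ?thesis
      using annih_below_anticommute[of r i s i t] by simp
  qed simp
qed simp

text \<open>
  The complete homogeneous operator is of degree at most \<open>m - s\<^sub>1 - k\<close> on \<open>k\<close> holes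
  \<open>s\<^sub>1 < \<dots> < s\<^sub>k\<close> in a row filled up to \<open>m\<close>, and its top coefficient shifts the holes.
\<close>
lemma fock_H_row_annih:
  assumes Y: "\<And>j. j \<ge> 1 \<Longrightarrow> fock_H r i j Y = 0" "\<And>s. s \<ge> m \<Longrightarrow> annih_below r i s Y = 0"
    and "sorted_wrt (<) (s # ss)" "\<forall>t\<in>set (s # ss). t < m" "j + Suc (length ss) + s \<ge> m"
  shows "fock_H r i j (row_annih r i (s # ss) Y) =
    (if j + Suc (length ss) + s = m then row_annih r i (map (\<lambda>t. t - 1) ss @ [m - 1]) Y else 0)"
  using assms(3-)
proof (induction ss arbitrary: s j)
  case Nil
  have "fock_H r i j (annih_below r i s Y) = annih_below r i (s + j) Y" for s
  proof (induction j arbitrary: s)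
    case (Suc j)
    show ?case by (simp add: fock_H_shift Y(1) Suc)
  qed simp
  then show ?case using Nil Y(2) by (auto simp: add.commute)
next
  case (Cons t ss)
  let ?A = "row_annih r i (t # ss) Y"
  let ?R = "row_annih r i (map (\<lambda>t. t - 1) (t # ss) @ [m - 1]) Y"
  have st: "s < t" using Cons.prems by simp
  have srt: "sorted_wrt (<) (t # ss)" and lt: "\<forall>u\<in>set (t # ss). u < m" using Cons.prems by auto
  have len: "t + Suc (length ss) \<le> m"
  proof -
    have "sorted_wrt (<) us \<Longrightarrow> (\<forall>u\<in>set us. u < m) \<Longrightarrow> us \<noteq> [] \<Longrightarrow> hd us + length us \<le> m" for us :: "nat list"
    proof (induction us)
      case (Cons u us)
      then show ?case by (cases us) auto
    qed simp
    from this[OF srt lt] show ?thesis by simp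
  qed
  \<comment> \<open>This is Pieri's rule in an exterior power: a hole can move up at most to the
    column just below the next hole. The induction on the gap moves the first hole by one column at
    a time; once it would touch the next one, the shifted term repeats a derivative and
    vanishes.\<close>
  have "fock_H r i j' (annih_below r i s' ?A) = (if j' + Suc (length (t # ss)) + s' = m then ?R else 0)"
    if "s' < t" "j' + Suc (length (t # ss)) + s' \<ge> m" for s' j'
    using that
  proof (induction "t - s'" arbitrary: s' j')
    case (Suc d)
    have IH: "fock_H r i j' ?A = (if j' + Suc (length ss) + t = m then row_annih r i (map (\<lambda>t. t - 1) ss @ [m - 1]) Y else 0)"
      using Cons.IH[OF srt lt, of j'] Suc.prems by simp
    show ?case
    proof (cases "Suc s' = t")
      case True
      then have "annih_below r i (Suc s') ?A = 0"
        by (intro annih_below_row_annih_mem) auto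
      then have "fock_H r i j' (annih_below r i s' ?A) = annih_below r i s' (fock_H r i j' ?A)"
        by (cases j') (simp_all add: fock_H_shift)
      then show ?thesis
        using IH True by auto
    next
      case False
      obtain j'' where j'': "j' = Suc j''"
        using Suc.prems len False by (cases j') auto
      then have "fock_H r i j'' (annih_below r i (Suc s') ?A) =
          (if j'' + Suc (length (t # ss)) + Suc s' = m then ?R else 0)"
        by (intro Suc.hyps(1)) (use Suc.hyps(2) Suc.prems False in \<open>auto simp: j''\<close>)
      moreover have "fock_H r i j' ?A = 0"
        using IH Suc.prems False by auto
      ultimately show ?thesis
        unfolding j'' fock_H_shift by (auto simp: j'')
    qed
  qed simp
  from this[OF st] show ?case
    using Cons.prems by simp
qed

section \<open>Derivatives of products of lowering operators\<close>

text \<open>Folding over a multiset requires operators that commute for all indices, while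
  \<open>g\<close> is only known to commute below \<open>n\<close>; the guard turns the other
  operators into identities.\<close>

definition mprod :: "nat \<Rightarrow> (nat \<Rightarrow> 'v \<Rightarrow> 'v) \<Rightarrow> nat multiset \<Rightarrow> 'v \<Rightarrow> 'v" where
  "mprod n g M v = fold_mset (\<lambda>i u. if i < n then g i u else u) v M"

locale commuting_family =
  fixes n :: nat and g :: "nat \<Rightarrow> 'v \<Rightarrow> 'v"
  assumes g_commute: "i < n \<Longrightarrow> j < n \<Longrightarrow> g i (g j v) = g j (g i v)"
begin

lemma comp_fun_commute_guarded: "comp_fun_commute (\<lambda>i u. if i < n then g i u else u)"
  by unfold_locales (auto simp: fun_eq_iff g_commute)

lemma mprod_empty [simp]: "mprod n g {#} v = v"
  by (simp add: mprod_def)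

lemma mprod_add [simp]: "i < n \<Longrightarrow> mprod n g (add_mset i M) v = g i (mprod n g M v)"
  by (simp add: mprod_def comp_fun_commute.fold_mset_add_mset[OF comp_fun_commute_guarded])

lemma mprod_add_inner:
  "set_mset M \<subseteq> {..<n} \<Longrightarrow> i < n \<Longrightarrow> mprod n g (add_mset i M) v = mprod n g M (g i v)"
  by (induction M) (auto simp: g_commute[of i])

end

definition lowered_weight :: "nat \<Rightarrow> nat multiset \<Rightarrow> nat" where
  "lowered_weight n M = (\<Sum>i\<in>#M. n - i)"

lemma lowered_weight_simps [simp]:
  "lowered_weight n {#} = 0" "lowered_weight n (add_mset i M) = n - i + lowered_weight n M"
  by (simp_all add: lowered_weight_def)

lemma lowered_weight_diff:
  "i \<in># M \<Longrightarrow> lowered_weight n M = n - i + lowered_weight n (M - {#i#})"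
  by (metis insert_DiffM lowered_weight_simps(2))

lemma lowered_weight_plus: "lowered_weight n (M + M') = lowered_weight n M + lowered_weight n M'"
  by (simp add: lowered_weight_def)

lemma lowered_weight_replicate_Suc:
  "Suc i < n \<Longrightarrow> lowered_weight n (replicate_mset s i) = lowered_weight n (replicate_mset s (Suc i)) + s"
  by (induction s) auto

abbreviation fock_P :: "nat \<Rightarrow> nat \<Rightarrow> nat multiset \<Rightarrow> fock \<Rightarrow> fock" where
  "fock_P r n \<equiv> mprod n (\<lambda>i. current r n i 0)"

interpretation fock_P: commuting_family n "\<lambda>i. current r n i 0" for r n
  by unfold_locales (subst current_commutator, simp)

lemma fock_P_linear:
  assumes "set_mset M \<subseteq> {..<n}"
  shows "fock_P r n M (f + g) = fock_P r n M f + fock_P r n M g"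
    and "fock_P r n M (fscale c f) = fscale c (fock_P r n M f)"
    and "fock_P r n M 0 = 0"
  using assms by (induction M) (auto simp: current_linear)

lemma annih_below_fock_P_row:
  assumes "set_mset M \<subseteq> {..<n}" "i < n"
  shows "annih_below r i s (fock_P r n M f) = fock_P r n M (annih_below r i s f)"
  using assms by (induction M) (auto simp: annih_below_current)

text \<open>A Leibniz rule: the bracket with E_(n,i) turns the derivative in row n into the one in
  row i and the same column, and this commutes with all remaining factors.\<close>

lemma annih_below_fock_P_last:
  assumes "set_mset M \<subseteq> {..<n}" "annih_below r n s z = 0"
  shows "annih_below r n s (fock_P r n M z) =
    (\<Sum>i\<in>#M. fock_P r n (M - {#i#}) (annih_below r i s z))"
  using assms(1)
proof (induction M)
  case empty
  then show ?case by (simp add: assms(2))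
next
  case (add q M)
  have q: "q < n" and M: "set_mset M \<subseteq> {..<n}" using add.prems by auto
  have lin: "current r n q 0 (\<Sum>i\<in>#A. h i) = (\<Sum>i\<in>#A. current r n q 0 (h i))" for A and h :: "nat \<Rightarrow> fock"
    by (induction A) (auto simp: current_linear)
  have "annih_below r n s (fock_P r n (add_mset q M) z) =
      current r n q 0 (\<Sum>i\<in>#M. fock_P r n (M - {#i#}) (annih_below r i s z)) +
      fock_P r n M (annih_below r q s z)"
    using q M add.IH by (simp add: annih_below_current annih_below_fock_P_row)
  also have "current r n q 0 (\<Sum>i\<in>#M. fock_P r n (M - {#i#}) (annih_below r i s z)) =
      (\<Sum>i\<in>#M. fock_P r n (add_mset q M - {#i#}) (annih_below r i s z))"
    unfolding lin by (intro arg_cong[of _ _ sum_mset] image_mset_cong) (use q in auto)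
  finally show ?case by (simp add: add.commute)
qed

section \<open>Triangularity of last-row derivatives on products of lowering operators\<close>

definition last_annihs :: "nat \<Rightarrow> nat \<Rightarrow> (nat \<times> nat) list \<Rightarrow> fock \<Rightarrow> fock" where
  "last_annihs r n qs f = foldr (\<lambda>(i, s). annih_below r n s) qs f"

definition row_annihs :: "nat \<Rightarrow> (nat \<times> nat) list \<Rightarrow> fock \<Rightarrow> fock" where
  "row_annihs r qs f = foldr (\<lambda>(i, s). annih_below r i s) qs f"

lemma last_annihs_linear:
  "last_annihs r n qs (f + g) = last_annihs r n qs f + last_annihs r n qs g"
  "last_annihs r n qs (fscale c f) = fscale c (last_annihs r n qs f)"
  "last_annihs r n qs 0 = 0"
  by (induction qs) (auto simp: last_annihs_def annih_below_linear split: prod.splits)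

lemma last_annihs_sum_mset: "last_annihs r n qs (\<Sum>i\<in>#A. h i) = (\<Sum>i\<in>#A. last_annihs r n qs (h i))"
  by (induction A) (auto simp: last_annihs_linear)

lemma last_annihs_current:
  "i < n \<Longrightarrow> last_annihs r n qs (current r i j a f) = current r i j a (last_annihs r n qs f)"
  by (induction qs) (auto simp: last_annihs_def annih_below_current)

locale fock_vacuum =
  fixes r n :: nat and \<xi> :: "nat \<Rightarrow> nat"
  assumes decreasing: "i \<le> j \<Longrightarrow> j \<le> n \<Longrightarrow> \<xi> j \<le> \<xi> i"
begin

definition vacuum_like :: "fock \<Rightarrow> bool" where
  "vacuum_like z \<longleftrightarrow> (\<forall>i\<le>n. \<forall>s\<ge>\<xi> i. annih_below r i s z = 0)"

text \<open>From column \<open>\<xi> (Suc i)\<close> on, the rows after row i are empty. A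
  derivative in row n labelled (i, s) can therefore only remove factors E_(n,j) with j at most i;
  the label i records which factor it is meant to remove.\<close>

definition admissible :: "(nat \<times> nat) list \<Rightarrow> bool" where
  "admissible qs \<longleftrightarrow> (\<forall>(i, s)\<in>set qs. i < n \<and> \<xi> (Suc i) \<le> s)"

lemma vacuum_like_annih: "vacuum_like z \<Longrightarrow> vacuum_like (annih_below r j t z)"
  using annih_below_anticommute[of r _ _ j t z] by (auto simp: vacuum_like_def)

lemma annih_below_vacuum_like:
  assumes "vacuum_like z" "admissible qs" "(i, s) \<in> set qs" "i < j" "j \<le> n"
  shows "annih_below r j s z = 0"
proof -
  have "\<xi> j \<le> \<xi> (Suc i)" using assms by (intro decreasing) auto
  also have "\<dots> \<le> s" using assms by (auto simp: admissible_def)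
  finally show ?thesis using assms by (auto simp: vacuum_like_def)
qed

lemma last_annihs_step:
  assumes "vacuum_like z" "admissible (qs @ [(i, s)])" "set_mset M \<subseteq> {..<n}"
  shows "last_annihs r n (qs @ [(i, s)]) (fock_P r n M z) =
    (\<Sum>j\<in>#M. if j \<le> i then last_annihs r n qs (fock_P r n (M - {#j#}) (annih_below r j s z)) else 0)"
proof -
  have "annih_below r j s z = 0" if "i < j" "j \<le> n" for j
    using annih_below_vacuum_like[OF assms(1,2), of i s j] that by simp
  moreover have "i < n" using assms(2) by (auto simp: admissible_def)
  ultimately have vac: "annih_below r n s z = 0" "\<And>j. i < j \<Longrightarrow> j < n \<Longrightarrow> annih_below r j s z = 0"
    by auto
  have sub: "set_mset (M - {#j#}) \<subseteq> {..<n}" for j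
    using assms(3) by (meson in_diffD subset_iff)
  have "last_annihs r n (qs @ [(i, s)]) (fock_P r n M z) = last_annihs r n qs (annih_below r n s (fock_P r n M z))"
    by (simp add: last_annihs_def)
  also have "\<dots> = (\<Sum>j\<in>#M. last_annihs r n qs (fock_P r n (M - {#j#}) (annih_below r j s z)))"
    by (simp add: annih_below_fock_P_last[OF assms(3) vac(1)] last_annihs_sum_mset)
  also have "\<dots> = (\<Sum>j\<in>#M. if j \<le> i then last_annihs r n qs (fock_P r n (M - {#j#}) (annih_below r j s z)) else 0)"
    by (intro arg_cong[of _ _ sum_mset] image_mset_cong)
       (use vac assms(3) in \<open>auto simp: fock_P_linear(3)[OF sub] last_annihs_linear subset_iff\<close>)
  finally show ?thesis .
qed

lemma admissible_append [simp]:
  "admissible (qs @ [(i, s)]) \<longleftrightarrow> admissible qs \<and> i < n \<and> \<xi> (Suc i) \<le> s"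
  by (auto simp: admissible_def)

lemma admissible_Nil [simp]: "admissible []"
  by (simp add: admissible_def)

text \<open>A derivative labelled i removes some j at most i, which costs at least n - i in height.
  If the total height is too small, the factors run out before the derivatives do, and the next
  derivative in row n finds nothing to act on.\<close>

lemma last_annihs_fock_P_less:
  assumes "admissible qs" "vacuum_like z" "set_mset M \<subseteq> {..<n}"
    and "lowered_weight n M < lowered_weight n (mset (map fst qs))"
  shows "last_annihs r n qs (fock_P r n M z) = 0"
  using assms
proof (induction qs arbitrary: M z rule: rev_induct)
  case (snoc q qs)
  obtain i s where q: "q = (i, s)" by force
  have "last_annihs r n qs (fock_P r n (M - {#j#}) (annih_below r j s z)) = 0" if "j \<in># M" "j \<le> i" for j
  proof (rule snoc.IH)
    show "lowered_weight n (M - {#j#}) < lowered_weight n (mset (map fst qs))"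
      using snoc.prems(4) lowered_weight_diff[OF that(1), of n] that(2) by (simp add: q)
    show "set_mset (M - {#j#}) \<subseteq> {..<n}"
      using snoc.prems(3) by (meson in_diffD subset_iff)
  qed (use snoc.prems in \<open>auto simp: q intro: vacuum_like_annih\<close>)
  then have "(\<Sum>j\<in>#M. if j \<le> i then last_annihs r n qs (fock_P r n (M - {#j#}) (annih_below r j s z)) else 0) =
      (\<Sum>j\<in>#M. 0)"
    by (intro arg_cong[of _ _ sum_mset] image_mset_cong) auto
  then show ?case
    using snoc.prems by (subst q, subst last_annihs_step) (auto simp: q)
qed simp

text \<open>With equal heights no derivative may remove more than its own label, so the labels must
  form exactly \<open>M\<close>. The constant counts the matchings of derivatives with factors, a
  product of factorials, and is positive.\<close>

lemma last_annihs_fock_P_eq: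
  assumes "admissible qs" "vacuum_like z" "set_mset M \<subseteq> {..<n}"
    and "lowered_weight n M = lowered_weight n (mset (map fst qs))"
  shows "if M = mset (map fst qs)
    then \<exists>c::nat. c > 0 \<and> last_annihs r n qs (fock_P r n M z) = fscale (of_nat c) (row_annihs r qs z)
    else last_annihs r n qs (fock_P r n M z) = 0"
  using assms
proof (induction qs arbitrary: M z rule: rev_induct)
  case Nil
  then have "x \<notin># M" for x by (force simp: lowered_weight_def subset_iff)
  then have "M = {#}" by (metis multiset_nonemptyE)
  then show ?case
    by (auto simp: last_annihs_def row_annihs_def intro!: exI[of _ "1::nat"])
next
  case (snoc q qs)
  obtain i s where q: "q = (i, s)" by force
  have adm: "admissible qs" "i < n" using snoc.prems(1) by (auto simp: q)
  have sub: "set_mset (M - {#j#}) \<subseteq> {..<n}" for j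
    using snoc.prems(3) by (meson in_diffD subset_iff)
  let ?z = "annih_below r i s z"
  let ?X = "last_annihs r n qs (fock_P r n (M - {#i#}) ?z)"
  have "last_annihs r n qs (fock_P r n (M - {#j#}) (annih_below r j s z)) = 0" if "j \<in># M" "j < i" for j
  proof (rule last_annihs_fock_P_less)
    show "lowered_weight n (M - {#j#}) < lowered_weight n (mset (map fst qs))"
      using snoc.prems(4) lowered_weight_diff[OF that(1), of n] that(2) adm by (simp add: q)
  qed (use snoc.prems sub in \<open>auto simp: q intro: vacuum_like_annih\<close>)
  then have "(\<Sum>j\<in>#M. if j \<le> i then last_annihs r n qs (fock_P r n (M - {#j#}) (annih_below r j s z)) else 0) =
      (\<Sum>j\<in>#M. if j = i then ?X else 0)"
    by (intro arg_cong[of _ _ sum_mset] image_mset_cong) auto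
  also have "\<dots> = fscale (of_nat (count M i)) ?X"
  proof -
    have "(\<Sum>j\<in>#A. if j = i then X else 0) = fscale (of_nat (count A i)) X" for A and X :: fock
      by (induction A) (auto simp: fock.scale_left_distrib)
    then show ?thesis .
  qed
  finally have X: "last_annihs r n (qs @ [q]) (fock_P r n M z) = fscale (of_nat (count M i)) ?X"
    using snoc.prems by (subst q, subst last_annihs_step) (auto simp: q)
  show ?case
  proof (cases "i \<in># M")
    case True
    have "lowered_weight n (M - {#i#}) = lowered_weight n (mset (map fst qs))"
      using snoc.prems(4) lowered_weight_diff[OF True, of n] by (simp add: q)
    then have IH: "if M - {#i#} = mset (map fst qs)
        then \<exists>c::nat. c > 0 \<and> ?X = fscale (of_nat c) (row_annihs r qs ?z) else ?X = 0"
      using snoc.prems adm sub by (intro snoc.IH vacuum_like_annih) auto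
    have eq: "M = mset (map fst (qs @ [q])) \<longleftrightarrow> M - {#i#} = mset (map fst qs)"
    proof
      assume *: "M - {#i#} = mset (map fst qs)"
      have "M = add_mset i (M - {#i#})" using True by simp
      then show "M = mset (map fst (qs @ [q]))" unfolding * by (simp add: q)
    qed (simp add: q)
    show ?thesis
    proof (cases "M - {#i#} = mset (map fst qs)")
      case M: True
      then obtain c :: nat where "c > 0" "?X = fscale (of_nat c) (row_annihs r qs ?z)" using IH by auto
      then have "count M i * c > 0 \<and> last_annihs r n (qs @ [q]) (fock_P r n M z) =
          fscale (of_nat (count M i * c)) (row_annihs r (qs @ [q]) z)"
        using True X by (simp add: row_annihs_def q)
      then have "\<exists>c::nat. c > 0 \<and> last_annihs r n (qs @ [q]) (fock_P r n M z) =
          fscale (of_nat c) (row_annihs r (qs @ [q]) z)" by blast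
      then show ?thesis using eq M by simp
    qed (use eq IH X in simp)
  next
    case False
    then have "M \<noteq> mset (map fst (qs @ [q]))" by (auto simp: q)
    then show ?thesis using X False by (simp add: not_in_iff)
  qed
qed

end


section \<open>Patterns of holes in several rows\<close>

definition rows_annih :: "nat \<Rightarrow> (nat \<Rightarrow> nat list) \<Rightarrow> nat list \<Rightarrow> fock \<Rightarrow> fock" where
  "rows_annih r Ss is f = foldr (\<lambda>i. row_annih r i (Ss i)) is f"

abbreviation holes :: "nat \<Rightarrow> nat \<Rightarrow> (nat \<Rightarrow> nat list) \<Rightarrow> fock \<Rightarrow> fock" where
  "holes r n Ss \<equiv> rows_annih r Ss [0..<n]"

lemma rows_annih_simps [simp]:
  "rows_annih r Ss [] f = f" "rows_annih r Ss (i # is) f = row_annih r i (Ss i) (rows_annih r Ss is f)"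
  by (simp_all add: rows_annih_def)

lemma rows_annih_append: "rows_annih r Ss (is @ js) f = rows_annih r Ss is (rows_annih r Ss js f)"
  by (simp add: rows_annih_def)

lemma rows_annih_cong: "(\<And>i. i \<in> set is \<Longrightarrow> Ss i = Ts i) \<Longrightarrow> rows_annih r Ss is f = rows_annih r Ts is f"
  by (induction "is") auto

lemma row_annih_scale: "row_annih r i ss (fscale c f) = fscale c (row_annih r i ss f)"
  by (induction ss) (auto simp: annih_below_linear)

lemma row_annih_zero [simp]: "row_annih r i ss 0 = 0"
  by (induction ss) auto

lemma rows_annih_scale: "rows_annih r Ss is (fscale c f) = fscale c (rows_annih r Ss is f)"
  by (induction "is") (auto simp: row_annih_scale)

lemma rows_annih_zero [simp]: "rows_annih r Ss is 0 = 0"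
  by (induction "is") auto

lemma row_annihs_eq_rows_annih:
  "row_annihs r (concat (map (\<lambda>i. map (Pair i) (Ss i)) is)) f = rows_annih r Ss is f"
proof (induction "is")
  case (Cons i "is")
  have "row_annihs r (map (Pair i) ss @ qs) f = row_annih r i ss (row_annihs r qs f)" for ss qs
    by (induction ss) (simp_all add: row_annihs_def)
  then show ?case using Cons by simp
qed (simp add: row_annihs_def)

lemma annih_below_rows_annih:
  "\<exists>c. c \<noteq> 0 \<and> (\<forall>f. annih_below r i s (rows_annih r Ss is f) = fscale c (rows_annih r Ss is (annih_below r i s f)))"
proof (induction "is")
  case Nil
  then show ?case by (auto intro!: exI[of _ 1])
next
  case (Cons j "is")
  then obtain c where c: "c \<noteq> 0" "\<And>f. annih_below r i s (rows_annih r Ss is f) = fscale c (rows_annih r Ss is (annih_below r i s f))"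
    by blast
  have *: "annih_below r i s (row_annih r j ss f) = fscale ((-1) ^ length ss) (row_annih r j ss (annih_below r i s f))" for ss f
  proof (induction ss)
    case (Cons t ss)
    then show ?case
      using annih_below_anticommute[of r i s j t "row_annih r j ss f"] by (simp add: annih_below_linear)
  qed simp
  show ?case
    by (rule exI[of _ "(-1) ^ length (Ss j) * c"]) (simp add: * c row_annih_scale)
qed

lemma fock_H_rows_annih:
  assumes "i \<notin> set is"
  shows "fock_H r i j (rows_annih r Ss is f) = rows_annih r Ss is (fock_H r i j f)"
proof -
  have "fock_H r i j (row_annih r k ss f) = row_annih r k ss (fock_H r i j f)" if "k \<noteq> i" for k ss f
    by (induction ss) (simp_all add: fock_H_commute[OF that, symmetric])
  then show ?thesis using assms by (induction "is") auto
qed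

text \<open>In the top coefficient the last hole arrives at column m - 1, the end of the row. It is
  absorbed by shortening the row by one box, and the pattern is left with one hole fewer.\<close>

lemma fock_H_holes:
  assumes "i < n" "finite Q" and Q: "\<And>s. (i, s) \<in> Q \<longleftrightarrow> s < m" and "m \<le> r"
    and Ss: "Ss i = s # ss" "sorted_wrt (<) (s # ss)" "\<forall>t\<in>set (s # ss). t < m"
  shows "j + Suc (length ss) + s > m \<Longrightarrow> fock_H r i j (holes r n Ss (monomial Q)) = 0"
    and "j + Suc (length ss) + s = m \<Longrightarrow> \<exists>c. c \<noteq> 0 \<and> fock_H r i j (holes r n Ss (monomial Q)) =
      fscale c (holes r n (Ss(i := map (\<lambda>t. t - 1) ss)) (monomial (Q - {(i, m - 1)})))"
proof -
  let ?Y = "rows_annih r Ss [Suc i..<n] (monomial Q)"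
  have split: "[0..<n] = [0..<i] @ i # [Suc i..<n]"
    using upt_add_eq_append[of 0 i "n - i"] \<open>i < n\<close> by (simp add: upt_conv_Cons)
  have Hmon: "fock_H r i j (monomial Q) = 0" if "j \<ge> 1" for j
  proof -
    have "current r i i b (monomial Q) = 0" if "b \<ge> 1" for b
      by (rule current_monomial_contiguous[OF \<open>finite Q\<close> that]) (use Q in auto)
    then have "fock_H r i j (monomial Q) \<in> {0}"
      using that by (intro fock_p.H_vanish fock.subspace_single_0) simp_all
    then show ?thesis by simp
  qed
  have Y1: "fock_H r i j ?Y = 0" if "j \<ge> 1" for j
    using Hmon[OF that] by (simp add: fock_H_rows_annih)
  have Y2: "annih_below r i s ?Y = 0" if "s \<ge> m" for s
  proof -
    obtain c where "annih_below r i s ?Y = fscale c (rows_annih r Ss [Suc i..<n] (annih_below r i s (monomial Q)))"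
      using annih_below_rows_annih[of r i s Ss "[Suc i..<n]"] by blast
    then show ?thesis using that Q by (simp add: annih_below_monomial[OF \<open>finite Q\<close>])
  qed
  have main: "fock_H r i j (holes r n Ss (monomial Q)) = rows_annih r Ss [0..<i]
      (if j + Suc (length ss) + s = m then row_annih r i (map (\<lambda>t. t - 1) ss @ [m - 1]) ?Y else 0)"
    if "j + Suc (length ss) + s \<ge> m"
    unfolding split rows_annih_append rows_annih_simps Ss(1)
    by (subst fock_H_rows_annih, simp, subst fock_H_row_annih[OF Y1 Y2 Ss(2,3) that]) auto
  show "fock_H r i j (holes r n Ss (monomial Q)) = 0" if "j + Suc (length ss) + s > m"
    using main that by simp
  show "\<exists>c. c \<noteq> 0 \<and> fock_H r i j (holes r n Ss (monomial Q)) =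
      fscale c (holes r n (Ss(i := map (\<lambda>t. t - 1) ss)) (monomial (Q - {(i, m - 1)})))"
    if eq: "j + Suc (length ss) + s = m"
  proof -
    let ?Ts = "Ss(i := map (\<lambda>t. t - 1) ss)"
    obtain c where c: "c \<noteq> 0" "annih_below r i (m - 1) ?Y =
        fscale c (rows_annih r Ss [Suc i..<n] (annih_below r i (m - 1) (monomial Q)))"
      using annih_below_rows_annih[of r i "m - 1" Ss "[Suc i..<n]"] by blast
    let ?c = "c * wedge_sign {(i, m - 1)} (Q - {(i, m - 1)})"
    have "m - 1 < r" "(i, m - 1) \<in> Q" using Q \<open>m \<le> r\<close> eq by auto
    then have "annih_below r i (m - 1) ?Y = fscale ?c (rows_annih r Ss [Suc i..<n] (monomial (Q - {(i, m - 1)})))"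
      unfolding c(2) annih_below_monomial[OF \<open>finite Q\<close>] by (simp add: rows_annih_scale)
    then have "fock_H r i j (holes r n Ss (monomial Q)) = fscale ?c (rows_annih r Ss [0..<i]
        (row_annih r i (map (\<lambda>t. t - 1) ss) (rows_annih r Ss [Suc i..<n] (monomial (Q - {(i, m - 1)})))))"
      using main eq by (simp add: row_annih_append row_annih_scale rows_annih_scale)
    also have "rows_annih r Ss [0..<i] (row_annih r i (map (\<lambda>t. t - 1) ss)
          (rows_annih r Ss [Suc i..<n] (monomial (Q - {(i, m - 1)})))) =
        holes r n ?Ts (monomial (Q - {(i, m - 1)}))"
    proof -
      have "rows_annih r Ss [0..<i] f = rows_annih r ?Ts [0..<i] f"
        "rows_annih r Ss [Suc i..<n] f = rows_annih r ?Ts [Suc i..<n] f" for f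
        by (auto intro: rows_annih_cong)
      then show ?thesis
        by (simp only: split rows_annih_append rows_annih_simps fun_upd_same)
    qed
    finally show ?thesis
      using c by (intro exI[of _ ?c]) (simp add: wedge_sign_nonzero)
  qed
qed

lemma row_annih_monomial:
  assumes "finite Q" "distinct ss" "\<And>s. s \<in> set ss \<Longrightarrow> s < r \<and> (i, s) \<in> Q"
  shows "\<exists>c. c \<noteq> 0 \<and> row_annih r i ss (monomial Q) = fscale c (monomial (Q - {i} \<times> set ss))"
  using assms(2,3)
proof (induction ss)
  case Nil
  then show ?case by (auto intro!: exI[of _ 1])
next
  case (Cons s ss)
  then obtain c where c: "c \<noteq> 0" "row_annih r i ss (monomial Q) = fscale c (monomial (Q - {i} \<times> set ss))"
    by auto
  let ?Q = "Q - {i} \<times> set ss"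
  have "(i, s) \<in> ?Q" "s < r" "?Q - {(i, s)} = Q - {i} \<times> set (s # ss)"
    using Cons.prems by auto
  then have "row_annih r i (s # ss) (monomial Q) =
      fscale (c * wedge_sign {(i, s)} (?Q - {(i, s)})) (monomial (Q - {i} \<times> set (s # ss)))"
    using assms(1) by (simp add: c annih_below_linear annih_below_monomial)
  then show ?case using c by (intro exI[of _ "c * wedge_sign {(i, s)} (?Q - {(i, s)})"]) (simp add: wedge_sign_nonzero)
qed

lemma rows_annih_monomial:
  assumes "finite Q" "distinct is" "\<And>i. i \<in> set is \<Longrightarrow> distinct (Ss i)"
    "\<And>i s. i \<in> set is \<Longrightarrow> s \<in> set (Ss i) \<Longrightarrow> s < r \<and> (i, s) \<in> Q"
  shows "\<exists>c. c \<noteq> 0 \<and> rows_annih r Ss is (monomial Q) = fscale c (monomial (Q - (SIGMA i:set is. set (Ss i))))"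
  using assms(2-)
proof (induction "is")
  case Nil
  then show ?case by (auto intro!: exI[of _ 1])
next
  case (Cons i "is")
  let ?Q = "Q - (SIGMA i:set is. set (Ss i))"
  from Cons obtain c where c: "c \<noteq> 0" "rows_annih r Ss is (monomial Q) = fscale c (monomial ?Q)"
    by auto
  obtain c' where c': "c' \<noteq> 0" "row_annih r i (Ss i) (monomial ?Q) = fscale c' (monomial (?Q - {i} \<times> set (Ss i)))"
    using row_annih_monomial[of ?Q "Ss i" r i] assms(1) Cons.prems by auto
  have "?Q - {i} \<times> set (Ss i) = Q - (SIGMA i:set (i # is). set (Ss i))" by auto
  then have "rows_annih r Ss (i # is) (monomial Q) =
      fscale (c * c') (monomial (Q - (SIGMA i:set (i # is). set (Ss i))))"
    by (simp add: c c' row_annih_scale)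
  then show ?case using c c' by (intro exI[of _ "c * c'"]) simp
qed

section \<open>Representations of currents\<close>

text \<open>\<open>A i j a\<close> is E_(i,j) t^a. Local nilpotency of the simple lowering operators
  is the integrability behind the vanishing of their high powers. It is asked of every vector
  because the generators of the layers take over the role of the highest weight vector in lower
  rank.\<close>

locale gl_current_rep = vector_space scale
  for scale :: "complex \<Rightarrow> 'e::ab_group_add \<Rightarrow> 'e" +
  fixes m :: nat and A :: "nat \<Rightarrow> nat \<Rightarrow> nat \<Rightarrow> 'e \<Rightarrow> 'e"
  assumes A_add: "A i j a (u + v) = A i j a u + A i j a v"
    and A_scale: "A i j a (scale c u) = scale c (A i j a u)"
    and A_commutator: "\<lbrakk>i < m; j < m; k < m; l < m\<rbrakk> \<Longrightarrow>
      A i j a (A k l b u) = A k l b (A i j a u) + (if j = k then A i l (a + b) u else 0)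
        - (if l = i then A k j (a + b) u else 0)"
    and A_nilpotent: "Suc i < m \<Longrightarrow> \<exists>p. (A (Suc i) i 0 ^^ p) u = 0"
begin

sublocale row: power_sum_action scale "\<lambda>b u. - A i i b u" for i
  by unfold_locales (simp_all add: A_add A_scale)

abbreviation HE :: "nat \<Rightarrow> nat \<Rightarrow> 'e \<Rightarrow> 'e" where
  "HE i \<equiv> Hop scale (\<lambda>b u. - A i i b u)"

abbreviation EE :: "nat \<Rightarrow> nat \<Rightarrow> 'e \<Rightarrow> 'e" where
  "EE i \<equiv> Eop scale (\<lambda>b u. - A i i b u)"

lemma A_zero [simp]: "A i j a 0 = 0"
  using A_scale[of i j a 0 0] by simp

lemma A_minus: "A i j a (- u) = - A i j a u"
  using A_scale[of i j a "-1" u] by simp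

lemma A_diff: "A i j a (u - v) = A i j a u - A i j a v"
  using A_add[of i j a u "- v"] by (simp add: A_minus)

lemma A_sum: "A i j a (\<Sum>x\<in>X. h x) = (\<Sum>x\<in>X. A i j a (h x))"
  by (induction X rule: infinite_finite_induct) (auto simp: A_add)

definition stable :: "nat \<Rightarrow> 'e set \<Rightarrow> bool" where
  "stable n N \<longleftrightarrow> subspace N \<and> (\<forall>i<n. \<forall>j<n. \<forall>a. \<forall>u\<in>N. A i j a u \<in> N)"

inductive_set gens :: "nat \<Rightarrow> 'e set \<Rightarrow> 'e set" for n B where
  base: "u \<in> B \<Longrightarrow> u \<in> gens n B"
| zero: "0 \<in> gens n B"
| add: "u \<in> gens n B \<Longrightarrow> v \<in> gens n B \<Longrightarrow> u + v \<in> gens n B"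
| scale: "u \<in> gens n B \<Longrightarrow> scale c u \<in> gens n B"
| act: "u \<in> gens n B \<Longrightarrow> i < n \<Longrightarrow> j < n \<Longrightarrow> A i j a u \<in> gens n B"

lemma stableD:
  assumes "stable n N"
  shows "subspace N" "i < n \<Longrightarrow> j < n \<Longrightarrow> u \<in> N \<Longrightarrow> A i j a u \<in> N"
    "0 \<in> N" "u \<in> N \<Longrightarrow> v \<in> N \<Longrightarrow> u + v \<in> N" "u \<in> N \<Longrightarrow> scale c u \<in> N"
    "u \<in> N \<Longrightarrow> v \<in> N \<Longrightarrow> u - v \<in> N" "u \<in> N \<Longrightarrow> - u \<in> N"
  using assms by (auto simp: stable_def subspace_0 subspace_add subspace_scale subspace_diff subspace_neg)

lemma stable_mono: "stable n N \<Longrightarrow> k \<le> n \<Longrightarrow> stable k N"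
  by (auto simp: stable_def)

lemma stable_gens: "stable n (gens n B)"
  by (auto simp: stable_def intro!: subspaceI intro: gens.intros)

lemma gens_minimal:
  assumes "u \<in> gens n B" "B \<subseteq> N" "stable n N"
  shows "u \<in> N"
  using assms(1) by induction (use assms(2,3) stableD in blast)+

lemma gens_mono: "B \<subseteq> C \<Longrightarrow> gens n B \<subseteq> gens n C"
  using gens_minimal[OF _ _ stable_gens] gens.base by blast

lemma gens_split:
  assumes "u \<in> gens n (N \<union> B)" "stable n N"
  shows "\<exists>v\<in>N. \<exists>w\<in>gens n B. u = v + w"
  using assms(1)
proof induction
  case (base u)
  then show ?case
  proof
    assume "u \<in> N"
    then show ?thesis using gens.zero by (intro bexI[of _ u] bexI[of _ 0]) auto
  next
    assume "u \<in> B"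
    then show ?thesis using gens.base stableD(3)[OF assms(2)] by (intro bexI[of _ 0] bexI[of _ u]) auto
  qed
next
  case zero
  show ?case using gens.zero stableD(3)[OF assms(2)] by (intro bexI[of _ 0]) auto
next
  case (add u v)
  then obtain u1 u2 v1 v2 where "u1 \<in> N" "u2 \<in> gens n B" "u = u1 + u2" "v1 \<in> N" "v2 \<in> gens n B" "v = v1 + v2"
    by blast
  then show ?case
    using stableD(4)[OF assms(2)] gens.add
    by (intro bexI[of _ "u1 + v1"] bexI[of _ "u2 + v2"]) (auto simp: algebra_simps)
next
  case (scale u c)
  then obtain u1 u2 where "u1 \<in> N" "u2 \<in> gens n B" "u = u1 + u2" by blast
  then show ?case
    using stableD(5)[OF assms(2)] gens.scale
    by (intro bexI[of _ "scale c u1"] bexI[of _ "scale c u2"]) (auto simp: scale_right_distrib)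
next
  case (act u i j a)
  then obtain u1 u2 where "u1 \<in> N" "u2 \<in> gens n B" "u = u1 + u2" by blast
  then show ?case
    using stableD(2)[OF assms(2)] gens.act act
    by (intro bexI[of _ "A i j a u1"] bexI[of _ "A i j a u2"]) (auto simp: A_add)
qed

lemma gens_finite:
  assumes "u \<in> gens n B"
  shows "\<exists>F. finite F \<and> F \<subseteq> B \<and> u \<in> gens n F"
  using assms
proof induction
  case (base u)
  then show ?case by (intro exI[of _ "{u}"]) (auto intro: gens.base)
next
  case (add u v)
  then obtain F G where "finite F" "F \<subseteq> B" "u \<in> gens n F" "finite G" "G \<subseteq> B" "v \<in> gens n G" by blast
  then show ?case
    using gens_mono[of F "F \<union> G" n] gens_mono[of G "F \<union> G" n]
    by (intro exI[of _ "F \<union> G"]) (auto intro: gens.add)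
qed (auto intro: gens.intros)

lemma HE_stable: "stable n N \<Longrightarrow> i < n \<Longrightarrow> u \<in> N \<Longrightarrow> HE i j u \<in> N"
  by (rule row.H_closed) (auto simp: stableD)

lemma EE_stable: "stable n N \<Longrightarrow> i < n \<Longrightarrow> u \<in> N \<Longrightarrow> EE i j u \<in> N"
  by (rule row.El_closed) (auto simp: stableD)

lemma HE_commute_A:
  assumes "i < m" "k < m" "l < m" "i \<noteq> k" "i \<noteq> l"
  shows "A k l a (HE i j u) = HE i j (A k l a u)"
proof (rule row.H_commute)
  show "A k l a (- A i i b v) = - A i i b (A k l a v)" for b v
    using A_commutator[of k l i i a b v] assms by (simp add: A_minus)
qed (simp_all add: A_add A_scale)

lemma HE_commute_diag:
  assumes "i < m" "k < m"
  shows "A k k a (HE i j u) = HE i j (A k k a u)"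
proof (rule row.H_commute)
  show "A k k a (- A i i b v) = - A i i b (A k k a v)" for b v
    using A_commutator[of k k i i a b v] assms by (simp add: A_minus)
qed (simp_all add: A_add A_scale)

lemma HE_minus: "HE i j (- u) = - HE i j u"
  using row.H_scale[of i j "-1" u] by simp

lemma HE_diff: "HE i j (u - v) = HE i j u - HE i j v"
  using row.H_add[of i j u "- v"] by (simp add: HE_minus)

lemma HE_commute_HE:
  assumes "i < m" "k < m"
  shows "HE k j (HE i l u) = HE i l (HE k j u)"
proof (rule row.H_commute)
  show "HE k j (- A i i b v) = - A i i b (HE k j v)" for b v
    using HE_commute_diag[OF assms(2,1)] by (simp add: HE_minus)
qed (simp_all add: row.H_add row.H_scale)

lemma EE_commute_HE:
  assumes "i < m" "k < m"
  shows "HE k j (EE i l u) = EE i l (HE k j u)"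
proof (rule row.El_commute)
  show "HE k j (- A i i b v) = - A i i b (HE k j v)" for b v
    using HE_commute_diag[OF assms(2,1)] by (simp add: HE_minus)
qed (simp_all add: row.H_add row.H_scale)

lemma EE_commute_A:
  assumes "i < m" "k < m" "l < m" "i \<noteq> k" "i \<noteq> l"
  shows "A k l a (EE i j u) = EE i j (A k l a u)"
proof (rule row.El_commute)
  show "A k l a (- A i i b v) = - A i i b (A k l a v)" for b v
    using A_commutator[of k l i i a b v] assms by (simp add: A_minus)
qed (simp_all add: A_add A_scale)

section \<open>Equivariant maps to the exterior algebra and the statement for the induction\<close>

definition equivariant :: "nat \<Rightarrow> nat \<Rightarrow> ('e \<Rightarrow> fock) \<Rightarrow> bool" where
  "equivariant r n \<Phi> \<longleftrightarrow> (\<forall>u v. \<Phi> (u + v) = \<Phi> u + \<Phi> v) \<and> (\<forall>c u. \<Phi> (scale c u) = fscale c (\<Phi> u)) \<and>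
     (\<forall>i<n. \<forall>j<n. \<forall>a u. \<Phi> (A i j a u) = current r i j a (\<Phi> u))"

lemma equivariantD:
  assumes "equivariant r n \<Phi>"
  shows "\<Phi> (u + v) = \<Phi> u + \<Phi> v" "\<Phi> (scale c u) = fscale c (\<Phi> u)"
    "i < n \<Longrightarrow> j < n \<Longrightarrow> \<Phi> (A i j a u) = current r i j a (\<Phi> u)"
    "\<Phi> 0 = 0" "\<Phi> (- u) = - \<Phi> u"
proof -
  show s: "\<Phi> (scale c u) = fscale c (\<Phi> u)" for c u using assms by (simp add: equivariant_def)
  show "\<Phi> 0 = 0" using s[of 0 0] by simp
  show "\<Phi> (- u) = - \<Phi> u" using s[of "-1" u] by simp
qed (use assms in \<open>auto simp: equivariant_def\<close>)

lemma equivariant_HE: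
  assumes "equivariant r n \<Phi>" "i < n"
  shows "\<Phi> (HE i j u) = fock_H r i j (\<Phi> u)"
proof (induction j rule: less_induct)
  case (less j)
  have s: "\<Phi> (\<Sum>x\<in>X. h x) = (\<Sum>x\<in>X. \<Phi> (h x))" for X and h :: "nat \<Rightarrow> 'e"
    by (induction X rule: infinite_finite_induct) (auto simp: equivariantD[OF assms(1)])
  show ?case
    using less assms
    by (cases "j = 0") (simp_all add: Hop.simps[of _ _ j] equivariantD[OF assms(1)] s)
qed

lemma equivariant_gens_zero:
  assumes "equivariant r n \<Phi>" "\<And>u. u \<in> B \<Longrightarrow> \<Phi> u = 0" "u \<in> gens n B"
  shows "\<Phi> u = 0"
  using assms(3) by induction (auto simp: equivariantD[OF assms(1)] assms(2))

definition highest_weight :: "nat \<Rightarrow> 'e set \<Rightarrow> (nat \<Rightarrow> nat) \<Rightarrow> 'e \<Rightarrow> bool" where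
  "highest_weight n N \<eta> w \<longleftrightarrow> (\<forall>i j a. i < j \<longrightarrow> j < n \<longrightarrow> A i j a w \<in> N) \<and>
     (\<forall>i<n. A i i 0 w - scale (of_nat (\<eta> i)) w \<in> N) \<and> (\<forall>i<n. \<forall>a\<ge>1. A i i a w \<in> N)"

text \<open>The subspace, the vector and the map are all quantified, since one step of the induction
  on n uses many layers, and for each layer a whole family of maps.\<close>

definition weyl_faithful :: "nat \<Rightarrow> nat \<Rightarrow> bool" where
  "weyl_faithful r n \<longleftrightarrow> (\<forall>N w \<eta> \<Phi> Q c.
     stable n N \<and> highest_weight n N \<eta> w \<and> (\<forall>i j. i \<le> j \<longrightarrow> j < n \<longrightarrow> \<eta> j \<le> \<eta> i) \<and> (\<forall>i<n. \<eta> i \<le> r) \<and>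
     equivariant r n \<Phi> \<and> (\<forall>u\<in>N. \<Phi> u = 0) \<and> finite Q \<and> (\<forall>i<n. \<forall>s. (i, s) \<in> Q \<longleftrightarrow> s < \<eta> i) \<and>
     c \<noteq> 0 \<and> \<Phi> w = fscale c (monomial Q) \<longrightarrow> (\<forall>u\<in>gens n {w}. \<Phi> u = 0 \<longrightarrow> u \<in> N))"

lemma weyl_faithfulD:
  assumes "weyl_faithful r n" "stable n N" "highest_weight n N \<eta> w"
    and "\<And>i j. i \<le> j \<Longrightarrow> j < n \<Longrightarrow> \<eta> j \<le> \<eta> i" "\<And>i. i < n \<Longrightarrow> \<eta> i \<le> r"
    and "equivariant r n \<Phi>" "\<And>u. u \<in> N \<Longrightarrow> \<Phi> u = 0" "finite Q"
    and "\<And>i s. i < n \<Longrightarrow> (i, s) \<in> Q \<longleftrightarrow> s < \<eta> i" "c \<noteq> 0" "\<Phi> w = fscale c (monomial Q)"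
    and "u \<in> gens n {w}" "\<Phi> u = 0"
  shows "u \<in> N"
proof -
  have "\<forall>u\<in>gens n {w}. \<Phi> u = 0 \<longrightarrow> u \<in> N"
    by (rule assms(1)[unfolded weyl_faithful_def, THEN spec[of _ N], THEN spec[of _ w], THEN spec[of _ \<eta>],
          THEN spec[of _ \<Phi>], THEN spec[of _ Q], THEN spec[of _ c], THEN mp], intro conjI allI impI ballI)
       (simp_all add: assms)
  then show ?thesis using assms(12,13) by simp
qed

text \<open>In rank 0 nothing acts, so the cyclic module is the line through \<open>w\<close>, and
  \<open>\<Phi> w\<close> is not zero.\<close>

lemma weyl_faithful_0: "weyl_faithful r 0"
  unfolding weyl_faithful_def
proof (intro allI impI ballI, elim conjE)
  fix N w \<eta> \<Phi> Q c u
  assume N: "stable 0 N" and \<Phi>: "equivariant r 0 \<Phi>" and "(c::complex) \<noteq> 0" "\<Phi> w = fscale c (monomial Q)"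
    and u: "u \<in> gens 0 {w}" "\<Phi> u = 0"
  from u(1) have "\<exists>d. u = scale d w"
  proof induction
    case (base u)
    then show ?case by (auto intro!: exI[of _ 1])
  next
    case zero
    show ?case by (rule exI[of _ 0]) simp
  next
    case (add u v)
    then show ?case by (auto simp: scale_left_distrib[symmetric])
  qed auto
  then obtain d where d: "u = scale d w" by blast
  have "\<Phi> u Q = d * c"
    using \<open>\<Phi> w = _\<close> by (simp add: d equivariantD[OF \<Phi>] fscale_apply monomial_def)
  then have "d = 0" using u(2) \<open>c \<noteq> 0\<close> by (simp add: fun_apply)
  then show "u \<in> N" using stableD(3)[OF N] by (simp add: d)
qed

text \<open>
  If \<open>k\<^sub>i\<close> and \<open>M\<^sub>i\<close> are positive, then \<open>w' = H\<^sub>M w\<close>, taken in row \<open>i\<close>, generates a module with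
  \<open>k\<^sub>i\<close> decreased, and modulo \<open>w'\<close> the vector \<open>w\<close> has \<open>c\<^sub>i\<close> increased and \<open>M\<^sub>i\<close> decreased. On the
  holes \<open>S\<^sub>i\<close>, this is the recursion of Pascal's triangle: \<open>c\<^sub>i\<close> is a hole or not.
\<close>

lemma gens_faithful_tower:
  assumes IH: "weyl_faithful r n" and "n \<le> m"
  assumes "stable n N"
    and "\<And>i j a. i < j \<Longrightarrow> j < n \<Longrightarrow> A i j a w \<in> N"
    and "\<And>i. i < n \<Longrightarrow> A i i 0 w - scale (of_nat (c i + M i)) w \<in> N"
    and "\<And>i j. i < n \<Longrightarrow> j > M i \<Longrightarrow> HE i j w \<in> N"
    and "\<And>i j. i < n \<Longrightarrow> j > k i \<Longrightarrow> EE i j w \<in> N"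
    and "\<And>i j. i \<le> j \<Longrightarrow> j < n \<Longrightarrow> c j + M j \<le> c i + M i"
    and "\<And>i. i < n \<Longrightarrow> c i + k i + M i \<le> r"
    and "\<And>Ss. (\<And>i. i < n \<Longrightarrow> length (Ss i) = k i \<and> sorted_wrt (<) (Ss i) \<and> set (Ss i) \<subseteq> {c i..<c i + k i + M i}) \<Longrightarrow>
      \<exists>\<Phi> Q d. equivariant r n \<Phi> \<and> (\<forall>u\<in>N \<union> K. \<Phi> u = 0) \<and> finite Q \<and>
        (\<forall>i<n. \<forall>s. (i, s) \<in> Q \<longleftrightarrow> s < c i + k i + M i) \<and> d \<noteq> 0 \<and> \<Phi> w = fscale d (holes r n Ss (monomial Q))"
  shows "gens n {w} \<inter> K \<subseteq> N"
  using assms(3-)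
proof (induction "\<Sum>i<n. k i + M i" arbitrary: N w c k M K rule: less_induct)
  case less
  note N = less.prems(1) and hw = less.prems(2,3) and HN = less.prems(4) and EN = less.prems(5)
    and dec = less.prems(6) and bound = less.prems(7) and family = less.prems(8)
  have m: "i < m" if "i < n" for i using that \<open>n \<le> m\<close> by simp
  have pN: "- A i i b u \<in> N" if "i < n" "u \<in> N" for i b u
    using that N by (auto simp: stableD)
  show ?case
  proof (cases "\<exists>i<n. k i > 0 \<and> M i > 0")
    case False
    then have leaf: "k i = 0 \<or> M i = 0" if "i < n" for i using that by auto
    \<comment> \<open>Here one of the two degree bounds of each row is zero. If it is the elementary
      one, the relation between the two series expresses h_j by terms with e_c, c positive, all in
      \<open>N\<close>. In either case no power sum survives, and \<open>w\<close> is a highest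
      weight vector for the induction hypothesis.\<close>
    have "HE i j w \<in> N" if "i < n" "j \<ge> 1" for i j
    proof (cases "M i = 0")
      case True
      then show ?thesis using HN that by auto
    next
      case False
      then have k: "k i = 0" using leaf[OF that(1)] by simp
      have "{..j} = insert 0 {1..j}" using that by auto
      then have "HE i j w = - (\<Sum>c\<in>{1..j}. scale ((-1) ^ c) (HE i (j - c) (EE i c w)))"
        using row.El_H_sum[OF that(2), of i w] by (simp add: eq_neg_iff_add_eq_0)
      also have "\<dots> \<in> N"
        using EN[OF that(1)] k that N
        by (auto intro!: stableD subspace_sum HE_stable)
      finally show ?thesis .
    qed
    then have pw: "A i i a w \<in> N" if "i < n" "a \<ge> 1" for i a
      using row.p_vanish_if_H_vanish[of N i w a] pN that N stableD(7)[OF N, of "- A i i a w"]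
      by (auto simp: stableD)
    define \<eta> where "\<eta> = (\<lambda>i. c i + M i)"
    \<comment> \<open>The only pattern left. The block of holes is either empty or fills the end of
      the row, so the first \<open>c i + M i\<close> boxes of row i remain, in accordance with the
      weight.\<close>
    let ?Ss = "\<lambda>i. [c i..<c i + k i]"
    obtain \<Phi> Q d where \<Phi>: "equivariant r n \<Phi>" "\<forall>u\<in>N \<union> K. \<Phi> u = 0" "finite Q"
      and Q: "\<forall>i<n. \<forall>s. (i, s) \<in> Q \<longleftrightarrow> s < c i + k i + M i"
      and d: "d \<noteq> 0" "\<Phi> w = fscale d (holes r n ?Ss (monomial Q))"
      using family[of ?Ss] by (auto simp: strict_sorted_iff)
    have "s < r \<and> (i, s) \<in> Q" if "i \<in> set [0..<n]" "s \<in> set (?Ss i)" for i s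
      using that Q bound[of i] by auto
    then obtain d' where d': "d' \<noteq> 0" "holes r n ?Ss (monomial Q) = fscale d' (monomial (Q - (SIGMA i:{0..<n}. {c i..<c i + k i})))"
      using rows_annih_monomial[OF \<Phi>(3), of "[0..<n]" ?Ss r] by auto
    let ?Q = "Q - (SIGMA i:{0..<n}. {c i..<c i + k i})"
    have "u \<in> N" if u: "u \<in> gens n {w}" "\<Phi> u = 0" for u
    proof (rule weyl_faithfulD[OF IH N, of \<eta> w \<Phi> ?Q "d * d'" u])
      show "highest_weight n N \<eta> w"
        using hw pw by (auto simp: highest_weight_def \<eta>_def)
      show "(i, s) \<in> ?Q \<longleftrightarrow> s < \<eta> i" if "i < n" for i s
        using that Q leaf[of i] by (auto simp: \<eta>_def)
      show "\<eta> i \<le> r" if "i < n" for i using bound[OF that] by (simp add: \<eta>_def)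
    qed (use \<Phi> d d' dec u in \<open>auto simp: \<eta>_def\<close>)
    then show ?thesis using \<Phi>(2) by blast
  next
    case True
    then obtain i where i: "i < n" "k i > 0" "M i > 0" by blast
    have im: "i < m" using m i by simp
    define w' where "w' = HE i (M i) w"
    define N' where "N' = gens n (N \<union> {w'})"
    have N': "stable n N'" by (simp add: N'_def stable_gens)
    have NN': "N \<subseteq> N'" and w'N': "w' \<in> N'" by (auto simp: N'_def intro: gens.base)
    have sum_less: "(\<Sum>j<n. f j) < (\<Sum>j<n. g j)"
      if "\<And>j. j < n \<Longrightarrow> f j \<le> g j" "f i < g i" for f g :: "nat \<Rightarrow> nat"
      using that i(1) by (intro sum_strict_mono_ex1) auto
    have w'_raise: "A l j a w' \<in> N" if "l < j" "j < n" for l j a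
    proof -
      have "\<forall>l j a. l < j \<longrightarrow> j < n \<longrightarrow> A l j a w' \<in> N"
      proof -
        let ?X = "{u. \<forall>l j a. l < j \<longrightarrow> j < n \<longrightarrow> A l j a u \<in> N}"
        have "HE i (M i) w \<in> ?X"
        proof (rule row.H_closed)
          show "subspace ?X"
            by (rule subspaceI) (auto simp: A_add A_scale stableD[OF N])
          show "- A i i b u \<in> ?X" if "u \<in> ?X" for b u
          proof -
            have "A l j a (A i i b u) \<in> N" if "l < j" "j < n" for l j a
              using A_commutator[of l j i i a b u] that \<open>u \<in> ?X\<close> i(1) m[of l] m[of j] im stableD(2)[OF N]
              by (auto intro!: stableD(4,6)[OF N])
            then show ?thesis by (auto simp: A_minus intro: stableD(7)[OF N])
          qed
          show "w \<in> ?X" using hw(1) by blast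
        qed
        then show ?thesis by (simp add: w'_def)
      qed
      then show ?thesis using that by blast
    qed
    have w'_weight: "A l l 0 w' - scale (of_nat (c l + M l)) w' \<in> N" if "l < n" for l
    proof -
      have "A l l 0 w' - scale (of_nat (c l + M l)) w' = HE i (M i) (A l l 0 w - scale (of_nat (c l + M l)) w)"
        by (simp add: w'_def HE_commute_diag m that im HE_diff row.H_scale)
      then show ?thesis using HE_stable[OF N i(1) hw(2)[OF that]] by simp
    qed
    have w'_H: "HE l j w' \<in> N" if "l < n" "j > M l" for l j
      using HE_stable[OF N i(1) HN[OF that]] by (simp add: w'_def HE_commute_HE im m that)
    have w'_E: "EE l j w' \<in> N" if "l < n" "j > k l" for l j
    proof -
      have "HE i (M i) (EE l j w) \<in> N" by (rule HE_stable[OF N i(1) EN[OF that]])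
      then show ?thesis using EE_commute_HE[of l i "M i" j w] m[OF that(1)] im by (simp add: w'_def)
    qed
    \<comment> \<open>In degree \<open>k i + M i\<close> every term of the relation between the two
      series has a factor beyond one of the bounds, except e_k h_M, which therefore lies in
      \<open>N\<close> as well when applied to \<open>w\<close>.\<close>
    have w'_Ei: "EE i j w' \<in> N" if "j \<ge> k i" for j
    proof (cases "j = k i")
      case jk: True
      let ?J = "k i + M i"
      let ?t = "\<lambda>c. scale ((-1) ^ c) (HE i (?J - c) (EE i c w))"
      have "(\<Sum>c\<le>?J. ?t c) = 0"
        using i by (intro row.El_H_sum) auto
      then have "?t (k i) + (\<Sum>c\<in>{..?J} - {k i}. ?t c) = 0"
        by (subst (asm) sum.remove[of _ "k i"]) auto
      moreover have "(\<Sum>c\<in>{..?J} - {k i}. ?t c) \<in> N"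
      proof (rule subspace_sum[OF stableD(1)[OF N]])
        fix c assume c: "c \<in> {..?J} - {k i}"
        show "?t c \<in> N"
        proof (cases "c < k i")
          case True
          then show ?thesis
            using EE_stable[OF N i(1) HN[OF i(1), of "?J - c"], of c] stableD(5)[OF N]
            by (simp add: EE_commute_HE im)
        next
          case False
          then show ?thesis
            using HE_stable[OF N i(1) EN[OF i(1), of c]] c stableD(5)[OF N] by simp
        qed
      qed
      ultimately have "?t (k i) \<in> N"
        using stableD(7)[OF N] unfolding eq_neg_iff_add_eq_0[symmetric] by simp
      then have "scale ((-1) ^ k i) (?t (k i)) \<in> N" by (rule stableD(5)[OF N])
      then have "HE i (M i) (EE i (k i) w) \<in> N" by (simp flip: power_mult_distrib)
      then show ?thesis by (simp add: jk w'_def EE_commute_HE im)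
    qed (use w'_E i that in auto)
    define mi where "mi = c i + k i + M i"

    \<comment> \<open>The patterns for the quotient avoid column \<open>c i\<close>. Their first
      hole then lies too far up for h_M, so the corresponding maps kill \<open>w'\<close> and pass
      to the quotient.\<close>
    have quot: "gens n {w} \<inter> K \<subseteq> N'"
    proof (rule less.hyps[of "k" "M(i := M i - 1)" N' w "c(i := Suc (c i))"])
      show "(\<Sum>j<n. k j + (M(i := M i - 1)) j) < (\<Sum>j<n. k j + M j)"
        using i by (intro sum_less) auto
      show "HE l j w \<in> N'" if "l < n" "j > (M(i := M i - 1)) l" for l j
      proof (cases "l = i \<and> j = M i")
        case True
        then show ?thesis using w'N' by (simp add: w'_def)
      next
        case False
        then show ?thesis using HN[of l j] that NN' by (auto split: if_splits)
      qed
      have cM: "(c(i := Suc (c i))) l + (M(i := M i - 1)) l = c l + M l" for l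
        using i by auto
      have ckM: "(c(i := Suc (c i))) l + k l + (M(i := M i - 1)) l = c l + k l + M l" for l
        using i by auto
      show "A l l 0 w - scale (of_nat ((c(i := Suc (c i))) l + (M(i := M i - 1)) l)) w \<in> N'" if "l < n" for l
        unfolding cM using hw(2)[OF that] NN' by blast
      show "(c(i := Suc (c i))) j + (M(i := M i - 1)) j \<le> (c(i := Suc (c i))) l + (M(i := M i - 1)) l"
        if "l \<le> j" "j < n" for l j
        unfolding cM using dec that by blast
      show "(c(i := Suc (c i))) l + k l + (M(i := M i - 1)) l \<le> r" if "l < n" for l
        unfolding ckM using bound that by blast
      fix Ss
      assume Ss: "\<And>l. l < n \<Longrightarrow> length (Ss l) = k l \<and> sorted_wrt (<) (Ss l) \<and>
        set (Ss l) \<subseteq> {(c(i := Suc (c i))) l..<(c(i := Suc (c i))) l + k l + (M(i := M i - 1)) l}"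
      have Ss': "length (Ss l) = k l \<and> sorted_wrt (<) (Ss l) \<and> set (Ss l) \<subseteq> {c l..<c l + k l + M l}" if "l < n" for l
        using Ss[OF that] unfolding ckM by (auto split: if_splits)
      obtain \<Phi> Q d where \<Phi>: "equivariant r n \<Phi>" "\<forall>u\<in>N \<union> K. \<Phi> u = 0" "finite Q"
        and Q: "\<forall>i<n. \<forall>s. (i, s) \<in> Q \<longleftrightarrow> s < c i + k i + M i"
        and d: "d \<noteq> 0" "\<Phi> w = fscale d (holes r n Ss (monomial Q))"
        using family[of Ss] Ss' by blast
      obtain s ss where ss: "Ss i = s # ss" using Ss'[OF i(1)] i(2) by (cases "Ss i") auto
      have "fock_H r i (M i) (holes r n Ss (monomial Q)) = 0"
      proof (rule fock_H_holes(1)[where m = mi and s = s and ss = ss])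
        show "i < n" "finite Q" "Ss i = s # ss" using i \<Phi>(3) ss by auto
        show "(i, s) \<in> Q \<longleftrightarrow> s < mi" for s using Q i(1) by (simp add: mi_def)
        show "mi \<le> r" using bound[OF i(1)] by (simp add: mi_def)
        show "sorted_wrt (<) (s # ss)" "\<forall>t\<in>set (s # ss). t < mi"
          using Ss'[OF i(1)] by (auto simp: ss mi_def)
        show "mi < M i + Suc (length ss) + s"
          using Ss[OF i(1)] by (auto simp: ss mi_def)
      qed
      then have "\<Phi> w' = 0"
        by (simp add: w'_def equivariant_HE[OF \<Phi>(1) i(1)] d fock_p.H_scale)
      then have "\<forall>u\<in>N' \<union> K. \<Phi> u = 0"
        using equivariant_gens_zero[OF \<Phi>(1), of "N \<union> {w'}"] \<Phi>(2) by (auto simp: N'_def)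
      then show "\<exists>\<Phi> Q d. equivariant r n \<Phi> \<and> (\<forall>u\<in>N' \<union> K. \<Phi> u = 0) \<and> finite Q \<and>
          (\<forall>l<n. \<forall>s. (l, s) \<in> Q \<longleftrightarrow> s < (c(i := Suc (c i))) l + k l + (M(i := M i - 1)) l) \<and> d \<noteq> 0 \<and>
          \<Phi> w = fscale d (holes r n Ss (monomial Q))"
        unfolding ckM using \<Phi> Q d by blast
    qed (use N' hw EN NN' in auto)

    \<comment> \<open>An element of \<open>K\<close> will be split as u + v with u in
      \<open>N\<close> and v generated by \<open>w'\<close>, so the condition on v has to be stated
      up to \<open>N\<close>. Every map of the family kills u and u + v, hence also v.\<close>
    have sub: "gens n {w'} \<inter> {v. \<exists>u\<in>N. u + v \<in> K} \<subseteq> N"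
    proof (rule less.hyps[of "k(i := k i - 1)" "M" N w' "c"])
      show "(\<Sum>j<n. (k(i := k i - 1)) j + M j) < (\<Sum>j<n. k j + M j)"
        using i by (intro sum_less) auto
      show "EE l j w' \<in> N" if "l < n" "j > (k(i := k i - 1)) l" for l j
        using that w'_E[of l j] w'_Ei[of j] i by (cases "l = i") auto
      show "c l + (k(i := k i - 1)) l + M l \<le> r" if "l < n" for l
        using bound[OF that] by auto
      fix Ss
      assume Ss: "\<And>l. l < n \<Longrightarrow> length (Ss l) = (k(i := k i - 1)) l \<and> sorted_wrt (<) (Ss l) \<and>
        set (Ss l) \<subseteq> {c l..<c l + (k(i := k i - 1)) l + M l}"
      \<comment> \<open>The top coefficient h_M uses up the hole at \<open>c i\<close> and moves the
        others down by one column, so they are moved up beforehand.\<close>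
      let ?Ts = "Ss(i := c i # map Suc (Ss i))"
      have Ts: "length (?Ts l) = k l \<and> sorted_wrt (<) (?Ts l) \<and> set (?Ts l) \<subseteq> {c l..<c l + k l + M l}" if "l < n" for l
      proof (cases "l = i")
        case True
        have "sorted_wrt (<) (map Suc (Ss i))" using Ss[OF i(1)] by (simp add: sorted_wrt_map)
        then show ?thesis using Ss[OF i(1)] i True by (auto simp: subset_iff)
      qed (use Ss[OF that] in auto)
      then obtain \<Phi> Q d where \<Phi>: "equivariant r n \<Phi>" "\<forall>u\<in>N \<union> K. \<Phi> u = 0" "finite Q"
        and Q: "\<forall>i<n. \<forall>s. (i, s) \<in> Q \<longleftrightarrow> s < c i + k i + M i"
        and d: "d \<noteq> 0" "\<Phi> w = fscale d (holes r n ?Ts (monomial Q))"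
        using family[of ?Ts] by blast
      have "\<exists>d'. d' \<noteq> 0 \<and> fock_H r i (M i) (holes r n ?Ts (monomial Q)) =
          fscale d' (holes r n (?Ts(i := map (\<lambda>t. t - 1) (map Suc (Ss i)))) (monomial (Q - {(i, mi - 1)})))"
      proof (rule fock_H_holes(2)[where m = mi and s = "c i" and ss = "map Suc (Ss i)"])
        show "i < n" "finite Q" using i \<Phi>(3) by auto
        show "(i, s) \<in> Q \<longleftrightarrow> s < mi" for s using Q i(1) by (simp add: mi_def)
        show "mi \<le> r" using bound[OF i(1)] by (simp add: mi_def)
        show "?Ts i = c i # map Suc (Ss i)" by simp
        show "sorted_wrt (<) (c i # map Suc (Ss i))" "\<forall>t\<in>set (c i # map Suc (Ss i)). t < mi"
          using Ts[OF i(1)] by (auto simp: mi_def)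
        show "M i + Suc (length (map Suc (Ss i))) + c i = mi"
          using Ss[OF i(1)] i by (auto simp: mi_def)
      qed
      moreover have "?Ts(i := map (\<lambda>t. t - 1) (map Suc (Ss i))) = Ss"
        by (simp add: o_def)
      ultimately obtain d' where d': "d' \<noteq> 0"
        "fock_H r i (M i) (holes r n ?Ts (monomial Q)) = fscale d' (holes r n Ss (monomial (Q - {(i, mi - 1)})))"
        by auto
      have "\<Phi> w' = fscale (d * d') (holes r n Ss (monomial (Q - {(i, mi - 1)})))"
        by (simp add: w'_def equivariant_HE[OF \<Phi>(1) i(1)] d fock_p.H_scale d')
      moreover have "(l, s) \<in> Q - {(i, mi - 1)} \<longleftrightarrow> s < c l + (k(i := k i - 1)) l + M l" if "l < n" for l s
        using Q that i by (auto simp: mi_def)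
      moreover have "\<Phi> v = 0" if "u \<in> N" "u + v \<in> K" for u v
      proof -
        have "\<Phi> u = 0" "\<Phi> (u + v) = 0" using \<Phi>(2) that by auto
        then show ?thesis by (simp add: equivariantD[OF \<Phi>(1)])
      qed
      ultimately show "\<exists>\<Phi> Q d. equivariant r n \<Phi> \<and> (\<forall>u\<in>N \<union> {v. \<exists>u\<in>N. u + v \<in> K}. \<Phi> u = 0) \<and> finite Q \<and>
          (\<forall>l<n. \<forall>s. (l, s) \<in> Q \<longleftrightarrow> s < c l + (k(i := k i - 1)) l + M l) \<and> d \<noteq> 0 \<and>
          \<Phi> w' = fscale d (holes r n Ss (monomial Q))"
        using \<Phi> d d' by (intro exI[of _ \<Phi>] exI[of _ "Q - {(i, mi - 1)}"] exI[of _ "d * d'"]) auto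
    qed (use N w'_raise w'_weight w'_H dec in auto)

    show ?thesis
    proof
      fix u assume u: "u \<in> gens n {w} \<inter> K"
      then have "u \<in> gens n (N \<union> {w'})" using quot by (auto simp: N'_def)
      then obtain v v' where v: "v \<in> N" "v' \<in> gens n {w'}" "u = v + v'"
        using gens_split[OF _ N] by blast
      then have "v' \<in> N" using sub u by auto
      then show "u \<in> N" using v stableD(4)[OF N] by simp
    qed
  qed
qed

end

section \<open>Garland's identity\<close>

context gl_current_rep
begin

definition cong_mod :: "'e set \<Rightarrow> 'e \<Rightarrow> 'e \<Rightarrow> bool" where
  "cong_mod N u v \<longleftrightarrow> u - v \<in> N"

lemma cong_mod_intros:
  assumes "stable n N"
  shows "cong_mod N u u"
    and "cong_mod N u v \<Longrightarrow> cong_mod N v u"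
    and "cong_mod N u v \<Longrightarrow> cong_mod N v w \<Longrightarrow> cong_mod N u w"
    and "cong_mod N u v \<Longrightarrow> cong_mod N u' v' \<Longrightarrow> cong_mod N (u + u') (v + v')"
    and "cong_mod N u v \<Longrightarrow> cong_mod N u' v' \<Longrightarrow> cong_mod N (u - u') (v - v')"
    and "cong_mod N u v \<Longrightarrow> cong_mod N (- u) (- v)"
    and "cong_mod N u v \<Longrightarrow> cong_mod N (scale c u) (scale c v)"
    and "i < n \<Longrightarrow> j < n \<Longrightarrow> cong_mod N u v \<Longrightarrow> cong_mod N (A i j a u) (A i j a v)"
    and "(\<And>x. x \<in> X \<Longrightarrow> cong_mod N (f x) (h x)) \<Longrightarrow> cong_mod N (\<Sum>x\<in>X. f x) (\<Sum>x\<in>X. h x)"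
    and "cong_mod N u v \<Longrightarrow> v \<in> N \<Longrightarrow> u \<in> N"
    and "cong_mod N u 0 \<longleftrightarrow> u \<in> N"
    and "cong_mod N u v \<Longrightarrow> u \<in> N \<Longrightarrow> v \<in> N"
proof -
  note S = stableD[OF assms]
  show "cong_mod N u u" using S(3) by (simp add: cong_mod_def)
  show sym: "cong_mod N v u" if "cong_mod N u v" for u v using S(7)[of "u - v"] that by (simp add: cong_mod_def)
  show "cong_mod N u v \<Longrightarrow> cong_mod N v w \<Longrightarrow> cong_mod N u w"
    using S(4)[of "u - v" "v - w"] by (simp add: cong_mod_def)
  show "cong_mod N u v \<Longrightarrow> cong_mod N u' v' \<Longrightarrow> cong_mod N (u + u') (v + v')"
    using S(4)[of "u - v" "u' - v'"] by (simp add: cong_mod_def algebra_simps)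
  show "cong_mod N u v \<Longrightarrow> cong_mod N u' v' \<Longrightarrow> cong_mod N (u - u') (v - v')"
    using S(6)[of "u - v" "u' - v'"] by (simp add: cong_mod_def algebra_simps)
  show "cong_mod N u v \<Longrightarrow> cong_mod N (- u) (- v)"
    using S(7)[of "u - v"] by (simp add: cong_mod_def algebra_simps)
  show "cong_mod N u v \<Longrightarrow> cong_mod N (scale c u) (scale c v)"
    using S(5)[of "u - v" c] by (simp add: cong_mod_def scale_right_diff_distrib)
  show "i < n \<Longrightarrow> j < n \<Longrightarrow> cong_mod N u v \<Longrightarrow> cong_mod N (A i j a u) (A i j a v)"
    using S(2)[of i j "u - v" a] by (simp add: cong_mod_def A_diff)
  show "(\<And>x. x \<in> X \<Longrightarrow> cong_mod N (f x) (h x)) \<Longrightarrow> cong_mod N (\<Sum>x\<in>X. f x) (\<Sum>x\<in>X. h x)"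
    unfolding cong_mod_def sum_subtractf[symmetric] by (rule subspace_sum[OF S(1)])
  show in1: "u \<in> N" if "cong_mod N u v" "v \<in> N" for u v
    using S(4)[of "u - v" v] that by (simp add: cong_mod_def)
  show "cong_mod N u 0 \<longleftrightarrow> u \<in> N" by (simp add: cong_mod_def)
  show "cong_mod N u v \<Longrightarrow> u \<in> N \<Longrightarrow> v \<in> N" using in1 sym by blast
qed

lemma stable_scale_cancel:
  assumes "stable n N" "scale c u \<in> N" "c \<noteq> 0"
  shows "u \<in> N"
  using stableD(5)[OF assms(1,2), of "inverse c"] assms(3) by simp

text \<open>
  Garland's identity for the simple root \<open>i\<close>: raising \<open>H\<^sub>j f\<^sup>k w\<close> with \<open>E\<^sub>i\<^sub>,\<^sub>i\<^sub>+\<^sub>1 \<otimes> t\<close> gives a nonzero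
  multiple of \<open>H\<^sub>j\<^sub>+\<^sub>1 f\<^sup>k\<^sup>-\<^sup>1 w\<close>, where \<open>f = E\<^sub>i\<^sub>+\<^sub>1\<^sub>,\<^sub>i\<close>.
\<close>
lemma garland:
  assumes "n \<le> m" "Suc i < n" and N: "stable n N" and hw: "highest_weight n N \<eta> w"
    and \<eta>: "\<eta> (Suc i) \<le> \<eta> i" and "j + k > \<eta> i - \<eta> (Suc i)"
  shows "HE i j ((A (Suc i) i 0 ^^ k) w) \<in> N"
proof -
  let ?f = "A (Suc i) i" and ?e = "A i (Suc i)"
  let ?w = "\<lambda>k. (?f 0 ^^ k) w"
  define Y where "Y k j = HE i j (?w k)" for k j
  have bounds: "i < m" "Suc i < m" "i < n" using assms by auto
  note cm = cong_mod_intros[OF N]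
  note S = stableD[OF N]
  have ff: "?f a (?f b u) = ?f b (?f a u)" for a b u
    using A_commutator[of "Suc i" i "Suc i" i a b u] bounds by simp
  have hwE: "?e a w \<in> N" for a using hw bounds assms(2) by (auto simp: highest_weight_def)
  have hwH: "A l l a w \<in> N" if "a \<ge> 1" "l < n" for l a using hw that by (auto simp: highest_weight_def)
  have hwH0: "cong_mod N (A l l 0 w) (scale (of_nat (\<eta> l)) w)" if "l < n" for l
    using hw that by (auto simp: highest_weight_def cong_mod_def)

  \<comment> \<open>The sl_2 computation e f^(p+1) w = (p+1)(lam - p) f^p w modulo \<open>N\<close>.
    Local nilpotency provides a first power of f sending \<open>w\<close> into \<open>N\<close>, and
    for p > lam the coefficient is invertible, so this power is at most lam + 1.\<close>
  have wN: "?w k \<in> N" if k: "k > \<eta> i - \<eta> (Suc i)" for k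
  proof -
    define lam where "lam = \<eta> i - \<eta> (Suc i)"
    have h: "cong_mod N (A i i 0 (?w p) - A (Suc i) (Suc i) 0 (?w p)) (scale (of_nat lam - 2 * of_nat p) (?w p))" for p
    proof (induction p)
      case 0
      have "cong_mod N (A i i 0 w - A (Suc i) (Suc i) 0 w) (scale (of_nat (\<eta> i)) w - scale (of_nat (\<eta> (Suc i))) w)"
        by (intro cm(5) hwH0) (use assms in auto)
      also have "scale (of_nat (\<eta> i)) w - scale (of_nat (\<eta> (Suc i))) w = scale (of_nat lam) w"
        using \<eta> by (simp add: lam_def scale_left_diff_distrib[symmetric] of_nat_diff)
      finally show ?case by simp
    next
      case (Suc p)
      have "A i i 0 (?w (Suc p)) - A (Suc i) (Suc i) 0 (?w (Suc p)) =
          ?f 0 (A i i 0 (?w p) - A (Suc i) (Suc i) 0 (?w p)) - scale 2 (?w (Suc p))"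
        using A_commutator[of i i "Suc i" i 0 0 "?w p"] A_commutator[of "Suc i" "Suc i" "Suc i" i 0 0 "?w p"] bounds
          scale_left_distrib[of 1 1 "?f 0 (?w p)"]
        by (simp add: A_diff)
      moreover have "cong_mod N (?f 0 (A i i 0 (?w p) - A (Suc i) (Suc i) 0 (?w p)) - scale 2 (?w (Suc p)))
          (?f 0 (scale (of_nat lam - 2 * of_nat p) (?w p)) - scale 2 (?w (Suc p)))"
        by (intro cm(5,8,1) Suc) (use assms in auto)
      moreover have "?f 0 (scale (of_nat lam - 2 * of_nat p) (?w p)) - scale 2 (?w (Suc p)) =
          scale (of_nat lam - 2 * of_nat (Suc p)) (?w (Suc p))"
        by (simp add: A_scale scale_left_diff_distrib[symmetric])
      ultimately show ?case by simp
    qed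
    have e: "cong_mod N (?e 0 (?w (Suc p))) (scale (of_nat (Suc p) * (of_nat lam - of_nat p)) (?w p))" for p
    proof (induction p)
      case 0
      have "?e 0 (?w 1) = ?f 0 (?e 0 w) + (A i i 0 (?w 0) - A (Suc i) (Suc i) 0 (?w 0))"
        using A_commutator[of i "Suc i" "Suc i" i 0 0 w] bounds by simp
      moreover have "cong_mod N (?f 0 (?e 0 w) + (A i i 0 (?w 0) - A (Suc i) (Suc i) 0 (?w 0)))
          (0 + scale (of_nat lam - 2 * of_nat 0) (?w 0))"
        by (intro cm(4) h) (use S(2) hwE assms cm(11) in auto)
      ultimately show ?case by simp
    next
      case (Suc p)
      have "?e 0 (?w (Suc (Suc p))) = ?f 0 (?e 0 (?w (Suc p))) + (A i i 0 (?w (Suc p)) - A (Suc i) (Suc i) 0 (?w (Suc p)))"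
        using A_commutator[of i "Suc i" "Suc i" i 0 0 "?w (Suc p)"] bounds by simp
      moreover have "cong_mod N (?f 0 (?e 0 (?w (Suc p))) + (A i i 0 (?w (Suc p)) - A (Suc i) (Suc i) 0 (?w (Suc p))))
          (?f 0 (scale (of_nat (Suc p) * (of_nat lam - of_nat p)) (?w p)) + scale (of_nat lam - 2 * of_nat (Suc p)) (?w (Suc p)))"
        by (intro cm(4,8) h Suc) (use assms in auto)
      moreover have "?f 0 (scale (of_nat (Suc p) * (of_nat lam - of_nat p)) (?w p)) + scale (of_nat lam - 2 * of_nat (Suc p)) (?w (Suc p)) =
          scale (of_nat (Suc p) * (of_nat lam - of_nat p) + (of_nat lam - 2 * of_nat (Suc p))) (?w (Suc p))"
        by (simp add: A_scale scale_left_distrib)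
      moreover have "of_nat (Suc p) * (of_nat lam - of_nat p) + (of_nat lam - 2 * of_nat (Suc p)) =
          (of_nat (Suc (Suc p)) * (of_nat lam - of_nat (Suc p)) :: complex)"
        by (simp add: algebra_simps)
      ultimately show ?case by simp
    qed
    obtain q where "?w q = 0" using A_nilpotent[of i w] bounds by auto
    then have ex: "\<exists>q. ?w q \<in> N" using S(3) by metis
    define q where "q = (LEAST q. ?w q \<in> N)"
    have qN: "?w q \<in> N" unfolding q_def using ex by (rule LeastI_ex)
    have "q \<le> Suc lam"
    proof (rule ccontr)
      assume "\<not> q \<le> Suc lam"
      then obtain p where p: "q = Suc p" "p > lam" by (cases q) auto
      have "?e 0 (?w q) \<in> N" using S(2) qN assms by auto
      then have "scale (of_nat (Suc p) * (of_nat lam - of_nat p)) (?w p) \<in> N"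
        using e[of p] cm(12) p by blast
      moreover have "(of_nat (Suc p) * (of_nat lam - of_nat p) :: complex) \<noteq> 0"
        using p(2) by (simp del: of_nat_Suc)
      ultimately have "?w p \<in> N" by (rule stable_scale_cancel[OF N])
      then have "q \<le> p" unfolding q_def by (rule Least_le)
      then show False using p by simp
    qed
    then have "q \<le> k" using k by (simp add: lam_def)
    then obtain d where "k = d + q" by (metis add.commute le_Suc_ex)
    moreover have "?w (d + q) \<in> N" for d by (induction d) (use qN S(2) assms in auto)
    ultimately show ?thesis by simp
  qed

  have shift: "- A i i b (?f a u) = ?f a (- A i i b u) + ?f (a + b) u" for a b u
    using A_commutator[of i i "Suc i" i b a u] bounds by (simp add: A_minus add.commute)
  \<comment> \<open>In generating series Y_k(z) = f(z)^k H(z) w, where f(z) is the sum of f_c z^c: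
    every factor f contributes one variable, that is 1/(1 - tz).\<close>
  have Y_Suc: "Y (Suc k) j = (\<Sum>c\<le>j. ?f c (Y k (j - c)))" for k j
  proof -
    have "HE i j (?f 0 (?w k)) = (\<Sum>c\<le>j. ?f (0 + c) (HE i (j - c) (?w k)))"
      by (rule row.H_shift_sum) (auto simp: A_add A_scale shift)
    then show ?thesis by (simp add: Y_def)
  qed
  have Y0: "Y 0 j \<in> N" if "j \<ge> 1" for j
    unfolding Y_def
    by (rule row.H_vanish) (use that S hwH bounds in auto)
  have newton: "scale (of_nat j) (Y k j) = (\<Sum>b\<in>{1..j}. - A i i b (Y k (j - b)))" for k j
    unfolding Y_def by (rule row.H_newton)
  \<comment> \<open>The power sum acts as a derivation on the k + 1 commuting factors f(z), all of
    which contribute alike, and it kills H(z) w modulo \<open>N\<close>.\<close>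
  have pY: "cong_mod N (- A i i b (Y (Suc k) j)) (scale (of_nat (Suc k)) (\<Sum>c\<le>j. ?f (b + c) (Y k (j - c))))"
    if "b \<ge> 1" for b k j
  proof (induction k arbitrary: j)
    have ex: "- A i i b (Y (Suc k) j) = (\<Sum>c\<le>j. ?f c (- A i i b (Y k (j - c)))) + (\<Sum>c\<le>j. ?f (b + c) (Y k (j - c)))" for k j
      unfolding Y_Suc A_sum sum_negf[symmetric] sum.distrib[symmetric]
      by (intro sum.cong refl) (simp add: shift add.commute)
    {
      case 0
      have "- A i i b (Y 0 (j - c)) \<in> N" for c
      proof (cases "j - c \<ge> 1")
        case True
        then show ?thesis using Y0 S bounds by auto
      next
        case False
        then show ?thesis using hwH[OF that] bounds S(7) by (simp add: Y_def)
      qed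
      then have "cong_mod N ((\<Sum>c\<le>j. ?f c (- A i i b (Y 0 (j - c)))) + (\<Sum>c\<le>j. ?f (b + c) (Y 0 (j - c))))
          (0 + (\<Sum>c\<le>j. ?f (b + c) (Y 0 (j - c))))"
        by (intro cm(4,1)) (use S(1,2) bounds assms(2) in \<open>auto simp: cm(11) intro!: subspace_sum\<close>)
      then show ?case unfolding ex by simp
    next
      case (Suc k)
      have "cong_mod N (\<Sum>c\<le>j. ?f c (- A i i b (Y (Suc k) (j - c))))
          (\<Sum>c\<le>j. ?f c (scale (of_nat (Suc k)) (\<Sum>c'\<le>j - c. ?f (b + c') (Y k (j - c - c')))))"
        by (intro cm(9,8) Suc) (use assms in auto)
      also have "(\<Sum>c\<le>j. ?f c (scale (of_nat (Suc k)) (\<Sum>c'\<le>j - c. ?f (b + c') (Y k (j - c - c'))))) =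
          scale (of_nat (Suc k)) (\<Sum>c\<le>j. \<Sum>c'\<le>j - c. ?f (b + c') (?f c (Y k (j - c - c'))))"
        by (simp add: A_scale A_sum scale_sum_right ff)
      also have "(\<Sum>c\<le>j. \<Sum>c'\<le>j - c. ?f (b + c') (?f c (Y k (j - c - c')))) =
          (\<Sum>c'\<le>j. \<Sum>c\<le>j - c'. ?f (b + c') (?f c (Y k (j - c' - c))))"
        by (simp add: sum.Sigma)
           (rule sum.reindex_bij_witness[of _ "\<lambda>(x,y). (y,x)" "\<lambda>(x,y). (y,x)"], auto simp: add.commute)
      also have "\<dots> = (\<Sum>c'\<le>j. ?f (b + c') (Y (Suc k) (j - c')))"
        by (simp add: Y_Suc[of k] A_sum)
      finally have "cong_mod N (\<Sum>c\<le>j. ?f c (- A i i b (Y (Suc k) (j - c))))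
          (scale (of_nat (Suc k)) (\<Sum>c'\<le>j. ?f (b + c') (Y (Suc k) (j - c'))))" .
      then have "cong_mod N (- A i i b (Y (Suc (Suc k)) j))
          (scale (of_nat (Suc k)) (\<Sum>c'\<le>j. ?f (b + c') (Y (Suc k) (j - c'))) + (\<Sum>c\<le>j. ?f (b + c) (Y (Suc k) (j - c))))"
        unfolding ex by (intro cm(4,1))
      moreover have "scale (of_nat (Suc k)) (\<Sum>c'\<le>j. ?f (b + c') (Y (Suc k) (j - c'))) + (\<Sum>c\<le>j. ?f (b + c) (Y (Suc k) (j - c))) =
          scale (of_nat (Suc (Suc k))) (\<Sum>c\<le>j. ?f (b + c) (Y (Suc k) (j - c)))"
        using scale_left_distrib[of "of_nat (Suc k)" 1] by (simp add: add.commute)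
      ultimately show ?case by simp
    }
  qed
  \<comment> \<open>The chain rule: z d/dz of f(z)^(k+1) is (k+1) f(z)^k times z f'(z), where H(z) w
    is constant modulo \<open>N\<close>.\<close>
  have X: "cong_mod N (scale (of_nat J) (Y (Suc k) J)) (scale (of_nat (Suc k)) (\<Sum>c\<le>J. scale (of_nat c) (?f c (Y k (J - c)))))" for k J
  proof -
    have "cong_mod N (\<Sum>b\<in>{1..J}. - A i i b (Y (Suc k) (J - b)))
        (\<Sum>b\<in>{1..J}. scale (of_nat (Suc k)) (\<Sum>c\<le>J - b. ?f (b + c) (Y k (J - b - c))))"
      by (intro cm(9) pY) auto
    also have "(\<Sum>b\<in>{1..J}. scale (of_nat (Suc k)) (\<Sum>c\<le>J - b. ?f (b + c) (Y k (J - b - c)))) =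
        scale (of_nat (Suc k)) (\<Sum>b\<in>{1..J}. \<Sum>c\<le>J - b. ?f (b + c) (Y k (J - b - c)))"
      by (simp add: scale_sum_right)
    also have "(\<Sum>b\<in>{1..J}. \<Sum>c\<le>J - b. ?f (b + c) (Y k (J - b - c))) = (\<Sum>c\<le>J. \<Sum>b\<in>{1..c}. ?f c (Y k (J - c)))"
      by (simp add: sum.Sigma)
         (rule sum.reindex_bij_witness[of _ "\<lambda>(c,b). (b,c-b)" "\<lambda>(b,c). (b+c,b)"], auto)
    also have "\<dots> = (\<Sum>c\<le>J. scale (of_nat c) (?f c (Y k (J - c))))"
      by (simp add: sum_constant_scale del: sum_constant)
    finally show ?thesis unfolding newton .
  qed
  \<comment> \<open>The trace of the 2 by 2 block in degree b commutes with f and kills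
    \<open>w\<close> modulo \<open>N\<close>, so -E_(i+1,i+1) t^b may be replaced by E_(i,i)
    t^b.\<close>
  have hY: "cong_mod N (A i i b (Y k j) - A (Suc i) (Suc i) b (Y k j)) (scale 2 (A i i b (Y k j)))" if "b \<ge> 1" for b k j
  proof -
    have "A i i b (?w k) + A (Suc i) (Suc i) b (?w k) \<in> N" for k
    proof (induction k)
      case 0
      then show ?case using hwH[OF that] bounds assms(2) S(4) by simp
    next
      case (Suc k)
      have "A i i b (?f 0 (?w k)) + A (Suc i) (Suc i) b (?f 0 (?w k)) = ?f 0 (A i i b (?w k) + A (Suc i) (Suc i) b (?w k))"
        using A_commutator[of i i "Suc i" i b 0 "?w k"] A_commutator[of "Suc i" "Suc i" "Suc i" i b 0 "?w k"] bounds
        by (simp add: A_add)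
      then show ?case using S(2)[OF assms(2) bounds(3) Suc, of 0] by simp
    qed
    then have "HE i j (A i i b (?w k) + A (Suc i) (Suc i) b (?w k)) \<in> N"
      by (rule HE_stable[OF N bounds(3)])
    then have "A i i b (Y k j) + A (Suc i) (Suc i) b (Y k j) \<in> N"
      by (simp add: row.H_add Y_def HE_commute_diag bounds)
    then have "- (A i i b (Y k j) + A (Suc i) (Suc i) b (Y k j)) \<in> N" by (rule S(7))
    then show ?thesis
      using scale_left_distrib[of 1 1 "A i i b (Y k j)"] by (simp add: cong_mod_def algebra_simps)
  qed
  \<comment> \<open>Commuting e_1 past the first factor f_c leaves Cartan elements of degree c + 1.
    Their sum is again Newton's sum, one degree higher, which is how h_(j+1) appears; the remaining
    terms come from the same formula with one factor less and from the chain rule.\<close>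
  have eY: "cong_mod N (?e 1 (Y (Suc k) j)) (- scale (of_nat (Suc k)) (scale (of_nat (Suc j)) (Y k (Suc j))))" for k j
  proof (induction k arbitrary: j)
    have ex: "?e 1 (Y (Suc k) j) = (\<Sum>c\<le>j. ?f c (?e 1 (Y k (j - c)))) +
        (\<Sum>c\<le>j. A i i (Suc c) (Y k (j - c)) - A (Suc i) (Suc i) (Suc c) (Y k (j - c)))" for k j
      unfolding Y_Suc A_sum sum.distrib[symmetric]
      by (intro sum.cong refl)
         (use A_commutator[of i "Suc i" "Suc i" i 1] bounds in simp)
    have sec: "cong_mod N (\<Sum>c\<le>j. A i i (Suc c) (Y k (j - c)) - A (Suc i) (Suc i) (Suc c) (Y k (j - c)))
        (- scale 2 (scale (of_nat (Suc j)) (Y k (Suc j))))" for k j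
    proof -
      have "cong_mod N (\<Sum>c\<le>j. A i i (Suc c) (Y k (j - c)) - A (Suc i) (Suc i) (Suc c) (Y k (j - c)))
          (\<Sum>c\<le>j. scale 2 (A i i (Suc c) (Y k (j - c))))"
        by (intro cm(9) hY) auto
      also have "(\<Sum>c\<le>j. scale 2 (A i i (Suc c) (Y k (j - c)))) = - scale 2 (\<Sum>c\<le>j. - A i i (Suc c) (Y k (Suc j - Suc c)))"
        by (simp add: scale_sum_right sum_negf)
      also have "(\<Sum>c\<le>j. - A i i (Suc c) (Y k (Suc j - Suc c))) = (\<Sum>b\<in>{1..Suc j}. - A i i b (Y k (Suc j - b)))"
        by (rule sum.reindex_bij_witness[of _ "\<lambda>b. b - 1" Suc]) auto
      finally show ?thesis unfolding newton .
    qed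
    {
      case 0
      have "?e 1 (Y 0 l) \<in> N" for l
      proof (cases "l \<ge> 1")
        case True
        then show ?thesis using Y0 S bounds assms(2) by auto
      next
        case False
        then have "l = 0" by simp
        then show ?thesis using hwE by (simp add: Y_def)
      qed
      then have "(\<Sum>c\<le>j. ?f c (?e 1 (Y 0 (j - c)))) \<in> N"
        using S bounds assms(2) by (auto intro!: subspace_sum)
      moreover have "- scale 2 (scale (of_nat (Suc j)) (Y 0 (Suc j))) \<in> N"
        "- scale (of_nat (Suc 0)) (scale (of_nat (Suc j)) (Y 0 (Suc j))) \<in> N"
        using Y0 S by auto
      ultimately have "?e 1 (Y (Suc 0) j) \<in> N"
        unfolding ex using sec[where k = 0 and j = j] cm(10) S(4) by blast
      then show ?case
        using \<open>- scale (of_nat (Suc 0)) _ \<in> N\<close> S(6) by (simp only: cong_mod_def)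
    next
      case (Suc k)
      let ?J = "Suc j"
      have "cong_mod N (\<Sum>c\<le>j. ?f c (?e 1 (Y (Suc k) (j - c))))
          (\<Sum>c\<le>j. ?f c (- scale (of_nat (Suc k)) (scale (of_nat (Suc (j - c))) (Y k (Suc (j - c))))))"
        by (intro cm(9,8) Suc) (use assms in auto)
      also have "(\<Sum>c\<le>j. ?f c (- scale (of_nat (Suc k)) (scale (of_nat (Suc (j - c))) (Y k (Suc (j - c)))))) =
          - scale (of_nat (Suc k)) (\<Sum>c\<le>j. scale (of_nat (?J - c)) (?f c (Y k (?J - c))))"
        unfolding scale_sum_right sum_negf[symmetric]
        by (intro sum.cong refl) (simp only: A_scale A_minus atMost_iff Suc_diff_le)
      also have "(\<Sum>c\<le>j. scale (of_nat (?J - c)) (?f c (Y k (?J - c)))) = (\<Sum>c\<le>?J. scale (of_nat (?J - c)) (?f c (Y k (?J - c))))"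
        by simp
      also have "\<dots> = scale (of_nat ?J) (Y (Suc k) ?J) - (\<Sum>c\<le>?J. scale (of_nat c) (?f c (Y k (?J - c))))"
        unfolding Y_Suc[of k] scale_sum_right sum_subtractf[symmetric]
        by (intro sum.cong refl) (auto simp: scale_left_diff_distrib[symmetric] of_nat_diff)
      finally have first: "cong_mod N (\<Sum>c\<le>j. ?f c (?e 1 (Y (Suc k) (j - c))))
          (- scale (of_nat (Suc k)) (scale (of_nat ?J) (Y (Suc k) ?J) - (\<Sum>c\<le>?J. scale (of_nat c) (?f c (Y k (?J - c))))))" .
      have "cong_mod N (- scale (of_nat (Suc k)) (scale (of_nat ?J) (Y (Suc k) ?J) - (\<Sum>c\<le>?J. scale (of_nat c) (?f c (Y k (?J - c))))))
          (- scale (of_nat (Suc k)) (scale (of_nat ?J) (Y (Suc k) ?J)) + scale (of_nat ?J) (Y (Suc k) ?J))"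
      proof -
        have "cong_mod N (- scale (of_nat (Suc k)) U + scale (of_nat (Suc k)) T) (- scale (of_nat (Suc k)) U + U)"
          if "cong_mod N U (scale (of_nat (Suc k)) T)" for U T
          by (intro cm(4,1) cm(2)[OF that])
        from this[OF X] show ?thesis by (simp only: scale_right_diff_distrib minus_diff_eq uminus_add_conv_diff)
      qed
      then have "cong_mod N (?e 1 (Y (Suc (Suc k)) j))
          (- scale (of_nat (Suc k)) (scale (of_nat ?J) (Y (Suc k) ?J)) + scale (of_nat ?J) (Y (Suc k) ?J) +
           - scale 2 (scale (of_nat ?J) (Y (Suc k) ?J)))"
        unfolding ex[of "Suc k"] by (intro cm(4) sec cm(3)[OF first])
      moreover have alg: "- scale (of_nat (Suc k)) u + u + - scale 2 u = - scale (of_nat (Suc (Suc k))) u" for u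
      proof -
        have "- scale (of_nat (Suc k)) u + u + - scale 2 u = scale (- of_nat (Suc k) + 1 + - 2) u"
          by (simp only: scale_left_distrib scale_minus_left scale_one)
        also have "(- of_nat (Suc k) + 1 + - 2 :: complex) = - of_nat (Suc (Suc k))" by simp
        finally show ?thesis by (simp only: scale_minus_left)
      qed
      ultimately show ?case unfolding alg by blast
    }
  qed
  \<comment> \<open>Applying e_1 trades one factor f for one degree of h and keeps j + k. The claim
    for degree j + 1 thus follows from degree j with one more factor, down to j = 0, where the power
    of f itself is in \<open>N\<close>.\<close>
  have "Y k j \<in> N" if "j + k > \<eta> i - \<eta> (Suc i)" for k j
    using that
  proof (induction j arbitrary: k)
    case 0
    then show ?case using wN by (simp add: Y_def)
  next
    case (Suc j)
    then have "Y (Suc k) j \<in> N" by simp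
    then have "?e 1 (Y (Suc k) j) \<in> N" using S(2) assms by auto
    then have "- scale (of_nat (Suc k)) (scale (of_nat (Suc j)) (Y k (Suc j))) \<in> N"
      using eY cm(12) by blast
    then have "scale (- of_nat (Suc k) * of_nat (Suc j)) (Y k (Suc j)) \<in> N"
      by (simp del: of_nat_Suc)
    then show ?case
      by (rule stable_scale_cancel[OF N]) (simp del: of_nat_Suc)
  qed
  then show ?thesis using assms(6) by (simp add: Y_def)
qed

end

section \<open>Induction on the rank\<close>

locale gl_parabolic_step = gl_current_rep scale m A
  for scale :: "complex \<Rightarrow> 'e::ab_group_add \<Rightarrow> 'e" and m :: nat and A +
  fixes n :: nat and N :: "'e set" and \<xi> :: "nat \<Rightarrow> nat" and x :: 'e
  assumes Suc_n_le: "Suc n \<le> m"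
    and N: "stable (Suc n) N"
    and highest: "highest_weight (Suc n) N \<xi> x"
    and decreasing: "i \<le> j \<Longrightarrow> j \<le> n \<Longrightarrow> \<xi> j \<le> \<xi> i"
begin

sublocale lowering: commuting_family n "\<lambda>i. A n i 0"
proof
  fix i j v assume "i < n" "j < n"
  then show "A n i 0 (A n j 0 v) = A n j 0 (A n i 0 v)"
    using A_commutator[of n i n j 0 0 v] Suc_n_le by simp
qed

abbreviation lower :: "nat multiset \<Rightarrow> 'e \<Rightarrow> 'e" where
  "lower \<equiv> mprod n (\<lambda>i. A n i 0)"

definition P :: "nat multiset \<Rightarrow> 'e" where
  "P M = lower M x"

definition below :: "nat \<Rightarrow> 'e set" where
  "below \<kappa> = gens n (N \<union> P ` {M. set_mset M \<subseteq> {..<n} \<and> lowered_weight n M < \<kappa>})"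

lemma m_bounds: "n < m" "i < n \<Longrightarrow> i < m" "i < Suc n \<Longrightarrow> i < m"
  using Suc_n_le by auto

lemma N': "stable n N"
  using stable_mono[OF N] by simp

lemma stable_below: "stable n (below \<kappa>)"
  by (simp add: below_def stable_gens)

lemma N_below: "N \<subseteq> below \<kappa>"
  by (auto simp: below_def intro: gens.base)

lemma P_below: "set_mset M \<subseteq> {..<n} \<Longrightarrow> lowered_weight n M < \<kappa> \<Longrightarrow> P M \<in> below \<kappa>"
  by (auto simp: below_def intro: gens.base)

lemma below_mono: "\<kappa> \<le> \<kappa>' \<Longrightarrow> below \<kappa> \<subseteq> below \<kappa>'"
  unfolding below_def by (intro gens_mono) auto

lemma lower_linear:
  assumes "set_mset M \<subseteq> {..<n}"
  shows "lower M (u + v) = lower M u + lower M v" "lower M (scale c u) = scale c (lower M u)"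
    "u \<in> N \<Longrightarrow> lower M u \<in> N"
  using assms stableD(2)[OF N] by (induction M) (auto simp: A_add A_scale)

lemma lower_remove:
  assumes "set_mset M \<subseteq> {..<n}" "i \<in># M"
  shows "A n i 0 (lower (M - {#i#}) v) = lower M v"
proof -
  have "i < n" using assms by auto
  then have "A n i 0 (lower (M - {#i#}) v) = lower (add_mset i (M - {#i#})) v" by simp
  then show ?thesis using assms by simp
qed

lemma last_row_commute: "i < n \<Longrightarrow> j < n \<Longrightarrow> A n i a (A n j b v) = A n j b (A n i a v)"
  using A_commutator[of n i n j a b v] m_bounds by simp

text \<open>The bracket of E_(i,j) t^a with E_(n,i) is -E_(n,j) t^a, which commutes with the other
  factors; it arises once for each occurrence of i.\<close>

lemma A_lower:
  assumes "i < n" "j < n" "set_mset M \<subseteq> {..<n}"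
  shows "A i j a (lower M v) = lower M (A i j a v) - scale (of_nat (count M i)) (A n j a (lower (M - {#i#}) v))"
  using assms(3)
proof (induction M)
  case empty
  then show ?case by simp
next
  case (add q M)
  have q: "q < n" and M: "set_mset M \<subseteq> {..<n}" using add.prems by auto
  let ?R = "A n q 0 (lower M (A i j a v))"
  have "A i j a (lower (add_mset q M) v) = A n q 0 (A i j a (lower M v)) - (if q = i then A n j a (lower M v) else 0)"
    using A_commutator[of i j n q a 0 "lower M v"] q assms m_bounds by simp
  also have "A n q 0 (A i j a (lower M v)) =
      ?R - scale (of_nat (count M i)) (A n j a (A n q 0 (lower (M - {#i#}) v)))"
    unfolding add.IH[OF M] A_diff A_scale by (subst (2) last_row_commute) (use q assms in auto)
  finally have *: "A i j a (lower (add_mset q M) v) =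
      ?R - scale (of_nat (count M i)) (A n j a (A n q 0 (lower (M - {#i#}) v))) - (if q = i then A n j a (lower M v) else 0)" .
  show ?case
  proof (cases "i \<in># M")
    case True
    then obtain M' where M': "M = add_mset i M'" by (metis multi_member_split)
    have "A n q 0 (lower (M - {#i#}) v) = lower (add_mset q M - {#i#}) v"
      using q by (simp add: M' add_mset_commute[of q i])
    then show ?thesis
      using * q True lower_remove[OF M True, of v] scale_left_distrib[of "of_nat (count M i)" 1 "A n j a (lower M v)"]
      by (auto simp: add.commute diff_diff_eq)
  next
    case False
    then have "count M i = 0" by (simp add: not_in_iff)
    then show ?thesis using * q by auto
  qed
qed

text \<open>This is why the products \<open>P M\<close> contain no positive powers of t. The element
  E_(q,q) t^b, b > 0, kills \<open>x\<close> modulo \<open>N\<close>, so on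
  \<open>P (add_mset q M)\<close> it only replaces one factor E_(n,q) by E_(n,q) t^b, with the
  invertible coefficient count + 1.\<close>

lemma last_row_P:
  assumes "set_mset M \<subseteq> {..<n}" "q < n"
  shows "A n q b (P M) \<in> gens n (N \<union> {P (add_mset q M)})"
proof (cases "b = 0")
  case True
  then show ?thesis using assms by (auto simp: P_def intro: gens.base)
next
  case False
  let ?G = "gens n (N \<union> {P (add_mset q M)})"
  let ?M = "add_mset q M"
  have M: "set_mset ?M \<subseteq> {..<n}" using assms by auto
  have "A q q b (P ?M) = lower ?M (A q q b x) - scale (of_nat (Suc (count M q))) (A n q b (P M))"
    using A_lower[OF assms(2,2) M] by (simp add: P_def)
  moreover have "A q q b (P ?M) \<in> ?G" using assms by (intro gens.act gens.base) auto
  moreover have "lower ?M (A q q b x) \<in> N"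
    using highest assms False by (intro lower_linear(3)[OF M]) (auto simp: highest_weight_def)
  then have "lower ?M (A q q b x) \<in> ?G" by (auto intro: gens.base)
  ultimately have "scale (of_nat (Suc (count M q))) (A n q b (P M)) \<in> ?G"
    using stableD(6)[OF stable_gens, of "lower ?M (A q q b x)" n "N \<union> {P ?M}" "A q q b (P ?M)"] by simp
  then show ?thesis
    by (rule stable_scale_cancel[OF stable_gens]) (simp del: of_nat_Suc)
qed

text \<open>Raising turns a factor E_(n,i) into E_(n,j) t^a, and this reduces the height because i <
  j.\<close>

lemma raise_P:
  assumes "i < j" "j < n" "set_mset M \<subseteq> {..<n}"
  shows "A i j a (P M) \<in> below (lowered_weight n M)"
proof -
  have eq: "A i j a (P M) = lower M (A i j a x) - scale (of_nat (count M i)) (A n j a (P (M - {#i#})))"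
    using A_lower[of i j M a x] assms by (simp add: P_def)
  have "lower M (A i j a x) \<in> N"
    using highest assms by (intro lower_linear(3)) (auto simp: highest_weight_def)
  then have 1: "lower M (A i j a x) \<in> below (lowered_weight n M)" using N_below by blast
  have 2: "scale (of_nat (count M i)) (A n j a (P (M - {#i#}))) \<in> below (lowered_weight n M)"
  proof (cases "i \<in># M")
    case True
    have sub: "set_mset (M - {#i#}) \<subseteq> {..<n}" using assms by (meson in_diffD subset_iff)
    have "lowered_weight n (add_mset j (M - {#i#})) < lowered_weight n M"
      using lowered_weight_diff[OF True, of n] assms by simp
    then have "P (add_mset j (M - {#i#})) \<in> below (lowered_weight n M)"
      using sub assms by (intro P_below) auto
    then have "gens n (N \<union> {P (add_mset j (M - {#i#}))}) \<subseteq> below (lowered_weight n M)"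
      using gens_minimal[OF _ _ stable_below] N_below by blast
    then show ?thesis
      using last_row_P[OF sub assms(2)] stableD(5)[OF stable_below] by blast
  next
    case False
    then show ?thesis using stableD(3)[OF stable_below] by (simp add: not_in_iff)
  qed
  show ?thesis unfolding eq by (rule stableD(6)[OF stable_below 1 2])
qed

lemma weight_P:
  assumes "i < n" "set_mset M \<subseteq> {..<n}"
  shows "A i i 0 (P M) - scale (of_nat (\<xi> i) - of_nat (count M i)) (P M) \<in> N"
proof -
  have "scale (of_nat (count M i)) (A n i 0 (P (M - {#i#}))) = scale (of_nat (count M i)) (P M)"
    using lower_remove[OF assms(2), of i x] by (cases "i \<in># M") (auto simp: P_def not_in_iff)
  then have "A i i 0 (P M) = lower M (A i i 0 x) - scale (of_nat (count M i)) (P M)"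
    using A_lower[OF assms(1,1,2), of 0 x] by (simp add: P_def)
  also have "lower M (A i i 0 x) = lower M (A i i 0 x - scale (of_nat (\<xi> i)) x) + scale (of_nat (\<xi> i)) (P M)"
    using lower_linear(1,2)[OF assms(2)] by (metis P_def diff_add_cancel)
  finally have "A i i 0 (P M) - scale (of_nat (\<xi> i) - of_nat (count M i)) (P M) = lower M (A i i 0 x - scale (of_nat (\<xi> i)) x)"
    by (simp add: scale_left_diff_distrib)
  also have "\<dots> \<in> N"
    using highest assms by (intro lower_linear(3)) (auto simp: highest_weight_def)
  finally show ?thesis .
qed

text \<open>Each factor E_(n,i) is one variable and raises the degree of the elementary operators by
  at most one; the other factors commute with row i, and on \<open>x\<close> all positive degrees
  vanish modulo \<open>N\<close>.\<close>

lemma EE_P: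
  assumes "i < n" "set_mset M \<subseteq> {..<n}" "j > count M i"
  shows "EE i j (P M) \<in> N"
  using assms(2,3)
proof (induction M arbitrary: j)
  case empty
  have "EE i j x \<in> N"
  proof (rule row.El_vanish)
    show "- A i i b x \<in> N" if "b \<ge> 1" for b
      using highest that assms(1) by (intro stableD(7)[OF N]) (auto simp: highest_weight_def)
  qed (use empty stableD[OF N] assms in auto)
  then show ?case by (simp add: P_def)
next
  case (add q M)
  have q: "q < n" and M: "set_mset M \<subseteq> {..<n}" using add.prems by auto
  have P: "P (add_mset q M) = A n q 0 (P M)" using q by (simp add: P_def)
  show ?case
  proof (cases "q = i")
    case True
    obtain j' where j: "j = Suc j'" "j' > count M i" using add.prems True by (cases j) auto
    have "EE i (Suc j') (A n i 0 (P M)) = A n i 0 (EE i (Suc j') (P M)) + A n i (Suc 0) (EE i j' (P M))"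
    proof (rule row.El_shift)
      show "- A i i b (A n i a v) = A n i a (- A i i b v) + A n i (a + b) v" for a b v
        using A_commutator[of i i n i b a v] m_bounds assms(1) by (simp add: A_minus add.commute)
    qed (simp_all add: A_add A_scale)
    moreover have "EE i (Suc j') (P M) \<in> N" "EE i j' (P M) \<in> N" using add.IH[OF M] j by auto
    ultimately show ?thesis using True P j assms(1) stableD[OF N] by auto
  next
    case False
    then have "EE i j (P (add_mset q M)) = A n q 0 (EE i j (P M))"
      unfolding P using EE_commute_A[of i n q 0 j "P M"] m_bounds q assms(1) by simp
    then show ?thesis using add.IH[OF M] add.prems False q stableD(2)[OF N] by auto
  qed
qed

lemma lower_simple_root:
  assumes "Suc i < n" "set_mset K \<subseteq> {..<n}"
  shows "lower K (A (Suc i) i 0 v) = A (Suc i) i 0 (lower K v) +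
    scale (of_nat (count K (Suc i))) (lower (add_mset i (K - {#Suc i#})) v)"
proof -
  have "A (Suc i) i 0 (lower K v) = lower K (A (Suc i) i 0 v) -
      scale (of_nat (count K (Suc i))) (A n i 0 (lower (K - {#Suc i#}) v))"
    using A_lower[of "Suc i" i K 0 v] assms by simp
  then show ?thesis using assms by simp
qed

text \<open>Moved to the left through the product, each f = E_(i+1,i) either turns an E_(n,i+1) into
  E_(n,i) or comes out in front. In the second case it acts as an element of gl_n on something of
  smaller height and stays in the filtration. If all s copies are absorbed, the coefficient is a
  falling factorial of \<open>count K (Suc i)\<close>, not zero since this count is at least
  s.\<close>

lemma lower_simple_root_power:
  assumes "Suc i < n" "set_mset K \<subseteq> {..<n}" "count K (Suc i) \<ge> s"
  shows "\<exists>c. c \<noteq> 0 \<and> lower K ((A (Suc i) i 0 ^^ s) x) -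
      scale c (P (K - replicate_mset s (Suc i) + replicate_mset s i)) \<in> below (lowered_weight n K + s)"
  using assms(2,3)
proof (induction s arbitrary: K)
  case 0
  show ?case
    by (rule exI[of _ 1]) (use stableD(3)[OF stable_below] in \<open>simp add: P_def\<close>)
next
  case (Suc s)
  let ?f = "A (Suc i) i 0"
  let ?K' = "add_mset i (K - {#Suc i#})"
  have K: "Suc i \<in># K" using Suc.prems(2) by (simp add: Suc_le_eq count_greater_zero_iff[symmetric] del: count_greater_zero_iff)
  have K': "set_mset ?K' \<subseteq> {..<n}" using Suc.prems(1) assms(1) by (auto dest: in_diffD)
  have wK': "lowered_weight n ?K' = Suc (lowered_weight n K)"
    using lowered_weight_diff[OF K, of n] assms(1) by simp
  have target: "set_mset (K - replicate_mset s (Suc i) + replicate_mset s i) \<subseteq> {..<n}"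
    using Suc.prems(1) assms(1) by (auto dest: in_diffD split: if_splits)
  have wtarget: "lowered_weight n (K - replicate_mset s (Suc i) + replicate_mset s i) = lowered_weight n K + s"
    if "count K (Suc i) \<ge> s" for s
  proof -
    have "replicate_mset s (Suc i) \<subseteq># K" using that by (simp add: count_le_replicate_mset_subset_eq)
    then obtain L where L: "K = L + replicate_mset s (Suc i)" by (metis subset_mset.diff_add)
    then show ?thesis
      using lowered_weight_replicate_Suc[OF assms(1)] by (simp add: lowered_weight_plus)
  qed
  have "lower K ((?f ^^ s) x) \<in> below (lowered_weight n K + Suc s)"
  proof -
    obtain c where c: "lower K ((?f ^^ s) x) - scale c (P (K - replicate_mset s (Suc i) + replicate_mset s i)) \<in> below (lowered_weight n K + s)"
      using Suc.IH[of K] Suc.prems by auto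
    have "P (K - replicate_mset s (Suc i) + replicate_mset s i) \<in> below (lowered_weight n K + Suc s)"
      using target wtarget[of s] Suc.prems by (intro P_below) auto
    then have "scale c (P (K - replicate_mset s (Suc i) + replicate_mset s i)) \<in> below (lowered_weight n K + Suc s)"
      by (rule stableD(5)[OF stable_below])
    moreover have "lower K ((?f ^^ s) x) - scale c (P (K - replicate_mset s (Suc i) + replicate_mset s i)) \<in> below (lowered_weight n K + Suc s)"
      using c below_mono[of "lowered_weight n K + s" "lowered_weight n K + Suc s"] by auto
    ultimately show ?thesis using stableD(4)[OF stable_below] by fastforce
  qed
  then have 1: "?f (lower K ((?f ^^ s) x)) \<in> below (lowered_weight n K + Suc s)"
    using assms(1) by (intro stableD(2)[OF stable_below]) auto
  have "count ?K' (Suc i) \<ge> s" using Suc.prems(2) by simp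
  moreover have "lowered_weight n ?K' + s = lowered_weight n K + Suc s"
    by (simp add: wK' del: lowered_weight_simps)
  ultimately obtain c where c: "c \<noteq> 0"
    "lower ?K' ((?f ^^ s) x) - scale c (P (?K' - replicate_mset s (Suc i) + replicate_mset s i)) \<in> below (lowered_weight n K + Suc s)"
    using Suc.IH[OF K'] by metis
  have tgt: "?K' - replicate_mset s (Suc i) + replicate_mset s i = K - replicate_mset (Suc s) (Suc i) + replicate_mset (Suc s) i"
    by (rule multiset_eqI) (use Suc.prems(2) in \<open>auto simp: count_replicate_mset\<close>)
  let ?d = "of_nat (count K (Suc i)) :: complex"
  have "lower K ((?f ^^ Suc s) x) - scale (?d * c) (P (K - replicate_mset (Suc s) (Suc i) + replicate_mset (Suc s) i)) =
      ?f (lower K ((?f ^^ s) x)) + scale ?d (lower ?K' ((?f ^^ s) x) -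
        scale c (P (K - replicate_mset (Suc s) (Suc i) + replicate_mset (Suc s) i)))"
    using lower_simple_root[OF assms(1) Suc.prems(1), of "(?f ^^ s) x"] by (simp add: scale_right_diff_distrib)
  also have "\<dots> \<in> below (lowered_weight n K + Suc s)"
    using c(2) unfolding tgt by (intro stableD(4)[OF stable_below 1] stableD(5)[OF stable_below])
  finally show ?case
    using c(1) K by (intro exI[of _ "?d * c"]) auto
qed

lemma HE_commute_lower:
  assumes "i < n" "set_mset K \<subseteq> {..<n}" "i \<notin># K"
  shows "lower K (HE i j v) = HE i j (lower K v)"
  using assms(2,3)
proof (induction K)
  case (add q K)
  then have "q < n" "q \<noteq> i" by auto
  then show ?case using add HE_commute_A[of i n q 0 j] m_bounds assms(1) by simp
qed simp

text \<open>Garland's identity needs powers of a simple root vector. For i + 1 = n these are the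
  factors E_(n,i) themselves. Otherwise E_(n,i)^k is traded, modulo smaller height, for E_(n,i+1)^k
  f^k with f = E_(i+1,i); the factors in front of f^k then commute with the operators of row
  i.\<close>

lemma HE_P:
  assumes i: "i < n" and M: "set_mset M \<subseteq> {..<n}" and j: "j + count M i > \<xi> i - \<xi> (Suc i)"
  shows "HE i j (P M) \<in> below (lowered_weight n M)"
proof -
  define k where "k = count M i"
  define L where "L = M - replicate_mset k i"
  have M_eq: "M = L + replicate_mset k i"
    unfolding L_def k_def by (simp add: count_le_replicate_mset_subset_eq[symmetric] subset_mset.diff_add)
  have L: "set_mset L \<subseteq> {..<n}" "i \<notin># L"
    using M by (auto simp: L_def k_def dest: in_diffD) (simp add: not_in_iff[symmetric] count_eq_zero_iff[symmetric] in_diff_count)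
  have G: "HE i j ((A (Suc i) i 0 ^^ k) x) \<in> N"
    using garland[OF Suc_n_le _ N highest, of i j k] i j decreasing[of i "Suc i"] by (simp add: k_def)
  show ?thesis
  proof (cases "Suc i = n")
    case True
    have "lower (L + replicate_mset l i) x = lower L ((A n i 0 ^^ l) x)" for l
    proof (induction l)
      case (Suc l)
      have "lower (L + replicate_mset (Suc l) i) x = A n i 0 (lower L ((A n i 0 ^^ l) x))"
        using Suc i by simp
      also have "\<dots> = lower L (A n i 0 ((A n i 0 ^^ l) x))"
        using lowering.mprod_add_inner[OF L(1) i] i by simp
      finally show ?case by simp
    qed simp
    then have "HE i j (P M) = HE i j (lower L ((A n i 0 ^^ k) x))" by (simp add: P_def M_eq)
    also have "\<dots> = lower L (HE i j ((A n i 0 ^^ k) x))" by (rule HE_commute_lower[symmetric, OF i L])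
    also have "\<dots> \<in> N" using G True by (intro lower_linear(3)[OF L(1)]) simp
    finally show ?thesis using N_below by blast
  next
    case False
    then have Si: "Suc i < n" using i by simp
    define K where "K = L + replicate_mset k (Suc i)"
    have K: "set_mset K \<subseteq> {..<n}" "i \<notin># K" using L Si by (auto simp: K_def split: if_splits)
    have KM: "K - replicate_mset k (Suc i) + replicate_mset k i = M" by (simp add: K_def M_eq)
    have wM: "lowered_weight n K + k = lowered_weight n M"
      using lowered_weight_replicate_Suc[OF Si] by (simp add: K_def M_eq lowered_weight_plus)
    have "count K (Suc i) \<ge> k" by (simp add: K_def)
    from lower_simple_root_power[OF Si K(1) this] obtain c where c: "c \<noteq> 0"
      "lower K ((A (Suc i) i 0 ^^ k) x) - scale c (P M) \<in> below (lowered_weight n M)"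
      by (auto simp: KM wM)
    have "HE i j (lower K ((A (Suc i) i 0 ^^ k) x) - scale c (P M)) \<in> below (lowered_weight n M)"
      by (rule HE_stable[OF stable_below i c(2)])
    then have "lower K (HE i j ((A (Suc i) i 0 ^^ k) x)) - scale c (HE i j (P M)) \<in> below (lowered_weight n M)"
      by (simp add: HE_diff row.H_scale HE_commute_lower[OF i K])
    moreover have "lower K (HE i j ((A (Suc i) i 0 ^^ k) x)) \<in> below (lowered_weight n M)"
      using lower_linear(3)[OF K(1) G] N_below by blast
    ultimately have "scale c (HE i j (P M)) \<in> below (lowered_weight n M)"
      using stableD(6)[OF stable_below] by fastforce
    then show ?thesis by (rule stable_scale_cancel[OF stable_below _ c(1)])
  qed
qed

text \<open>The layers exhaust the module, because the gl_n-module generated by \<open>N\<close> and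
  all \<open>P M\<close> is already stable under gl_(n+1). The lowering operators come first: the
  treatment of E_(n,n) and of E_(q,n) produces them as commutators.\<close>

lemma gens_parabolic:
  assumes "u \<in> gens (Suc n) {x}"
  shows "\<exists>\<kappa>. u \<in> below \<kappa>"
proof -
  define B where "B = N \<union> P ` {M. set_mset M \<subseteq> {..<n}}"
  let ?G = "gens n B"
  have G: "stable n ?G" by (rule stable_gens)
  note S = stableD[OF G]
  have PG: "P M \<in> ?G" if "set_mset M \<subseteq> {..<n}" for M using that by (auto simp: B_def intro: gens.base)
  have NG: "N \<subseteq> ?G" by (auto simp: B_def intro: gens.base)
  have low: "A n q b u \<in> ?G" if "u \<in> ?G" "q < n" for q b u
    using that
  proof (induction arbitrary: q b)
    case (base u)
    then consider "u \<in> N" | M where "set_mset M \<subseteq> {..<n}" "u = P M" by (auto simp: B_def)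
    then show ?case
    proof cases
      case 1
      have "A n q b u \<in> N" by (rule stableD(2)[OF N]) (use base(2) 1 in auto)
      then show ?thesis using NG by blast
    next
      case 2
      have "gens n (N \<union> {P (add_mset q M)}) \<subseteq> ?G"
        using 2 base by (intro gens_mono) (auto simp: B_def)
      then show ?thesis using last_row_P[OF 2(1) base(2)] 2(2) by blast
    qed
  next
    case (act u i j a)
    have "A n q b (A i j a u) = A i j a (A n q b u) + (if q = i then A n j (b + a) u else 0)"
      using A_commutator[of n q i j b a u] act m_bounds by simp
    then show ?case using act by (simp add: S(2,4,6))
  qed (simp_all add: A_add A_scale S(3,4,5))
  have diag: "A n n b u \<in> ?G" if "u \<in> ?G" for b u
    using that
  proof induction
    case (base u)
    then consider "u \<in> N" | M where "set_mset M \<subseteq> {..<n}" "u = P M" by (auto simp: B_def)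
    then show ?case
    proof cases
      case 1
      have "A n n b u \<in> N" by (rule stableD(2)[OF N]) (use 1 in auto)
      then show ?thesis using NG by blast
    next
      case 2
      from 2(1) have "A n n b (P M) \<in> ?G"
      proof (induction M)
        case empty
        have x: "x \<in> ?G" using PG[of "{#}"] by (simp add: P_def)
        have "A n n 0 x - scale (of_nat (\<xi> n)) x \<in> ?G" "\<And>b. b \<ge> 1 \<Longrightarrow> A n n b x \<in> ?G"
          using highest NG by (auto simp: highest_weight_def)
        then show ?case
          using S(4)[of "A n n 0 x - scale (of_nat (\<xi> n)) x" "scale (of_nat (\<xi> n)) x"] S(5)[OF x]
          by (cases "b = 0") (auto simp: P_def)
      next
        case (add q M)
        then have q: "q < n" and M: "set_mset M \<subseteq> {..<n}" by auto
        have "A n n b (P (add_mset q M)) = A n q 0 (A n n b (P M)) + A n q b (P M)"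
          using A_commutator[of n n n q b 0 "P M"] q m_bounds by (simp add: P_def)
        then show ?case using add.IH[OF M] low q PG[OF M] S(4) by simp
      qed
      then show ?thesis using 2 by simp
    qed
  next
    case (act u i j a)
    have "A n n b (A i j a u) = A i j a (A n n b u)"
      using A_commutator[of n n i j b a u] act m_bounds by simp
    then show ?case using act by (simp add: S(2,4,6))
  qed (simp_all add: A_add A_scale S(3,4,5))
  have raise: "A q n b u \<in> ?G" if "u \<in> ?G" "q < n" for q b u
    using that
  proof (induction arbitrary: q b)
    case (base u)
    then consider "u \<in> N" | M where "set_mset M \<subseteq> {..<n}" "u = P M" by (auto simp: B_def)
    then show ?case
    proof cases
      case 1
      have "A q n b u \<in> N" by (rule stableD(2)[OF N]) (use base(2) 1 in auto)
      then show ?thesis using NG by blast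
    next
      case 2
      from 2(1) have "A q n b (P M) \<in> ?G"
      proof (induction M)
        case empty
        then show ?case using highest base(2) NG by (auto simp: P_def highest_weight_def)
      next
        case (add p M)
        then have p: "p < n" and M: "set_mset M \<subseteq> {..<n}" by auto
        have "A q n b (P (add_mset p M)) = A n p 0 (A q n b (P M)) + A q p b (P M) - (if p = q then A n n b (P M) else 0)"
          using A_commutator[of q n n p b 0 "P M"] p base m_bounds by (simp add: P_def)
        then show ?case
          using add.IH[OF M] low[OF _ p] diag PG[OF M] S(2)[OF base(2) p] S(4,6) by auto
      qed
      then show ?thesis using 2 by simp
    qed
  next
    case (act u i j a)
    have "A q n b (A i j a u) = A i j a (A q n b u) - (if j = q then A i n (b + a) u else 0)"
      using A_commutator[of q n i j b a u] act m_bounds by simp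
    then show ?case using act by (simp add: S(2,4,6))
  qed (simp_all add: A_add A_scale S(3,4,5))
  have "A i j a u \<in> ?G" if "i < Suc n" "j < Suc n" "u \<in> ?G" for i j a u
    using that low[of u j a] diag[of u a] raise[of u i a] S(2)[of i j u a]
    by (cases "i = n"; cases "j = n") simp_all
  then have "stable (Suc n) ?G"
    using S(1) by (simp add: stable_def)
  then have "u \<in> ?G"
    using assms PG[of "{#}"] by (intro gens_minimal[OF assms]) (auto simp: P_def)
  \<comment> \<open>One element involves only finitely many generators, so a single height bounds
    them all.\<close>
  from gens_finite[OF this] obtain F where F: "finite F" "F \<subseteq> B" "u \<in> gens n F" by blast
  have "\<forall>v\<in>F. \<exists>\<kappa>. v \<in> below \<kappa>"
  proof
    fix v assume "v \<in> F"
    with F(2) have "v \<in> N \<union> P ` {M. set_mset M \<subseteq> {..<n}}" unfolding B_def by blast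
    then consider "v \<in> N" | M where "set_mset M \<subseteq> {..<n}" "v = P M" by blast
    then show "\<exists>\<kappa>. v \<in> below \<kappa>"
    proof cases
      case 1
      then show ?thesis using N_below by blast
    next
      case 2
      then show ?thesis using P_below[of M "Suc (lowered_weight n M)"] by blast
    qed
  qed
  from bchoice[OF this] obtain \<kappa> where "\<forall>v\<in>F. v \<in> below (\<kappa> v)" ..
  then have \<kappa>: "v \<in> below (\<kappa> v)" if "v \<in> F" for v using that by blast
  have "F \<subseteq> below (Max (insert 0 (\<kappa> ` F)))"
  proof
    fix v assume "v \<in> F"
    then have "\<kappa> v \<le> Max (insert 0 (\<kappa> ` F))" using F(1) by (intro Max_ge) auto
    then show "v \<in> below (Max (insert 0 (\<kappa> ` F)))" using \<kappa>[OF \<open>v \<in> F\<close>] below_mono by blast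
  qed
  then show ?thesis using gens_minimal[OF F(3) _ stable_below] by blast
qed

end

section \<open>The step from gl_n to gl_(n+1)\<close>

context gl_current_rep
begin

lemma equivariant_last_annihs:
  assumes "equivariant r (Suc n) \<Phi>"
  shows "equivariant r n (\<lambda>u. last_annihs r n qs (\<Phi> u))"
  unfolding equivariant_def
  by (auto simp: equivariantD[OF assms] last_annihs_linear last_annihs_current)

lemma equivariant_mprod:
  assumes "equivariant r (Suc n) \<Phi>" "set_mset M \<subseteq> {..<n}" "Suc n \<le> m"
  shows "\<Phi> (mprod n (\<lambda>i. A n i 0) M u) = fock_P r n M (\<Phi> u)"
proof -
  interpret commuting_family n "\<lambda>i. A n i 0"
  proof
    fix i j v assume "i < n" "j < n"
    then show "A n i 0 (A n j 0 v) = A n j 0 (A n i 0 v)"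
      using A_commutator[of n i n j 0 0 v] assms(3) by simp
  qed
  show ?thesis
    using assms(2) by (induction M) (auto simp: equivariantD(3)[OF assms(1)])
qed

lemma weyl_faithful_Suc:
  assumes IH: "weyl_faithful r n" and nm: "Suc n \<le> m"
  shows "weyl_faithful r (Suc n)"
  unfolding weyl_faithful_def
proof (intro allI impI, elim conjE)
  fix N x \<xi> \<Phi> Q c
  assume N: "stable (Suc n) N" and hw: "highest_weight (Suc n) N \<xi> x"
    and dec: "\<forall>i j. i \<le> j \<longrightarrow> j < Suc n \<longrightarrow> \<xi> j \<le> \<xi> i" and r: "\<forall>i<Suc n. \<xi> i \<le> r"
    and \<Phi>: "equivariant r (Suc n) \<Phi>" and \<Phi>N: "\<forall>u\<in>N. \<Phi> u = 0" and "finite Q"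
    and Q: "\<forall>i<Suc n. \<forall>s. (i, s) \<in> Q \<longleftrightarrow> s < \<xi> i" and "c \<noteq> 0" and \<Phi>x: "\<Phi> x = fscale c (monomial Q)"
  interpret gl_parabolic_step scale m A n N \<xi> x
    by unfold_locales (use N hw dec nm in auto)
  interpret fock_vacuum r n \<xi>
    by unfold_locales (use dec in auto)
  have vac: "vacuum_like (fscale c (monomial Q))"
    using Q by (auto simp: vacuum_like_def annih_below_linear annih_below_monomial[OF \<open>finite Q\<close>] less_Suc_eq_le)
  have \<Phi>P: "\<Phi> (P M) = fock_P r n M (fscale c (monomial Q))" if "set_mset M \<subseteq> {..<n}" for M
    using equivariant_mprod[OF \<Phi> that nm] by (simp add: P_def \<Phi>x)

  \<comment> \<open>Within one height the vectors \<open>P M\<close> are adjoined one at a time,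
    each being tested modulo the earlier ones and all smaller heights.\<close>
  have step: "u \<in> below \<kappa>"
    if "finite \<M>" "\<And>M. M \<in> \<M> \<Longrightarrow> set_mset M \<subseteq> {..<n} \<and> lowered_weight n M = \<kappa>"
      "u \<in> gens n (below \<kappa> \<union> P ` \<M>)" "\<Phi> u = 0" for \<kappa> u \<M>
    using that
  proof (induction \<M> arbitrary: u)
    case empty
    have "u \<in> gens n (below \<kappa>)" using empty.prems(2) by simp
    then show ?case by (rule gens_minimal[OF _ subset_refl stable_below])
  next
    case (insert M \<M>)
    define N1 where "N1 = gens n (below \<kappa> \<union> P ` \<M>)"
    have N1: "stable n N1" by (simp add: N1_def stable_gens)
    have bN1: "below \<kappa> \<subseteq> N1" by (auto simp: N1_def intro: gens.base)
    have M: "set_mset M \<subseteq> {..<n}" "lowered_weight n M = \<kappa>" using insert.prems(1) by auto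
    have "below \<kappa> \<union> P ` insert M \<M> \<subseteq> N1 \<union> {P M}"
      by (auto simp: N1_def intro: gens.base)
    from gens_mono[OF this] have "u \<in> gens n (N1 \<union> {P M})" using insert.prems(2) by blast
    then obtain v w where vw: "v \<in> N1" "w \<in> gens n {P M}" "u = v + w"
      using gens_split[OF _ N1] by blast
    have "w \<in> N1"
    proof (cases "\<exists>i<n. count M i > \<xi> i - \<xi> (Suc i)")
      case True
      \<comment> \<open>In degree 0 the complete homogeneous operator is the identity, so a
        multiplicity beyond \<open>\<xi> i - \<xi> (Suc i)\<close> puts \<open>P M\<close> itself
        into a lower layer.\<close>
      then have "P M \<in> below \<kappa>" using HE_P[OF _ M(1), of _ 0] M(2) by auto
      then show ?thesis by (intro gens_minimal[OF vw(2) _ N1]) (use bN1 in auto)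
    next
      case False
      then have le: "count M i \<le> \<xi> i - \<xi> (Suc i)" if "i < n" for i using that by (meson not_le)
      have \<xi>: "\<xi> (Suc i) \<le> \<xi> i" if "i < n" for i using decreasing[of i "Suc i"] that by simp
      \<comment> \<open>The holes of row i are confined to the columns from
        \<open>\<xi> (Suc i)\<close> to \<open>\<xi> i\<close>, where the next row is empty. The
        multiplicity of i in \<open>M\<close> is their number, and \<open>?M i\<close> counts the
        boxes that stay in this stretch.\<close>
      let ?c = "\<lambda>i. \<xi> (Suc i)" and ?k = "count M" and ?M = "\<lambda>i. \<xi> i - \<xi> (Suc i) - count M i"
      have cM: "?c i + ?M i = \<xi> i - count M i" if "i < n" for i using le[OF that] \<xi>[OF that] by simp
      have ckM: "?c i + ?k i + ?M i = \<xi> i" if "i < n" for i using le[OF that] \<xi>[OF that] by simp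
      \<comment> \<open>The test set consists of the w that some v in \<open>N1\<close> completes to
        an element of the kernel. A map that factors through \<open>\<Phi>\<close> and kills
        \<open>N1\<close> kills v + w and v, hence w.\<close>
      have "gens n {P M} \<inter> {w. \<exists>v\<in>N1. \<Phi> (v + w) = 0} \<subseteq> N1"
      proof (rule gens_faithful_tower[OF IH, where c = ?c and k = ?k and M = ?M])
        show "n \<le> m" using nm by simp
        show "A i j a (P M) \<in> N1" if "i < j" "j < n" for i j a
          using raise_P[OF that M(1)] bN1 M(2) by blast
        show "A i i 0 (P M) - scale (of_nat (?c i + ?M i)) (P M) \<in> N1" if "i < n" for i
        proof -
          have "of_nat (?c i + ?M i) = (of_nat (\<xi> i) - of_nat (count M i) :: complex)"
            unfolding cM[OF that] using le[OF that] by (simp add: of_nat_diff)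
          then show ?thesis using weight_P[OF that M(1)] N_below bN1 by auto
        qed
        show "HE i j (P M) \<in> N1" if "i < n" "?M i < j" for i j
        proof -
          have "\<xi> i - \<xi> (Suc i) < j + count M i" using that(2) by simp
          from HE_P[OF that(1) M(1) this] show ?thesis using bN1 M(2) by blast
        qed
        show "EE i j (P M) \<in> N1" if "i < n" "?k i < j" for i j
          using EE_P[OF that(1) M(1) that(2)] N_below bN1 by blast
        show "?c j + ?M j \<le> ?c i + ?M i" if "i \<le> j" "j < n" for i j
        proof (cases "i = j")
          case False
          then have "\<xi> j \<le> \<xi> (Suc i)" using that by (intro decreasing) auto
          then show ?thesis using cM[of j] that by simp
        qed simp
        show "?c i + ?k i + ?M i \<le> r" if "i < n" for i unfolding ckM[OF that] using r that by simp
        fix Ss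
        assume Ss: "\<And>i. i < n \<Longrightarrow> length (Ss i) = ?k i \<and> sorted_wrt (<) (Ss i) \<and> set (Ss i) \<subseteq> {?c i..<?c i + ?k i + ?M i}"
        \<comment> \<open>Differentiating row n in the columns of all prescribed holes sends
          \<open>P M\<close> to a nonzero multiple of the monomial with exactly these holes, and by
          triangularity it kills the other vectors of this height and everything below.\<close>
        define qs where "qs = concat (map (\<lambda>i. map (Pair i) (Ss i)) [0..<n])"
        have adm: "admissible qs"
          using Ss by (fastforce simp: admissible_def qs_def)
        have qsM: "mset (map fst qs) = M"
        proof (rule multiset_eqI)
          fix i
          have "count (mset (map fst (concat (map (\<lambda>i. map (Pair i) (Ss i)) is)))) i = (if i \<in> set is then length (Ss i) else 0)"
            if "distinct is" for "is" :: "nat list"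
            using that by (induction "is") (auto simp: o_def image_mset_const_eq count_replicate_mset)
          then show "count (mset (map fst qs)) i = count M i"
            using Ss[of i] M(1) unfolding qs_def by (auto simp: not_in_iff[symmetric] count_eq_zero_iff subset_iff)
        qed
        note annihs_eq = last_annihs_fock_P_eq[OF adm vac, unfolded qsM M(2)]
        note annihs_less = last_annihs_fock_P_less[OF adm vac, unfolded qsM M(2)]
        let ?\<Phi> = "\<lambda>u. last_annihs r n qs (\<Phi> u)"
        have eqv: "equivariant r n ?\<Phi>" by (rule equivariant_last_annihs[OF \<Phi>])
        have zero: "?\<Phi> (P M') = 0" if "set_mset M' \<subseteq> {..<n}" "lowered_weight n M' \<le> \<kappa>" "M' \<noteq> M" for M'
        proof (cases "lowered_weight n M' = \<kappa>")
          case True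
          then show ?thesis
            using annihs_eq[OF that(1)] that(3) by (simp add: \<Phi>P[OF that(1)])
        next
          case False
          then show ?thesis
            using annihs_less[OF that(1)] that(2) by (simp add: \<Phi>P[OF that(1)])
        qed
        have below0: "?\<Phi> u = 0" if "u \<in> below \<kappa>" for u
        proof (rule equivariant_gens_zero[OF eqv _ that[unfolded below_def]])
          fix v assume "v \<in> N \<union> P ` {M. set_mset M \<subseteq> {..<n} \<and> lowered_weight n M < \<kappa>}"
          then consider "v \<in> N" | M' where "v = P M'" "set_mset M' \<subseteq> {..<n}" "lowered_weight n M' < \<kappa>" by blast
          then show "?\<Phi> v = 0"
          proof cases
            case 1
            then show ?thesis using \<Phi>N by (simp add: last_annihs_linear)
          next
            case 2
            then have "M' \<noteq> M" using M(2) by auto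
            then show ?thesis unfolding 2(1) using 2(2,3) by (intro zero) auto
          qed
        qed
        have N10: "?\<Phi> u = 0" if "u \<in> N1" for u
        proof (rule equivariant_gens_zero[OF eqv _ that[unfolded N1_def]])
          fix v assume "v \<in> below \<kappa> \<union> P ` \<M>"
          then consider "v \<in> below \<kappa>" | M' where "v = P M'" "M' \<in> \<M>" by blast
          then show "?\<Phi> v = 0"
          proof cases
            case 2
            then have "M' \<noteq> M" "set_mset M' \<subseteq> {..<n} \<and> lowered_weight n M' = \<kappa>"
              using insert.hyps(2) insert.prems(1)[of M'] by auto
            then show ?thesis unfolding 2(1) by (intro zero) auto
          qed (rule below0)
        qed
        obtain d :: nat where d: "d > 0" "?\<Phi> (P M) = fscale (of_nat d) (row_annihs r qs (fscale c (monomial Q)))"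
          using annihs_eq[OF M(1)] M(2) by (auto simp: \<Phi>P[OF M(1)])
        have "row_annihs r qs f = holes r n Ss f" for f
          by (simp add: qs_def row_annihs_eq_rows_annih)
        then have \<Phi>M: "?\<Phi> (P M) = fscale (of_nat d * c) (holes r n Ss (monomial Q))"
          by (simp add: d(2) rows_annih_scale)
        have K0: "?\<Phi> w = 0" if "v \<in> N1" "\<Phi> (v + w) = 0" for v w
          using N10[OF that(1)] that(2) equivariantD(1)[OF eqv, of v w] by (simp add: last_annihs_linear)
        show "\<exists>\<Phi>' Q' d. equivariant r n \<Phi>' \<and> (\<forall>u\<in>N1 \<union> {w. \<exists>v\<in>N1. \<Phi> (v + w) = 0}. \<Phi>' u = 0) \<and>
            finite Q' \<and> (\<forall>i<n. \<forall>s. (i, s) \<in> Q' \<longleftrightarrow> s < ?c i + ?k i + ?M i) \<and> d \<noteq> 0 \<and>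
            \<Phi>' (P M) = fscale d (holes r n Ss (monomial Q'))"
        proof (intro exI conjI)
          show "\<forall>u\<in>N1 \<union> {w. \<exists>v\<in>N1. \<Phi> (v + w) = 0}. ?\<Phi> u = 0" using N10 K0 by blast
          show "\<forall>i<n. \<forall>s. (i, s) \<in> Q \<longleftrightarrow> s < ?c i + ?k i + ?M i" using Q ckM by simp
          show "of_nat d * c \<noteq> 0" using d(1) \<open>c \<noteq> 0\<close> by simp
        qed (fact eqv \<open>finite Q\<close> \<Phi>M)+
      qed (rule N1)
      then show ?thesis using vw insert.prems(3) by auto
    qed
    then have "u \<in> N1" using vw stableD(4)[OF N1] by simp
    then show ?case
      unfolding N1_def using insert.prems(1,3) by (intro insert.IH) auto
  qed

  have level: "u \<in> N" if "u \<in> below \<kappa>" "\<Phi> u = 0" for \<kappa> u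
    using that
  proof (induction \<kappa> arbitrary: u)
    case 0
    then have "u \<in> gens n N" by (simp add: below_def)
    then show ?case by (rule gens_minimal[OF _ subset_refl N'])
  next
    case (Suc \<kappa>)
    \<comment> \<open>The generators that are not already in the smaller layer have height exactly
      \<open>\<kappa>\<close>, and finitely many of them suffice, as the argument within one height
      requires.\<close>
    from gens_finite[OF Suc.prems(1)[unfolded below_def]] obtain F where F: "finite F"
      "F \<subseteq> N \<union> P ` {M. set_mset M \<subseteq> {..<n} \<and> lowered_weight n M < Suc \<kappa>}" "u \<in> gens n F"
      by blast
    obtain \<M> where \<M>: "finite \<M>" "\<M> \<subseteq> {M. set_mset M \<subseteq> {..<n} \<and> lowered_weight n M = \<kappa>}"
      "F - below \<kappa> = P ` \<M>"
    proof -
      have "F - below \<kappa> \<subseteq> P ` {M. set_mset M \<subseteq> {..<n} \<and> lowered_weight n M = \<kappa>}"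
      proof
        fix v assume v: "v \<in> F - below \<kappa>"
        then have "v \<notin> N" using subsetD[OF N_below, of v \<kappa>] by auto
        then have "v \<in> P ` {M. set_mset M \<subseteq> {..<n} \<and> lowered_weight n M < Suc \<kappa>}"
          using subsetD[OF F(2), of v] v by simp
        then obtain M where M: "v = P M" "set_mset M \<subseteq> {..<n}" "lowered_weight n M < Suc \<kappa>" by auto
        then have "\<not> lowered_weight n M < \<kappa>" using P_below[OF M(2), of \<kappa>] v by auto
        then have "lowered_weight n M = \<kappa>" using M(3) by simp
        then show "v \<in> P ` {M. set_mset M \<subseteq> {..<n} \<and> lowered_weight n M = \<kappa>}"
          unfolding M(1) using M(2) by (intro imageI) simp
      qed
      from finite_subset_image[OF finite_Diff[OF F(1)] this] obtain \<M> where
        "\<M> \<subseteq> {M. set_mset M \<subseteq> {..<n} \<and> lowered_weight n M = \<kappa>}" "finite \<M>" "F - below \<kappa> = P ` \<M>"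
        by blast
      then show ?thesis by (intro that)
    qed
    have "u \<in> gens n (below \<kappa> \<union> P ` \<M>)"
    proof -
      have "F \<subseteq> below \<kappa> \<union> P ` \<M>" using \<M>(3) by blast
      from gens_mono[OF this] show ?thesis using F(3) by blast
    qed
    then have "u \<in> below \<kappa>" using \<M>(1,2) Suc.prems(2) by (intro step[of \<M>]) auto
    then show ?case using Suc.prems(2) by (rule Suc.IH)
  qed
  show "\<forall>u\<in>gens (Suc n) {x}. \<Phi> u = 0 \<longrightarrow> u \<in> N"
  proof (intro ballI impI)
    fix u assume u: "u \<in> gens (Suc n) {x}" "\<Phi> u = 0"
    from gens_parabolic[OF u(1)] obtain \<kappa> where "u \<in> below \<kappa>" ..
    then show "u \<in> N" using u(2) by (rule level)
  qed
qed

theorem weyl_faithful: "n \<le> m \<Longrightarrow> weyl_faithful r n"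
  by (induction n) (auto intro: weyl_faithful_0 weyl_faithful_Suc)

end

section \<open>Free and enveloping algebras\<close>

definition vscale :: "complex \<Rightarrow> ('x \<Rightarrow> complex) \<Rightarrow> 'x \<Rightarrow> complex" where
  "vscale c f = (\<lambda>w. c * f w)"

lemma vector_space_vscale: "vector_space vscale"
  by unfold_locales (auto simp: vscale_def algebra_simps fun_eq_iff fun_apply)

interpretation fun_space: vector_space vscale
  by (rule vector_space_vscale)

section \<open>Left multiplication by letters in the free algebra\<close>

definition word_lmult :: "'x \<Rightarrow> ('x list \<Rightarrow> complex) \<Rightarrow> 'x list \<Rightarrow> complex" where
  "word_lmult x f = (\<lambda>w. case w of [] \<Rightarrow> 0 | y # v \<Rightarrow> if y = x then f v else 0)"

definition word_one :: "'x list \<Rightarrow> complex" where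
  "word_one = (\<lambda>w. if w = [] then 1 else 0)"

lemma word_lmult_linear:
  "word_lmult x (f + g) = word_lmult x f + word_lmult x g"
  "word_lmult x (vscale c f) = vscale c (word_lmult x f)"
  "word_lmult x 0 = 0" "word_lmult x (f - g) = word_lmult x f - word_lmult x g"
  by (auto simp: word_lmult_def vscale_def fun_eq_iff fun_apply split: list.splits)

lemma free_algebra_simps:
  "f \<oplus>\<^bsub>free_algebra X\<^esub> g = f + g" "\<zero>\<^bsub>free_algebra X\<^esub> = 0" "c \<odot>\<^bsub>free_algebra X\<^esub> f = vscale c f"
  "\<one>\<^bsub>free_algebra X\<^esub> = word_one"
  by (simp_all add: free_algebra_def vscale_def word_one_def fun_eq_iff fun_apply)

lemma letter_mult: "letter x \<otimes>\<^bsub>free_algebra X\<^esub> f = word_lmult x f"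
proof
  fix w
  show "(letter x \<otimes>\<^bsub>free_algebra X\<^esub> f) w = word_lmult x f w"
  proof (cases w)
    case Nil
    then show ?thesis by (simp add: free_algebra_def letter_def word_lmult_def)
  next
    case (Cons y v)
    have "(\<Sum>k\<le>length w. letter x (take k w) * f (drop k w)) = (\<Sum>k\<le>length w. if k = 1 then letter x [y] * f v else 0)"
      by (rule sum.cong[OF refl]) (auto simp: letter_def Cons take_Cons' split: if_splits)
    also have "\<dots> = letter x [y] * f v" using Cons by (subst sum.delta) auto
    finally show ?thesis
      by (simp add: free_algebra_def letter_def word_lmult_def Cons del: sum.atMost_Suc)
  qed
qed

lemma letter_eq: "letter x = word_lmult x word_one"
  by (auto simp: letter_def word_lmult_def word_one_def fun_eq_iff split: list.splits)

lemma free_algebra_carrier: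
  "word_one \<in> carrier (free_algebra X)"
  "0 \<in> carrier (free_algebra X)"
  "f \<in> carrier (free_algebra X) \<Longrightarrow> g \<in> carrier (free_algebra X) \<Longrightarrow> f + g \<in> carrier (free_algebra X)"
  "f \<in> carrier (free_algebra X) \<Longrightarrow> vscale c f \<in> carrier (free_algebra X)"
  "f \<in> carrier (free_algebra X) \<Longrightarrow> - f \<in> carrier (free_algebra X)"
  "f \<in> carrier (free_algebra X) \<Longrightarrow> g \<in> carrier (free_algebra X) \<Longrightarrow> f - g \<in> carrier (free_algebra X)"
  "x \<in> X \<Longrightarrow> f \<in> carrier (free_algebra X) \<Longrightarrow> word_lmult x f \<in> carrier (free_algebra X)"
  "x \<in> X \<Longrightarrow> letter x \<in> carrier (free_algebra X)"
proof -
  interpret F: ring "free_algebra X" by (rule ring_free_algebra)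
  interpret M: Module.module class_ring "free_algebra X" by (rule module_free_algebra)
  show one: "word_one \<in> carrier (free_algebra X)"
    using F.one_closed by (simp only: free_algebra_simps)
  show "0 \<in> carrier (free_algebra X)" using F.zero_closed by (simp only: free_algebra_simps)
  show add: "f + g \<in> carrier (free_algebra X)" if "f \<in> carrier (free_algebra X)" "g \<in> carrier (free_algebra X)" for f g
    using F.a_closed[OF that] by (simp only: free_algebra_simps)
  show sc: "vscale c f \<in> carrier (free_algebra X)" if "f \<in> carrier (free_algebra X)" for c f
    using M.smult_closed[of c f] that by (simp add: free_algebra_simps)
  show neg: "- f \<in> carrier (free_algebra X)" if "f \<in> carrier (free_algebra X)" for f
  proof -
    have "- f = vscale (-1) f" by (simp add: vscale_def fun_eq_iff fun_apply)
    show ?thesis unfolding \<open>- f = vscale (-1) f\<close> by (rule sc[OF that])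
  qed
  show "f - g \<in> carrier (free_algebra X)" if "f \<in> carrier (free_algebra X)" "g \<in> carrier (free_algebra X)" for f g
    using add[OF that(1) neg[OF that(2)]] by simp
  show letter: "letter x \<in> carrier (free_algebra X)" if "x \<in> X" for x
    using that by (auto simp: free_algebra_def letter_def)
  show "word_lmult x f \<in> carrier (free_algebra X)" if "x \<in> X" "f \<in> carrier (free_algebra X)" for x f
    using F.m_closed[OF letter[OF that(1)] that(2)] by (simp only: letter_mult)
qed

lemma free_algebra_a_minus:
  assumes "f \<in> carrier (free_algebra X)" "g \<in> carrier (free_algebra X)"
  shows "f \<ominus>\<^bsub>free_algebra X\<^esub> g = f - g"
proof -
  interpret F: ring "free_algebra X" by (rule ring_free_algebra)
  have "\<ominus>\<^bsub>free_algebra X\<^esub> g = - g"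
    by (rule F.minus_equality) (use assms in \<open>auto simp: free_algebra_simps free_algebra_carrier\<close>)
  then show ?thesis by (simp add: a_minus_def free_algebra_simps)
qed

lemma free_algebra_induct [consumes 1, case_names one zero add scale lmult]:
  assumes "f \<in> carrier (free_algebra X)"
    and one: "P word_one" and zero: "P 0"
    and add: "\<And>f g. f \<in> carrier (free_algebra X) \<Longrightarrow> g \<in> carrier (free_algebra X) \<Longrightarrow> P f \<Longrightarrow> P g \<Longrightarrow> P (f + g)"
    and scale: "\<And>c f. f \<in> carrier (free_algebra X) \<Longrightarrow> P f \<Longrightarrow> P (vscale c f)"
    and lmult: "\<And>x f. x \<in> X \<Longrightarrow> f \<in> carrier (free_algebra X) \<Longrightarrow> P f \<Longrightarrow> P (word_lmult x f)"
  shows "P f"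
proof -
  define e :: "'a list \<Rightarrow> 'a list \<Rightarrow> complex" where "e w = (\<lambda>v. if v = w then 1 else 0)" for w
  have e: "e w \<in> carrier (free_algebra X) \<and> P (e w)" if "set w \<subseteq> X" for w
    using that
  proof (induction w)
    case Nil
    have "e [] = word_one" by (simp add: e_def word_one_def)
    then show ?case using one by (simp add: free_algebra_carrier)
  next
    case (Cons x w)
    have "e (x # w) = word_lmult x (e w)"
      by (auto simp: e_def word_lmult_def fun_eq_iff split: list.splits)
    then show ?case using Cons lmult by (auto simp: free_algebra_carrier)
  qed
  have "(\<Sum>w\<in>T. vscale (f w) (e w)) \<in> carrier (free_algebra X) \<and> P (\<Sum>w\<in>T. vscale (f w) (e w))"
    if "finite T" "\<forall>w\<in>T. set w \<subseteq> X" for T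
    using that
    by (induction T rule: finite_induct)
       (auto simp: free_algebra_carrier e zero intro!: add scale)
  moreover have "f = (\<Sum>w\<in>{w. f w \<noteq> 0}. vscale (f w) (e w))"
  proof
    fix v
    have fin: "finite {w. f w \<noteq> 0}" using assms(1) by (simp add: free_algebra_def)
    have "(\<Sum>w\<in>T. vscale (f w) (e w)) v = (\<Sum>w\<in>T. f w * e w v)" if "finite T" for T
      using that by (induction T rule: finite_induct) (auto simp: fun_apply vscale_def)
    from this[OF fin] have "(\<Sum>w\<in>{w. f w \<noteq> 0}. vscale (f w) (e w)) v = (\<Sum>w\<in>{w. f w \<noteq> 0}. if w = v then f v else 0)"
      by (simp only:) (intro sum.cong, auto simp: e_def)
    then show "f v = (\<Sum>w\<in>{w. f w \<noteq> 0}. vscale (f w) (e w)) v"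
      using fin by (simp add: sum.delta)
  qed
  moreover have "finite {w. f w \<noteq> 0}" "\<forall>w\<in>{w. f w \<noteq> 0}. set w \<subseteq> X"
    using assms(1) by (simp_all add: free_algebra_def)
  ultimately show ?thesis by metis
qed

section \<open>Evaluating noncommutative polynomials on a vector\<close>

definition word_eval :: "('x \<Rightarrow> fock \<Rightarrow> fock) \<Rightarrow> fock \<Rightarrow> ('x list \<Rightarrow> complex) \<Rightarrow> fock" where
  "word_eval act y f = (\<Sum>w\<in>{w. f w \<noteq> 0}. fscale (f w) (foldr act w y))"

lemma word_eval_superset:
  assumes "finite T" "{w. f w \<noteq> 0} \<subseteq> T"
  shows "word_eval act y f = (\<Sum>w\<in>T. fscale (f w) (foldr act w y))"
  unfolding word_eval_def by (rule sum.mono_neutral_left) (use assms in auto)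

lemma word_eval_one [simp]: "word_eval act y word_one = y"
  by (subst word_eval_superset[of "{[]}"]) (auto simp: word_one_def)

lemma word_eval_zero [simp]: "word_eval act y 0 = 0"
  by (simp add: word_eval_def fun_apply)

lemma word_eval_linear:
  assumes "f \<in> carrier (free_algebra X)" "g \<in> carrier (free_algebra X)"
  shows "word_eval act y (f + g) = word_eval act y f + word_eval act y g"
    "word_eval act y (vscale c f) = fscale c (word_eval act y f)"
    "word_eval act y (f - g) = word_eval act y f - word_eval act y g"
proof -
  have fin: "finite {w. f w \<noteq> 0}" "finite {w. g w \<noteq> 0}" using assms by (simp_all add: free_algebra_def)
  let ?T = "{w. f w \<noteq> 0} \<union> {w. g w \<noteq> 0}"
  have T: "finite ?T" "{w. f w \<noteq> 0} \<subseteq> ?T" "{w. g w \<noteq> 0} \<subseteq> ?T" using fin by auto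
  have lin: "word_eval act y h = word_eval act y f + fscale d (word_eval act y g)"
    if h: "\<And>w. h w = f w + d * g w" for h d
  proof -
    have "{w. h w \<noteq> 0} \<subseteq> ?T" using h by auto
    then have "word_eval act y h = (\<Sum>w\<in>?T. fscale (h w) (foldr act w y))" by (rule word_eval_superset[OF T(1)])
    also have "\<dots> = (\<Sum>w\<in>?T. fscale (f w) (foldr act w y)) + fscale d (\<Sum>w\<in>?T. fscale (g w) (foldr act w y))"
      unfolding fock.scale_sum_right sum.distrib[symmetric]
      by (intro sum.cong refl) (simp add: h fock.scale_left_distrib)
    finally show ?thesis
      unfolding word_eval_superset[OF T(1,2)] word_eval_superset[OF T(1,3)] .
  qed
  show "word_eval act y (f + g) = word_eval act y f + word_eval act y g"
    using lin[of "f + g" 1] by (simp add: fun_apply)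
  show "word_eval act y (f - g) = word_eval act y f - word_eval act y g"
    using lin[of "f - g" "-1"] by (simp add: fun_apply)
  show "word_eval act y (vscale c f) = fscale c (word_eval act y f)"
    by (subst (1 2) word_eval_superset[OF fin(1)]) (auto simp: vscale_def fock.scale_sum_right)
qed

lemma word_eval_lmult:
  assumes "f \<in> carrier (free_algebra X)"
    and act: "\<And>u v. act x (u + v) = act x u + act x v" "\<And>c u. act x (fscale c u) = fscale c (act x u)"
  shows "word_eval act y (word_lmult x f) = act x (word_eval act y f)"
proof -
  have fin: "finite {w. f w \<noteq> 0}" using assms by (simp add: free_algebra_def)
  have z: "act x 0 = 0" using act(2)[of 0 0] by simp
  have s: "act x (\<Sum>i\<in>T. h i) = (\<Sum>i\<in>T. act x (h i))" for T and h :: "'a list \<Rightarrow> fock"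
    by (induction T rule: infinite_finite_induct) (auto simp: act z)
  have "word_eval act y (word_lmult x f) = (\<Sum>w\<in>(#) x ` {w. f w \<noteq> 0}. fscale (word_lmult x f w) (foldr act w y))"
  proof (rule word_eval_superset)
    show "{w. word_lmult x f w \<noteq> 0} \<subseteq> (#) x ` {w. f w \<noteq> 0}"
    proof
      fix w assume "w \<in> {w. word_lmult x f w \<noteq> 0}"
      then show "w \<in> (#) x ` {w. f w \<noteq> 0}"
        by (cases w) (auto simp: word_lmult_def split: if_splits)
    qed
  qed (use fin in simp)
  also have "\<dots> = (\<Sum>w\<in>{w. f w \<noteq> 0}. act x (fscale (f w) (foldr act w y)))"
    by (subst sum.reindex) (auto simp: word_lmult_def act)
  finally show ?thesis by (simp add: word_eval_def s)
qed

text \<open>Serves for two quotients, of the free algebra by a two-sided ideal and of U(L) by a left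
  ideal; what they share is the additive and scalar structure.\<close>

locale quotient_of_module =
  fixes A :: "(complex, 'a) module" and I :: "'a set"
  assumes A_group: "abelian_group A" and I_subgroup: "additive_subgroup I A"
    and I_smult: "\<And>c u. u \<in> I \<Longrightarrow> c \<odot>\<^bsub>A\<^esub> u \<in> I"
    and A_smult: "\<And>c u. u \<in> carrier A \<Longrightarrow> c \<odot>\<^bsub>A\<^esub> u \<in> carrier A"
      "\<And>c u v. u \<in> carrier A \<Longrightarrow> v \<in> carrier A \<Longrightarrow> c \<odot>\<^bsub>A\<^esub> (u \<oplus>\<^bsub>A\<^esub> v) = c \<odot>\<^bsub>A\<^esub> u \<oplus>\<^bsub>A\<^esub> c \<odot>\<^bsub>A\<^esub> v"
begin

sublocale grp: abelian_group A by (rule A_group)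

sublocale sub: abelian_subgroup I A
  by (rule abelian_subgroupI3[OF I_subgroup A_group])

abbreviation coset :: "'a \<Rightarrow> 'a set" where
  "coset u \<equiv> I +>\<^bsub>A\<^esub> u"

abbreviation Q where "Q \<equiv> quotient_algebra A I"

lemma I_carrier: "u \<in> I \<Longrightarrow> u \<in> carrier A"
  using sub.a_subset by blast

lemma coset_mem:
  assumes "u \<in> carrier A"
  shows "v \<in> coset u \<longleftrightarrow> (\<exists>i\<in>I. v = i \<oplus>\<^bsub>A\<^esub> u)"
  by (auto simp: a_r_coset_def')

lemma coset_eq:
  assumes "u \<in> carrier A" "i \<in> I"
  shows "coset (i \<oplus>\<^bsub>A\<^esub> u) = coset u"
  using sub.a_repr_independence'[of "i \<oplus>\<^bsub>A\<^esub> u" u] assms coset_mem[OF assms(1)] by auto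

lemma coset_eq_iff:
  assumes "u \<in> carrier A" "v \<in> carrier A"
  shows "coset u = coset v \<longleftrightarrow> u \<ominus>\<^bsub>A\<^esub> v \<in> I"
proof
  assume "coset u = coset v"
  then have "u \<in> coset v" using sub.a_rcos_self[OF assms(1)] by simp
  then show "u \<ominus>\<^bsub>A\<^esub> v \<in> I" using sub.a_rcos_module_minus[OF _ assms(2,1)] sub.a_rcos_module[of v u] assms by (simp add: a_minus_def)
next
  assume "u \<ominus>\<^bsub>A\<^esub> v \<in> I"
  then have "coset ((u \<ominus>\<^bsub>A\<^esub> v) \<oplus>\<^bsub>A\<^esub> v) = coset v" by (rule coset_eq[OF assms(2)])
  moreover have "(u \<ominus>\<^bsub>A\<^esub> v) \<oplus>\<^bsub>A\<^esub> v = u" using assms by (simp add: a_minus_def grp.a_assoc grp.l_neg)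
  ultimately show "coset u = coset v" by simp
qed

lemma Q_carrier: "carrier Q = coset ` carrier A"
  by (auto simp: quotient_algebra_def A_RCOSETS_def')

lemma Q_add: "u \<in> carrier A \<Longrightarrow> v \<in> carrier A \<Longrightarrow> coset u \<oplus>\<^bsub>Q\<^esub> coset v = coset (u \<oplus>\<^bsub>A\<^esub> v)"
  by (simp add: quotient_algebra_def sub.a_rcos_sum)

lemma Q_zero: "\<zero>\<^bsub>Q\<^esub> = coset \<zero>\<^bsub>A\<^esub>"
  by (simp add: quotient_algebra_def sub.a_subset grp.a_coset_add_zero)

text \<open>Operations on cosets are unions over representatives. If the result does not depend on
  the representative, all members of the union coincide.\<close>

lemma coset_UN:
  assumes u: "u \<in> carrier A"
    and f: "\<And>i. i \<in> I \<Longrightarrow> h (i \<oplus>\<^bsub>A\<^esub> u) = h u"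
  shows "(\<Union>x\<in>coset u. h x) = h u"
proof -
  have "h x = h u" if "x \<in> coset u" for x using that f coset_mem[OF u] by auto
  moreover have "u \<in> coset u" by (rule sub.a_rcos_self[OF u])
  ultimately show ?thesis by blast
qed

lemma Q_smult: "u \<in> carrier A \<Longrightarrow> c \<odot>\<^bsub>Q\<^esub> coset u = coset (c \<odot>\<^bsub>A\<^esub> u)"
  unfolding quotient_algebra_def
  by simp (rule coset_UN, auto simp: A_smult I_carrier I_smult intro!: coset_eq)

lemma Q_group: "abelian_group Q"
proof (rule abelian_groupI)
  fix x y z assume "x \<in> carrier Q" "y \<in> carrier Q" "z \<in> carrier Q"
  then obtain u v w where "u \<in> carrier A" "x = coset u" "v \<in> carrier A" "y = coset v" "w \<in> carrier A" "z = coset w"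
    unfolding Q_carrier by blast
  then show "x \<oplus>\<^bsub>Q\<^esub> y \<in> carrier Q" "(x \<oplus>\<^bsub>Q\<^esub> y) \<oplus>\<^bsub>Q\<^esub> z = x \<oplus>\<^bsub>Q\<^esub> (y \<oplus>\<^bsub>Q\<^esub> z)"
    by (auto simp: Q_add Q_carrier grp.a_assoc)
next
  fix x y assume "x \<in> carrier Q" "y \<in> carrier Q"
  then obtain u v where "u \<in> carrier A" "x = coset u" "v \<in> carrier A" "y = coset v"
    unfolding Q_carrier by blast
  then show "x \<oplus>\<^bsub>Q\<^esub> y = y \<oplus>\<^bsub>Q\<^esub> x" by (simp add: Q_add grp.a_comm)
next
  show "\<zero>\<^bsub>Q\<^esub> \<in> carrier Q" by (auto simp: Q_zero Q_carrier)
next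
  fix x assume "x \<in> carrier Q"
  then obtain u where u: "u \<in> carrier A" "x = coset u" unfolding Q_carrier by blast
  then show "\<zero>\<^bsub>Q\<^esub> \<oplus>\<^bsub>Q\<^esub> x = x" by (simp add: Q_zero Q_add)
  show "\<exists>y\<in>carrier Q. y \<oplus>\<^bsub>Q\<^esub> x = \<zero>\<^bsub>Q\<^esub>"
    using u by (intro bexI[of _ "coset (\<ominus>\<^bsub>A\<^esub> u)"]) (auto simp: Q_zero Q_add Q_carrier grp.l_neg)
qed

lemma Q_minus:
  assumes "u \<in> carrier A" "v \<in> carrier A"
  shows "coset u \<ominus>\<^bsub>Q\<^esub> coset v = coset (u \<ominus>\<^bsub>A\<^esub> v)"
proof -
  interpret Q: abelian_group Q by (rule Q_group)
  have "\<ominus>\<^bsub>Q\<^esub> coset v = coset (\<ominus>\<^bsub>A\<^esub> v)"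
    by (rule Q.minus_equality) (use assms in \<open>auto simp: Q_add Q_zero Q_carrier grp.l_neg\<close>)
  then show ?thesis using assms by (simp add: a_minus_def Q_add)
qed

end

lemma free_algebra_mult_linear:
  "(f + g) \<otimes>\<^bsub>free_algebra X\<^esub> h = f \<otimes>\<^bsub>free_algebra X\<^esub> h + g \<otimes>\<^bsub>free_algebra X\<^esub> h"
  "(f - g) \<otimes>\<^bsub>free_algebra X\<^esub> h = f \<otimes>\<^bsub>free_algebra X\<^esub> h - g \<otimes>\<^bsub>free_algebra X\<^esub> h"
  "vscale c f \<otimes>\<^bsub>free_algebra X\<^esub> h = vscale c (f \<otimes>\<^bsub>free_algebra X\<^esub> h)"
  "0 \<otimes>\<^bsub>free_algebra X\<^esub> h = 0"
  by (simp_all add: free_algebra_def fun_eq_iff fun_apply vscale_def algebra_simps sum.distrib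
      sum_subtractf sum_distrib_left)

lemma word_one_mult: "f \<in> carrier (free_algebra X) \<Longrightarrow> word_one \<otimes>\<^bsub>free_algebra X\<^esub> f = f"
  using ring.ring_simprules(12)[OF ring_free_algebra, of f X] by (simp add: free_algebra_simps)

lemma word_lmult_mult:
  assumes "x \<in> X" "f \<in> carrier (free_algebra X)" "g \<in> carrier (free_algebra X)"
  shows "word_lmult x f \<otimes>\<^bsub>free_algebra X\<^esub> g = word_lmult x (f \<otimes>\<^bsub>free_algebra X\<^esub> g)"
proof -
  interpret F: ring "free_algebra X" by (rule ring_free_algebra)
  have "letter x \<otimes>\<^bsub>free_algebra X\<^esub> f \<otimes>\<^bsub>free_algebra X\<^esub> g = letter x \<otimes>\<^bsub>free_algebra X\<^esub> (f \<otimes>\<^bsub>free_algebra X\<^esub> g)"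
    by (rule F.m_assoc) (use assms in \<open>auto simp: free_algebra_carrier\<close>)
  then show ?thesis by (simp only: letter_mult)
qed

section \<open>Cyclic modules by generators and relations\<close>

locale lie_presentation =
  fixes L :: "(complex, 'l) lie_algebra" and R :: "('l list \<Rightarrow> complex) set set"
  assumes L_closed: "\<And>x y. x \<in> carrier L \<Longrightarrow> y \<in> carrier L \<Longrightarrow> x \<oplus>\<^bsub>L\<^esub> y \<in> carrier L"
      "\<And>c x. x \<in> carrier L \<Longrightarrow> c \<odot>\<^bsub>L\<^esub> x \<in> carrier L"
      "\<And>x y. x \<in> carrier L \<Longrightarrow> y \<in> carrier L \<Longrightarrow> lie_bracket L x y \<in> carrier L"
    and R_carrier: "R \<subseteq> carrier (uea L)"
begin

abbreviation F where "F \<equiv> free_algebra (carrier L)"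
abbreviation I where "I \<equiv> uea_ideal L"
abbreviation U where "U \<equiv> uea L"
abbreviation J where "J \<equiv> generated_left_ideal (uea L) R"

lemma relations_carrier: "uea_relations L \<subseteq> carrier F"
proof -
  interpret F: ring F by (rule ring_free_algebra)
  have "letter x \<in> carrier F" if "x \<in> carrier L" for x using that by (rule free_algebra_carrier)
  then show ?thesis
    by (auto simp: uea_relations_def Let_def free_algebra_simps(3) L_closed free_algebra_carrier)
qed

sublocale ideal: ideal I F
  unfolding uea_ideal_def by (rule ring.genideal_ideal[OF ring_free_algebra relations_carrier])

sublocale qF: quotient_of_module F I
proof (rule quotient_of_module.intro)
  show "abelian_group F" by (rule ring.is_abelian_group[OF ring_free_algebra])
  show "additive_subgroup I F" ..
  show "c \<odot>\<^bsub>F\<^esub> u \<in> I" if "u \<in> I" for c u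
  proof -
    have u: "u \<in> carrier F" using that ideal.a_subset by blast
    have "vscale c word_one \<otimes>\<^bsub>F\<^esub> u \<in> I" by (rule ideal.I_l_closed[OF that]) (simp add: free_algebra_carrier)
    then show ?thesis by (simp add: free_algebra_mult_linear word_one_mult[OF u] free_algebra_simps)
  qed
qed (auto simp: free_algebra_simps free_algebra_carrier fun_space.scale_right_distrib)

lemma U_eq: "U = qF.Q"
  by (simp add: uea_def)

lemma U_mult: "f \<in> carrier F \<Longrightarrow> g \<in> carrier F \<Longrightarrow> qF.coset f \<otimes>\<^bsub>U\<^esub> qF.coset g = qF.coset (f \<otimes>\<^bsub>F\<^esub> g)"
  by (simp add: uea_def quotient_algebra_def ideal.rcoset_mult_add)

lemma U_smult: "f \<in> carrier F \<Longrightarrow> c \<odot>\<^bsub>U\<^esub> qF.coset f = qF.coset (vscale c f)"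
  by (simp add: U_eq qF.Q_smult free_algebra_simps)

lemma U_add: "f \<in> carrier F \<Longrightarrow> g \<in> carrier F \<Longrightarrow> qF.coset f \<oplus>\<^bsub>U\<^esub> qF.coset g = qF.coset (f + g)"
  by (simp add: U_eq qF.Q_add free_algebra_simps)

lemma U_zero: "\<zero>\<^bsub>U\<^esub> = qF.coset 0"
  by (simp add: U_eq qF.Q_zero free_algebra_simps)

lemma U_carrier: "carrier U = qF.coset ` carrier F"
  by (simp add: U_eq qF.Q_carrier)

lemma U_carrierE:
  assumes "X \<in> carrier U"
  obtains f where "f \<in> carrier F" "X = qF.coset f"
  using assms unfolding U_carrier by (rule imageE)

lemma U_one: "\<one>\<^bsub>U\<^esub> = qF.coset word_one"
  by (simp add: uea_def quotient_algebra_def free_algebra_simps)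

lemma uea_emb_eq: "uea_emb L x = qF.coset (letter x)"
  by (simp add: uea_emb_def)

lemma uea_emb_power:
  assumes "x \<in> carrier L"
  shows "uea_emb L x [^]\<^bsub>U\<^esub> k = qF.coset ((word_lmult x ^^ k) word_one) \<and> (word_lmult x ^^ k) word_one \<in> carrier F"
proof -
  have shift: "(word_lmult x ^^ k) word_one \<otimes>\<^bsub>F\<^esub> letter x = (word_lmult x ^^ Suc k) word_one \<and>
      (word_lmult x ^^ k) word_one \<in> carrier F" for k
  proof (induction k)
    case 0
    show ?case using word_one_mult[of "letter x" "carrier L"] assms by (simp add: free_algebra_carrier flip: letter_eq)
  next
    case (Suc k)
    then have c: "(word_lmult x ^^ k) word_one \<in> carrier F" by simp
    have "(word_lmult x ^^ Suc k) word_one \<otimes>\<^bsub>F\<^esub> letter x = word_lmult x ((word_lmult x ^^ k) word_one \<otimes>\<^bsub>F\<^esub> letter x)"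
      using word_lmult_mult[OF assms c] assms by (simp add: free_algebra_carrier)
    then show ?case using Suc assms by (simp add: free_algebra_carrier)
  qed
  have "uea_emb L x [^]\<^bsub>U\<^esub> k = qF.coset ((word_lmult x ^^ k) word_one)"
  proof (induction k)
    case 0
    then show ?case by (simp add: nat_pow_def U_one)
  next
    case (Suc k)
    have "uea_emb L x [^]\<^bsub>U\<^esub> Suc k = uea_emb L x [^]\<^bsub>U\<^esub> k \<otimes>\<^bsub>U\<^esub> uea_emb L x"
      by (simp add: nat_pow_def)
    also have "\<dots> = qF.coset ((word_lmult x ^^ k) word_one \<otimes>\<^bsub>F\<^esub> letter x)"
      unfolding Suc unfolding uea_emb_eq by (rule U_mult) (use shift assms in \<open>auto simp: free_algebra_carrier\<close>)
    finally show ?case using shift by simp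
  qed
  then show ?thesis using shift by blast
qed

lemma left_ideal_J: "left_ideal J U"
proof -
  interpret U: abelian_group U unfolding U_eq by (rule qF.Q_group)
  have mult_closed: "a \<otimes>\<^bsub>U\<^esub> b \<in> carrier U" if ab: "a \<in> carrier U" "b \<in> carrier U" for a b
  proof -
    obtain f where f: "f \<in> carrier F" "a = qF.coset f" using ab(1) by (rule U_carrierE)
    obtain g where g: "g \<in> carrier F" "b = qF.coset g" using ab(2) by (rule U_carrierE)
    show ?thesis
      unfolding f(2) g(2) U_mult[OF f(1) g(1)] U_carrier
      by (rule imageI) (rule ideal.m_closed[OF f(1) g(1)])
  qed
  have top: "left_ideal (carrier U) U"
    unfolding left_ideal_def
  proof (intro conjI ballI)
    show "additive_subgroup (carrier U) U"
      using group.subgroup_self[OF U.a_group] by (intro additive_subgroupI) simp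
  qed (rule mult_closed)
  define S where "S = {J. left_ideal J U \<and> R \<subseteq> J}"
  have mem: "K \<in> S \<Longrightarrow> left_ideal K U" for K by (simp add: S_def)
  have "carrier U \<in> S" using top R_carrier by (simp add: S_def)
  then have ne: "S \<noteq> {}" by auto
  have "additive_subgroup (\<Inter>S) U"
  proof (rule additive_subgroupI, rule group.subgroups_Inter[OF U.a_group _ ne])
    show "subgroup K (add_monoid U)" if "K \<in> S" for K
      using mem[OF that] by (simp add: left_ideal_def additive_subgroup.a_subgroup)
  qed
  moreover have "a \<otimes>\<^bsub>U\<^esub> b \<in> \<Inter>S" if "a \<in> carrier U" "b \<in> \<Inter>S" for a b
  proof (rule InterI)
    fix K assume K: "K \<in> S"
    then have "b \<in> K" using that(2) by simp
    then show "a \<otimes>\<^bsub>U\<^esub> b \<in> K" using mem[OF K] that(1) by (simp add: left_ideal_def)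
  qed
  ultimately have "left_ideal (\<Inter>S) U" by (simp add: left_ideal_def)
  then show ?thesis by (simp only: generated_left_ideal_def S_def)
qed

lemma J_mult: "f \<in> carrier F \<Longrightarrow> X \<in> J \<Longrightarrow> qF.coset f \<otimes>\<^bsub>U\<^esub> X \<in> J"
proof -
  assume f: "f \<in> carrier F" and X: "X \<in> J"
  have "qF.coset f \<in> carrier U" unfolding U_eq qF.Q_carrier by (rule imageI[OF f])
  then show "qF.coset f \<otimes>\<^bsub>U\<^esub> X \<in> J" using left_ideal_J X by (simp add: left_ideal_def)
qed

lemma J_carrier: "X \<in> J \<Longrightarrow> \<exists>f\<in>carrier F. X = qF.coset f"
proof -
  have "additive_subgroup J U" using left_ideal_J by (simp add: left_ideal_def)
  then have "J \<subseteq> carrier U" by (rule additive_subgroup.a_subset)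
  moreover assume "X \<in> J"
  ultimately have "X \<in> carrier U" by (rule subsetD)
  then show "\<exists>f\<in>carrier F. X = qF.coset f" unfolding U_eq qF.Q_carrier by (auto elim: imageE)
qed

sublocale qU: quotient_of_module U J
proof (rule quotient_of_module.intro)
  show "abelian_group U" unfolding U_eq by (rule qF.Q_group)
  show "additive_subgroup J U" using left_ideal_J by (simp add: left_ideal_def)
  show "c \<odot>\<^bsub>U\<^esub> X \<in> J" if X: "X \<in> J" for c X
  proof -
    obtain f where f: "f \<in> carrier F" "X = qF.coset f" using J_carrier[OF X] by blast
    have "qF.coset (vscale c word_one) \<otimes>\<^bsub>U\<^esub> X \<in> J" by (rule J_mult[OF _ X]) (simp add: free_algebra_carrier)
    then show ?thesis
      using f by (simp add: U_mult free_algebra_carrier free_algebra_mult_linear word_one_mult U_smult)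
  qed
  show "c \<odot>\<^bsub>U\<^esub> X \<in> carrier U" if X: "X \<in> carrier U" for c X
  proof -
    obtain f where f: "f \<in> carrier F" "X = qF.coset f" using X by (rule U_carrierE)
    then show ?thesis by (simp add: U_smult U_carrier free_algebra_carrier)
  qed
  show "c \<odot>\<^bsub>U\<^esub> (X \<oplus>\<^bsub>U\<^esub> Y) = c \<odot>\<^bsub>U\<^esub> X \<oplus>\<^bsub>U\<^esub> c \<odot>\<^bsub>U\<^esub> Y" if XY: "X \<in> carrier U" "Y \<in> carrier U" for c X Y
  proof -
    obtain f where f: "f \<in> carrier F" "X = qF.coset f" using XY(1) by (rule U_carrierE)
    obtain g where g: "g \<in> carrier F" "Y = qF.coset g" using XY(2) by (rule U_carrierE)
    show ?thesis
      using f g by (simp add: U_smult U_add free_algebra_carrier fun_space.scale_right_distrib)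
  qed
qed

text \<open>The preimage of the left ideal in the free algebra. It merges the two successive
  quotients into one, and the cyclic module becomes the free algebra modulo this subspace.\<close>

definition Z :: "('l list \<Rightarrow> complex) set" where
  "Z = {f \<in> carrier F. qF.coset f \<in> J}"

lemma Z_carrier: "f \<in> Z \<Longrightarrow> f \<in> carrier F"
  by (simp add: Z_def)

lemma Z_subspace: "fun_space.subspace Z"
proof (rule fun_space.subspaceI)
  show "0 \<in> Z" using qU.sub.zero_closed by (simp add: Z_def U_zero free_algebra_carrier)
next
  fix f g assume "f \<in> Z" "g \<in> Z"
  then have "qF.coset f \<oplus>\<^bsub>U\<^esub> qF.coset g \<in> J" by (auto simp: Z_def intro: qU.sub.a_closed)
  then show "f + g \<in> Z"
    using \<open>f \<in> Z\<close> \<open>g \<in> Z\<close> by (simp add: Z_def U_add free_algebra_carrier)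
next
  fix c f assume "f \<in> Z"
  then have "c \<odot>\<^bsub>U\<^esub> qF.coset f \<in> J" by (auto simp: Z_def intro: qU.I_smult)
  then show "vscale c f \<in> Z"
    using \<open>f \<in> Z\<close> by (simp add: Z_def U_smult free_algebra_carrier)
qed

lemma Z_lmult: "x \<in> carrier L \<Longrightarrow> f \<in> Z \<Longrightarrow> word_lmult x f \<in> Z"
  using J_mult[of "letter x" "qF.coset f"]
  by (simp add: Z_def U_mult free_algebra_carrier letter_mult)

lemma Z_ideal: "f \<in> I \<Longrightarrow> f \<in> Z"
proof -
  assume f: "f \<in> I"
  have c: "f \<in> carrier F" using f ideal.a_subset by blast
  have "qF.coset f = \<zero>\<^bsub>U\<^esub>"
    using ideal.a_rcos_const[OF f] by (simp add: U_eq quotient_algebra_def)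
  then show "f \<in> Z" using qU.sub.zero_closed c by (simp add: Z_def)
qed

lemma Z_relation: "f \<in> carrier F \<Longrightarrow> qF.coset f \<in> R \<Longrightarrow> f \<in> Z"
  by (auto simp: Z_def generated_left_ideal_def)

text \<open>Closure under left multiplication by letters extends to the whole free algebra, so the
  image of \<open>Z'\<close> in U(L) is a left ideal containing the relations; as \<open>Z'\<close>
  contains the two-sided ideal, membership of the image can be lifted back.\<close>

lemma Z_minimal:
  assumes sub: "fun_space.subspace Z'" "Z' \<subseteq> carrier F" and "I \<subseteq> Z'"
    and lmult: "\<And>x f. x \<in> carrier L \<Longrightarrow> f \<in> Z' \<Longrightarrow> word_lmult x f \<in> Z'"
    and R: "\<And>X. X \<in> R \<Longrightarrow> \<exists>f\<in>Z'. X = qF.coset f"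
  shows "Z \<subseteq> Z'"
proof
  fix f assume f: "f \<in> Z"
  have mult: "g \<otimes>\<^bsub>F\<^esub> h \<in> Z'" if "g \<in> carrier F" "h \<in> Z'" for g h
    using that(1)
  proof (induction rule: free_algebra_induct)
    case one
    have "h \<in> carrier F" using that sub(2) by blast
    then show ?case using that by (simp add: word_one_mult)
  next
    case (lmult x g)
    have "h \<in> carrier F" using that sub(2) by blast
    then show ?case using lmult assms(4) by (simp add: word_lmult_mult)
  qed (auto simp: free_algebra_mult_linear fun_space.subspace_0[OF sub(1)]
      fun_space.subspace_add[OF sub(1)] fun_space.subspace_scale[OF sub(1)])
  have "left_ideal (qF.coset ` Z') U"
    unfolding left_ideal_def
  proof (intro conjI ballI)
    show "additive_subgroup (qF.coset ` Z') U"
    proof (rule additive_subgroupI, rule group.subgroupI[OF qU.grp.a_group])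
      show "qF.coset ` Z' \<subseteq> carrier (add_monoid U)"
        using sub(2) by (simp add: U_carrier image_mono)
      show "qF.coset ` Z' \<noteq> {}" using fun_space.subspace_0[OF sub(1)] by blast
      show "inv\<^bsub>add_monoid U\<^esub> X \<in> qF.coset ` Z'" if X: "X \<in> qF.coset ` Z'" for X
      proof -
        obtain g where g: "g \<in> Z'" "X = qF.coset g" using X by blast
        have gF: "g \<in> carrier F" using g sub(2) by blast
        have "\<ominus>\<^bsub>U\<^esub> X = qF.coset (- g)"
          by (rule qU.grp.minus_equality)
             (use gF in \<open>simp_all add: g U_add U_zero U_carrier free_algebra_carrier\<close>)
        then show ?thesis using fun_space.subspace_neg[OF sub(1) g(1)] by (simp add: a_inv_def)
      qed
      show "X \<otimes>\<^bsub>add_monoid U\<^esub> Y \<in> qF.coset ` Z'" if X: "X \<in> qF.coset ` Z'" "Y \<in> qF.coset ` Z'" for X Y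
      proof -
        obtain g h where g: "g \<in> Z'" "X = qF.coset g" "h \<in> Z'" "Y = qF.coset h" using X by blast
        have "X \<oplus>\<^bsub>U\<^esub> Y = qF.coset (g + h)"
          using g sub(2) by (simp add: U_add subset_iff)
        then show ?thesis using fun_space.subspace_add[OF sub(1) g(1,3)] by simp
      qed
    qed
    show "X \<otimes>\<^bsub>U\<^esub> Y \<in> qF.coset ` Z'" if X: "X \<in> carrier U" "Y \<in> qF.coset ` Z'" for X Y
    proof -
      obtain g where "g \<in> carrier F" "X = qF.coset g" using X(1) by (rule U_carrierE)
      moreover obtain h where "h \<in> Z'" "Y = qF.coset h" using X(2) by blast
      ultimately have g: "g \<in> carrier F" "X = qF.coset g" "h \<in> Z'" "Y = qF.coset h" by auto
      have "h \<in> carrier F" using g(3) sub(2) by blast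
      then have "X \<otimes>\<^bsub>U\<^esub> Y = qF.coset (g \<otimes>\<^bsub>F\<^esub> h)" unfolding g(2,4) by (rule U_mult[OF g(1)])
      then show ?thesis using mult[OF g(1,3)] by blast
    qed
  qed
  moreover have "R \<subseteq> qF.coset ` Z'" using R by blast
  ultimately have "J \<subseteq> qF.coset ` Z'" unfolding generated_left_ideal_def by blast
  then obtain g where g: "g \<in> Z'" "qF.coset f = qF.coset g" using f by (auto simp: Z_def)
  have gF: "g \<in> carrier F" using g sub(2) by blast
  have fF: "f \<in> carrier F" using f by (rule Z_carrier)
  have "f - g \<in> I" using qF.coset_eq_iff[OF fF gF] g(2) free_algebra_a_minus[OF fF gF] by simp
  then have "f - g \<in> Z'" using assms(3) by blast
  from fun_space.subspace_add[OF sub(1) this g(1)] show "f \<in> Z'" by simp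
qed

text \<open>The relations of U(L) may stand in front of any \<open>f\<close>, because they generate
  a two-sided ideal and so may be multiplied by \<open>f\<close> on the right.\<close>

lemma Z_lie_relations:
  assumes "x \<in> carrier L" "y \<in> carrier L" "f \<in> carrier F"
  shows "word_lmult (x \<oplus>\<^bsub>L\<^esub> y) f - (word_lmult x f + word_lmult y f) \<in> Z"
    and "word_lmult (c \<odot>\<^bsub>L\<^esub> x) f - vscale c (word_lmult x f) \<in> Z"
    and "(word_lmult x (word_lmult y f) - word_lmult y (word_lmult x f)) - word_lmult (lie_bracket L x y) f \<in> Z"
proof -
  have rel: "u \<otimes>\<^bsub>F\<^esub> f \<in> Z" if "u \<in> uea_relations L" for u
  proof -
    have "u \<in> I" unfolding uea_ideal_def by (rule subsetD[OF ideal.genideal_self[OF relations_carrier] that])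
    then have "u \<otimes>\<^bsub>F\<^esub> f \<in> I" using assms(3) by (rule ideal.I_r_closed)
    then show ?thesis by (rule Z_ideal)
  qed
  have l: "letter z \<in> carrier F" if "z \<in> carrier L" for z using that by (rule free_algebra_carrier)
  note simps = free_algebra_a_minus free_algebra_simps free_algebra_mult_linear letter_mult free_algebra_carrier
    L_closed assms
  have "(letter (x \<oplus>\<^bsub>L\<^esub> y) \<ominus>\<^bsub>F\<^esub> (letter x \<oplus>\<^bsub>F\<^esub> letter y)) \<otimes>\<^bsub>F\<^esub> f \<in> Z"
    by (rule rel, unfold uea_relations_def Let_def, rule UnI1, rule UnI1, rule CollectI, rule exI[of _ x], rule exI[of _ y], simp add: assms)
  then show "word_lmult (x \<oplus>\<^bsub>L\<^esub> y) f - (word_lmult x f + word_lmult y f) \<in> Z"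
    by (simp add: simps)
  have "(letter (c \<odot>\<^bsub>L\<^esub> x) \<ominus>\<^bsub>F\<^esub> (c \<odot>\<^bsub>F\<^esub> letter x)) \<otimes>\<^bsub>F\<^esub> f \<in> Z"
    by (rule rel, unfold uea_relations_def Let_def, rule UnI1, rule UnI2, rule CollectI, rule exI[of _ c], rule exI[of _ x], simp add: assms)
  then show "word_lmult (c \<odot>\<^bsub>L\<^esub> x) f - vscale c (word_lmult x f) \<in> Z"
    by (simp add: simps)
  have "((letter x \<otimes>\<^bsub>F\<^esub> letter y \<ominus>\<^bsub>F\<^esub> letter y \<otimes>\<^bsub>F\<^esub> letter x) \<ominus>\<^bsub>F\<^esub> letter (lie_bracket L x y)) \<otimes>\<^bsub>F\<^esub> f \<in> Z"
    by (rule rel, unfold uea_relations_def Let_def, rule UnI2, rule CollectI, rule exI[of _ x], rule exI[of _ y], simp add: assms)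
  then show "(word_lmult x (word_lmult y f) - word_lmult y (word_lmult x f)) - word_lmult (lie_bracket L x y) f \<in> Z"
    by (simp add: simps word_lmult_mult)
qed

lemma word_eval_ideal:
  assumes lin: "\<And>x u v. x \<in> carrier L \<Longrightarrow> act x (u + v) = act x u + act x v"
      "\<And>x c u. x \<in> carrier L \<Longrightarrow> act x (fscale c u) = fscale c (act x u)"
    and rep: "\<And>x y u. x \<in> carrier L \<Longrightarrow> y \<in> carrier L \<Longrightarrow> act (x \<oplus>\<^bsub>L\<^esub> y) u = act x u + act y u"
      "\<And>c x u. x \<in> carrier L \<Longrightarrow> act (c \<odot>\<^bsub>L\<^esub> x) u = fscale c (act x u)"
      "\<And>x y u. x \<in> carrier L \<Longrightarrow> y \<in> carrier L \<Longrightarrow> act (lie_bracket L x y) u = act x (act y u) - act y (act x u)"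
    and "f \<in> I"
  shows "word_eval act y f = 0"
proof -
  have ev_lmult: "word_eval act y (word_lmult x f) = act x (word_eval act y f)" if "x \<in> carrier L" "f \<in> carrier F" for x f
    by (rule word_eval_lmult[OF that(2)]) (use lin that in auto)
  have act0: "act x 0 = 0" if "x \<in> carrier L" for x using lin(2)[OF that, of 0 0] by simp
  have ev_mult: "word_eval act y (g \<otimes>\<^bsub>F\<^esub> f) = 0" if "g \<in> carrier F" "f \<in> carrier F" "word_eval act y f = 0" for g f
    using that(1)
  proof (induction rule: free_algebra_induct)
    case one
    then show ?case using that by (simp add: word_one_mult)
  next
    case zero
    then show ?case by (simp add: free_algebra_mult_linear word_eval_linear[OF that(2,2)])
  next
    case (add g h)
    have "g \<otimes>\<^bsub>F\<^esub> f \<in> carrier F" "h \<otimes>\<^bsub>F\<^esub> f \<in> carrier F" using add that by auto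
    then show ?case using add by (simp add: free_algebra_mult_linear word_eval_linear[where X = "carrier L"])
  next
    case (scale c g)
    have "g \<otimes>\<^bsub>F\<^esub> f \<in> carrier F" using scale that by auto
    from word_eval_linear(2)[OF this this, of act y c] show ?case using scale by (simp add: free_algebra_mult_linear)
  next
    case (lmult x g)
    have "g \<otimes>\<^bsub>F\<^esub> f \<in> carrier F" using lmult that by auto
    then show ?case using lmult that act0 by (simp add: word_lmult_mult ev_lmult)
  qed
  \<comment> \<open>The polynomials that annihilate \<open>y\<close> alone form only a left ideal.
    Demanding the same after right multiplication by every g gives a two-sided ideal, to which
    minimality of the generated ideal applies; g = 1 returns the claim.\<close>
  let ?K = "{f \<in> carrier F. \<forall>g\<in>carrier F. word_eval act y (f \<otimes>\<^bsub>F\<^esub> g) = 0}"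
  have "Ring.ring F" by (rule ring_free_algebra)
  have "ideal ?K F"
  proof (rule idealI[OF ring_free_algebra])
    show "subgroup ?K (add_monoid F)"
    proof (rule group.subgroupI[OF ideal.a_group])
      show "?K \<subseteq> carrier (add_monoid F)" by auto
      have "0 \<in> ?K"
        by (auto simp: free_algebra_carrier free_algebra_mult_linear)
      then show "?K \<noteq> {}" by blast
      show "inv\<^bsub>add_monoid F\<^esub> u \<in> ?K" if u: "u \<in> ?K" for u
      proof -
        have "\<ominus>\<^bsub>F\<^esub> u = vscale (-1) u"
          by (rule ideal.minus_equality) (use u in \<open>auto simp: free_algebra_simps free_algebra_carrier\<close>)
        moreover have "word_eval act y (vscale (-1) u \<otimes>\<^bsub>F\<^esub> g) = 0" if "g \<in> carrier F" for g
        proof -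
          have "u \<otimes>\<^bsub>F\<^esub> g \<in> carrier F" using u that by auto
          from word_eval_linear(2)[OF this this, of act y "-1"] show ?thesis
            using u that unfolding free_algebra_mult_linear by simp
        qed
        ultimately show ?thesis using u by (auto simp: a_inv_def free_algebra_carrier)
      qed
      show "u \<otimes>\<^bsub>add_monoid F\<^esub> v \<in> ?K" if u: "u \<in> ?K" "v \<in> ?K" for u v
      proof -
        have "word_eval act y ((u + v) \<otimes>\<^bsub>F\<^esub> g) = 0" if "g \<in> carrier F" for g
        proof -
          have "u \<otimes>\<^bsub>F\<^esub> g \<in> carrier F" "v \<otimes>\<^bsub>F\<^esub> g \<in> carrier F" using u that by auto
          then show ?thesis using u that by (simp add: free_algebra_mult_linear word_eval_linear[where X = "carrier L"])
        qed
        then show ?thesis using u by (auto simp: free_algebra_simps free_algebra_carrier)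
      qed
    qed
    show "h \<otimes>\<^bsub>F\<^esub> u \<in> ?K" if u: "u \<in> ?K" "h \<in> carrier F" for u h
      using u ev_mult by (auto simp: ideal.m_assoc)
    show "u \<otimes>\<^bsub>F\<^esub> h \<in> ?K" if u: "u \<in> ?K" "h \<in> carrier F" for u h
      using u by (auto simp: ideal.m_assoc)
  qed
  moreover have "uea_relations L \<subseteq> ?K"
  proof -
    have l: "letter z \<in> carrier F" if "z \<in> carrier L" for z using that by (rule free_algebra_carrier)
    note simps = free_algebra_a_minus free_algebra_simps free_algebra_mult_linear letter_mult free_algebra_carrier
      L_closed word_eval_linear[where X = "carrier L"] ev_lmult word_lmult_mult rep lin
    have mc: "word_lmult x g \<in> carrier F" if "x \<in> carrier L" "g \<in> carrier F" for x g
      using that by (rule free_algebra_carrier)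
    have sc: "word_eval act y (vscale c (word_lmult x g)) = fscale c (act x (word_eval act y g))"
      if "x \<in> carrier L" "g \<in> carrier F" for c x g
      using word_eval_linear(2)[OF mc[OF that] mc[OF that]] ev_lmult[OF that] by simp
    show ?thesis
      unfolding uea_relations_def Let_def
      by (auto simp: simps sc)
  qed
  ultimately have "I \<subseteq> ?K" unfolding uea_ideal_def by (rule ideal.genideal_minimal)
  then have f: "f \<in> carrier F" "word_eval act y (f \<otimes>\<^bsub>F\<^esub> word_one) = 0"
    using assms(6) by (auto simp: free_algebra_carrier)
  have "f \<otimes>\<^bsub>F\<^esub> word_one = f"
    using ideal.r_one[OF f(1)] by (simp add: free_algebra_simps)
  then show ?thesis using f(2) by simp
qed

abbreviation W where "W \<equiv> cyclic_lie_module L R"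

definition cls :: "('l list \<Rightarrow> complex) \<Rightarrow> ('l list \<Rightarrow> complex) set set" where
  "cls f = qU.coset (qF.coset f)"

lemma qF_coset_carrier: "f \<in> carrier F \<Longrightarrow> qF.coset f \<in> carrier U"
  by (simp add: U_carrier)

lemma cls_eq_iff:
  assumes "f \<in> carrier F" "g \<in> carrier F"
  shows "cls f = cls g \<longleftrightarrow> f - g \<in> Z"
proof -
  have "qF.coset f \<ominus>\<^bsub>U\<^esub> qF.coset g = qF.coset (f - g)"
    using qF.Q_minus[OF assms] free_algebra_a_minus[OF assms] by (simp add: U_eq)
  then show ?thesis
    using qU.coset_eq_iff[OF qF_coset_carrier[OF assms(1)] qF_coset_carrier[OF assms(2)]] assms
    by (simp add: cls_def Z_def free_algebra_carrier)
qed

lemma W_carrier: "carrier W = cls ` carrier F"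
proof -
  have "carrier W = qU.coset ` carrier U" using qU.Q_carrier by (simp add: cyclic_lie_module_def Let_def)
  then show ?thesis by (simp add: U_carrier image_image cls_def)
qed

lemma W_add:
  assumes "f \<in> carrier F" "g \<in> carrier F"
  shows "cls f \<oplus>\<^bsub>W\<^esub> cls g = cls (f + g)"
proof -
  have "cls f \<oplus>\<^bsub>W\<^esub> cls g = qU.coset (qF.coset f) \<oplus>\<^bsub>qU.Q\<^esub> qU.coset (qF.coset g)"
    by (simp add: cyclic_lie_module_def Let_def cls_def)
  also have "\<dots> = qU.coset (qF.coset f \<oplus>\<^bsub>U\<^esub> qF.coset g)"
    by (rule qU.Q_add) (use assms qF_coset_carrier in auto)
  also have "qF.coset f \<oplus>\<^bsub>U\<^esub> qF.coset g = qF.coset (f + g)"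
    by (rule U_add[OF assms])
  finally show ?thesis by (simp add: cls_def)
qed

lemma W_smult:
  assumes "f \<in> carrier F"
  shows "c \<odot>\<^bsub>W\<^esub> cls f = cls (vscale c f)"
proof -
  have "c \<odot>\<^bsub>W\<^esub> cls f = c \<odot>\<^bsub>qU.Q\<^esub> qU.coset (qF.coset f)"
    by (simp add: cyclic_lie_module_def Let_def cls_def)
  also have "\<dots> = qU.coset (c \<odot>\<^bsub>U\<^esub> qF.coset f)"
    by (rule qU.Q_smult) (use assms qF_coset_carrier in auto)
  also have "c \<odot>\<^bsub>U\<^esub> qF.coset f = qF.coset (vscale c f)"
    by (rule U_smult[OF assms])
  finally show ?thesis by (simp add: cls_def)
qed

lemma W_act:
  assumes "x \<in> carrier L" "f \<in> carrier F"
  shows "lie_act W x (cls f) = cls (word_lmult x f)"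
proof -
  have lx: "letter x \<in> carrier F" using assms(1) by (rule free_algebra_carrier)
  have "lie_act W x (cls f) = (\<Union>u\<in>qU.coset (qF.coset f). qU.coset (qF.coset (letter x) \<otimes>\<^bsub>U\<^esub> u))"
    by (simp add: cyclic_lie_module_def Let_def cls_def uea_emb_eq)
  also have "\<dots> = qU.coset (qF.coset (letter x) \<otimes>\<^bsub>U\<^esub> qF.coset f)"
  proof (rule qU.coset_UN)
    show "qF.coset f \<in> carrier U" by (rule qF_coset_carrier[OF assms(2)])
    fix X assume X: "X \<in> J"
    obtain g where g: "g \<in> carrier F" "X = qF.coset g" using J_carrier[OF X] by blast
      have "qF.coset (letter x) \<otimes>\<^bsub>U\<^esub> (X \<oplus>\<^bsub>U\<^esub> qF.coset f) =
        (qF.coset (letter x) \<otimes>\<^bsub>U\<^esub> X) \<oplus>\<^bsub>U\<^esub> (qF.coset (letter x) \<otimes>\<^bsub>U\<^esub> qF.coset f)"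
      using lx g(1) assms by (simp add: g(2) U_add U_mult letter_mult word_lmult_linear free_algebra_carrier)
    moreover have "qF.coset (letter x) \<otimes>\<^bsub>U\<^esub> qF.coset f \<in> carrier U"
      using assms by (simp add: U_mult[OF lx assms(2)] letter_mult U_carrier free_algebra_carrier)
    ultimately show "qU.coset (qF.coset (letter x) \<otimes>\<^bsub>U\<^esub> (X \<oplus>\<^bsub>U\<^esub> qF.coset f)) =
        qU.coset (qF.coset (letter x) \<otimes>\<^bsub>U\<^esub> qF.coset f)"
      using qU.coset_eq[OF _ J_mult[OF lx X]] by simp
  qed
  also have "qF.coset (letter x) \<otimes>\<^bsub>U\<^esub> qF.coset f = qF.coset (word_lmult x f)"
    using U_mult[OF lx assms(2)] by (simp add: letter_mult)
  finally show ?thesis by (simp add: cls_def)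
qed

text \<open>Both modules are images of the free algebra, one under \<open>cls\<close> and the other
  under evaluation at \<open>y\<close>; the last hypothesis says that the two kernels agree.\<close>

lemma isomorphic_to_generated_submodule:
  fixes V :: "(complex, 'l, fock) lie_module"
  assumes V: "\<And>u v. u \<oplus>\<^bsub>V\<^esub> v = u + v" "\<And>c u. c \<odot>\<^bsub>V\<^esub> u = fscale c u" "\<zero>\<^bsub>V\<^esub> = 0"
    and V_module: "Module.module class_ring V" and y: "y \<in> carrier V"
    and V_act: "\<And>x u. x \<in> carrier L \<Longrightarrow> u \<in> carrier V \<Longrightarrow> lie_act V x u \<in> carrier V"
    and lin: "\<And>x u v. x \<in> carrier L \<Longrightarrow> lie_act V x (u + v) = lie_act V x u + lie_act V x v"
      "\<And>x c u. x \<in> carrier L \<Longrightarrow> lie_act V x (fscale c u) = fscale c (lie_act V x u)"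
    and Z: "\<And>f. f \<in> carrier F \<Longrightarrow> f \<in> Z \<longleftrightarrow> word_eval (lie_act V) y f = 0"
  shows "lie_module_isomorphic L (generated_lie_submodule L V y) W"
proof -
  let ?ev = "word_eval (lie_act V) y"
  let ?T = "?ev ` carrier F"
  interpret V: Module.module class_ring V by (rule V_module)
  have ev_lmult: "?ev (word_lmult x f) = lie_act V x (?ev f)" if "x \<in> carrier L" "f \<in> carrier F" for x f
    by (rule word_eval_lmult[OF that(2)]) (use lin that in auto)
  have Vadd: "u + v \<in> carrier V" if "u \<in> carrier V" "v \<in> carrier V" for u v
    using V.a_closed[OF that] by (simp add: V)
  have Vsc: "fscale c u \<in> carrier V" if "u \<in> carrier V" for c u
    using V.smult_closed[of c u] that by (simp add: V)
  have ev_in: "?ev f \<in> N" if N: "lie_submodule L V N" "y \<in> N" and f: "f \<in> carrier F" for N f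
  proof -
    have sub: "N \<subseteq> carrier V" "\<And>u v. u \<in> N \<Longrightarrow> v \<in> N \<Longrightarrow> u + v \<in> N" "0 \<in> N" "\<And>c u. u \<in> N \<Longrightarrow> fscale c u \<in> N"
      and actN: "\<And>x u. x \<in> carrier L \<Longrightarrow> u \<in> N \<Longrightarrow> lie_act V x u \<in> N"
      using N(1) by (auto simp: lie_submodule_def LinearCombinations.submodule_def V)
    show ?thesis using f
    proof (induction rule: free_algebra_induct)
      case one
      show ?case using N(2) by simp
    next
      case zero
      show ?case using sub(3) by simp
    next
      case (add f g)
      then show ?case using sub(2) by (simp add: word_eval_linear[where X = "carrier L"])
    next
      case (scale c f)
      then show ?case using sub(4) word_eval_linear(2)[OF scale(1,1)] by simp
    next
      case (lmult x f)
      then show ?case using actN by (simp add: ev_lmult)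
    qed
  qed
  have "lie_submodule L V (carrier V)"
    using V_act V.zero_closed Vadd Vsc
    by (auto simp: lie_submodule_def LinearCombinations.submodule_def V V_module)
  then have TV: "?T \<subseteq> carrier V" using ev_in y by blast
  have zeroT: "0 \<in> ?T"
    by (rule image_eqI[of _ _ 0]) (simp_all add: free_algebra_carrier)
  have addT: "u + v \<in> ?T" if uv: "u \<in> ?T" "v \<in> ?T" for u v
  proof -
    obtain f g where f: "f \<in> carrier F" "u = ?ev f" and g: "g \<in> carrier F" "v = ?ev g" using uv by blast
    then have "u + v = ?ev (f + g)" by (simp add: word_eval_linear[where X = "carrier L"])
    then show ?thesis using free_algebra_carrier(3)[OF f(1) g(1)] by blast
  qed
  have scT: "fscale c u \<in> ?T" if u: "u \<in> ?T" for c u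
  proof -
    obtain f where f: "f \<in> carrier F" "u = ?ev f" using u by blast
    then have "fscale c u = ?ev (vscale c f)" using word_eval_linear(2)[OF f(1,1)] by simp
    then show ?thesis using free_algebra_carrier(4)[OF f(1)] by blast
  qed
  have actT: "lie_act V x u \<in> ?T" if u: "x \<in> carrier L" "u \<in> ?T" for x u
  proof -
    obtain f where f: "f \<in> carrier F" "u = ?ev f" using u by blast
    then have "lie_act V x u = ?ev (word_lmult x f)" using ev_lmult[OF u(1) f(1)] by simp
    then show ?thesis using free_algebra_carrier(7)[OF u(1) f(1)] by blast
  qed
  have "lie_submodule L V ?T"
    using TV zeroT addT scT actT
    by (auto simp: lie_submodule_def LinearCombinations.submodule_def V V_module)
  moreover have "y \<in> ?T"
    by (rule image_eqI[of _ _ word_one]) (simp_all add: free_algebra_carrier)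
  ultimately have "\<Inter>{N. lie_submodule L V N \<and> y \<in> N} = ?T"
    using ev_in by blast
  then have G: "carrier (generated_lie_submodule L V y) = ?T" by (simp add: generated_lie_submodule_def)
  have Gops: "u \<oplus>\<^bsub>generated_lie_submodule L V y\<^esub> v = u + v" "c \<odot>\<^bsub>generated_lie_submodule L V y\<^esub> u = fscale c u"
    "lie_act (generated_lie_submodule L V y) = lie_act V" for u v c
    by (simp_all add: generated_lie_submodule_def V)
  have cls_ev: "cls f = cls g \<longleftrightarrow> ?ev f = ?ev g" if "f \<in> carrier F" "g \<in> carrier F" for f g
    using cls_eq_iff[OF that] Z[of "f - g"] word_eval_linear(3)[OF that] that by (simp add: free_algebra_carrier)
  define \<phi> where "\<phi> v = cls (SOME f. f \<in> carrier F \<and> ?ev f = v)" for v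
  have \<phi>: "\<phi> (?ev f) = cls f" if f: "f \<in> carrier F" for f
  proof -
    have "(SOME g. g \<in> carrier F \<and> ?ev g = ?ev f) \<in> carrier F \<and> ?ev (SOME g. g \<in> carrier F \<and> ?ev g = ?ev f) = ?ev f"
      by (rule someI[of _ f]) (use f in simp)
    then show ?thesis unfolding \<phi>_def using cls_ev f by blast
  qed
  have "\<phi> \<in> LinearCombinations.module_hom class_ring (generated_lie_submodule L V y) W"
    unfolding LinearCombinations.module_hom_def
  proof (intro CollectI conjI allI impI)
    show "\<phi> \<in> carrier (generated_lie_submodule L V y) \<rightarrow> carrier W"
      unfolding G W_carrier using \<phi> by auto
  next
    fix u v assume "u \<in> carrier (generated_lie_submodule L V y) \<and> v \<in> carrier (generated_lie_submodule L V y)"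
    then obtain f g where f: "f \<in> carrier F" "u = ?ev f" and g: "g \<in> carrier F" "v = ?ev g" unfolding G by blast
    then have "\<phi> (u + v) = \<phi> (?ev (f + g))" by (simp add: word_eval_linear[where X = "carrier L"])
    also have "\<dots> = cls (f + g)" using f g by (intro \<phi>) (simp add: free_algebra_carrier)
    finally show "\<phi> (u \<oplus>\<^bsub>generated_lie_submodule L V y\<^esub> v) = \<phi> u \<oplus>\<^bsub>W\<^esub> \<phi> v"
      using f g by (simp add: Gops W_add \<phi>)
  next
    fix c :: complex and u assume "c \<in> carrier class_ring \<and> u \<in> carrier (generated_lie_submodule L V y)"
    then obtain f where f: "f \<in> carrier F" "u = ?ev f" unfolding G by blast
    then have "\<phi> (fscale c u) = \<phi> (?ev (vscale c f))" using word_eval_linear(2)[OF f(1,1)] by simp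
    also have "\<dots> = cls (vscale c f)" using f by (intro \<phi>) (simp add: free_algebra_carrier)
    finally show "\<phi> (c \<odot>\<^bsub>generated_lie_submodule L V y\<^esub> u) = c \<odot>\<^bsub>W\<^esub> \<phi> u"
      using f by (simp add: Gops W_smult \<phi>)
  qed
  moreover have "bij_betw \<phi> (carrier (generated_lie_submodule L V y)) (carrier W)"
    unfolding bij_betw_def
  proof
    show "inj_on \<phi> (carrier (generated_lie_submodule L V y))"
      unfolding G by (rule inj_onI) (use \<phi> cls_ev in force)
    show "\<phi> ` carrier (generated_lie_submodule L V y) = carrier W"
      unfolding G W_carrier image_image using \<phi> by auto
  qed
  moreover have "\<phi> (lie_act (generated_lie_submodule L V y) x u) = lie_act W x (\<phi> u)"
    if "x \<in> carrier L" "u \<in> carrier (generated_lie_submodule L V y)" for x u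
  proof -
    obtain f where f: "f \<in> carrier F" "u = ?ev f" using \<open>u \<in> _\<close> unfolding G by blast
    have "\<phi> (lie_act V x u) = \<phi> (?ev (word_lmult x f))" using ev_lmult[OF that(1) f(1)] f by simp
    also have "\<dots> = cls (word_lmult x f)" using that f by (intro \<phi>) (simp add: free_algebra_carrier)
    finally show ?thesis using f that by (simp add: Gops W_act \<phi>)
  qed
  ultimately show ?thesis unfolding lie_module_isomorphic_def by blast
qed

end

section \<open>The exterior algebra as a module\<close>

lemma sum_fun_apply: "(\<Sum>x\<in>X. h x) S = (\<Sum>x\<in>X. h x S :: complex)"
  by (induction X rule: infinite_finite_induct) (auto simp: fun_apply)

section \<open>The generating vector as the monomial of a Young diagram\<close>

lemma wedge_monomial:
  assumes "finite A" "finite B" "A \<inter> B = {}"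
    and ord: "\<And>a b. a \<in> A \<Longrightarrow> b \<in> B \<Longrightarrow> (b, a) \<notin> less_than <*lex*> less_than"
  shows "wedge (monomial A) (monomial B) = monomial (A \<union> B)"
proof
  fix S :: "(nat \<times> nat) set"
  have "{(a, b) \<in> A \<times> B. (b, a) \<in> less_than <*lex*> less_than} = {}" using ord by blast
  then have s: "wedge_sign A B = 1" by (simp only: wedge_sign_def card.empty power_0)
  show "wedge (monomial A) (monomial B) S = monomial (A \<union> B) S"
  proof (cases "finite S")
    case True
    have "wedge (monomial A) (monomial B) S = (\<Sum>C\<in>Pow S. if C = A then (if S = A \<union> B then 1 else 0) else 0)"
      unfolding wedge_def
    proof (rule sum.cong[OF refl])
      fix C assume "C \<in> Pow S"
      then have "S - A = B \<longleftrightarrow> S = A \<union> B" if "C = A" using that assms(3) by blast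
      then show "wedge_sign C (S - C) * monomial A C * monomial B (S - C) =
          (if C = A then (if S = A \<union> B then 1 else 0) else 0)"
        using s by (auto simp: monomial_def)
    qed
    also have "\<dots> = (if A \<in> Pow S then (if S = A \<union> B then 1 else 0) else 0)"
      using True by (simp add: sum.delta)
    also have "\<dots> = monomial (A \<union> B) S" by (auto simp: monomial_def)
    finally show ?thesis .
  next
    case False
    then have "S \<noteq> A \<union> B" using assms(1,2) by blast
    then show ?thesis using False by (simp add: wedge_infinite monomial_def)
  qed
qed

lemma foldr_wedge_monomial:
  assumes "\<And>i. finite (B i)" "\<And>i. i \<ge> k \<Longrightarrow> g i = monomial (B i)"
    and "\<And>i j a b. i < j \<Longrightarrow> a \<in> B i \<Longrightarrow> b \<in> B j \<Longrightarrow> (a, b) \<in> less_than <*lex*> less_than"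
  shows "foldr wedge (map g [k..<m]) wedge_one = monomial (\<Union>i\<in>{k..<m}. B i)"
proof (cases "k \<le> m")
  case True
  then show ?thesis using assms(2)
  proof (induction rule: inc_induct)
    case base
    show ?case by (simp add: wedge_one_def monomial_def fun_eq_iff)
  next
    case (step l)
    have lt: "(b, a) \<notin> less_than <*lex*> less_than \<and> a \<noteq> b" if ab: "a \<in> B l" "b \<in> (\<Union>i\<in>{Suc l..<m}. B i)" for a b
    proof -
      obtain i where "Suc l \<le> i" "b \<in> B i" using ab(2) by auto
      then have "(a, b) \<in> less_than <*lex*> less_than" using assms(3)[of l i a b] ab(1) by simp
      then show ?thesis by (cases a; cases b) auto
    qed
    have "{l..<m} = insert l {Suc l..<m}" using step.hyps by auto
    then have "(\<Union>i\<in>{l..<m}. B i) = B l \<union> (\<Union>i\<in>{Suc l..<m}. B i)" by simp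
    moreover have "wedge (g l) (monomial (\<Union>i\<in>{Suc l..<m}. B i)) = monomial (B l \<union> (\<Union>i\<in>{Suc l..<m}. B i))"
      unfolding step.prems[OF order_refl]
    proof (rule wedge_monomial)
      show "B l \<inter> (\<Union>i\<in>{Suc l..<m}. B i) = {}" using lt by blast
      show "(b, a) \<notin> less_than <*lex*> less_than" if "a \<in> B l" "b \<in> (\<Union>i\<in>{Suc l..<m}. B i)" for a b
        using lt[OF that] by blast
    qed (simp_all add: assms(1))
    ultimately show ?case
      using step by (simp add: upt_conv_Cons)
  qed
qed (simp add: wedge_one_def monomial_def fun_eq_iff)

definition diagram :: "nat \<Rightarrow> (nat \<Rightarrow> nat) \<Rightarrow> (nat \<times> nat) set" where
  "diagram n \<xi> = (\<Union>i\<in>{0..<n}. Pair i ` {..<\<xi> i})"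

lemma mem_diagram [simp]: "(i, s) \<in> diagram n \<xi> \<longleftrightarrow> i < n \<and> s < \<xi> i"
  by (auto simp: diagram_def)

lemma finite_diagram [simp]: "finite (diagram n \<xi>)"
  by (simp add: diagram_def)

lemma y_row_monomial: "y_row i m = monomial (Pair i ` {..<m})"
proof -
  have "(\<Union>j\<in>{0..<m}. {(i, j)}) = Pair i ` {..<m}" by auto
  then show ?thesis
    unfolding y_row_def
    by (subst foldr_wedge_monomial[where B = "\<lambda>j. {(i, j)}"]) (auto simp: yvar_def monomial_def)
qed

lemma y_part_monomial: "y_part \<xi> = monomial (diagram (part_length \<xi>) \<xi>)"
  unfolding y_part_def diagram_def
  by (subst foldr_wedge_monomial[where B = "\<lambda>i. Pair i ` {..<\<xi> i}"]) (auto simp: y_row_monomial)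

lemma downclosed_eq_lessThan:
  fixes S :: "nat set"
  assumes "finite S" "\<And>i j. i \<in> S \<Longrightarrow> j \<le> i \<Longrightarrow> j \<in> S"
  shows "S = {..<card S}"
proof (cases "S = {}")
  case False
  then have "S = {..Max S}" using assms by (auto intro: Max_ge Max_in)
  moreover from this have "card S = Suc (Max S)" by (metis card_atMost)
  ultimately show ?thesis using lessThan_Suc_atMost by metis
qed simp

lemma partitionsD:
  assumes "\<xi> \<in> partitions n r"
  shows "i \<le> j \<Longrightarrow> \<xi> j \<le> \<xi> i" "\<xi> i \<le> r" "n \<le> i \<Longrightarrow> \<xi> i = 0" "y_part \<xi> = monomial (diagram n \<xi>)"
proof -
  have mono: "antimono \<xi>" and fin: "finite {i. \<xi> i \<noteq> 0}" and len: "part_length \<xi> \<le> n"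
    and tr: "part_length (part_transpose \<xi>) \<le> r"
    using assms by (simp_all add: partitions_def is_partition_def)
  show dec: "\<xi> j \<le> \<xi> i" if "i \<le> j" for i j using mono that by (rule antimonoD)
  have "{i. \<xi> i \<noteq> 0} = {..<part_length \<xi>}"
    unfolding part_length_def
  proof (rule downclosed_eq_lessThan[OF fin])
    fix i j assume "i \<in> {i. \<xi> i \<noteq> 0}" "j \<le> i"
    then show "j \<in> {i. \<xi> i \<noteq> 0}" using dec[of j i] by simp
  qed
  then have nz: "\<xi> i \<noteq> 0 \<longleftrightarrow> i < part_length \<xi>" for i by blast
  show "\<xi> i = 0" if "n \<le> i" for i using nz[of i] that len by simp
  have "diagram (part_length \<xi>) \<xi> = diagram n \<xi>"
  proof (rule Set.set_eqI)
    fix p :: "nat \<times> nat"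
    show "p \<in> diagram (part_length \<xi>) \<xi> \<longleftrightarrow> p \<in> diagram n \<xi>"
      using nz[of "fst p"] len by (cases p) auto
  qed
  then show "y_part \<xi> = monomial (diagram n \<xi>)" by (simp add: y_part_monomial)
  have "part_transpose \<xi> j \<noteq> 0 \<longleftrightarrow> j < \<xi> 0" for j
  proof -
    have f: "finite {i. j < \<xi> i}" by (rule finite_subset[OF _ fin]) auto
    have "part_transpose \<xi> j \<noteq> 0 \<longleftrightarrow> (\<exists>i. j < \<xi> i)" using f by (auto simp: part_transpose_def)
    also have "\<dots> \<longleftrightarrow> j < \<xi> 0" using dec[of 0] by (meson less_le_trans zero_le)
    finally show ?thesis .
  qed
  then have "part_length (part_transpose \<xi>) = \<xi> 0" by (simp add: part_length_def)
  then show "\<xi> i \<le> r" for i using tr dec[of 0 i] by simp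
qed

lemma monomial_in_ext_module:
  assumes "\<xi> \<in> partitions n r"
  shows "monomial (diagram n \<xi>) \<in> carrier (ext_module n r)"
proof -
  have "diagram n \<xi> \<subseteq> {..<n} \<times> {..<r}"
    using partitionsD(2)[OF assms] by (auto simp: diagram_def intro: less_le_trans)
  then show ?thesis by (simp add: ext_module_def monomial_def)
qed

lemma wedge_yvar_yderiv: "wedge (yvar i s) (yderiv j t f) = creat (i, s) (annih (j, t) f)"
proof
  fix S
  show "wedge (yvar i s) (yderiv j t f) S = creat (i, s) (annih (j, t) f) S"
    by (cases "finite S") (auto simp: yvar_wedge wedge_infinite creat_def annih_def yderiv_def)
qed

lemma ext_act:
  "lie_act (ext_module n r) x f =
     (\<Sum>k<r. \<Sum>i<n. \<Sum>j<n. fscale (x k $$ (i, j)) (current r i j k f))"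
  by (simp add: ext_module_def wedge_yvar_yderiv fun_eq_iff sum_fun_apply fscale_apply current_def)

lemma ext_act_linear:
  "lie_act (ext_module n r) x (u + v) = lie_act (ext_module n r) x u + lie_act (ext_module n r) x v"
  "lie_act (ext_module n r) x (fscale c u) = fscale c (lie_act (ext_module n r) x u)"
  by (simp_all add: ext_act current_linear fock.scale_right_distrib sum.distrib fock.scale_sum_right
      mult.commute)

lemma current_in_ext_module:
  assumes "i < n" "f \<in> carrier (ext_module n r)"
  shows "current r i j a f \<in> carrier (ext_module n r)"
proof -
  have "S \<subseteq> {..<n} \<times> {..<r}" if nz: "current r i j a f S \<noteq> 0" for S
  proof -
    have "\<exists>s<r - a. creat (i, s) (annih (j, s + a) f) S \<noteq> 0"
    proof (rule ccontr)
      assume "\<not> ?thesis"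
      then have "current r i j a f S = 0" unfolding current_def sum_fun_apply by (intro sum.neutral) simp
      then show False using nz by simp
    qed
    then obtain s where s: "s < r - a" "creat (i, s) (annih (j, s + a) f) S \<noteq> 0" by (elim exE conjE)
    then have "(i, s) \<in> S" "f (insert (j, s + a) (S - {(i, s)})) \<noteq> 0"
      by (auto simp: creat_def annih_def split: if_splits)
    moreover have "\<forall>T. f T \<noteq> 0 \<longrightarrow> T \<subseteq> {..<n} \<times> {..<r}" using assms(2) by (simp add: ext_module_def)
    ultimately have "insert (j, s + a) (S - {(i, s)}) \<subseteq> {..<n} \<times> {..<r}" by blast
    moreover have "(i, s) \<in> {..<n} \<times> {..<r}" using assms(1) s(1) by simp
    ultimately show ?thesis using subset_insert_iff by fast
  qed
  then show ?thesis by (simp add: ext_module_def)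
qed

lemma ext_act_closed:
  assumes "f \<in> carrier (ext_module n r)"
  shows "lie_act (ext_module n r) x f \<in> carrier (ext_module n r)"
proof -
  interpret V: Module.module class_ring "ext_module n r" by (rule module_ext_module)
  have add: "u + v \<in> carrier (ext_module n r)" if "u \<in> carrier (ext_module n r)" "v \<in> carrier (ext_module n r)" for u v
    using V.a_closed[OF that] by (simp add: ext_module_def fun_apply)
  have sc: "fscale c u \<in> carrier (ext_module n r)" if "u \<in> carrier (ext_module n r)" for c u
    using that by (simp add: ext_module_def fscale_def)
  have zero: "0 \<in> carrier (ext_module n r)"
    by (simp add: ext_module_def fun_apply)
  have sum: "(\<Sum>i\<in>T. h i) \<in> carrier (ext_module n r)"
    if "\<And>i. i \<in> T \<Longrightarrow> h i \<in> carrier (ext_module n r)" for T and h :: "nat \<Rightarrow> fock"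
    using that by (induction T rule: infinite_finite_induct) (auto intro: add zero)
  show ?thesis unfolding ext_act
    by (intro sum sc current_in_ext_module assms) simp
qed

lemma current_ge: "r \<le> a \<Longrightarrow> current r i j a f = 0"
  by (simp add: current_def)

lemma sum_permute4:
  "(\<Sum>i\<in>A. \<Sum>j\<in>B. \<Sum>b\<in>C. \<Sum>l\<in>D. h i j b l) = (\<Sum>b\<in>C. \<Sum>i\<in>A. \<Sum>l\<in>D. \<Sum>j\<in>B. (h i j b l :: 'a :: comm_monoid_add))"
proof -
  have "(\<Sum>i\<in>A. \<Sum>j\<in>B. \<Sum>b\<in>C. \<Sum>l\<in>D. h i j b l) = (\<Sum>i\<in>A. \<Sum>b\<in>C. \<Sum>l\<in>D. \<Sum>j\<in>B. h i j b l)"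
    by (rule sum.cong[OF refl], subst sum.swap, rule sum.cong[OF refl], rule sum.swap)
  also have "\<dots> = (\<Sum>b\<in>C. \<Sum>i\<in>A. \<Sum>l\<in>D. \<Sum>j\<in>B. h i j b l)" by (rule sum.swap)
  finally show ?thesis .
qed

lemma current_sum: "current r i j a (\<Sum>x\<in>X. h x) = (\<Sum>x\<in>X. current r i j a (h x))"
  by (induction X rule: infinite_finite_induct) (auto simp: current_linear)

section \<open>Brackets of matrix-valued currents\<close>

definition currents :: "nat \<Rightarrow> nat \<Rightarrow> (nat \<Rightarrow> nat \<Rightarrow> nat \<Rightarrow> complex) \<Rightarrow> fock \<Rightarrow> fock" where
  "currents n r x f = (\<Sum>a<r. \<Sum>i<n. \<Sum>j<n. fscale (x a i j) (current r i j a f))"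

text \<open>Bilinear expansion of the bracket of two elementary currents. The pairs of degrees with
  sum at least r drop out because such a current is zero, which leaves exactly the product in
  C[t]/t^r.\<close>

lemma currents_commutator:
  "currents n r x (currents n r y f) - currents n r y (currents n r x f) =
    currents n r (\<lambda>c i j. \<Sum>a\<le>c. \<Sum>m<n. x a i m * y (c - a) m j - y (c - a) i m * x a m j) f"
proof -
  let ?S = "\<lambda>h. \<Sum>a<r. \<Sum>i<n. \<Sum>j<n. \<Sum>b<r. \<Sum>k<n. \<Sum>l<n. (h a i j b k l :: fock)"
  let ?xy = "\<lambda>a i j b k l. fscale (x a i j * y b k l)"
  have 1: "currents n r x (currents n r y f) = ?S (\<lambda>a i j b k l. ?xy a i j b k l (current r i j a (current r k l b f)))"
    unfolding currents_def current_sum current_linear fock.scale_sum_right fock.scale_scale ..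
  have 2: "currents n r y (currents n r x f) = ?S (\<lambda>a i j b k l. ?xy a i j b k l (current r k l b (current r i j a f)))"
  proof -
    let ?T = "{..<r} \<times> {..<n} \<times> {..<n}"
    let ?h = "\<lambda>(b, k, l) (a, i, j). ?xy a i j b k l (current r k l b (current r i j a f))"
    have "currents n r y (currents n r x f) =
        (\<Sum>b<r. \<Sum>k<n. \<Sum>l<n. \<Sum>a<r. \<Sum>i<n. \<Sum>j<n. ?xy a i j b k l (current r k l b (current r i j a f)))"
      unfolding currents_def current_sum current_linear fock.scale_sum_right fock.scale_scale
      by (simp add: mult.commute)
    also have "\<dots> = (\<Sum>u\<in>?T. \<Sum>t\<in>?T. ?h u t)"
      by (simp add: sum.cartesian_product' flip: sum.cartesian_product)
    also have "\<dots> = (\<Sum>t\<in>?T. \<Sum>u\<in>?T. ?h u t)" by (rule sum.swap)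
    also have "\<dots> = ?S (\<lambda>a i j b k l. ?xy a i j b k l (current r k l b (current r i j a f)))"
      by (simp add: sum.cartesian_product' flip: sum.cartesian_product)
    finally show ?thesis .
  qed
  have "currents n r x (currents n r y f) - currents n r y (currents n r x f) =
     ?S (\<lambda>a i j b k l. if j = k then ?xy a i j b k l (current r i l (a + b) f) else 0) -
     ?S (\<lambda>a i j b k l. if l = i then ?xy a i j b k l (current r k j (a + b) f) else 0)"
    unfolding 1 2 sum_subtractf[symmetric]
    by (intro sum.cong refl) (subst current_commutator, simp add: fock.scale_right_distrib fock.scale_right_diff_distrib)
  also have "?S (\<lambda>a i j b k l. if j = k then ?xy a i j b k l (current r i l (a + b) f) else 0) =
     (\<Sum>a<r. \<Sum>b<r. \<Sum>i<n. \<Sum>j<n. fscale (\<Sum>m<n. x a i m * y b m j) (current r i j (a + b) f))"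
  proof (rule sum.cong[OF refl])
    fix a
    have "(\<Sum>i<n. \<Sum>j<n. \<Sum>b<r. \<Sum>k<n. \<Sum>l<n. if j = k then ?xy a i j b k l (current r i l (a + b) f) else 0) =
       (\<Sum>i<n. \<Sum>j<n. \<Sum>b<r. \<Sum>l<n. ?xy a i j b j l (current r i l (a + b) f))"
    proof (rule sum.cong[OF refl], rule sum.cong[OF refl], rule sum.cong[OF refl])
      fix i j b assume "j \<in> {..<n}"
      then show "(\<Sum>k<n. \<Sum>l<n. if j = k then ?xy a i j b k l (current r i l (a + b) f) else 0) =
          (\<Sum>l<n. ?xy a i j b j l (current r i l (a + b) f))"
        by (subst sum.swap) (simp add: sum.delta')
    qed
    also have "\<dots> = (\<Sum>b<r. \<Sum>i<n. \<Sum>l<n. \<Sum>j<n. ?xy a i j b j l (current r i l (a + b) f))"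
      by (rule sum_permute4)
    finally show "(\<Sum>i<n. \<Sum>j<n. \<Sum>b<r. \<Sum>k<n. \<Sum>l<n. if j = k then ?xy a i j b k l (current r i l (a + b) f) else 0) =
       (\<Sum>b<r. \<Sum>i<n. \<Sum>j<n. fscale (\<Sum>m<n. x a i m * y b m j) (current r i j (a + b) f))"
      by (simp only: fock.scale_sum_left)
  qed
  also have "?S (\<lambda>a i j b k l. if l = i then ?xy a i j b k l (current r k j (a + b) f) else 0) =
     (\<Sum>a<r. \<Sum>b<r. \<Sum>i<n. \<Sum>j<n. fscale (\<Sum>m<n. y b i m * x a m j) (current r i j (a + b) f))"
  proof (rule sum.cong[OF refl])
    fix a
    have "(\<Sum>i<n. \<Sum>j<n. \<Sum>b<r. \<Sum>k<n. \<Sum>l<n. if l = i then ?xy a i j b k l (current r k j (a + b) f) else 0) =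
       (\<Sum>i<n. \<Sum>j<n. \<Sum>b<r. \<Sum>k<n. ?xy a i j b k i (current r k j (a + b) f))"
      by (rule sum.cong[OF refl], rule sum.cong[OF refl], rule sum.cong[OF refl], rule sum.cong[OF refl])
         (simp add: sum.delta)
    also have "\<dots> = (\<Sum>b<r. \<Sum>i<n. \<Sum>k<n. \<Sum>j<n. ?xy a i j b k i (current r k j (a + b) f))"
      by (rule sum_permute4)
    also have "\<dots> = (\<Sum>b<r. \<Sum>k<n. \<Sum>j<n. \<Sum>i<n. ?xy a i j b k i (current r k j (a + b) f))"
      by (rule sum.cong[OF refl], subst sum.swap, rule sum.cong[OF refl], rule sum.swap)
    finally show "(\<Sum>i<n. \<Sum>j<n. \<Sum>b<r. \<Sum>k<n. \<Sum>l<n. if l = i then ?xy a i j b k l (current r k j (a + b) f) else 0) =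
       (\<Sum>b<r. \<Sum>i<n. \<Sum>j<n. fscale (\<Sum>m<n. y b i m * x a m j) (current r i j (a + b) f))"
      by (simp only: fock.scale_sum_left mult.commute[of "x _ _ _"])
  qed
  also have "(\<Sum>a<r. \<Sum>b<r. \<Sum>i<n. \<Sum>j<n. fscale (\<Sum>m<n. x a i m * y b m j) (current r i j (a + b) f)) -
      (\<Sum>a<r. \<Sum>b<r. \<Sum>i<n. \<Sum>j<n. fscale (\<Sum>m<n. y b i m * x a m j) (current r i j (a + b) f)) =
      (\<Sum>a<r. \<Sum>b<r. \<Sum>i<n. \<Sum>j<n. fscale (\<Sum>m<n. x a i m * y b m j - y b i m * x a m j) (current r i j (a + b) f))"
    unfolding sum_subtractf[symmetric] fock.scale_left_diff_distrib[symmetric] ..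
  also have "\<dots> = (\<Sum>(a, b)\<in>{..<r} \<times> {..<r}. \<Sum>i<n. \<Sum>j<n. fscale (\<Sum>m<n. x a i m * y b m j - y b i m * x a m j) (current r i j (a + b) f))"
    by (rule sum.cartesian_product)
  also have "\<dots> = (\<Sum>(a, b)\<in>{(a, b). a + b < r}. \<Sum>i<n. \<Sum>j<n. fscale (\<Sum>m<n. x a i m * y b m j - y b i m * x a m j) (current r i j (a + b) f))"
    by (rule sum.mono_neutral_right) (auto simp: current_ge)
  also have "\<dots> = (\<Sum>c<r. \<Sum>a\<le>c. \<Sum>i<n. \<Sum>j<n. fscale (\<Sum>m<n. x a i m * y (c - a) m j - y (c - a) i m * x a m j) (current r i j (a + (c - a)) f))"
    by (rule sum.triangle_reindex)
  also have "\<dots> = (\<Sum>c<r. \<Sum>i<n. \<Sum>j<n. \<Sum>a\<le>c. fscale (\<Sum>m<n. x a i m * y (c - a) m j - y (c - a) i m * x a m j) (current r i j c f))"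
  proof (rule sum.cong[OF refl])
    fix c
    have "(\<Sum>a\<le>c. \<Sum>i<n. \<Sum>j<n. fscale (\<Sum>m<n. x a i m * y (c - a) m j - y (c - a) i m * x a m j) (current r i j (a + (c - a)) f)) =
      (\<Sum>a\<le>c. \<Sum>i<n. \<Sum>j<n. fscale (\<Sum>m<n. x a i m * y (c - a) m j - y (c - a) i m * x a m j) (current r i j c f))"
      by (rule sum.cong[OF refl]) simp
    also have "\<dots> = (\<Sum>i<n. \<Sum>j<n. \<Sum>a\<le>c. fscale (\<Sum>m<n. x a i m * y (c - a) m j - y (c - a) i m * x a m j) (current r i j c f))"
      by (subst sum.swap, rule sum.cong[OF refl], rule sum.swap)
    finally show "(\<Sum>a\<le>c. \<Sum>i<n. \<Sum>j<n. fscale (\<Sum>m<n. x a i m * y (c - a) m j - y (c - a) i m * x a m j) (current r i j (a + (c - a)) f)) =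
      (\<Sum>i<n. \<Sum>j<n. \<Sum>a\<le>c. fscale (\<Sum>m<n. x a i m * y (c - a) m j - y (c - a) i m * x a m j) (current r i j c f))" .
  qed
  also have "\<dots> = currents n r (\<lambda>c i j. \<Sum>a\<le>c. \<Sum>m<n. x a i m * y (c - a) m j - y (c - a) i m * x a m j) f"
    by (simp only: currents_def fock.scale_sum_left)
  finally show ?thesis .
qed

section \<open>Traceless matrices\<close>

lemma gl_simps:
  "carrier (gl n) = carrier_mat n n" "A \<oplus>\<^bsub>gl n\<^esub> B = A + B" "c \<odot>\<^bsub>gl n\<^esub> A = c \<cdot>\<^sub>m A" "\<zero>\<^bsub>gl n\<^esub> = 0\<^sub>m n n"
  "lie_bracket (gl n) A B = A * B - B * A"
  by (simp_all add: gl_def)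

lemma sl_simps:
  "A \<oplus>\<^bsub>sl n\<^esub> B = A + B" "c \<odot>\<^bsub>sl n\<^esub> A = c \<cdot>\<^sub>m A" "\<zero>\<^bsub>sl n\<^esub> = 0\<^sub>m n n"
  "lie_bracket (sl n) A B = A * B - B * A"
  by (simp_all add: sl_def gl_def)

lemma mat_mult_entry:
  fixes A B :: "complex mat"
  assumes "A \<in> carrier_mat n n" "B \<in> carrier_mat n n" "p < n" "q < n"
  shows "(A * B) $$ (p, q) = (\<Sum>m<n. A $$ (p, m) * B $$ (m, q))"
  using assms by (auto simp: scalar_prod_def atLeast0LessThan intro!: sum.cong)

lemma mat_sum_insert:
  fixes h :: "'t \<Rightarrow> complex mat"
  assumes "finite T" "t \<notin> T" "h t \<in> carrier_mat n n"
  shows "mat n n (\<lambda>p. \<Sum>s\<in>insert t T. h s $$ p) = h t + mat n n (\<lambda>p. \<Sum>s\<in>T. h s $$ p)"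
  using assms by (intro eq_matI) auto

lemma mat_sum_in_submodule:
  assumes N: "LinearCombinations.submodule class_ring N (gl n)"
    and "finite T" "\<And>t. t \<in> T \<Longrightarrow> h t \<in> N"
  shows "mat n n (\<lambda>p. \<Sum>t\<in>T. h t $$ p) \<in> N"
  using assms(2,3)
proof (induction T rule: finite_induct)
  case empty
  have "mat n n (\<lambda>p. \<Sum>t\<in>{}. h t $$ p) = 0\<^sub>m n n" by (intro eq_matI) auto
  then show ?case using submodule.zero_closed[OF N] by (simp only: gl_simps)
next
  case (insert t T)
  have "h t \<in> carrier_mat n n" using submodule.subset[OF N] insert.prems by (auto simp: gl_simps)
  note eq = mat_sum_insert[where h = h, OF insert.hyps this]
  have "mat n n (\<lambda>p. \<Sum>t\<in>T. h t $$ p) \<in> N" by (rule insert.IH) (simp add: insert.prems)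
  then show ?case
    unfolding eq using submodule.m_closed[OF N, of "h t"] insert.prems[of t] by (simp add: gl_simps)
qed

lemma mat_unit_carrier [simp]: "mat_unit n i j \<in> carrier_mat n n"
  by (simp add: mat_unit_def)

lemma mat_unit_dim [simp]: "dim_row (mat_unit n i j) = n" "dim_col (mat_unit n i j) = n"
  by (simp_all add: mat_unit_def)

lemma mat_unit_index [simp]:
  "p < n \<Longrightarrow> q < n \<Longrightarrow> mat_unit n i j $$ (p, q) = (if p = i \<and> q = j then 1 else 0)"
  by (simp add: mat_unit_def)

lemma mat_unit_mult:
  assumes "j < n"
  shows "mat_unit n i j * mat_unit n k l = (if j = k then mat_unit n i l else 0\<^sub>m n n)"
proof (rule eq_matI)
  fix p q assume pq: "p < dim_row (if j = k then mat_unit n i l else 0\<^sub>m n n)"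
    "q < dim_col (if j = k then mat_unit n i l else 0\<^sub>m n n)"
  then have pq: "p < n" "q < n" by (auto simp: mat_unit_def split: if_splits)
  have "(mat_unit n i j * mat_unit n k l) $$ (p, q) = (\<Sum>m<n. if m = j then (if p = i \<and> j = k \<and> q = l then 1 else 0) else 0)"
    unfolding mat_mult_entry[OF mat_unit_carrier mat_unit_carrier pq]
    by (rule sum.cong[OF refl]) (use pq in auto)
  then show "(mat_unit n i j * mat_unit n k l) $$ (p, q) = (if j = k then mat_unit n i l else 0\<^sub>m n n) $$ (p, q)"
    using assms pq by (simp add: sum.delta)
qed (auto simp: mat_unit_def)

text \<open>The component of \<open>E\<^sub>i\<^sub>j\<close> in the decomposition of \<open>gl\<close> into \<open>sl\<close> and the scalar matrices.\<close>
definition traceless_unit :: "nat \<Rightarrow> nat \<Rightarrow> nat \<Rightarrow> complex mat" where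
  "traceless_unit n i j =
     mat n n (\<lambda>(p, q). (if p = i \<and> q = j then 1 else 0) - (if i = j \<and> p = q then 1 / of_nat n else 0))"

lemma traceless_unit_index:
  "p < n \<Longrightarrow> q < n \<Longrightarrow> traceless_unit n i j $$ (p, q) =
     (if p = i \<and> q = j then 1 else 0) - (if i = j \<and> p = q then 1 / of_nat n else 0)"
  by (simp add: traceless_unit_def)

lemma traceless_unit_carrier [simp]: "traceless_unit n i j \<in> carrier_mat n n"
  by (simp add: traceless_unit_def)

lemma sl_span:
  "LinearCombinations.submodule class_ring (carrier (sl n)) (gl n)"
  "A \<in> carrier_mat n n \<Longrightarrow> B \<in> carrier_mat n n \<Longrightarrow> A * B - B * A \<in> carrier (sl n)"
  "Module.module class_ring (sl n)"
proof -
  interpret G: Module.module class_ring "gl n" by (rule module_gl)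
  let ?S = "{lie_bracket (gl n) A B | A B. A \<in> carrier (gl n) \<and> B \<in> carrier (gl n)}"
  have S: "?S \<subseteq> carrier (gl n)" by (auto simp: gl_simps)
  show sub: "LinearCombinations.submodule class_ring (carrier (sl n)) (gl n)"
    using G.span_is_submodule[OF S] by (simp add: sl_def)
  show "A * B - B * A \<in> carrier (sl n)" if "A \<in> carrier_mat n n" "B \<in> carrier_mat n n" for A B
  proof -
    have "A * B - B * A \<in> ?S" using that by (auto simp: gl_simps)
    then have "A * B - B * A \<in> G.span ?S" using G.in_own_span[OF S] by blast
    then show ?thesis by (simp add: sl_def)
  qed
  show "Module.module class_ring (sl n)"
    using G.submodule_is_module[OF sub] by (simp add: sl_def)
qed

text \<open>A commutator has trace zero. Conversely E_(i,j) with distinct indices is the commutator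
  of E_(i,i) and E_(i,j), and E_(i,i) - 1/n is the average over k of the commutators of E_(i,k) and
  E_(k,i).\<close>

lemma sl_carrier:
  assumes "n \<ge> 1"
  shows "carrier (sl n) = {A \<in> carrier_mat n n. (\<Sum>i<n. A $$ (i, i)) = 0}" (is "_ = ?N")
proof
  interpret G: Module.module class_ring "gl n" by (rule module_gl)
  let ?S = "{lie_bracket (gl n) A B | A B. A \<in> carrier (gl n) \<and> B \<in> carrier (gl n)}"
  have "LinearCombinations.submodule class_ring ?N (gl n)"
    by (rule submodule.intro[OF module_gl]) (auto simp: gl_simps sum.distrib sum_distrib_left[symmetric])
  moreover have "?S \<subseteq> ?N"
  proof
    fix X assume "X \<in> ?S"
    then obtain A B where X: "A \<in> carrier_mat n n" "B \<in> carrier_mat n n" "X = A * B - B * A"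
      by (auto simp: gl_simps)
    have "(\<Sum>i<n. X $$ (i, i)) = (\<Sum>i<n. (A * B) $$ (i, i) - (B * A) $$ (i, i))"
      unfolding X(3) by (rule sum.cong[OF refl], subst index_minus_mat(1)) (use X(1,2) in auto)
    also have "\<dots> = (\<Sum>i<n. \<Sum>m<n. A $$ (i, m) * B $$ (m, i)) - (\<Sum>i<n. \<Sum>m<n. B $$ (i, m) * A $$ (m, i))"
      unfolding sum_subtractf by (simp add: mat_mult_entry[OF X(1,2)] mat_mult_entry[OF X(2,1)])
    also have "(\<Sum>i<n. \<Sum>m<n. B $$ (i, m) * A $$ (m, i)) = (\<Sum>m<n. \<Sum>i<n. A $$ (m, i) * B $$ (i, m))"
      by (subst sum.swap) (simp add: mult.commute)
    finally have "(\<Sum>i<n. X $$ (i, i)) = 0" by simp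
    moreover have "X \<in> carrier_mat n n"
      unfolding X(3) using X(1,2) by (intro minus_carrier_mat mult_carrier_mat)
    ultimately show "X \<in> ?N" by simp
  qed
  ultimately show "carrier (sl n) \<subseteq> ?N"
    using G.span_is_subset[of ?S ?N] by (simp add: sl_def)
  note sub = sl_span(1)[of n]
  have smult: "c \<cdot>\<^sub>m A \<in> carrier (sl n)" if "A \<in> carrier (sl n)" for c A
    using submodule.smult_closed[OF sub, of c A] that by (simp add: gl_simps)
  have T: "traceless_unit n i j \<in> carrier (sl n)" if ij: "i < n" "j < n" for i j
  proof (cases "i = j")
    case False
    have "traceless_unit n i j = mat_unit n i i * mat_unit n i j - mat_unit n i j * mat_unit n i i"
      unfolding mat_unit_mult[OF ij(1)] mat_unit_mult[OF ij(2)]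
      by (rule eq_matI) (use False in \<open>auto simp: traceless_unit_def\<close>)
    then show ?thesis using sl_span(2)[of "mat_unit n i i" n "mat_unit n i j"] by simp
  next
    case True
    let ?h = "\<lambda>k. (1 / of_nat n) \<cdot>\<^sub>m (mat_unit n i k * mat_unit n k i - mat_unit n k i * mat_unit n i k)"
    have "traceless_unit n i j = mat n n (\<lambda>p. \<Sum>k\<in>{..<n}. ?h k $$ p)"
    proof (rule eq_matI)
      fix p q assume "p < dim_row (mat n n (\<lambda>p. \<Sum>k\<in>{..<n}. ?h k $$ p))" "q < dim_col (mat n n (\<lambda>p. \<Sum>k\<in>{..<n}. ?h k $$ p))"
      then have pq: "p < n" "q < n" by simp_all
      have "(\<Sum>k<n. ?h k $$ (p, q)) =
          (\<Sum>k<n. (1 / of_nat n) * (if p = i \<and> q = i then 1 else 0) - (if k = p then (if p = q then 1 / of_nat n else 0) else 0))"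
        by (rule sum.cong[OF refl]) (use pq ij in \<open>auto simp: mat_unit_mult\<close>)
      also have "\<dots> = traceless_unit n i j $$ (p, q)"
        using pq True assms by (simp add: sum_subtractf traceless_unit_index sum.delta)
      finally show "traceless_unit n i j $$ (p, q) = mat n n (\<lambda>p. \<Sum>k\<in>{..<n}. ?h k $$ p) $$ (p, q)"
        using pq by simp
    qed (simp_all add: traceless_unit_def)
    then show ?thesis
      using mat_sum_in_submodule[OF sub, of "{..<n}" ?h] smult sl_span(2)[OF mat_unit_carrier mat_unit_carrier]
      by (metis finite_lessThan)
  qed
  show "?N \<subseteq> carrier (sl n)"
  proof
    fix A assume A: "A \<in> ?N"
    \<comment> \<open>Expanding \<open>A\<close> in traceless units instead of matrix units changes
      it by trace(A)/n times the identity, which is zero here.\<close>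
    let ?h = "\<lambda>t. A $$ t \<cdot>\<^sub>m traceless_unit n (fst t) (snd t)"
    have "A = mat n n (\<lambda>p. \<Sum>t\<in>{..<n} \<times> {..<n}. ?h t $$ p)"
    proof (rule eq_matI)
      fix p q assume "p < dim_row (mat n n (\<lambda>p. \<Sum>t\<in>{..<n} \<times> {..<n}. ?h t $$ p))" "q < dim_col (mat n n (\<lambda>p. \<Sum>t\<in>{..<n} \<times> {..<n}. ?h t $$ p))"
      then have pq: "p < n" "q < n" by simp_all
      have "(\<Sum>t\<in>{..<n} \<times> {..<n}. ?h t $$ (p, q)) = (\<Sum>i<n. \<Sum>j<n. ?h (i, j) $$ (p, q))"
        by (simp add: sum.cartesian_product case_prod_beta)
      also have "\<dots> = (\<Sum>i<n. \<Sum>j<n. (if j = q then if i = p then A $$ (p, q) else 0 else 0)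
          - (if i = j then A $$ (i, i) * (if p = q then 1 / of_nat n else 0) else 0))"
        by (rule sum.cong[OF refl], rule sum.cong[OF refl]) (use pq in \<open>auto simp: traceless_unit_def algebra_simps\<close>)
      also have "\<dots> = A $$ (p, q) - (\<Sum>i<n. A $$ (i, i)) * (if p = q then 1 / of_nat n else 0)"
        using pq by (simp add: sum_subtractf sum_distrib_right)
      finally show "A $$ (p, q) = mat n n (\<lambda>p. \<Sum>t\<in>{..<n} \<times> {..<n}. ?h t $$ p) $$ (p, q)"
        using A pq by simp
    qed (use A in auto)
    moreover have "mat n n (\<lambda>p. \<Sum>t\<in>{..<n} \<times> {..<n}. ?h t $$ p) \<in> carrier (sl n)"
      by (rule mat_sum_in_submodule[OF sub]) (auto intro!: smult T)
    ultimately show "A \<in> carrier (sl n)" by simp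
  qed
qed

lemma n_plus_facts:
  "A \<in> carrier (n_plus n) \<Longrightarrow> A \<in> carrier_mat n n \<and> (\<forall>p<n. \<forall>q\<le>p. A $$ (p, q) = 0)"
  "i < j \<Longrightarrow> j < n \<Longrightarrow> mat_unit n i j \<in> carrier (n_plus n)"
  "0\<^sub>m n n \<in> carrier (n_plus n)"
proof -
  interpret G: Module.module class_ring "gl n" by (rule module_gl)
  let ?S = "{mat_unit n i j | i j. i < j \<and> j < n}"
  let ?N = "{A \<in> carrier_mat n n. \<forall>p<n. \<forall>q\<le>p. A $$ (p, q) = 0}"
  have S: "?S \<subseteq> carrier (gl n)" by (auto simp: gl_simps)
  have "LinearCombinations.submodule class_ring ?N (gl n)"
    by (rule submodule.intro[OF module_gl]) (auto simp: gl_simps)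
  moreover have "?S \<subseteq> ?N" by auto
  ultimately show "A \<in> carrier_mat n n \<and> (\<forall>p<n. \<forall>q\<le>p. A $$ (p, q) = 0)" if "A \<in> carrier (n_plus n)"
    using G.span_is_subset[of ?S ?N] that by (auto simp: n_plus_def)
  show "mat_unit n i j \<in> carrier (n_plus n)" if "i < j" "j < n"
    using G.in_own_span[OF S] that by (auto simp: n_plus_def)
  show "0\<^sub>m n n \<in> carrier (n_plus n)"
    using submodule.zero_closed[OF G.span_is_submodule[OF S]] by (simp add: n_plus_def gl_simps)
qed

lemma sl_finsum:
  assumes "finite T" "\<And>t. t \<in> T \<Longrightarrow> h t \<in> carrier (sl n)"
  shows "finsum (sl n) h T = mat n n (\<lambda>p. \<Sum>t\<in>T. h t $$ p) \<and> finsum (sl n) h T \<in> carrier (sl n)"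
  using assms
proof (induction T rule: finite_induct)
  interpret S: Module.module class_ring "sl n" by (rule sl_span)
  {
    case empty
    have "mat n n (\<lambda>p. \<Sum>t\<in>{}. h t $$ p) = 0\<^sub>m n n" by (intro eq_matI) auto
    then show ?case using S.zero_closed by (simp add: sl_simps)
  next
    case (insert t T)
    have t: "h t \<in> carrier_mat n n" using submodule.subset[OF sl_span(1)] insert.prems by (auto simp: gl_simps)
    have IH: "finsum (sl n) h T = mat n n (\<lambda>p. \<Sum>t\<in>T. h t $$ p)" "finsum (sl n) h T \<in> carrier (sl n)"
      using insert.IH[THEN conjunct1] insert.IH[THEN conjunct2] insert.prems by blast+
    have fin: "finsum (sl n) h (insert t T) = h t + finsum (sl n) h T"
      using S.finsum_insert[of T t h] insert by (auto simp: sl_simps)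
    have "h t + finsum (sl n) h T \<in> carrier (sl n)"
      using S.a_closed[of "h t" "finsum (sl n) h T"] IH(2) insert.prems[of t] by (simp only: sl_simps insertI1)
    then show ?case
      unfolding mat_sum_insert[where h = h, OF insert.hyps t] fin using IH(1) by simp
  }
qed

section \<open>The Takiff algebra of the traceless matrices\<close>

abbreviation (input) slt :: "nat \<Rightarrow> nat \<Rightarrow> (complex, nat \<Rightarrow> complex mat) lie_algebra" where
  "slt n r \<equiv> takiff r (sl n)"

lemma slt_simps:
  "x \<oplus>\<^bsub>slt n r\<^esub> y = (\<lambda>k. x k + y k)" "c \<odot>\<^bsub>slt n r\<^esub> x = (\<lambda>k. c \<cdot>\<^sub>m x k)"
  by (simp_all add: takiff_def sl_simps)

lemma slt_carrier:
  assumes "n \<ge> 1"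
  shows "x \<in> carrier (slt n r) \<longleftrightarrow>
    (\<forall>k. x k \<in> carrier_mat n n) \<and> (\<forall>k<r. (\<Sum>i<n. x k $$ (i, i)) = 0) \<and> (\<forall>k\<ge>r. x k = 0\<^sub>m n n)"
proof -
  have "x k \<in> carrier_mat n n" if "\<forall>k<r. x k \<in> carrier_mat n n" "\<forall>k\<ge>r. x k = 0\<^sub>m n n" for k
    using that by (cases "k < r") auto
  then show ?thesis by (auto simp: takiff_def sl_carrier[OF assms] sl_simps)
qed

lemma slt_bracket:
  assumes x: "x \<in> carrier (slt n r)" and y: "y \<in> carrier (slt n r)"
  shows "lie_bracket (slt n r) x y \<in> carrier (slt n r)"
    and "k < r \<Longrightarrow> p < n \<Longrightarrow> q < n \<Longrightarrow> lie_bracket (slt n r) x y k $$ (p, q) =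
      (\<Sum>c\<le>k. \<Sum>m<n. x c $$ (p, m) * y (k - c) $$ (m, q) - y (k - c) $$ (p, m) * x c $$ (m, q))"
proof -
  let ?h = "\<lambda>k c. x c * y (k - c) - y (k - c) * x c"
  have sub: "carrier (sl n) \<subseteq> carrier_mat n n" using submodule.subset[OF sl_span(1)] by (simp add: gl_simps)
  have car: "x c \<in> carrier_mat n n" "y c \<in> carrier_mat n n" if "c < r" for c
    using x y that sub by (auto simp: takiff_def)
  have h: "?h k c \<in> carrier (sl n)" if "k < r" "c \<in> {..k}" for k c
    by (rule sl_span(2)) (use car that in auto)
  have fin: "lie_bracket (slt n r) x y k = mat n n (\<lambda>p. \<Sum>c\<le>k. ?h k c $$ p) \<and> lie_bracket (slt n r) x y k \<in> carrier (sl n)"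
    if "k < r" for k
  proof -
    have e: "lie_bracket (slt n r) x y k = finsum (sl n) (?h k) {..k}" using that by (simp add: takiff_def sl_simps)
    show ?thesis unfolding e by (rule sl_finsum) (use h[OF that] in auto)
  qed
  have "lie_bracket (slt n r) x y k = 0\<^sub>m n n" if "k \<ge> r" for k
    using that by (simp add: takiff_def sl_simps)
  moreover have "z \<in> carrier (slt n r) \<longleftrightarrow> (\<forall>k<r. z k \<in> carrier (sl n)) \<and> (\<forall>k\<ge>r. z k = 0\<^sub>m n n)" for z
    by (simp add: takiff_def sl_simps)
  ultimately show "lie_bracket (slt n r) x y \<in> carrier (slt n r)"
    using fin by blast
  show "lie_bracket (slt n r) x y k $$ (p, q) =
      (\<Sum>c\<le>k. \<Sum>m<n. x c $$ (p, m) * y (k - c) $$ (m, q) - y (k - c) $$ (p, m) * x c $$ (m, q))"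
    if kpq: "k < r" "p < n" "q < n"
  proof -
    have "lie_bracket (slt n r) x y k $$ (p, q) = (\<Sum>c\<le>k. ?h k c $$ (p, q))" using fin kpq by simp
    also have "\<dots> = (\<Sum>c\<le>k. \<Sum>m<n. x c $$ (p, m) * y (k - c) $$ (m, q) - y (k - c) $$ (p, m) * x c $$ (m, q))"
    proof (rule sum.cong[OF refl])
      fix c assume "c \<in> {..k}"
      then have c: "x c \<in> carrier_mat n n" "y (k - c) \<in> carrier_mat n n" using car kpq(1) by auto
      then have "?h k c $$ (p, q) = (x c * y (k - c)) $$ (p, q) - (y (k - c) * x c) $$ (p, q)"
        using kpq by (subst index_minus_mat(1)) auto
      then show "?h k c $$ (p, q) = (\<Sum>m<n. x c $$ (p, m) * y (k - c) $$ (m, q) - y (k - c) $$ (p, m) * x c $$ (m, q))"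
        by (simp add: mat_mult_entry[OF c kpq(2,3)] mat_mult_entry[OF c(2,1) kpq(2,3)] sum_subtractf)
    qed
    finally show ?thesis .
  qed
qed

lemma slt_closed:
  assumes "x \<in> carrier (slt n r)"
  shows "y \<in> carrier (slt n r) \<Longrightarrow> x \<oplus>\<^bsub>slt n r\<^esub> y \<in> carrier (slt n r)" "c \<odot>\<^bsub>slt n r\<^esub> x \<in> carrier (slt n r)"
proof -
  interpret S: Module.module class_ring "sl n" by (rule sl_span)
  show "x \<oplus>\<^bsub>slt n r\<^esub> y \<in> carrier (slt n r)" if "y \<in> carrier (slt n r)"
    using assms that S.a_closed S.l_zero[OF S.zero_closed] by (simp add: takiff_def)
  show "c \<odot>\<^bsub>slt n r\<^esub> x \<in> carrier (slt n r)"
    using assms S.smult_closed[of c] S.smult_r_null[of c] by (simp add: takiff_def)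
qed

lemma ext_act_currents: "lie_act (ext_module n r) x f = currents n r (\<lambda>k i j. x k $$ (i, j)) f"
  by (simp add: ext_act currents_def)

lemma currents_cong:
  "(\<And>a i j. a < r \<Longrightarrow> i < n \<Longrightarrow> j < n \<Longrightarrow> x a i j = y a i j) \<Longrightarrow> currents n r x f = currents n r y f"
  by (simp add: currents_def)

lemma ext_act_rep:
  assumes "n \<ge> 1" "x \<in> carrier (slt n r)"
  shows "y \<in> carrier (slt n r) \<Longrightarrow> lie_act (ext_module n r) (x \<oplus>\<^bsub>slt n r\<^esub> y) u =
      lie_act (ext_module n r) x u + lie_act (ext_module n r) y u"
    and "lie_act (ext_module n r) (c \<odot>\<^bsub>slt n r\<^esub> x) u = fscale c (lie_act (ext_module n r) x u)"
    and "y \<in> carrier (slt n r) \<Longrightarrow> lie_act (ext_module n r) (lie_bracket (slt n r) x y) u =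
      lie_act (ext_module n r) x (lie_act (ext_module n r) y u) - lie_act (ext_module n r) y (lie_act (ext_module n r) x u)"
proof -
  note car = slt_carrier[OF assms(1), THEN iffD1, THEN conjunct1, rule_format]
  show "lie_act (ext_module n r) (x \<oplus>\<^bsub>slt n r\<^esub> y) u = lie_act (ext_module n r) x u + lie_act (ext_module n r) y u"
    if "y \<in> carrier (slt n r)"
  proof -
    have "(x k + y k) $$ (i, j) = x k $$ (i, j) + y k $$ (i, j)" if "i < n" "j < n" for k i j
      using car[OF \<open>y \<in> carrier (slt n r)\<close>, of k] that by (intro index_add_mat(1)) auto
    then show ?thesis by (simp add: slt_simps ext_act fock.scale_left_distrib sum.distrib)
  qed
  show "lie_act (ext_module n r) (c \<odot>\<^bsub>slt n r\<^esub> x) u = fscale c (lie_act (ext_module n r) x u)"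
  proof -
    have "(c \<cdot>\<^sub>m x k) $$ (i, j) = c * x k $$ (i, j)" if "i < n" "j < n" for k i j
      using car[OF assms(2), of k] that by (intro index_smult_mat(1)) auto
    then show ?thesis by (simp add: slt_simps ext_act fock.scale_sum_right)
  qed
  show "lie_act (ext_module n r) (lie_bracket (slt n r) x y) u =
      lie_act (ext_module n r) x (lie_act (ext_module n r) y u) - lie_act (ext_module n r) y (lie_act (ext_module n r) x u)"
    if "y \<in> carrier (slt n r)"
    unfolding ext_act_currents currents_commutator
    by (rule currents_cong) (simp add: slt_bracket(2)[OF assms(2) that])
qed

definition unit_tensor :: "nat \<Rightarrow> nat \<Rightarrow> nat \<Rightarrow> nat \<Rightarrow> nat \<Rightarrow> nat \<Rightarrow> complex mat" where
  "unit_tensor n r i j a = takiff_tensor r (sl n) (traceless_unit n i j) a"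

lemma unit_tensor_index:
  "p < n \<Longrightarrow> q < n \<Longrightarrow> unit_tensor n r i j a k $$ (p, q) =
     (if k = a \<and> a < r then (if p = i \<and> q = j then 1 else 0) - (if i = j \<and> p = q then 1 / of_nat n else 0) else 0)"
  by (simp add: unit_tensor_def takiff_tensor_def traceless_unit_index sl_simps)

lemma traceless_unit_in_sl:
  assumes "n \<ge> 1" "i < n" "j < n"
  shows "traceless_unit n i j \<in> carrier (sl n)"
proof -
  have "(\<Sum>p<n. traceless_unit n i j $$ (p, p)) =
      (\<Sum>p<n. (if p = i then (if i = j then 1 else 0) else 0) - (if i = j then 1 / of_nat n else 0))"
    by (rule sum.cong) (auto simp: traceless_unit_index)
  also have "\<dots> = 0" using assms by (simp add: sum_subtractf)
  finally show ?thesis using assms(1) by (simp add: sl_carrier)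
qed

lemma takiff_tensor_closed:
  assumes "A \<in> carrier (sl n)"
  shows "takiff_tensor r (sl n) A a \<in> carrier (slt n r)"
proof -
  interpret S: Module.module class_ring "sl n" by (rule sl_span)
  show ?thesis using assms by (auto simp: takiff_tensor_def takiff_def)
qed

lemma unit_tensor_closed: "n \<ge> 1 \<Longrightarrow> i < n \<Longrightarrow> j < n \<Longrightarrow> unit_tensor n r i j a \<in> carrier (slt n r)"
  unfolding unit_tensor_def by (intro takiff_tensor_closed traceless_unit_in_sl)

text \<open>Scalar matrices are central, so the left side is the bracket of the matrix units. On the
  right the scalar corrections occur only if both terms are present and diagonal, and then they
  cancel.\<close>

lemma unit_tensor_bracket:
  assumes n: "n \<ge> 1" and ij: "i < n" "j < n" "k < n" "l < n" and c: "c < r" "p < n" "q < n"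
  shows "lie_bracket (slt n r) (unit_tensor n r i j a) (unit_tensor n r k l b) c $$ (p, q) =
    (if j = k then unit_tensor n r i l (a + b) c $$ (p, q) else 0) - (if l = i then unit_tensor n r k j (a + b) c $$ (p, q) else 0)"
proof -
  define \<alpha> where "\<alpha> = (if i = j then 1 / of_nat n else 0 :: complex)"
  define \<beta> where "\<beta> = (if k = l then 1 / of_nat n else 0 :: complex)"
  define X where "X p m = (if p = i \<and> m = j then 1 else 0 :: complex)" for p m
  define Y where "Y p m = (if p = k \<and> m = l then 1 else 0 :: complex)" for p m
  define D where "D p m = (if p = m then 1 else 0 :: complex)" for p m :: nat
  have D: "(\<Sum>m<n. D p m * g m) = g p" "(\<Sum>m<n. g m * D m q) = g q" for g
    using c by (simp_all add: D_def if_distrib[of "\<lambda>x. x * _"] if_distrib[of "\<lambda>x. _ * x"] cong: if_cong)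
  have XY: "(\<Sum>m<n. X p m * Y m q) = (if j = k \<and> p = i \<and> q = l then 1 else 0)"
    "(\<Sum>m<n. Y p m * X m q) = (if l = i \<and> p = k \<and> q = j then 1 else 0)"
  proof -
    have "(\<Sum>m<n. X p m * Y m q) = (\<Sum>m<n. if m = j then (if j = k \<and> p = i \<and> q = l then 1 else 0) else 0)"
      by (rule sum.cong) (auto simp: X_def Y_def)
    then show "(\<Sum>m<n. X p m * Y m q) = (if j = k \<and> p = i \<and> q = l then 1 else 0)" using ij by simp
    have "(\<Sum>m<n. Y p m * X m q) = (\<Sum>m<n. if m = l then (if l = i \<and> p = k \<and> q = j then 1 else 0) else 0)"
      by (rule sum.cong) (auto simp: X_def Y_def)
    then show "(\<Sum>m<n. Y p m * X m q) = (if l = i \<and> p = k \<and> q = j then 1 else 0)" using ij by simp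
  qed
  have prod: "(\<Sum>m<n. (x p m - s * D p m) * (y m q - t * D m q)) =
      (\<Sum>m<n. x p m * y m q) - t * x p q - s * y p q + s * t * D p q" for x y and s t
  proof -
    have "(\<Sum>m<n. (x p m - s * D p m) * (y m q - t * D m q)) =
       (\<Sum>m<n. x p m * y m q - t * (x p m * D m q) - s * (D p m * y m q) + s * t * (D p m * D m q))"
      by (rule sum.cong) (simp_all add: algebra_simps)
    then show ?thesis
      by (simp add: sum.distrib sum_subtractf D flip: sum_distrib_left)
  qed
  have ind: "unit_tensor n r i j a d $$ (u, v) = (if d = a \<and> a < r then X u v - \<alpha> * D u v else 0)"
    "unit_tensor n r k l b d $$ (u, v) = (if d = b \<and> b < r then Y u v - \<beta> * D u v else 0)" if "u < n" "v < n" for d u v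
    using that by (auto simp: unit_tensor_index X_def Y_def D_def \<alpha>_def \<beta>_def)
  have "lie_bracket (slt n r) (unit_tensor n r i j a) (unit_tensor n r k l b) c $$ (p, q) =
     (\<Sum>d\<le>c. if d = a then (if c = a + b then
        (\<Sum>m<n. (X p m - \<alpha> * D p m) * (Y m q - \<beta> * D m q)) - (\<Sum>m<n. (Y p m - \<beta> * D p m) * (X m q - \<alpha> * D m q)) else 0) else 0)"
    unfolding slt_bracket(2)[OF unit_tensor_closed[OF n ij(1,2)] unit_tensor_closed[OF n ij(3,4)] c]
  proof (rule sum.cong[OF refl])
    fix d assume d: "d \<in> {..c}"
    have *: "c = a + b \<longleftrightarrow> c - d = b" if "d = a" using that d by auto
    show "(\<Sum>m<n. unit_tensor n r i j a d $$ (p, m) * unit_tensor n r k l b (c - d) $$ (m, q) - unit_tensor n r k l b (c - d) $$ (p, m) * unit_tensor n r i j a d $$ (m, q)) =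
      (if d = a then (if c = a + b then
        (\<Sum>m<n. (X p m - \<alpha> * D p m) * (Y m q - \<beta> * D m q)) - (\<Sum>m<n. (Y p m - \<beta> * D p m) * (X m q - \<alpha> * D m q)) else 0) else 0)"
    proof (cases "d = a \<and> c - d = b")
      case True
      moreover have "a < r" "b < r" using True c d by auto
      ultimately show ?thesis using * c d by (simp add: ind sum_subtractf)
    next
      case False
      then have "unit_tensor n r i j a d $$ (p, m) * unit_tensor n r k l b (c - d) $$ (m, q) - unit_tensor n r k l b (c - d) $$ (p, m) * unit_tensor n r i j a d $$ (m, q) = 0"
        if "m < n" for m using c that by (auto simp: ind)
      then show ?thesis using False * by auto
    qed
  qed
  also have "\<dots> = (if c = a + b then (\<Sum>m<n. (X p m - \<alpha> * D p m) * (Y m q - \<beta> * D m q)) - (\<Sum>m<n. (Y p m - \<beta> * D p m) * (X m q - \<alpha> * D m q)) else 0)"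
    by (simp add: sum.delta)
  also have "\<dots> = (if c = a + b then (if j = k \<and> p = i \<and> q = l then 1 else 0) - (if l = i \<and> p = k \<and> q = j then 1 else 0) else 0)"
    by (simp add: prod XY)
  also have "\<dots> = (if j = k then unit_tensor n r i l (a + b) c $$ (p, q) else 0) - (if l = i then unit_tensor n r k j (a + b) c $$ (p, q) else 0)"
    using c by (auto simp: unit_tensor_index)
  finally show ?thesis .
qed

section \<open>Normal forms modulo the defining relations\<close>

text \<open>A projection of \<open>C\<close> along \<open>Z\<close> onto a complement, extended
  linearly to the whole space. Choosing linear representatives lets C/Z be treated inside the given
  type, where the abstract theory of current modules applies. It is built from a basis of
  \<open>Z\<close> extended to one of \<open>C\<close>.\<close>

lemma (in vector_space) exists_linear_reduction:
  assumes Z: "subspace Z" and C: "subspace C" and ZC: "Z \<subseteq> C"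
  shows "\<exists>nf. (\<forall>u v. nf (u + v) = nf u + nf v) \<and> (\<forall>c u. nf (scale c u) = scale c (nf u)) \<and>
    (\<forall>u. nf u \<in> C) \<and> (\<forall>u\<in>C. u - nf u \<in> Z) \<and> (\<forall>u\<in>Z. nf u = 0) \<and> (\<forall>u. nf (nf u) = nf u)"
proof -
  interpret vp: vector_space_pair scale scale ..
  obtain B where B: "B \<subseteq> Z" "independent B" "Z \<subseteq> span B" by (rule maximal_independent_subset)
  obtain B' where B': "B \<subseteq> B'" "B' \<subseteq> C" "independent B'" "C \<subseteq> span B'"
    using B ZC by (rule_tac maximal_independent_subset_extend[of B C]) auto
  let ?g = "\<lambda>b. if b \<in> B then 0 else b"
  let ?nf = "vp.construct B' ?g"
  interpret nf: Vector_Spaces.linear scale scale ?nf by (rule vp.linear_construct[OF B'(3)])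
  have range: "?nf u \<in> C" for u
  proof -
    have "?g ` B' \<subseteq> C" using B'(2) subspace_0[OF C] by auto
    then have "span (?g ` B') \<subseteq> C" by (rule span_minimal[OF _ C])
    then show ?thesis using vp.construct_in_span[OF B'(3)] by blast
  qed
  moreover have "?nf u = 0" if "u \<in> Z" for u
  proof -
    have "u \<in> span B" using that B(3) by blast
    then show ?thesis
    proof (induction rule: span_induct_alt)
      case base
      show ?case by (rule nf.zero)
    next
      case (step c b v)
      have "?nf b = ?g b" by (rule vp.construct_basis[OF B'(3)]) (use step B'(1) in auto)
      then show ?case using step by (simp add: nf.add nf.scale)
    qed
  qed
  moreover have "u - ?nf u \<in> Z" if "u \<in> C" for u
  proof -
    have "u \<in> span B'" using that B'(4) by blast
    then show ?thesis
    proof (induction rule: span_induct_alt)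
      case base
      show ?case by (simp add: nf.zero subspace_0[OF Z])
    next
      case (step c b v)
      have "?nf b = ?g b" by (rule vp.construct_basis[OF B'(3) step(1)])
      then have "b - ?nf b \<in> Z" using B(1) subspace_0[OF Z] by auto
      then have "scale c (b - ?nf b) + (v - ?nf v) \<in> Z"
        using subspace_add[OF Z subspace_scale[OF Z] step(2)] by blast
      moreover have "scale c b + v - ?nf (scale c b + v) = scale c (b - ?nf b) + (v - ?nf v)"
        by (simp add: nf.add nf.scale algebra_simps)
      ultimately show ?case by (simp only:)
    qed
  qed
  moreover have "?nf (?nf u) = ?nf u" for u
    using vp.construct_in_span[OF B'(3), of ?g u]
  proof (induction rule: span_induct_alt)
    case base
    show ?case by (rule nf.zero)
  next
    case (step c b v)
    then obtain b' where "b' \<in> B'" "b = ?g b'" by blast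
    then have "?nf b = b" using vp.construct_basis[OF B'(3), of b' ?g] nf.zero by auto
    then show ?case using step(2) by (simp only: nf.add nf.scale)
  qed
  ultimately show ?thesis using nf.add nf.scale by (intro exI[of _ ?nf]) blast
qed

context lie_presentation
begin

definition nf :: "('l list \<Rightarrow> complex) \<Rightarrow> 'l list \<Rightarrow> complex" where
  "nf = (SOME nf. (\<forall>u v. nf (u + v) = nf u + nf v) \<and> (\<forall>c u. nf (vscale c u) = vscale c (nf u)) \<and>
    (\<forall>u. nf u \<in> carrier F) \<and> (\<forall>u\<in>carrier F. u - nf u \<in> Z) \<and> (\<forall>u\<in>Z. nf u = 0) \<and>
    (\<forall>u. nf (nf u) = nf u))"

lemma carrier_subspace: "fun_space.subspace (carrier F)"
  by (rule fun_space.subspaceI) (auto intro: free_algebra_carrier)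

lemma nf_add: "nf (u + v) = nf u + nf v"
  and nf_scale: "nf (vscale c u) = vscale c (nf u)"
  and nf_carrier: "nf u \<in> carrier F"
  and nf_diff_in_Z: "f \<in> carrier F \<Longrightarrow> f - nf f \<in> Z"
  and nf_Z: "f \<in> Z \<Longrightarrow> nf f = 0"
  and nf_nf [simp]: "nf (nf f) = nf f"
proof -
  have "Z \<subseteq> carrier F" using Z_carrier by blast
  note * = someI_ex[OF fun_space.exists_linear_reduction[OF Z_subspace carrier_subspace this], folded nf_def]
  show "nf (u + v) = nf u + nf v" using * by blast
  show "nf (vscale c u) = vscale c (nf u)" using * by blast
  show "nf u \<in> carrier F" using * by blast
  show "f - nf f \<in> Z" if "f \<in> carrier F" using * that by blast
  show "nf f = 0" if "f \<in> Z" using * that by blast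
  show "nf (nf f) = nf f" using * by blast
qed

lemma nf_zero [simp]: "nf 0 = 0"
  using nf_scale[of 0 0] by simp

lemma nf_diff: "nf (u - v) = nf u - nf v"
  using nf_add[of "u - v" v] by (simp add: algebra_simps)

lemma nf_eqI: "f - g \<in> Z \<Longrightarrow> nf f = nf g"
  using nf_Z[of "f - g"] by (simp add: nf_diff)

text \<open>The action on the cyclic module, transported to normal forms of representatives.\<close>
definition nf_act :: "'l \<Rightarrow> ('l list \<Rightarrow> complex) \<Rightarrow> 'l list \<Rightarrow> complex" where
  "nf_act x e = nf (word_lmult x (nf e))"

lemma nf_act_linear:
  "nf_act x (u + v) = nf_act x u + nf_act x v" "nf_act x (vscale c u) = vscale c (nf_act x u)"
  "nf_act x 0 = 0" "nf_act x (nf u) = nf_act x u" "nf (nf_act x u) = nf_act x u"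
  by (simp_all add: nf_act_def nf_add nf_scale word_lmult_linear)

lemma nf_lmult:
  assumes "x \<in> carrier L" "f \<in> carrier F"
  shows "nf (word_lmult x f) = nf_act x f"
  unfolding nf_act_def
  using Z_lmult[OF assms(1) nf_diff_in_Z[OF assms(2)]] by (intro nf_eqI) (simp add: word_lmult_linear)

lemma nf_act_rep:
  assumes "x \<in> carrier L" "y \<in> carrier L"
  shows "nf_act (x \<oplus>\<^bsub>L\<^esub> y) e = nf_act x e + nf_act y e"
    and "nf_act (c \<odot>\<^bsub>L\<^esub> x) e = vscale c (nf_act x e)"
    and "nf_act (lie_bracket L x y) e = nf_act x (nf_act y e) - nf_act y (nf_act x e)"
proof -
  note Z = Z_lie_relations[OF assms nf_carrier[of e]]
  show "nf_act (x \<oplus>\<^bsub>L\<^esub> y) e = nf_act x e + nf_act y e"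
    using nf_eqI[OF Z(1)] by (simp add: nf_act_def nf_add)
  show "nf_act (c \<odot>\<^bsub>L\<^esub> x) e = vscale c (nf_act x e)"
    using nf_eqI[OF Z(2)] by (simp add: nf_act_def nf_scale)
  have "nf (word_lmult x (word_lmult y (nf e))) = nf_act x (nf_act y e)" if "x \<in> carrier L" "y \<in> carrier L" for x y
  proof -
    have "nf (word_lmult x (word_lmult y (nf e))) = nf_act x (word_lmult y (nf e))"
      using that by (intro nf_lmult) (auto intro: free_algebra_carrier nf_carrier)
    then show ?thesis using nf_act_linear(4)[of x "word_lmult y (nf e)"] by (simp add: nf_act_def)
  qed
  then show "nf_act (lie_bracket L x y) e = nf_act x (nf_act y e) - nf_act y (nf_act x e)"
    using nf_eqI[OF Z(3)] assms by (simp add: nf_diff) (simp add: nf_act_def)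
qed

lemma nf_power:
  assumes "x \<in> carrier L"
  shows "nf ((word_lmult x ^^ p) word_one) = (nf_act x ^^ p) (nf word_one)"
proof (induction p)
  case (Suc p)
  have "nf ((word_lmult x ^^ Suc p) word_one) = nf_act x ((word_lmult x ^^ p) word_one)"
    using nf_lmult[OF assms] uea_emb_power[OF assms, of p] by simp
  also have "\<dots> = nf_act x (nf ((word_lmult x ^^ p) word_one))" by (simp add: nf_act_linear)
  finally show ?case using Suc by simp
qed simp

end

section \<open>The defining relations lifted to the free algebra\<close>

definition weyl_coset :: "nat \<Rightarrow> nat \<Rightarrow> ((nat \<Rightarrow> complex mat) list \<Rightarrow> complex) \<Rightarrow> ((nat \<Rightarrow> complex mat) list \<Rightarrow> complex) set" where
  "weyl_coset n r f = uea_ideal (slt n r) +>\<^bsub>free_algebra (carrier (slt n r))\<^esub> f"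

lemma takiff_n_plus_subset:
  assumes "n \<ge> 1" "x \<in> carrier (takiff r (n_plus n))"
  shows "x \<in> carrier (slt n r)" "q \<le> p \<Longrightarrow> p < n \<Longrightarrow> x k $$ (p, q) = 0"
proof -
  have z: "\<zero>\<^bsub>n_plus n\<^esub> = 0\<^sub>m n n" by (simp add: n_plus_def gl_def)
  have x: "x k \<in> carrier_mat n n \<and> (\<forall>p<n. \<forall>q\<le>p. x k $$ (p, q) = 0)" if "k < r" for k
    by (rule n_plus_facts(1)) (use assms(2) that in \<open>simp add: takiff_def\<close>)
  have x0: "x k = 0\<^sub>m n n" if "k \<ge> r" for k using assms(2) that z by (simp add: takiff_def)
  show "x k $$ (p, q) = 0" if "q \<le> p" "p < n"
    using x[of k] x0[of k] that by (cases "k < r") auto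
  have "x k \<in> carrier_mat n n" for k using x[of k] x0[of k] by (cases "k < r") auto
  then show "x \<in> carrier (slt n r)" using x x0 by (simp add: slt_carrier[OF assms(1)])
qed

lemma slt_eqI:
  assumes "n \<ge> 1" "x \<in> carrier (slt n r)" "y \<in> carrier (slt n r)"
    and "\<And>k p q. k < r \<Longrightarrow> p < n \<Longrightarrow> q < n \<Longrightarrow> x k $$ (p, q) = y k $$ (p, q)"
  shows "x = y"
proof
  fix k
  have "x k \<in> carrier_mat n n" "y k \<in> carrier_mat n n" using assms(1-3) by (simp_all add: slt_carrier)
  moreover have "k \<ge> r \<Longrightarrow> x k = y k" using assms(1-3) by (simp add: slt_carrier)
  ultimately show "x k = y k" using assms(4)[of k] by (cases "k < r") (auto intro!: eq_matI)
qed

lemma takiff_mat_unit: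
  assumes "i \<noteq> j"
  shows "takiff_tensor r (sl n) (mat_unit n i j) a = unit_tensor n r i j a"
proof -
  have "mat_unit n i j = traceless_unit n i j" by (rule eq_matI) (use assms in \<open>auto simp: traceless_unit_def\<close>)
  then show ?thesis by (simp add: unit_tensor_def)
qed

lemma coroot_closed:
  assumes "Suc i < n"
  shows "takiff_tensor r (sl n) (coroot n i) a \<in> carrier (slt n r)"
proof (rule takiff_tensor_closed)
  have "(\<Sum>p<n. coroot n i $$ (p, p)) = (\<Sum>p<n. (if p = i then 1 else 0) - (if p = Suc i then 1 else 0))"
    unfolding coroot_def by (rule sum.cong[OF refl], subst index_minus_mat(1)) auto
  then have "(\<Sum>p<n. coroot n i $$ (p, p)) = 0" using assms by (simp add: sum_subtractf)
  then show "coroot n i \<in> carrier (sl n)"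
    using assms by (simp add: sl_carrier coroot_def minus_carrier_mat)
qed

lemma weyl_relations_eq:
  assumes "n \<ge> 1"
  shows "weyl_relations n r lam =
     {weyl_coset n r (letter x) | x. x \<in> carrier (takiff r (n_plus n))}
   \<union> {weyl_coset n r (letter (takiff_tensor r (sl n) (coroot n i) j) - vscale (if j = 0 then of_nat (lam i) else 0) word_one)
       | i j. i < n - 1 \<and> j < r}
   \<union> {weyl_coset n r ((word_lmult (unit_tensor n r (Suc i) i 0) ^^ (lam i + 1)) word_one) | i. i < n - 1}"
    and "weyl_relations n r lam \<subseteq> carrier (uea (slt n r))"
proof -
  \<comment> \<open>The empty set of relations is used, since it is one of the claims that the Weyl
    relations lie in the enveloping algebra.\<close>
  interpret P: lie_presentation "slt n r" "{}"
    by unfold_locales (auto intro: slt_closed slt_bracket)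
  have 2: "uea_emb (slt n r) (takiff_tensor r (sl n) (coroot n i) j)
        \<ominus>\<^bsub>P.U\<^esub> (c \<odot>\<^bsub>P.U\<^esub> \<one>\<^bsub>P.U\<^esub>) =
      weyl_coset n r (letter (takiff_tensor r (sl n) (coroot n i) j) - vscale c word_one) \<and>
      letter (takiff_tensor r (sl n) (coroot n i) j) - vscale c word_one \<in> carrier P.F"
    if "i < n - 1" for i j c
  proof -
    have l: "letter (takiff_tensor r (sl n) (coroot n i) j) \<in> carrier P.F"
      using that by (intro free_algebra_carrier coroot_closed) simp
    have o: "vscale c word_one \<in> carrier P.F" by (intro free_algebra_carrier)
    show ?thesis
      unfolding weyl_coset_def P.uea_emb_eq P.U_one P.U_smult[OF free_algebra_carrier(1)]
      unfolding P.U_eq P.qF.Q_minus[OF l o] free_algebra_a_minus[OF l o]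
      using free_algebra_carrier(6)[OF l o] by simp
  qed
  have 3: "uea_emb (slt n r) (takiff_tensor r (sl n) (mat_unit n (Suc i) i) 0) [^]\<^bsub>P.U\<^esub> k =
      weyl_coset n r ((word_lmult (unit_tensor n r (Suc i) i 0) ^^ k) word_one) \<and>
      (word_lmult (unit_tensor n r (Suc i) i 0) ^^ k) word_one \<in> carrier P.F" if "i < n - 1" for i k
    using P.uea_emb_power[OF unit_tensor_closed[OF assms, of "Suc i" i r 0], of k] that
    by (simp add: takiff_mat_unit weyl_coset_def)
  show eq: "weyl_relations n r lam =
     {weyl_coset n r (letter x) | x. x \<in> carrier (takiff r (n_plus n))}
   \<union> {weyl_coset n r (letter (takiff_tensor r (sl n) (coroot n i) j) - vscale (if j = 0 then of_nat (lam i) else 0) word_one)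
       | i j. i < n - 1 \<and> j < r}
   \<union> {weyl_coset n r ((word_lmult (unit_tensor n r (Suc i) i 0) ^^ (lam i + 1)) word_one) | i. i < n - 1}"
  proof -
    have a: "{uea_emb (slt n r) x | x. x \<in> carrier (takiff r (n_plus n))} =
        {weyl_coset n r (letter x) | x. x \<in> carrier (takiff r (n_plus n))}"
      by (simp add: P.uea_emb_eq weyl_coset_def)
    have b: "{uea_emb (slt n r) (takiff_tensor r (sl n) (coroot n i) j)
        \<ominus>\<^bsub>P.U\<^esub> ((if j = 0 then of_nat (lam i) else 0) \<odot>\<^bsub>P.U\<^esub> \<one>\<^bsub>P.U\<^esub>) | i j. i < n - 1 \<and> j < r} =
       {weyl_coset n r (letter (takiff_tensor r (sl n) (coroot n i) j) - vscale (if j = 0 then of_nat (lam i) else 0) word_one)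
       | i j. i < n - 1 \<and> j < r}"
      by (intro Collect_cong ex_cong1) (rule iffI; elim conjE; simp only: 2[THEN conjunct1] simp_thms)
    have c: "{uea_emb (slt n r) (takiff_tensor r (sl n) (mat_unit n (Suc i) i) 0) [^]\<^bsub>P.U\<^esub> (lam i + 1) | i. i < n - 1} =
       {weyl_coset n r ((word_lmult (unit_tensor n r (Suc i) i 0) ^^ (lam i + 1)) word_one) | i. i < n - 1}"
      by (intro Collect_cong ex_cong1) (rule iffI; elim conjE; simp only: 3[THEN conjunct1] simp_thms)
    show ?thesis unfolding weyl_relations_def Let_def a b c ..
  qed
  have "letter x \<in> carrier P.F" if "x \<in> carrier (takiff r (n_plus n))" for x
    using that takiff_n_plus_subset[OF assms] by (intro free_algebra_carrier)
  then show "weyl_relations n r lam \<subseteq> carrier (uea (slt n r))"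
    unfolding eq P.U_carrier weyl_coset_def using 2 3 by blast
qed

section \<open>The local Weyl module\<close>

locale takiff_weyl =
  fixes n r :: nat and \<xi> :: "nat \<Rightarrow> nat"
  assumes n_ge: "n \<ge> 2" and r_ge: "r \<ge> 1" and partition: "\<xi> \<in> partitions n r"
begin

lemma n_pos: "n \<ge> 1"
  using n_ge by simp

sublocale lie_presentation "slt n r" "weyl_relations n r (part_weight \<xi>)"
  by unfold_locales
     (auto intro: slt_closed slt_bracket weyl_relations_eq(2)[OF n_pos, THEN subsetD])

lemma nf_relation: "f \<in> carrier F \<Longrightarrow> weyl_coset n r f \<in> weyl_relations n r (part_weight \<xi>) \<Longrightarrow> nf f = 0"
  unfolding weyl_coset_def by (intro nf_Z Z_relation)

lemma nf_act_word_one: "x \<in> carrier (slt n r) \<Longrightarrow> nf_act x (nf word_one) = nf (letter x)"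
  by (simp add: nf_act_def letter_eq nf_lmult free_algebra_carrier)

lemma nf_relations:
  shows "x \<in> carrier (takiff r (n_plus n)) \<Longrightarrow> nf_act x (nf word_one) = 0"
    and "Suc i < n \<Longrightarrow> j < r \<Longrightarrow> nf_act (takiff_tensor r (sl n) (coroot n i) j) (nf word_one) =
      vscale (if j = 0 then of_nat (part_weight \<xi> i) else 0) (nf word_one)"
    and "Suc i < n \<Longrightarrow> (nf_act (unit_tensor n r (Suc i) i 0) ^^ (part_weight \<xi> i + 1)) (nf word_one) = 0"
proof -
  note eq = weyl_relations_eq(1)[OF n_pos]
  show "nf_act x (nf word_one) = 0" if x: "x \<in> carrier (takiff r (n_plus n))"
  proof -
    note xL = takiff_n_plus_subset(1)[OF n_pos x]
    have "weyl_coset n r (letter x) \<in> weyl_relations n r (part_weight \<xi>)"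
      unfolding eq using x by blast
    then have "nf (letter x) = 0" using xL by (intro nf_relation free_algebra_carrier)
    then show ?thesis by (simp add: nf_act_word_one[OF xL])
  qed
  show "nf_act (takiff_tensor r (sl n) (coroot n i) j) (nf word_one) =
      vscale (if j = 0 then of_nat (part_weight \<xi> i) else 0) (nf word_one)" if ij: "Suc i < n" "j < r"
  proof -
    let ?h = "takiff_tensor r (sl n) (coroot n i) j"
    let ?c = "if j = 0 then of_nat (part_weight \<xi> i) else 0 :: complex"
    have "i < n - 1" using ij by simp
    then have "weyl_coset n r (letter ?h - vscale ?c word_one) \<in> weyl_relations n r (part_weight \<xi>)"
      unfolding eq using ij(2) by blast
    then have "nf (letter ?h - vscale ?c word_one) = 0"
      by (intro nf_relation free_algebra_carrier coroot_closed ij(1))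
    then show ?thesis by (simp add: nf_act_word_one[OF coroot_closed[OF ij(1)]] nf_diff nf_scale)
  qed
  show "(nf_act (unit_tensor n r (Suc i) i 0) ^^ (part_weight \<xi> i + 1)) (nf word_one) = 0" if i: "Suc i < n"
  proof -
    have u: "unit_tensor n r (Suc i) i 0 \<in> carrier (slt n r)" using i n_pos by (intro unit_tensor_closed) auto
    have "i < n - 1" using i by simp
    then have "weyl_coset n r ((word_lmult (unit_tensor n r (Suc i) i 0) ^^ (part_weight \<xi> i + 1)) word_one) \<in> weyl_relations n r (part_weight \<xi>)"
      unfolding eq by blast
    from nf_relation[OF conjunct2[OF uea_emb_power[OF u]] this] show ?thesis by (simp only: nf_power[OF u])
  qed
qed

lemma nf_act_combination:
  assumes "finite S" "\<And>s. s \<in> S \<Longrightarrow> h s \<in> carrier (slt n r)"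
  shows "\<exists>z\<in>carrier (slt n r). (\<forall>k<r. \<forall>p<n. \<forall>q<n. z k $$ (p, q) = (\<Sum>s\<in>S. c s * h s k $$ (p, q))) \<and>
    (\<forall>e. nf_act z e = (\<Sum>s\<in>S. vscale (c s) (nf_act (h s) e)))"
  using assms
proof (induction S rule: finite_induct)
  case empty
  let ?z = "\<lambda>k. 0\<^sub>m n n :: complex mat"
  have z: "?z \<in> carrier (slt n r)" by (simp add: slt_carrier[OF n_pos])
  have "0 \<odot>\<^bsub>slt n r\<^esub> ?z = ?z" by (simp add: slt_simps)
  then have "nf_act ?z e = 0" for e using nf_act_rep(2)[OF z z, of 0 e] by simp
  then show ?case using z by (intro bexI[of _ ?z]) auto
next
  case (insert t S)
  then obtain z where z: "z \<in> carrier (slt n r)" "\<And>k p q. k < r \<Longrightarrow> p < n \<Longrightarrow> q < n \<Longrightarrow> z k $$ (p, q) = (\<Sum>s\<in>S. c s * h s k $$ (p, q))"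
    "\<And>e. nf_act z e = (\<Sum>s\<in>S. vscale (c s) (nf_act (h s) e))"
    by auto
  have t: "h t \<in> carrier (slt n r)" using insert.prems by simp
  have ct: "c t \<odot>\<^bsub>slt n r\<^esub> h t \<in> carrier (slt n r)" by (rule slt_closed(2)[OF t])
  have car: "z k \<in> carrier_mat n n" "h t k \<in> carrier_mat n n" for k
    using z(1) t by (auto simp: slt_carrier[OF n_pos])
  show ?case
  proof (intro bexI conjI allI impI)
    show "(c t \<odot>\<^bsub>slt n r\<^esub> h t) \<oplus>\<^bsub>slt n r\<^esub> z \<in> carrier (slt n r)" by (rule slt_closed(1)[OF ct z(1)])
    show "((c t \<odot>\<^bsub>slt n r\<^esub> h t) \<oplus>\<^bsub>slt n r\<^esub> z) k $$ (p, q) = (\<Sum>s\<in>insert t S. c s * h s k $$ (p, q))"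
      if "k < r" "p < n" "q < n" for k p q
      using car[of k] that insert.hyps by (simp add: slt_simps z(2))
    show "nf_act ((c t \<odot>\<^bsub>slt n r\<^esub> h t) \<oplus>\<^bsub>slt n r\<^esub> z) e = (\<Sum>s\<in>insert t S. vscale (c s) (nf_act (h s) e))" for e
      using insert.hyps by (simp add: nf_act_rep(1)[OF ct z(1)] nf_act_rep(2)[OF t t] z(3))
  qed
qed

lemma nf_act_eq_sum:
  assumes "x \<in> carrier (slt n r)" "finite S" "\<And>s. s \<in> S \<Longrightarrow> h s \<in> carrier (slt n r)"
    and "\<And>k p q. k < r \<Longrightarrow> p < n \<Longrightarrow> q < n \<Longrightarrow> x k $$ (p, q) = (\<Sum>s\<in>S. c s * h s k $$ (p, q))"
  shows "nf_act x e = (\<Sum>s\<in>S. vscale (c s) (nf_act (h s) e))"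
proof -
  obtain z where z: "z \<in> carrier (slt n r)" "\<And>k p q. k < r \<Longrightarrow> p < n \<Longrightarrow> q < n \<Longrightarrow> z k $$ (p, q) = (\<Sum>s\<in>S. c s * h s k $$ (p, q))"
    "nf_act z e = (\<Sum>s\<in>S. vscale (c s) (nf_act (h s) e))"
    using nf_act_combination[where h = h and c = c, OF assms(2,3)] by blast
  have "x = z" by (rule slt_eqI[OF n_pos assms(1) z(1)]) (simp add: assms(4) z(2))
  then show ?thesis using z(3) by simp
qed

lemma unit_closed: "i < n \<Longrightarrow> j < n \<Longrightarrow> unit_tensor n r i j a \<in> carrier (slt n r)"
  by (rule unit_tensor_closed[OF n_pos])

lemma nf_act_expand:
  assumes x: "x \<in> carrier (slt n r)"
  shows "nf_act x e = (\<Sum>(a, i, j)\<in>{..<r} \<times> {..<n} \<times> {..<n}. vscale (x a $$ (i, j)) (nf_act (unit_tensor n r i j a) e))"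
proof -
  let ?S = "{..<r} \<times> {..<n} \<times> {..<n}"
  have "nf_act x e = (\<Sum>t\<in>?S. vscale (x (fst t) $$ snd t) (nf_act (unit_tensor n r (fst (snd t)) (snd (snd t)) (fst t)) e))"
  proof (rule nf_act_eq_sum[OF x])
    show "finite ?S" by simp
    fix k p q assume kpq: "k < r" "p < n" "q < n"
    \<comment> \<open>The scalar parts of the traceless units add up to a multiple of this trace, so
      they leave the expansion unchanged.\<close>
    have tr: "(\<Sum>i<n. x k $$ (i, i)) = 0" using x kpq(1) by (simp add: slt_carrier[OF n_pos])
    have "(\<Sum>t\<in>?S. x (fst t) $$ snd t * unit_tensor n r (fst (snd t)) (snd (snd t)) (fst t) k $$ (p, q)) =
       (\<Sum>a<r. \<Sum>i<n. \<Sum>j<n. x a $$ (i, j) * unit_tensor n r i j a k $$ (p, q))"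
      by (simp add: sum.cartesian_product case_prod_beta)
    also have "\<dots> = (\<Sum>a<r. if a = k then (\<Sum>i<n. \<Sum>j<n. (if j = q then if i = p then x k $$ (p, q) else 0 else 0)
          - (if i = j then x k $$ (i, i) * (if p = q then 1 / of_nat n else 0) else 0)) else 0)"
    proof (rule sum.cong[OF refl])
      fix a assume "a \<in> {..<r}"
      show "(\<Sum>i<n. \<Sum>j<n. x a $$ (i, j) * unit_tensor n r i j a k $$ (p, q)) =
        (if a = k then (\<Sum>i<n. \<Sum>j<n. (if j = q then if i = p then x k $$ (p, q) else 0 else 0)
          - (if i = j then x k $$ (i, i) * (if p = q then 1 / of_nat n else 0) else 0)) else 0)"
      proof (cases "a = k")
        case True
        show ?thesis unfolding if_P[OF True]
          by (rule sum.cong[OF refl], rule sum.cong[OF refl])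
             (use kpq True in \<open>auto simp: unit_tensor_index algebra_simps\<close>)
      next
        case False
        then show ?thesis using kpq by (simp add: unit_tensor_index)
      qed
    qed
    also have "\<dots> = x k $$ (p, q) - (\<Sum>i<n. x k $$ (i, i)) * (if p = q then 1 / of_nat n else 0)"
      using kpq by (simp add: sum_subtractf sum_distrib_right)
    finally show "x k $$ (p, q) = (\<Sum>t\<in>?S. x (fst t) $$ snd t * unit_tensor n r (fst (snd t)) (snd (snd t)) (fst t) k $$ (p, q))"
      using tr by simp
  qed (auto intro: unit_closed)
  then show ?thesis by (simp add: case_prod_beta)
qed

lemma nf_act_unit_commutator:
  assumes "i < n" "j < n" "k < n" "l < n"
  shows "nf_act (unit_tensor n r i j a) (nf_act (unit_tensor n r k l b) e)
      - nf_act (unit_tensor n r k l b) (nf_act (unit_tensor n r i j a) e) =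
    (if j = k then nf_act (unit_tensor n r i l (a + b)) e else 0)
      - (if l = i then nf_act (unit_tensor n r k j (a + b)) e else 0)"
proof -
  note u = unit_closed[OF assms(1,2), of a] unit_closed[OF assms(3,4), of b]
  have "nf_act (lie_bracket (slt n r) (unit_tensor n r i j a) (unit_tensor n r k l b)) e =
    (\<Sum>s\<in>{0, 1 :: nat}. vscale (if s = 0 then if j = k then 1 else 0 else if l = i then -1 else 0)
       (nf_act (if s = 0 then unit_tensor n r i l (a + b) else unit_tensor n r k j (a + b)) e))"
  proof (rule nf_act_eq_sum)
    show "lie_bracket (slt n r) (unit_tensor n r i j a) (unit_tensor n r k l b) \<in> carrier (slt n r)"
      by (rule slt_bracket(1)[OF u])
  qed (use assms in \<open>auto simp: unit_tensor_bracket[OF n_pos] intro: unit_closed\<close>)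
  then show ?thesis
    unfolding nf_act_rep(3)[OF u] by (auto simp: vscale_def fun_eq_iff fun_apply)
qed

text \<open>The eigenvalue of the identity matrix, by which the action of \<open>sl\<close> is extended to \<open>gl\<close>.\<close>
definition level :: complex where
  "level = (\<Sum>p<n. of_nat (\<xi> p)) / of_nat n"

text \<open>The scalar is added in degree 0 only, so the identity matrix times a positive power of t
  acts by zero. This agrees with its action on the submodule generated by \<open>y\<close>.\<close>

definition A :: "nat \<Rightarrow> nat \<Rightarrow> nat \<Rightarrow> ((nat \<Rightarrow> complex mat) list \<Rightarrow> complex) \<Rightarrow> (nat \<Rightarrow> complex mat) list \<Rightarrow> complex" where
  "A i j a e = nf_act (unit_tensor n r i j a) e + vscale (if i = j \<and> a = 0 then level else 0) (nf e)"

lemma A_linear: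
  "A i j a (u + v) = A i j a u + A i j a v" "A i j a (vscale c u) = vscale c (A i j a u)"
  "A i j a 0 = 0" "A i j a (nf u) = A i j a u"
  by (simp_all add: A_def nf_act_linear nf_add nf_scale fun_space.scale_right_distrib mult.commute)

lemma A_commute:
  assumes "i < n" "j < n" "k < n" "l < n"
  shows "A i j a (A k l b u) = A k l b (A i j a u) + (if j = k then A i l (a + b) u else 0)
        - (if l = i then A k j (a + b) u else 0)"
proof -
  define s where "s = (if i = j \<and> a = 0 then level else 0)"
  define t where "t = (if k = l \<and> b = 0 then level else 0)"
  let ?X = "nf_act (unit_tensor n r i j a)"
  let ?Y = "nf_act (unit_tensor n r k l b)"
  have 1: "A i j a (A k l b u) = ?X (?Y u) + vscale t (?X u) + vscale s (?Y u) + vscale (s * t) (nf u)"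
    by (simp add: A_def nf_act_linear nf_add nf_scale fun_space.scale_right_distrib algebra_simps flip: s_def t_def)
  have 2: "A k l b (A i j a u) = ?Y (?X u) + vscale t (?X u) + vscale s (?Y u) + vscale (s * t) (nf u)"
    by (simp add: A_def nf_act_linear nf_add nf_scale fun_space.scale_right_distrib algebra_simps flip: s_def t_def)
  have 3: "(if j = k then A i l (a + b) u else 0) - (if l = i then A k j (a + b) u else 0) =
    (if j = k then nf_act (unit_tensor n r i l (a + b)) u else 0)
      - (if l = i then nf_act (unit_tensor n r k j (a + b)) u else 0)"
    by (auto simp: A_def)
  have "A i j a (A k l b u) - A k l b (A i j a u) = ?X (?Y u) - ?Y (?X u)"
    unfolding 1 2 by simp
  then show ?thesis
    unfolding nf_act_unit_commutator[OF assms] 3[symmetric] by (simp add: algebra_simps)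
qed

lemma nf_induct:
  assumes S: "fun_space.subspace S" and one: "nf word_one \<in> S"
    and A: "\<And>i j a u. i < n \<Longrightarrow> j < n \<Longrightarrow> u \<in> S \<Longrightarrow> A i j a u \<in> S"
    and "f \<in> carrier F"
  shows "nf f \<in> S"
  using assms(4)
proof (induction rule: free_algebra_induct)
  case (lmult x f)
  have "nf_act (unit_tensor n r i j a) (nf f) \<in> S" if "i < n" "j < n" for i j a
  proof -
    have "nf_act (unit_tensor n r i j a) (nf f) = A i j a (nf f) - vscale (if i = j \<and> a = 0 then level else 0) (nf f)"
      by (simp add: A_def)
    also have "\<dots> \<in> S"
      using A[OF that lmult(3)] lmult(3) fun_space.subspace_diff[OF S] fun_space.subspace_scale[OF S] by blast
    finally show ?thesis .
  qed
  then have "nf_act x (nf f) \<in> S"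
    unfolding nf_act_expand[OF lmult(1)]
    by (intro fun_space.subspace_sum[OF S]) (auto intro: fun_space.subspace_scale[OF S])
  then show ?case using nf_lmult[OF lmult(1,2)] by (simp add: nf_act_linear)
qed (auto simp: one nf_add nf_scale fun_space.subspace_0[OF S] fun_space.subspace_add[OF S] fun_space.subspace_scale[OF S])

text \<open>The relations give nilpotency on the generator only. It spreads because the bracket with
  f = E_(i+1,i) is nilpotent: on E_(k,l) it replaces k = i by i+1 or l = i+1 by i, and the number of
  replacements still possible is the measure of the outer induction.\<close>

lemma A_locally_nilpotent:
  assumes i: "Suc i < n"
  shows "\<exists>p. (A (Suc i) i 0 ^^ p) u = 0"
proof -
  let ?N = "A (Suc i) i 0"
  define S where "S = {v. \<exists>p. (?N ^^ p) v = 0}"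
  have lin: "(?N ^^ p) (u + v) = (?N ^^ p) u + (?N ^^ p) v" "(?N ^^ p) (vscale c u) = vscale c ((?N ^^ p) u)"
    "(?N ^^ p) 0 = 0" for p u v c
    by (induction p) (simp_all add: A_linear)
  have mono: "(?N ^^ (q + p)) v = 0" if "(?N ^^ p) v = 0" for p q v
    using that lin(3) by (simp add: funpow_add)
  have S: "fun_space.subspace S"
  proof (rule fun_space.subspaceI)
    show "0 \<in> S" unfolding S_def mem_Collect_eq by (rule exI) (rule lin(3))
    fix u v assume "u \<in> S" "v \<in> S"
    then obtain p q where pq: "(?N ^^ p) u = 0" "(?N ^^ q) v = 0" by (auto simp: S_def)
    from mono[OF pq(1), of q] mono[OF pq(2), of p] have "(?N ^^ (p + q)) (u + v) = 0" by (simp add: lin add.commute)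
    then show "u + v \<in> S" unfolding S_def by blast
  next
    fix c u assume "u \<in> S"
    then obtain p where "(?N ^^ p) u = 0" by (auto simp: S_def)
    then have "(?N ^^ p) (vscale c u) = 0" by (simp add: lin)
    then show "vscale c u \<in> S" unfolding S_def by blast
  qed
  have preimage: "v \<in> S" if "?N v \<in> S" for v
  proof -
    from that obtain p where "(?N ^^ p) (?N v) = 0" unfolding S_def mem_Collect_eq by (elim exE)
    then have "(?N ^^ Suc p) v = 0" by (simp add: funpow_swap1)
    then show "v \<in> S" unfolding S_def by blast
  qed
  have closed: "A k l b v \<in> S" if "k < n" "l < n" "v \<in> S" for k l b v
    using that
  proof (induction "(if k = i then 1 else 0) + (if l = Suc i then 1 else 0 :: nat)" arbitrary: k l b v rule: less_induct)
    case less
    obtain p where "(?N ^^ p) v = 0" using less.prems by (auto simp: S_def)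
    then show ?case using less.prems(3)
    proof (induction p arbitrary: v)
      case 0
      then show ?case using fun_space.subspace_0[OF S] by (simp add: A_linear)
    next
      case (Suc p)
      have "(?N ^^ p) (?N v) = 0" using Suc.prems(1) by (simp add: funpow_swap1)
      moreover from this have "?N v \<in> S" unfolding S_def by blast
      ultimately have 1: "A k l b (?N v) \<in> S" by (rule Suc.IH)
      have 2: "(if i = k then A (Suc i) l (0 + b) v else 0) \<in> S"
      proof (cases "i = k")
        case True
        have "A (Suc i) l (0 + b) v \<in> S"
          by (rule less.hyps) (use True less.prems(2) i Suc.prems(2) in simp_all)
        then show ?thesis by (simp only: if_P[OF True])
      qed (simp add: fun_space.subspace_0[OF S])
      have 3: "(if l = Suc i then A k i (0 + b) v else 0) \<in> S"
      proof (cases "l = Suc i")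
        case True
        have "A k i (0 + b) v \<in> S"
          by (rule less.hyps) (use True less.prems(1) i Suc.prems(2) in simp_all)
        then show ?thesis by (simp only: if_P[OF True])
      qed (simp add: fun_space.subspace_0[OF S])
      have "?N (A k l b v) = A k l b (?N v) + (if i = k then A (Suc i) l (0 + b) v else 0)
          - (if l = Suc i then A k i (0 + b) v else 0)"
        by (rule A_commute) (use less.prems i in auto)
      also have "\<dots> \<in> S" by (intro fun_space.subspace_diff[OF S] fun_space.subspace_add[OF S] 1 2 3)
      finally show ?case by (rule preimage)
    qed
  qed
  have N: "?N = nf_act (unit_tensor n r (Suc i) i 0)" by (rule ext) (simp add: A_def)
  have "nf word_one \<in> S"
    unfolding S_def mem_Collect_eq N by (rule exI) (rule nf_relations(3)[OF i])
  have "nf (nf u) \<in> S" by (rule nf_induct[OF S \<open>nf word_one \<in> S\<close> closed nf_carrier])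
  then obtain p where p: "(?N ^^ p) (nf u) = 0" unfolding nf_nf S_def mem_Collect_eq by (elim exE)
  have "(?N ^^ Suc p) u = (?N ^^ p) (?N u)" by (simp only: funpow_Suc_right comp_apply)
  also have "\<dots> = (?N ^^ p) (?N (nf u))" by (simp only: A_linear(4))
  also have "\<dots> = ?N ((?N ^^ p) (nf u))" by (simp only: funpow_swap1)
  also have "\<dots> = 0" unfolding p by (rule A_linear(3))
  finally show ?thesis by (rule exI)
qed

sublocale gl: gl_current_rep vscale n A
  by unfold_locales (fact A_linear(1,2) A_commute A_locally_nilpotent)+

lemma nf_in_gens: "f \<in> carrier F \<Longrightarrow> nf f \<in> gl.gens n {nf word_one}"
  by (rule nf_induct) (auto intro: gl.gens.intros gl.stableD(1)[OF gl.stable_gens])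

lemma unit_tensor_ge: "r \<le> a \<Longrightarrow> i < n \<Longrightarrow> j < n \<Longrightarrow> nf_act (unit_tensor n r i j a) e = 0"
  using nf_act_eq_sum[OF unit_closed, of i j "{}" "\<lambda>_. undefined" a "\<lambda>_. 0" e] by (simp add: unit_tensor_index)

lemma highest_weight: "gl.highest_weight n {0} \<xi> (nf word_one)"
proof -
  let ?x = "nf word_one"
  let ?u = "\<lambda>i a. nf_act (unit_tensor n r i i a) ?x"
  have off: "A i j a ?x = 0" if ij: "i < j" "j < n" for i j a
  proof -
    have "unit_tensor n r i j a = takiff_tensor r (sl n) (mat_unit n i j) a" using ij by (simp add: takiff_mat_unit)
    also have "\<dots> \<in> carrier (takiff r (n_plus n))"
      using n_plus_facts(2)[OF ij] n_plus_facts(3)[of n] by (simp add: takiff_tensor_def takiff_def sl_simps) (simp add: n_plus_def gl_def)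
    finally have "nf_act (unit_tensor n r i j a) ?x = 0" by (rule nf_relations(1))
    then show ?thesis using ij by (simp add: A_def)
  qed
  have diag: "A i i a ?x = vscale (if a = 0 then of_nat (\<xi> i) else 0) ?x" if i: "i < n" for i a
  proof (cases "a < r")
    case True
    define d where "d = (if a = 0 then 1 else 0 :: complex)"
    \<comment> \<open>The coroots fix only the differences of the diagonal eigenvalues, so the
      deviation \<open>w\<close> from the wanted eigenvalue does not depend on i. As the traceless
      units sum to zero, it is minus the mean of \<open>\<xi>\<close> in degree 0 and zero in
      positive degree; adding \<open>level\<close> removes it.\<close>
    define w where "w i = ?u i a - vscale (d * of_nat (\<xi> i)) ?x" for i
    have step: "w (Suc i) = w i" if "Suc i < n" for i
    proof -
      have "nf_act (takiff_tensor r (sl n) (coroot n i) a) ?x =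
          (\<Sum>s\<in>{0, 1 :: nat}. vscale (if s = 0 then 1 else -1) (nf_act (if s = 0 then unit_tensor n r i i a else unit_tensor n r (Suc i) (Suc i) a) ?x))"
      proof (rule nf_act_eq_sum[OF coroot_closed[OF that]])
        fix k p q assume "k < r" "p < n" "q < n"
        then show "takiff_tensor r (sl n) (coroot n i) a k $$ (p, q) =
           (\<Sum>s\<in>{0, 1 :: nat}. (if s = 0 then 1 else -1) * (if s = 0 then unit_tensor n r i i a else unit_tensor n r (Suc i) (Suc i) a) k $$ (p, q))"
          using True by (simp add: takiff_tensor_def unit_tensor_index coroot_def sl_simps)
      qed (use that in \<open>auto intro: unit_closed\<close>)
      moreover have "nf_act (takiff_tensor r (sl n) (coroot n i) a) ?x = vscale (d * of_nat (part_weight \<xi> i)) ?x"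
        using nf_relations(2)[OF that True] by (simp add: d_def)
      ultimately have "?u i a - ?u (Suc i) a = vscale (d * of_nat (part_weight \<xi> i)) ?x" by simp
      moreover have "(of_nat (part_weight \<xi> i) :: complex) = of_nat (\<xi> i) - of_nat (\<xi> (Suc i))"
        using partitionsD(1)[OF partition, of i "Suc i"] by (simp add: part_weight_def of_nat_diff)
      ultimately have "?u i a - ?u (Suc i) a = vscale (d * of_nat (\<xi> i)) ?x - vscale (d * of_nat (\<xi> (Suc i))) ?x"
        by (simp add: right_diff_distrib fun_space.scale_left_diff_distrib)
      then show ?thesis by (simp add: w_def algebra_simps)
    qed
    have w: "w i = w 0" if "i < n" for i using that by (induction i) (simp_all add: step)
    have "(\<Sum>s\<in>{..<n}. vscale 1 (?u s a)) = nf_act (\<lambda>k. 0\<^sub>m n n) ?x"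
    proof (rule nf_act_eq_sum[symmetric])
      show "(\<lambda>k. 0\<^sub>m n n) \<in> carrier (slt n r)" by (simp add: slt_carrier[OF n_pos])
      fix k p q assume kpq: "k < r" "p < n" "q < n"
      have "(\<Sum>s<n. 1 * unit_tensor n r s s a k $$ (p, q)) =
          (\<Sum>s<n. (if s = p then if k = a \<and> p = q then 1 else 0 else 0) - (if k = a \<and> p = q then 1 / of_nat n else 0))"
        by (rule sum.cong[OF refl]) (use True kpq in \<open>auto simp: unit_tensor_index\<close>)
      also have "\<dots> = 0" using kpq n_pos by (simp add: sum_subtractf)
      finally show "0\<^sub>m n n $$ (p, q) = (\<Sum>s<n. 1 * unit_tensor n r s s a k $$ (p, q))" using kpq by simp
    qed (auto intro: unit_closed)
    also have "nf_act (\<lambda>k. 0\<^sub>m n n) ?x = 0"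
      using nf_act_eq_sum[of "\<lambda>k. 0\<^sub>m n n" "{}" "\<lambda>_. undefined" "\<lambda>_. 0" ?x] by (simp add: slt_carrier[OF n_pos])
    finally have sum0: "(\<Sum>s<n. ?u s a) = 0" by simp
    have "vscale (of_nat n) (w 0) = (\<Sum>s<n. w s)"
    proof -
      have "(\<Sum>s<n. w s) = (\<Sum>s<n. w 0)" by (rule sum.cong[OF refl]) (use w in blast)
      moreover have "(\<Sum>s<k. w 0) = vscale (of_nat k) (w 0)" for k
        by (induction k) (simp_all add: fun_space.scale_left_distrib del: sum_constant)
      ultimately show ?thesis by (simp del: sum_constant)
    qed
    also have "\<dots> = - vscale (d * (\<Sum>s<n. of_nat (\<xi> s))) ?x"
      by (simp add: w_def sum_subtractf sum0 sum_distrib_left fun_space.scale_sum_left)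
    finally have "vscale (1 / of_nat n) (vscale (of_nat n) (w 0)) = vscale (1 / of_nat n) (- vscale (d * (\<Sum>s<n. of_nat (\<xi> s))) ?x)"
      by simp
    then have "w 0 = - vscale (d * level) ?x" using n_pos by (simp add: level_def)
    then have "w i = - vscale (d * level) ?x" using w[OF i] by simp
    then have "?u i a + vscale (d * level) ?x = vscale (d * of_nat (\<xi> i)) ?x"
      unfolding w_def by (simp add: algebra_simps)
    then show ?thesis by (simp add: A_def d_def split: if_splits)
  next
    \<comment> \<open>Since r is at least 1, the degree a is positive here and the scalar part of
      \<open>A\<close> is absent.\<close>
    case False
    then show ?thesis using unit_tensor_ge[of a i i ?x] i r_ge by (simp add: A_def)
  qed
  show ?thesis unfolding gl.highest_weight_def by (auto simp: off diag)
qed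

end

section \<open>The defining relations hold in the exterior algebra\<close>

lemma creat_annih_monomial_zero:
  assumes "finite D" "(j, t) \<notin> D \<or> ((i, s) \<in> D \<and> (i, s) \<noteq> (j, t))"
  shows "creat (i, s) (annih (j, t) (monomial D)) = 0"
proof
  fix S
  show "creat (i, s) (annih (j, t) (monomial D)) S = 0 S"
  proof (rule ccontr)
    assume "\<not> ?thesis"
    then have "finite S" "(i, s) \<in> S" "(j, t) \<notin> S - {(i, s)}" "insert (j, t) (S - {(i, s)}) = D"
      by (auto simp: creat_def annih_def monomial_def fun_apply split: if_splits)
    then show False using assms(2) by blast
  qed
qed

lemma creat_annih_monomial_same:
  assumes "finite D" "p \<in> D"
  shows "creat p (annih p (monomial D)) = monomial D"
proof
  fix S
  show "creat p (annih p (monomial D)) S = monomial D S"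
  proof (cases "S = D")
    case True
    then show ?thesis using assms by (simp add: creat_def annih_def monomial_def insert_absorb)
  next
    case False
    then have "insert p (S - {p}) \<noteq> D" if "p \<in> S" using that by blast
    then show ?thesis using False by (simp add: creat_def annih_def monomial_def)
  qed
qed

lemma current_support:
  assumes "current r i j 0 f S \<noteq> 0"
  shows "\<exists>s. finite S \<and> (i, s) \<in> S \<and> (j, s) \<notin> S - {(i, s)} \<and> f (insert (j, s) (S - {(i, s)})) \<noteq> 0"
proof (rule ccontr)
  assume no: "\<not> ?thesis"
  have "creat (i, s) (annih (j, s) f) S = 0" for s
  proof (rule ccontr)
    assume "creat (i, s) (annih (j, s) f) S \<noteq> 0"
    then have "finite S" "(i, s) \<in> S" "(j, s) \<notin> S - {(i, s)}" "f (insert (j, s) (S - {(i, s)})) \<noteq> 0"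
      by (auto simp: creat_def annih_def split: if_splits)
    then show False using no by blast
  qed
  then have "current r i j 0 f S = 0" by (simp add: current_def sum_fun_apply)
  then show False using assms by simp
qed

context takiff_weyl
begin

abbreviation y where "y \<equiv> monomial (diagram n \<xi>)"

abbreviation ev where "ev \<equiv> word_eval (lie_act (ext_module n r)) y"

lemma ev_linear:
  assumes "f \<in> carrier F" "g \<in> carrier F"
  shows "ev (f + g) = ev f + ev g" "ev (vscale c f) = fscale c (ev f)" "ev (f - g) = ev f - ev g"
  by (rule word_eval_linear[OF assms])+

lemma ev_lmult: "f \<in> carrier F \<Longrightarrow> ev (word_lmult x f) = lie_act (ext_module n r) x (ev f)"
  by (rule word_eval_lmult) (auto simp: ext_act_linear)

text \<open>Rows do not get longer downwards, so whenever box (j, s + a) is occupied, box (i, s) is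
  occupied too and cannot receive it.\<close>

lemma current_y_upper:
  assumes "i < j" "j < n"
  shows "current r i j a y = 0"
proof -
  have "creat (i, s) (annih (j, s + a) y) = 0" for s
    by (rule creat_annih_monomial_zero)
       (use assms partitionsD(1)[OF partition, of i j] in auto)
  then show ?thesis by (simp add: current_def)
qed

lemma current_y_diag:
  assumes "i < n"
  shows "current r i i a y = fscale (if a = 0 then of_nat (\<xi> i) else 0) y"
proof (cases "a = 0")
  case True
  have "current r i i 0 y = (\<Sum>s<r. if s < \<xi> i then y else 0)"
    unfolding current_def
  proof (simp, rule sum.cong[OF refl])
    fix s
    show "creat (i, s) (annih (i, s) y) = (if s < \<xi> i then y else 0)"
      using assms creat_annih_monomial_zero[of "diagram n \<xi>" i s i s] creat_annih_monomial_same[of "diagram n \<xi>" "(i, s)"]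
      by simp
  qed
  also have "\<dots> = (\<Sum>s<\<xi> i. y)"
    by (rule sum.mono_neutral_cong_right) (use partitionsD(2)[OF partition, of i] in auto)
  also have "(\<Sum>s<k. y) = fscale (of_nat k) y" for k
    by (induction k) (simp_all add: fock.scale_left_distrib del: sum_constant)
  finally show ?thesis using True by simp
next
  case False
  then show ?thesis by (simp, intro current_monomial_contiguous) auto
qed

text \<open>Each application moves a box from row i to row i+1 within its column. Row i+1 gains a
  box every time but never leaves the first \<open>\<xi> i\<close> columns, so it is full after
  \<open>\<xi> i - \<xi> (Suc i)\<close> steps.\<close>

lemma current_y_power:
  assumes i: "Suc i < n"
  shows "(current r (Suc i) i 0 ^^ (part_weight \<xi> i + 1)) y = 0"
proof -
  let ?row = "\<lambda>k S. {s. (k, s) \<in> (S :: (nat \<times> nat) set)}"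
  have supp: "finite S \<and> ?row i S \<subseteq> {..<\<xi> i} \<and> ?row (Suc i) S \<subseteq> {..<\<xi> i} \<and> card (?row (Suc i) S) = \<xi> (Suc i) + p"
    if "(current r (Suc i) i 0 ^^ p) y S \<noteq> 0" for p S
    using that
  proof (induction p arbitrary: S)
    case 0
    then have S: "S = diagram n \<xi>" by (simp add: monomial_def split: if_splits)
    have "?row i S = {..<\<xi> i}" "?row (Suc i) S = {..<\<xi> (Suc i)}" using i by (auto simp: S)
    then show ?case using partitionsD(1)[OF partition, of i "Suc i"] by (simp add: S)
  next
    case (Suc p)
    have "current r (Suc i) i 0 ((current r (Suc i) i 0 ^^ p) y) S \<noteq> 0" using Suc.prems by simp
    from current_support[OF this] obtain s where s: "finite S" "(Suc i, s) \<in> S"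
      "(current r (Suc i) i 0 ^^ p) y (insert (i, s) (S - {(Suc i, s)})) \<noteq> 0" by blast
    let ?S = "insert (i, s) (S - {(Suc i, s)})"
    have IH: "?row i ?S \<subseteq> {..<\<xi> i}" "?row (Suc i) ?S \<subseteq> {..<\<xi> i}" "card (?row (Suc i) ?S) = \<xi> (Suc i) + p"
      using Suc.IH[OF s(3)] by blast+
    have "s < \<xi> i" using IH(1) by auto
    have row: "?row (Suc i) S = insert s (?row (Suc i) ?S)" "s \<notin> ?row (Suc i) ?S" using s(2) by auto
    have "finite (?row (Suc i) ?S)" using IH(2) finite_subset by blast
    then have "card (?row (Suc i) S) = \<xi> (Suc i) + Suc p" unfolding row(1) using row(2) IH(3) by simp
    moreover have "?row (Suc i) S \<subseteq> {..<\<xi> i}" unfolding row(1) using IH(2) \<open>s < \<xi> i\<close> by blast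
    moreover have "?row i S \<subseteq> {..<\<xi> i}" using IH(1) by auto
    ultimately show ?case using s(1) by blast
  qed
  show ?thesis
  proof
    fix S
    show "(current r (Suc i) i 0 ^^ (part_weight \<xi> i + 1)) y S = 0 S"
    proof (rule ccontr)
      assume "\<not> ?thesis"
      then have "(current r (Suc i) i 0 ^^ (part_weight \<xi> i + 1)) y S \<noteq> 0" by (simp only: fun_apply not_False_eq_True)
      from supp[OF this] have "?row (Suc i) S \<subseteq> {..<\<xi> i}" "card (?row (Suc i) S) = \<xi> (Suc i) + (part_weight \<xi> i + 1)" by blast+
      then have "\<xi> (Suc i) + (part_weight \<xi> i + 1) \<le> \<xi> i" using card_mono[of "{..<\<xi> i}" "?row (Suc i) S"] by simp
      then show False using partitionsD(1)[OF partition, of i "Suc i"] by (simp add: part_weight_def)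
    qed
  qed
qed

text \<open>The action of the identity matrix times t^a, which measures the difference between gl
  and sl.\<close>

definition total :: "nat \<Rightarrow> fock \<Rightarrow> fock" where
  "total a f = (\<Sum>p<n. current r p p a f)"

lemma total_linear: "total a (f + g) = total a f + total a g" "total a (fscale c f) = fscale c (total a f)"
  "total a 0 = 0"
  by (simp_all add: total_def current_linear sum.distrib fock.scale_sum_right)

lemma total_sum: "total a (\<Sum>x\<in>X. h x) = (\<Sum>x\<in>X. total a (h x))"
  by (induction X rule: infinite_finite_induct) (auto simp: total_linear)

lemma total_current:
  assumes "i < n" "j < n"
  shows "total a (current r i j b f) = current r i j b (total a f)"
proof -
  have "total a (current r i j b f) =
     (\<Sum>p<n. current r i j b (current r p p a f) + (if p = i then current r i j (a + b) f else 0) - (if p = j then current r i j (a + b) f else 0))"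
    unfolding total_def
  proof (rule sum.cong[OF refl])
    fix p
    show "current r p p a (current r i j b f) = current r i j b (current r p p a f)
        + (if p = i then current r i j (a + b) f else 0) - (if p = j then current r i j (a + b) f else 0)"
      using current_commutator[of r p p a i j b f] by auto
  qed
  also have "\<dots> = current r i j b (total a f)"
    using assms by (simp add: sum.distrib sum_subtractf total_def current_sum)
  finally show ?thesis .
qed

lemma act_unit:
  assumes "i < n" "j < n"
  shows "lie_act (ext_module n r) (unit_tensor n r i j a) v =
    current r i j a v - fscale (if i = j then 1 / of_nat n else 0) (total a v)"
proof (cases "a < r")
  case True
  let ?c = "if i = j then 1 / of_nat n else 0 :: complex"
  have "lie_act (ext_module n r) (unit_tensor n r i j a) v =
     (\<Sum>k<r. if k = a then (\<Sum>p<n. \<Sum>q<n. (if q = j then if p = i then current r i j a v else 0 else 0)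
         - (if p = q then fscale ?c (current r p p a v) else 0)) else 0)"
    unfolding ext_act
  proof (rule sum.cong[OF refl])
    fix k assume "k \<in> {..<r}"
    show "(\<Sum>p<n. \<Sum>q<n. fscale (unit_tensor n r i j a k $$ (p, q)) (current r p q k v)) =
      (if k = a then (\<Sum>p<n. \<Sum>q<n. (if q = j then if p = i then current r i j a v else 0 else 0)
         - (if p = q then fscale ?c (current r p p a v) else 0)) else 0)"
    proof (cases "k = a")
      case eq: True
      show ?thesis unfolding if_P[OF eq]
        by (rule sum.cong[OF refl], rule sum.cong[OF refl])
           (use True eq in \<open>auto simp: unit_tensor_index fock.scale_left_diff_distrib\<close>)
    next
      case False
      then show ?thesis by (simp add: unit_tensor_index)
    qed
  qed
  also have "\<dots> = current r i j a v - fscale ?c (total a v)"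
    using True assms by (simp add: sum_subtractf total_def fock.scale_sum_right)
  finally show ?thesis .
next
  case False
  then show ?thesis by (simp add: ext_act unit_tensor_index current_ge total_def)
qed

text \<open>The identity matrix is central, so on the submodule generated by \<open>y\<close> it
  acts as on \<open>y\<close>: by the number of boxes in degree 0 and by zero in positive
  degree.\<close>

lemma total_ev:
  assumes "f \<in> carrier F"
  shows "total a (ev f) = fscale (if a = 0 then (\<Sum>p<n. of_nat (\<xi> p)) else 0) (ev f)"
  using assms
proof (induction rule: free_algebra_induct)
  case one
  show ?case by (simp add: total_def current_y_diag fock.scale_sum_left)
next
  case zero
  show ?case by (simp add: total_linear)
next
  case (add f g)
  then show ?case by (simp add: ev_linear total_linear fock.scale_right_distrib)
next
  case (scale c f)
  then show ?case by (simp add: ev_linear[OF scale(1) scale(1)] total_linear mult.commute)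
next
  case (lmult x f)
  have "total a (lie_act (ext_module n r) x v) = lie_act (ext_module n r) x (total a v)" for v
    by (simp add: ext_act total_sum total_linear total_current)
  then show ?case using lmult by (simp only: ev_lmult ext_act_linear)
qed

text \<open>This makes the homomorphism from the local Weyl module well defined: the polynomials
  annihilating \<open>y\<close> are closed under left multiplication, and they contain the relations
  of U(L) and lifts of the Weyl relations.\<close>

lemma Z_ev:
  assumes "f \<in> Z"
  shows "ev f = 0"
proof -
  let ?Z = "{f \<in> carrier F. ev f = 0}"
  have "Z \<subseteq> ?Z"
  proof (rule Z_minimal)
    show "fun_space.subspace ?Z"
      by (rule fun_space.subspaceI) (auto simp: free_algebra_carrier ev_linear)
    show "I \<subseteq> ?Z"
    proof
      fix f assume f: "f \<in> I"
      have "ev f = 0"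
        by (rule word_eval_ideal[OF _ _ _ _ _ f]) (simp_all only: ext_act_linear ext_act_rep[OF n_pos])
      then show "f \<in> ?Z" using f qF.I_carrier by simp
    qed
    show "word_lmult x f \<in> ?Z" if "x \<in> carrier (slt n r)" "f \<in> ?Z" for x f
    proof -
      have "lie_act (ext_module n r) x 0 = 0" using ext_act_linear(2)[of n r x 0 0] by simp
      then show ?thesis using that by (simp add: ev_lmult free_algebra_carrier)
    qed
    have letter: "ev (letter x) = lie_act (ext_module n r) x y" for x
      using ev_lmult[OF free_algebra_carrier(1), of x] by (simp add: letter_eq)
    have nplus: "letter x \<in> ?Z" if x: "x \<in> carrier (takiff r (n_plus n))" for x
    proof -
      have "fscale (x k $$ (i, j)) (current r i j k y) = 0" if "i < n" "j < n" for i j k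
        using takiff_n_plus_subset(2)[OF n_pos x, of j i k] current_y_upper[of i j k] that by (cases "j \<le> i") auto
      then have "lie_act (ext_module n r) x y = 0"
        unfolding ext_act by (intro sum.neutral ballI) (simp only: lessThan_iff)
      then show ?thesis using takiff_n_plus_subset(1)[OF n_pos x] by (simp add: letter free_algebra_carrier)
    qed
    have cartan: "letter (takiff_tensor r (sl n) (coroot n i) j) - vscale (if j = 0 then of_nat (part_weight \<xi> i) else 0) word_one \<in> ?Z"
      if i: "i < n - 1" and j: "j < r" for i j
    proof -
      let ?h = "takiff_tensor r (sl n) (coroot n i) j"
      have i': "i < n" "Suc i < n" using i by simp_all
      have h: "?h \<in> carrier (slt n r)" using i by (intro coroot_closed) simp
      have "lie_act (ext_module n r) ?h y =
         (\<Sum>k<r. if k = j then (\<Sum>p<n. \<Sum>q<n. (if q = i then if p = i then current r i i j y else 0 else 0)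
             - (if q = Suc i then if p = Suc i then current r (Suc i) (Suc i) j y else 0 else 0)) else 0)"
        unfolding ext_act
      proof (rule sum.cong[OF refl])
        fix k assume "k \<in> {..<r}"
        show "(\<Sum>p<n. \<Sum>q<n. fscale (?h k $$ (p, q)) (current r p q k y)) =
          (if k = j then (\<Sum>p<n. \<Sum>q<n. (if q = i then if p = i then current r i i j y else 0 else 0)
             - (if q = Suc i then if p = Suc i then current r (Suc i) (Suc i) j y else 0 else 0)) else 0)"
        proof (cases "k = j")
          case eq: True
          show ?thesis unfolding if_P[OF eq]
            by (rule sum.cong[OF refl], rule sum.cong[OF refl])
               (use j eq in \<open>auto simp: takiff_tensor_def coroot_def\<close>)
        next
          case False
          then show ?thesis by (simp add: takiff_tensor_def sl_simps)
        qed
      qed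
      also have "\<dots> = current r i i j y - current r (Suc i) (Suc i) j y"
        using i' j by (simp add: sum_subtractf)
      also have "\<dots> = fscale (if j = 0 then of_nat (\<xi> i) - of_nat (\<xi> (Suc i)) else 0) y"
        using i by (simp add: current_y_diag fock.scale_left_diff_distrib)
      also have "(of_nat (\<xi> i) - of_nat (\<xi> (Suc i)) :: complex) = of_nat (part_weight \<xi> i)"
        using partitionsD(1)[OF partition, of i "Suc i"] by (simp add: part_weight_def of_nat_diff)
      finally have act: "lie_act (ext_module n r) ?h y = fscale (if j = 0 then of_nat (part_weight \<xi> i) else 0) y" .
      have l: "letter ?h \<in> carrier F" using h by (rule free_algebra_carrier)
      show ?thesis
        using l act by (simp add: free_algebra_carrier ev_linear[OF l free_algebra_carrier(4)[OF free_algebra_carrier(1)]]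
            ev_linear(2)[OF free_algebra_carrier(1) free_algebra_carrier(1)] letter)
    qed
    have power: "(word_lmult (unit_tensor n r (Suc i) i 0) ^^ (part_weight \<xi> i + 1)) word_one \<in> ?Z"
      if i: "i < n - 1" for i
    proof -
      have i': "Suc i < n" "i < n" using i by simp_all
      note u = unit_closed[OF i', of 0]
      note c = conjunct2[OF uea_emb_power[OF u]]
      have act: "lie_act (ext_module n r) (unit_tensor n r (Suc i) i 0) v = current r (Suc i) i 0 v" for v
        by (simp add: act_unit[OF i'])
      have "ev ((word_lmult (unit_tensor n r (Suc i) i 0) ^^ p) word_one) = (current r (Suc i) i 0 ^^ p) y" for p
        by (induction p) (simp_all add: ev_lmult[OF c] act)
      then show ?thesis using c current_y_power[OF i'(1)] by (simp only: mem_Collect_eq simp_thms)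
    qed
    show "?Z \<subseteq> carrier F" by blast
    show "\<exists>f\<in>?Z. X = qF.coset f" if "X \<in> weyl_relations n r (part_weight \<xi>)" for X
      using that nplus cartan power unfolding weyl_relations_eq(1)[OF n_pos] weyl_coset_def by blast
  qed
  then show ?thesis using assms by blast
qed

lemma ev_nf: "f \<in> carrier F \<Longrightarrow> ev (nf f) = ev f"
  using Z_ev[OF nf_diff_in_Z, of f] ev_linear(3)[OF _ nf_carrier, of f f] by simp

text \<open>The scalar added in the definition of \<open>A\<close> makes up for the trace part
  subtracted in \<open>unit_tensor\<close>: both are the number of boxes divided by n.\<close>

lemma equivariant_ev: "gl.equivariant r n (\<lambda>u. ev (nf u))"
  unfolding gl.equivariant_def
proof (intro conjI allI impI)
  fix i j a :: nat and u assume ij: "i < n" "j < n"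
  let ?s = "if i = j \<and> a = 0 then level else 0"
  let ?x = "unit_tensor n r i j a"
  have c: "word_lmult ?x (nf u) \<in> carrier F" by (intro free_algebra_carrier unit_closed ij nf_carrier)
  have "ev (nf (A i j a u)) = ev (nf (word_lmult ?x (nf u)) + vscale ?s (nf u))"
    by (simp add: A_def nf_add nf_scale nf_act_def)
  also have "\<dots> = ev (word_lmult ?x (nf u)) + fscale ?s (ev (nf u))"
    by (simp only: ev_linear[OF nf_carrier free_algebra_carrier(4)[OF nf_carrier]] ev_linear(2)[OF nf_carrier nf_carrier] ev_nf[OF c])
  also have "ev (word_lmult ?x (nf u)) = current r i j a (ev (nf u))
      - fscale (if i = j then 1 / of_nat n else 0) (fscale (if a = 0 then (\<Sum>p<n. of_nat (\<xi> p)) else 0) (ev (nf u)))"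
    by (simp only: ev_lmult[OF nf_carrier] act_unit[OF ij] total_ev[OF nf_carrier])
  also have "fscale (if i = j then 1 / of_nat n else 0) (fscale (if a = 0 then (\<Sum>p<n. of_nat (\<xi> p)) else 0) (ev (nf u))) =
      fscale ?s (ev (nf u))"
    by (simp add: level_def)
  finally show "ev (nf (A i j a u)) = current r i j a (ev (nf u))" by simp
qed (simp_all only: nf_add nf_scale ev_linear[OF nf_carrier nf_carrier])

lemma Z_iff_ev:
  assumes f: "f \<in> carrier F"
  shows "f \<in> Z \<longleftrightarrow> ev f = 0"
proof
  assume "ev f = 0"
  \<comment> \<open>Faithfulness is applied with the zero subspace and the full diagram.
    Precomposing evaluation with \<open>nf\<close> makes the map linear on the whole type, not only
    on finitely supported functions.\<close>
  have "nf f \<in> {0}"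
  proof (rule gl.weyl_faithfulD[OF gl.weyl_faithful[OF order_refl] _ highest_weight _ _ equivariant_ev])
    show "gl.stable n {0}" by (simp add: gl.stable_def fun_space.subspace_single_0 A_linear)
    show "ev (nf (nf word_one)) = fscale 1 y" by (simp add: ev_nf free_algebra_carrier)
    show "nf f \<in> gl.gens n {nf word_one}" by (rule nf_in_gens[OF f])
    show "ev (nf (nf f)) = 0" using ev_nf[OF f] \<open>ev f = 0\<close> by simp
  qed (auto simp: partitionsD[OF partition])
  then show "f \<in> Z" using nf_diff_in_Z[OF f] by simp
qed (rule Z_ev)

lemma isomorphic: "lie_module_isomorphic (slt n r) (T_W n r \<xi>) (local_weyl_module n r (part_weight \<xi>))"
  unfolding T_W_def local_weyl_module_def partitionsD(4)[OF partition]
proof (rule isomorphic_to_generated_submodule)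
  show "u \<oplus>\<^bsub>ext_module n r\<^esub> v = u + v" "c \<odot>\<^bsub>ext_module n r\<^esub> u = fscale c u" "\<zero>\<^bsub>ext_module n r\<^esub> = 0" for u v c
    by (simp_all add: ext_module_def fun_eq_iff fun_apply fscale_apply)
  show "f \<in> Z \<longleftrightarrow> ev f = 0" if "f \<in> carrier F" for f by (rule Z_iff_ev[OF that])
  show "monomial (diagram n \<xi>) \<in> carrier (ext_module n r)" by (rule monomial_in_ext_module[OF partition])
qed (simp_all only: module_ext_module ext_act_closed ext_act_linear)

end

theorem theorem5p2:
  fixes n r :: nat and \<xi> :: "nat \<Rightarrow> nat"
  assumes "n \<ge> 2" and "r \<ge> 1" and "\<xi> \<in> partitions n r"
  shows "lie_module_isomorphic (takiff r (sl n))
           (T_W n r \<xi>) (local_weyl_module n r (part_weight \<xi>))"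
proof -
  interpret takiff_weyl n r \<xi> by unfold_locales (fact assms)+
  show ?thesis by (rule isomorphic)
qed

end
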